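(* Let $\Phi$ be a driftless Bernstein function and let $X_\Phi(t)=X(L_\Phi(t))$ be a non-local Pearson diffusion such that $X_\Phi(0)$ admits probability density function $m$, the stationary density of the Pearson diffusion $X$. Then the following properties hold: (i) if $\Phi$ is regularly varying at $0^+$ with order $\alpha\in(0,1)$, then $X_\Phi(t)$ is long-range dependent with respect to the initial datum; (ii) if $\lim_{z\to0^+}\frac{\Phi(z)}{z}=l\in(0,+\infty)$, then $X_\Phi(t)$ is short-range dependent with respect to the initial datum.
   Context: **Long/short-range dependence with respect to the initial datum.** Let $\gamma(n)=\mathrm{Corr}_m(X_\Phi(n),X_\Phi(0))$, $n\in\mathbb N$, where $\mathrm{Corr}_m$ is the correlation coefficient when $X_\Phi(0)$ has density $m$. $X_\Phi$ is long-range dependent if $\gamma(n)\sim\ell(n)n^{-\alpha}$ as $n\to\infty$, where $\ell$ is a slowly varying function and $\alpha\in(0,1)$; it is short-range dependent if $\sum_{n=1}^{+\infty}|\gamma(n)|<+\infty$. $\Phi$ is regularly varying at $0^+$ with order $\alpha$ if $\Phi(cz)/\Phi(z)\to c^\alpha$ as $z\to0^+$ for every $c>0$. **Bernstein functions and inverse subordinators.** A Bernstein function is a $C^\infty$ function $\Phi:(0,\infty)\to[0,\infty)$ with $(-1)^n\Phi^{(n)}\le 0$ for all $n\ge1$; it has the representation $\Phi(\lambda)=a_\Phi+b_\Phi\lambda+\int_0^\infty(1-e^{-\lambda t})\nu_\Phi(dt)$ with $a_\Phi,b_\Phi\ge0$, $\int_0^\infty(1\wedge t)\nu_\Phi(dt)<\infty$.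 Standing assumption: $a_\Phi=b_\Phi=0$ and $\nu_\Phi(0,\infty)=+\infty$. Let $\sigma_\Phi$ be the subordinator with $\mathbb E[e^{-\lambda\sigma_\Phi(y)}]=e^{-y\Phi(\lambda)}$ and $L_\Phi(t)=\inf\{y>0:\sigma_\Phi(y)>t\}$ its inverse, taken independent of $X$. **Pearson diffusions** ($W$ a standard Brownian motion, $E$ the diffusion space, $m$ the stationary density, $\theta>0$ throughout): - OU: $dX=-\theta(X-\mu)dt+\sqrt{2\theta\sigma^2}\,dW$, $\mu\in\mathbb R$, $\sigma\ne0$; $E=\mathbb R$; $m$ the $N(\mu,\sigma^2)$ density. - CIR: $dX=-\theta(X-\frac ba)dt+\sqrt{\frac{2\theta}{a}X}\,dW$, $a,b>0$; $E=(0,\infty)$; $m(x)=\frac{a^b}{\Gamma(b)}x^{b-1}e^{-ax}$. - Jacobi: $dX=-\theta(X-\frac{b-a}{a+b+2})dt+\sqrt{\frac{2\theta}{a+b+2}(1-X^2)}\,dW$, $a,b>-1$; $E=(-1,1)$; $m(x)=(1-x)^a(1+x)^b\frac{\Gamma(a+b+2)}{\Gamma(a+1)\Gamma(b+1)2^{a+b+1}}$. - Fisher–Snedecor: $dX=-\theta(X-\frac{\beta}{\beta-2})dt+\sqrt{\frac{4\theta}{\alpha(\beta-2)}X(\alpha X+\beta)}\,dW$, $\alpha>0$, $\beta>2$; $E=(0,\infty)$; $m(x)=\frac{1}{xB(\alpha/2,\beta/2)}\left(\frac{\alpha x}{\alpha x+\beta}\right)^{\alpha/2}\left(\frac{\beta}{\alpha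 x+\beta}\right)^{\beta/2}$ (here $\alpha$ is a parameter of the diffusion, unrelated to the order of regular variation). - Reciprocal Gamma: $dX=-\theta(X-\frac{\alpha}{\beta-1})dt+\sqrt{\frac{2\theta}{\beta-1}X^2}\,dW$, $\alpha>0$, $\beta>1$; $E=(0,\infty)$; $m(x)=\frac{\alpha^\beta}{\Gamma(\beta)}x^{-\beta-1}e^{-\alpha/x}$ (same remark on $\alpha$). - Student: $dX=-\theta(X-\mu)dt+\sqrt{\frac{2\theta\delta^2}{\nu-1}\left(1+\left(\frac{X-\mu'}{\delta}\right)^2\right)}\,dW$, $\delta>0$, $\mu,\mu'\in\mathbb R$, $\nu>1$; $E=\mathbb R$; $m(x)=c\,\exp\left\{\frac{(\mu-\mu')(\nu-1)}{\delta}\arctan\frac{x-\mu'}{\delta}\right\}\left[1+\left(\frac{x-\mu'}{\delta}\right)^2\right]^{-\frac{\nu+1}{2}}$, $c$ normalizing.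
   Formalization: The stationary density m is additionally assumed to have a finite second moment; otherwise (Fisher–Snedecor β≤4, reciprocal gamma β≤2, Student ν≤2) the correlation coefficient Corr_m is undefined. *)

theory Defs
  imports "HOL-Probability.Probability" "HOL-Library.Landau_Symbols"
begin

section \<open>Correlation and long/short-range dependence\<close>

definition correlation :: "'a measure \<Rightarrow> ('a \<Rightarrow> real) \<Rightarrow> ('a \<Rightarrow> real) \<Rightarrow> real" where
  "correlation M Y Z =
     (\<integral>\<omega>. (Y \<omega> - (\<integral>\<omega>'. Y \<omega>' \<partial>M)) * (Z \<omega> - (\<integral>\<omega>'. Z \<omega>' \<partial>M)) \<partial>M) /
     (sqrt (\<integral>\<omega>. (Y \<omega> - (\<integral>\<omega>'. Y \<omega>' \<partial>M))\<^sup>2 \<partial>M) *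
      sqrt (\<integral>\<omega>. (Z \<omega> - (\<integral>\<omega>'. Z \<omega>' \<partial>M))\<^sup>2 \<partial>M))"

text \<open>A process is a function of time and outcome; times are nonnegative reals, and values at
  negative times are never used.\<close>

definition autocorr :: "'a measure \<Rightarrow> (real \<Rightarrow> 'a \<Rightarrow> real) \<Rightarrow> nat \<Rightarrow> real" where
  "autocorr M Y n = correlation M (Y (real n)) (Y 0)"

definition slowly_varying :: "(real \<Rightarrow> real) \<Rightarrow> bool" where
  "slowly_varying l \<longleftrightarrow>
     l \<in> borel_measurable borel \<and> (\<forall>\<^sub>F x in at_top. l x > 0) \<and>
     (\<forall>c>0. ((\<lambda>x. l (c * x) / l x) \<longlongrightarrow> 1) at_top)"

definition long_range_dependent :: "'a measure \<Rightarrow> (real \<Rightarrow> 'a \<Rightarrow> real) \<Rightarrow> bool" where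
  "long_range_dependent M Y \<longleftrightarrow>
     (\<exists>l \<alpha>. slowly_varying l \<and> 0 < \<alpha> \<and> \<alpha> < 1 \<and>
        autocorr M Y \<sim>[sequentially] (\<lambda>n. l (real n) * real n powr (- \<alpha>)))"

definition short_range_dependent :: "'a measure \<Rightarrow> (real \<Rightarrow> 'a \<Rightarrow> real) \<Rightarrow> bool" where
  "short_range_dependent M Y \<longleftrightarrow> summable (\<lambda>n. \<bar>autocorr M Y (Suc n)\<bar>)"

definition regularly_varying_at_0 :: "(real \<Rightarrow> real) \<Rightarrow> real \<Rightarrow> bool" where
  "regularly_varying_at_0 \<Phi> \<alpha> \<longleftrightarrow>
     (\<forall>c>0. ((\<lambda>z. \<Phi> (c * z) / \<Phi> z) \<longlongrightarrow> c powr \<alpha>) (at_right 0))"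


section \<open>Bernstein functions, subordinators and their inverses\<close>

definition bernstein :: "(real \<Rightarrow> real) \<Rightarrow> bool" where
  "bernstein \<Phi> \<longleftrightarrow>
     (\<forall>x>0. \<Phi> x \<ge> 0) \<and>
     (\<forall>n. \<forall>x>0. (deriv ^^ n) \<Phi> field_differentiable at x) \<and>
     (\<forall>n\<ge>1. \<forall>x>0. (- 1) ^ n * (deriv ^^ n) \<Phi> x \<le> 0)"

definition levy_triplet :: "(real \<Rightarrow> real) \<Rightarrow> real \<Rightarrow> real \<Rightarrow> real measure \<Rightarrow> bool" where
  "levy_triplet \<Phi> a b \<nu> \<longleftrightarrow>
     a \<ge> 0 \<and> b \<ge> 0 \<and> sets \<nu> = sets borel \<and> emeasure \<nu> {..0} = 0 \<and>
     (\<integral>\<^sup>+t. ennreal (min 1 t) \<partial>\<nu>) < \<infinity> \<and>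
     (\<forall>x>0. \<Phi> x = a + b * x + (\<integral>t. (1 - exp (- x * t)) \<partial>\<nu>))"

definition subordinator :: "'a measure \<Rightarrow> (real \<Rightarrow> real) \<Rightarrow> (real \<Rightarrow> 'a \<Rightarrow> real) \<Rightarrow> bool" where
  "subordinator M \<Phi> \<sigma> \<longleftrightarrow>
     (\<forall>y\<ge>0. \<sigma> y \<in> borel_measurable M) \<and>
     (\<forall>\<omega>\<in>space M. \<sigma> 0 \<omega> = 0 \<and> mono_on {0..} (\<lambda>y. \<sigma> y \<omega>) \<and>
        (\<forall>y\<ge>0. continuous (at_right y) (\<lambda>y. \<sigma> y \<omega>))) \<and>
     (\<forall>n. \<forall>y :: nat \<Rightarrow> real. 0 \<le> y 0 \<and> mono y \<longrightarrow>
        prob_space.indep_vars M (\<lambda>_. borel) (\<lambda>i \<omega>. \<sigma> (y (Suc i)) \<omega> - \<sigma> (y i) \<omega>) {..<n}) \<and>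
     (\<forall>y\<ge>0. \<forall>h\<ge>0. distr M borel (\<lambda>\<omega>. \<sigma> (y + h) \<omega> - \<sigma> y \<omega>) = distr M borel (\<sigma> h)) \<and>
     (\<forall>y\<ge>0. \<forall>x>0. (\<integral>\<omega>. exp (- x * \<sigma> y \<omega>) \<partial>M) = exp (- y * \<Phi> x))"

text \<open>The value 0 is a convention for outcomes whose path never exceeds the level \<open>t\<close>, a null event
  for a subordinator without killing; it keeps the inverse nonnegative and measurable.\<close>

definition inverse_subordinator :: "(real \<Rightarrow> 'a \<Rightarrow> real) \<Rightarrow> real \<Rightarrow> 'a \<Rightarrow> real" where
  "inverse_subordinator \<sigma> t \<omega> =
     (if \<exists>y>0. \<sigma> y \<omega> > t then Inf {y. y > 0 \<and> \<sigma> y \<omega> > t} else 0)"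

definition time_change ::
    "(real \<Rightarrow> 'a \<Rightarrow> real) \<Rightarrow> (real \<Rightarrow> 'a \<Rightarrow> real) \<Rightarrow> real \<Rightarrow> 'a \<Rightarrow> real" where
  "time_change X L t \<omega> = X (L t \<omega>) \<omega>"

definition indep_processes ::
    "'a measure \<Rightarrow> (real \<Rightarrow> 'a \<Rightarrow> real) \<Rightarrow> (real \<Rightarrow> 'a \<Rightarrow> real) \<Rightarrow> bool" where
  "indep_processes M X Y \<longleftrightarrow>
     prob_space.indep_var M
       (Pi\<^sub>M {0..} (\<lambda>_. borel)) (\<lambda>\<omega>. \<lambda>t\<in>{0..}. X t \<omega>)
       (Pi\<^sub>M {0..} (\<lambda>_. borel)) (\<lambda>\<omega>. \<lambda>t\<in>{0..}. Y t \<omega>)"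


section \<open>Brownian motion and the Ito integral\<close>

definition filtered :: "'a measure \<Rightarrow> (real \<Rightarrow> 'a measure) \<Rightarrow> bool" where
  "filtered M F \<longleftrightarrow> filtration (space M) F \<and> (\<forall>t. subalgebra M (F t))"

definition adapted :: "(real \<Rightarrow> 'a measure) \<Rightarrow> (real \<Rightarrow> 'a \<Rightarrow> real) \<Rightarrow> bool" where
  "adapted F Y \<longleftrightarrow> (\<forall>t\<ge>0. Y t \<in> borel_measurable (F t))"

definition brownian_motion ::
    "'a measure \<Rightarrow> (real \<Rightarrow> 'a measure) \<Rightarrow> (real \<Rightarrow> 'a \<Rightarrow> real) \<Rightarrow> bool" where
  "brownian_motion M F W \<longleftrightarrow>
     adapted F W \<and>
     (\<forall>\<omega>\<in>space M. W 0 \<omega> = 0 \<and> continuous_on {0..} (\<lambda>t. W t \<omega>)) \<and>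
     (\<forall>s t. 0 \<le> s \<and> s < t \<longrightarrow>
        distributed M lborel (\<lambda>\<omega>. W t \<omega> - W s \<omega>) (\<lambda>x. ennreal (normal_density 0 (sqrt (t - s)) x)) \<and>
        prob_space.indep_set M (sets (F s))
          (sets (vimage_algebra (space M) (\<lambda>\<omega>. W t \<omega> - W s \<omega>) borel)))"

definition converges_in_prob ::
    "'a measure \<Rightarrow> (nat \<Rightarrow> 'a \<Rightarrow> real) \<Rightarrow> ('a \<Rightarrow> real) \<Rightarrow> bool" where
  "converges_in_prob M Y Z \<longleftrightarrow>
     (\<forall>n. Y n \<in> borel_measurable M) \<and> Z \<in> borel_measurable M \<and>
     (\<forall>\<epsilon>>0. (\<lambda>n. measure M {\<omega>\<in>space M. \<bar>Y n \<omega> - Z \<omega>\<bar> > \<epsilon>}) \<longlonglongrightarrow> 0)"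

text \<open>The data \<open>k, \<tau>, \<xi>\<close> encode the simple process
  \<open>\<Sum>i<k. \<xi> i * 1_(\<tau> i, \<tau> (i + 1)]\<close>.\<close>

definition simple_process ::
    "(real \<Rightarrow> 'a measure) \<Rightarrow> nat \<Rightarrow> (nat \<Rightarrow> real) \<Rightarrow> (nat \<Rightarrow> 'a \<Rightarrow> real) \<Rightarrow> bool" where
  "simple_process F k \<tau> \<xi> \<longleftrightarrow>
     0 \<le> \<tau> 0 \<and> (\<forall>i<k. \<tau> i \<le> \<tau> (Suc i) \<and> \<xi> i \<in> borel_measurable (F (\<tau> i)) \<and>
       (\<exists>C. \<forall>\<omega>\<in>space (F (\<tau> i)). \<bar>\<xi> i \<omega>\<bar> \<le> C))"

definition simple_value ::
    "nat \<Rightarrow> (nat \<Rightarrow> real) \<Rightarrow> (nat \<Rightarrow> 'a \<Rightarrow> real) \<Rightarrow> real \<Rightarrow> 'a \<Rightarrow> real" where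
  "simple_value k \<tau> \<xi> s \<omega> = (\<Sum>i<k. \<xi> i \<omega> * indicator {\<tau> i<..\<tau> (Suc i)} s)"

definition simple_integral ::
    "(real \<Rightarrow> 'a \<Rightarrow> real) \<Rightarrow> nat \<Rightarrow> (nat \<Rightarrow> real) \<Rightarrow> (nat \<Rightarrow> 'a \<Rightarrow> real) \<Rightarrow> real \<Rightarrow> 'a \<Rightarrow> real" where
  "simple_integral W k \<tau> \<xi> t \<omega> =
     (\<Sum>i<k. \<xi> i \<omega> * (W (min (\<tau> (Suc i)) t) \<omega> - W (min (\<tau> i) t) \<omega>))"

text \<open>\<open>Z\<close> is (a version of) the integral of \<open>H\<close> against \<open>W\<close> over \<open>[0, t]\<close>, where \<open>H\<close> is
  progressively measurable with almost surely square integrable paths. As usual the integral is the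
  limit in probability of the integrals of simple processes approximating \<open>H\<close>; it does not depend,
  up to null events, on the approximating sequence.\<close>

definition has_ito_integral ::
    "'a measure \<Rightarrow> (real \<Rightarrow> 'a measure) \<Rightarrow> (real \<Rightarrow> 'a \<Rightarrow> real) \<Rightarrow> (real \<Rightarrow> 'a \<Rightarrow> real) \<Rightarrow> real
      \<Rightarrow> ('a \<Rightarrow> real) \<Rightarrow> bool" where
  "has_ito_integral M F W H t Z \<longleftrightarrow>
     (\<forall>s\<in>{0..t}. (\<lambda>(r, \<omega>). H r \<omega>) \<in> borel_measurable (restrict_space borel {0..s} \<Otimes>\<^sub>M F s)) \<and>
     (AE \<omega> in M. set_integrable lborel {0..t} (\<lambda>s. (H s \<omega>)\<^sup>2)) \<and>
     (\<exists>k \<tau> \<xi>. (\<forall>n. simple_process F (k n) (\<tau> n) (\<xi> n)) \<and>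
        converges_in_prob M
          (\<lambda>n \<omega>. LINT s:{0..t}|lborel. (simple_value (k n) (\<tau> n) (\<xi> n) s \<omega> - H s \<omega>)\<^sup>2) (\<lambda>_. 0) \<and>
        converges_in_prob M (\<lambda>n. simple_integral W (k n) (\<tau> n) (\<xi> n) t) Z)"

text \<open>Weak solution of \<open>dX = b(X) dt + s(X) dW\<close> with continuous coefficients.\<close>

definition sde_solution ::
    "'a measure \<Rightarrow> (real \<Rightarrow> 'a measure) \<Rightarrow> (real \<Rightarrow> 'a \<Rightarrow> real) \<Rightarrow> (real \<Rightarrow> real) \<Rightarrow> (real \<Rightarrow> real)
      \<Rightarrow> (real \<Rightarrow> 'a \<Rightarrow> real) \<Rightarrow> bool" where
  "sde_solution M F W b s X \<longleftrightarrow>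
     filtered M F \<and> brownian_motion M F W \<and> adapted F X \<and>
     (\<forall>\<omega>\<in>space M. continuous_on {0..} (\<lambda>t. X t \<omega>)) \<and>
     (\<forall>t\<ge>0. \<exists>J. has_ito_integral M F W (\<lambda>r \<omega>. s (X r \<omega>)) t J \<and>
        (AE \<omega> in M. X t \<omega> = X 0 \<omega> + (LINT r:{0..t}|lborel. b (X r \<omega>)) + J \<omega>))"


section \<open>Pearson diffusions\<close>

text \<open>Parameters, in order: \<open>OU \<mu> \<sigma>\<close>, \<open>CIR a b\<close>, \<open>Jacobi a b\<close>, \<open>Fisher_Snedecor \<alpha> \<beta>\<close>,
  \<open>Reciprocal_Gamma \<alpha> \<beta>\<close>, \<open>Student \<delta> \<mu> \<mu>' \<nu>\<close>.\<close>

datatype pearson =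
    OU real real
  | CIR real real
  | Jacobi real real
  | Fisher_Snedecor real real
  | Reciprocal_Gamma real real
  | Student real real real real

fun admissible :: "pearson \<Rightarrow> bool" where
  "admissible (OU \<mu> \<sigma>) \<longleftrightarrow> \<sigma> \<noteq> 0"
| "admissible (CIR a b) \<longleftrightarrow> a > 0 \<and> b > 0"
| "admissible (Jacobi a b) \<longleftrightarrow> a > -1 \<and> b > -1"
| "admissible (Fisher_Snedecor \<alpha> \<beta>) \<longleftrightarrow> \<alpha> > 0 \<and> \<beta> > 2"
| "admissible (Reciprocal_Gamma \<alpha> \<beta>) \<longleftrightarrow> \<alpha> > 0 \<and> \<beta> > 1"
| "admissible (Student \<delta> \<mu> \<mu>' \<nu>) \<longleftrightarrow> \<delta> > 0 \<and> \<nu> > 1"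

fun state_space :: "pearson \<Rightarrow> real set" where
  "state_space (OU \<mu> \<sigma>) = UNIV"
| "state_space (CIR a b) = {0<..}"
| "state_space (Jacobi a b) = {-1<..<1}"
| "state_space (Fisher_Snedecor \<alpha> \<beta>) = {0<..}"
| "state_space (Reciprocal_Gamma \<alpha> \<beta>) = {0<..}"
| "state_space (Student \<delta> \<mu> \<mu>' \<nu>) = UNIV"

fun drift :: "real \<Rightarrow> pearson \<Rightarrow> real \<Rightarrow> real" where
  "drift \<theta> (OU \<mu> \<sigma>) x = - \<theta> * (x - \<mu>)"
| "drift \<theta> (CIR a b) x = - \<theta> * (x - b / a)"
| "drift \<theta> (Jacobi a b) x = - \<theta> * (x - (b - a) / (a + b + 2))"
| "drift \<theta> (Fisher_Snedecor \<alpha> \<beta>) x = - \<theta> * (x - \<beta> / (\<beta> - 2))"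
| "drift \<theta> (Reciprocal_Gamma \<alpha> \<beta>) x = - \<theta> * (x - \<alpha> / (\<beta> - 1))"
| "drift \<theta> (Student \<delta> \<mu> \<mu>' \<nu>) x = - \<theta> * (x - \<mu>)"

fun diffusion :: "real \<Rightarrow> pearson \<Rightarrow> real \<Rightarrow> real" where
  "diffusion \<theta> (OU \<mu> \<sigma>) x = sqrt (2 * \<theta> * \<sigma>\<^sup>2)"
| "diffusion \<theta> (CIR a b) x = sqrt (2 * \<theta> / a * x)"
| "diffusion \<theta> (Jacobi a b) x = sqrt (2 * \<theta> / (a + b + 2) * (1 - x\<^sup>2))"
| "diffusion \<theta> (Fisher_Snedecor \<alpha> \<beta>) x =
     sqrt (4 * \<theta> / (\<alpha> * (\<beta> - 2)) * x * (\<alpha> * x + \<beta>))"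
| "diffusion \<theta> (Reciprocal_Gamma \<alpha> \<beta>) x = sqrt (2 * \<theta> / (\<beta> - 1) * x\<^sup>2)"
| "diffusion \<theta> (Student \<delta> \<mu> \<mu>' \<nu>) x =
     sqrt (2 * \<theta> * \<delta>\<^sup>2 / (\<nu> - 1) * (1 + ((x - \<mu>') / \<delta>)\<^sup>2))"

definition student_weight :: "real \<Rightarrow> real \<Rightarrow> real \<Rightarrow> real \<Rightarrow> real \<Rightarrow> real" where
  "student_weight \<delta> \<mu> \<mu>' \<nu> x =
     exp ((\<mu> - \<mu>') * (\<nu> - 1) / \<delta> * arctan ((x - \<mu>') / \<delta>)) *
     (1 + ((x - \<mu>') / \<delta>)\<^sup>2) powr (- (\<nu> + 1) / 2)"

fun density_formula :: "pearson \<Rightarrow> real \<Rightarrow> real" where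
  "density_formula (OU \<mu> \<sigma>) x = normal_density \<mu> \<bar>\<sigma>\<bar> x"
| "density_formula (CIR a b) x = a powr b / Gamma b * x powr (b - 1) * exp (- a * x)"
| "density_formula (Jacobi a b) x =
     (1 - x) powr a * (1 + x) powr b *
     (Gamma (a + b + 2) / (Gamma (a + 1) * Gamma (b + 1) * 2 powr (a + b + 1)))"
| "density_formula (Fisher_Snedecor \<alpha> \<beta>) x =
     1 / (x * Beta (\<alpha> / 2) (\<beta> / 2)) *
     (\<alpha> * x / (\<alpha> * x + \<beta>)) powr (\<alpha> / 2) * (\<beta> / (\<alpha> * x + \<beta>)) powr (\<beta> / 2)"
| "density_formula (Reciprocal_Gamma \<alpha> \<beta>) x =
     \<alpha> powr \<beta> / Gamma \<beta> * x powr (- \<beta> - 1) * exp (- \<alpha> / x)"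
| "density_formula (Student \<delta> \<mu> \<mu>' \<nu>) x =
     student_weight \<delta> \<mu> \<mu>' \<nu> x / (LINT y|lborel. student_weight \<delta> \<mu> \<mu>' \<nu> y)"

definition stationary_density :: "pearson \<Rightarrow> real \<Rightarrow> real" where
  "stationary_density p x = density_formula p x * indicator (state_space p) x"

text \<open>Paths live in the closure of the diffusion space: for small shape parameters (for instance CIR
  with \<open>b < 1\<close>) the solution touches the boundary and is instantaneously reflected there, and a
  solution staying inside the open interval would not exist.\<close>

definition pearson_diffusion ::
    "'a measure \<Rightarrow> (real \<Rightarrow> 'a measure) \<Rightarrow> (real \<Rightarrow> 'a \<Rightarrow> real) \<Rightarrow> real \<Rightarrow> pearson
      \<Rightarrow> (real \<Rightarrow> 'a \<Rightarrow> real) \<Rightarrow> bool" where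
  "pearson_diffusion M F W \<theta> p X \<longleftrightarrow>
     \<theta> > 0 \<and> admissible p \<and> sde_solution M F W (drift \<theta> p) (diffusion \<theta> p) X \<and>
     (\<forall>t\<ge>0. \<forall>\<omega>\<in>space M. X t \<omega> \<in> closure (state_space p))"

end

theory Submission
  imports Defs
begin

text \<open>
  If \<open>X\<close> is a Pearson diffusion with mean \<open>\<mu>\<close>, started from its stationary density with variance \<open>v\<close>, then
  \<open>Y = X - \<mu>\<close> has drift \<open>- \<theta> * Y\<close> and a squared diffusion coefficient that is quadratic in \<open>Y\<close>. The first two
  moments of \<open>Y\<close> therefore satisfy linear Volterra equations, and the Pearson equation of the stationary
  density makes \<open>v\<close> a fixed point, so that \<open>E (Y t)\<^sup>2 = v\<close> and \<open>E (Y t * Y 0) = v * exp (- \<theta> * t)\<close>. Since \<open>X\<close> and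
  the inverse subordinator \<open>L\<close> are independent, the autocorrelation of the time-changed process is
  \<open>E exp (- \<theta> * L n)\<close>, a nonincreasing function of \<open>n\<close>. Its Laplace transform is
  \<open>\<Phi> z / (z * (\<theta> + \<Phi> z))\<close>. If \<open>\<Phi>\<close> varies regularly, then Karamata's Tauberian theorem gives
  \<open>E exp (- \<theta> * L n) \<sim> \<Phi> (1 / n) / (\<theta> * Gamma (1 - \<alpha>))\<close>. If \<open>\<Phi> z / z\<close> stays bounded, then so does the
  Laplace transform as \<open>z\<close> tends to 0, and the autocorrelations are summable.
\<close>

section \<open>Square integrable functions and a Gronwall inequality\<close>

text \<open>The correlation presupposes a finite variance, which admissibility does not give for the
  heavy-tailed Fisher-Snedecor, Reciprocal Gamma and Student families. Even then square
  integrability is known at time 0 only, while the Ito integral is defined as a limit in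
  probability, along one unspecified sequence of simple processes for each time. The isometry and
  the orthogonality that yield the moment equations live in L2. Hence two preliminary steps: all
  approximating sequences are shown to have the same limit, also locally on an event
  (\<open>ito_integral_localized\<close>), so that a convenient sequence may be chosen; and
  truncation where the path leaves \<open>[-K, K]\<close>, with a Gronwall bound uniform in
  \<open>K\<close>, carries square integrability to later times. The infinite Levy measure makes
  \<open>\<Phi>\<close> unbounded, so that \<open>\<sigma> y > 0\<close> almost surely for
  \<open>y > 0\<close>, and \<open>L 0 = 0\<close>. This is what identifies
  \<open>X\<^sub>\<Phi> 0\<close> with \<open>X 0\<close>, both for the initial density and in the
  autocorrelation.\<close>

definition square_integrable :: "'b measure \<Rightarrow> ('b \<Rightarrow> real) \<Rightarrow> bool" where
  "square_integrable N f \<longleftrightarrow> f \<in> borel_measurable N \<and> integrable N (\<lambda>x. (f x)\<^sup>2)"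

lemma square_integrableD:
  assumes "square_integrable N f"
  shows "f \<in> borel_measurable N" "integrable N (\<lambda>x. (f x)\<^sup>2)"
  using assms by (auto simp: square_integrable_def)

lemma square_integrable_mult:
  assumes "square_integrable N f" "square_integrable N g"
  shows "integrable N (\<lambda>x. f x * g x)"
proof (rule Bochner_Integration.integrable_bound)
  have [measurable]: "f \<in> borel_measurable N" "g \<in> borel_measurable N"
    using assms by (auto simp: square_integrable_def)
  show "integrable N (\<lambda>x. (f x)\<^sup>2 + (g x)\<^sup>2)" using assms by (auto simp: square_integrable_def)
  show "(\<lambda>x. f x * g x) \<in> borel_measurable N" by measurable
  show "AE x in N. norm (f x * g x) \<le> norm ((f x)\<^sup>2 + (g x)\<^sup>2)"
  proof (rule AE_I2)
    fix x
    have "2 * \<bar>f x * g x\<bar> \<le> (f x)\<^sup>2 + (g x)\<^sup>2"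
      using sum_squares_bound[of "\<bar>f x\<bar>" "\<bar>g x\<bar>"] by (simp add: abs_mult)
    then show "norm (f x * g x) \<le> norm ((f x)\<^sup>2 + (g x)\<^sup>2)" by simp
  qed
qed

lemma square_integrable_lincomb:
  assumes "square_integrable N f" "square_integrable N g"
  shows "square_integrable N (\<lambda>x. a * f x + b * g x)"
proof -
  have [measurable]: "f \<in> borel_measurable N" "g \<in> borel_measurable N"
    using assms by (auto simp: square_integrable_def)
  have "(a * f x + b * g x)\<^sup>2 = a\<^sup>2 * (f x)\<^sup>2 + 2 * a * b * (f x * g x) + b\<^sup>2 * (g x)\<^sup>2" for x
    by (simp add: power2_eq_square algebra_simps)
  then show ?thesis
    using square_integrable_mult[OF assms] assms by (simp add: square_integrable_def)
qed

lemma square_integrable_add: "square_integrable N f \<Longrightarrow> square_integrable N g \<Longrightarrow> square_integrable N (\<lambda>x. f x + g x)"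
  using square_integrable_lincomb[of N f g 1 1] by simp

lemma square_integrable_diff: "square_integrable N f \<Longrightarrow> square_integrable N g \<Longrightarrow> square_integrable N (\<lambda>x. f x - g x)"
  using square_integrable_lincomb[of N f g 1 "-1"] by simp

lemma square_integrable_cmult: "square_integrable N f \<Longrightarrow> square_integrable N (\<lambda>x. a * f x)"
  using square_integrable_lincomb[of N f f a 0] by simp

lemma integral_square_lincomb:
  assumes "square_integrable N f" "square_integrable N g"
  shows "(\<integral>x. (a * f x + b * g x)\<^sup>2 \<partial>N) =
    a\<^sup>2 * (\<integral>x. (f x)\<^sup>2 \<partial>N) + 2 * a * b * (\<integral>x. f x * g x \<partial>N) + b\<^sup>2 * (\<integral>x. (g x)\<^sup>2 \<partial>N)"
proof -
  have "(a * f x + b * g x)\<^sup>2 = a\<^sup>2 * (f x)\<^sup>2 + 2 * a * b * (f x * g x) + b\<^sup>2 * (g x)\<^sup>2" for x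
    by (simp add: power2_eq_square algebra_simps)
  then show ?thesis
    using square_integrable_mult[OF assms] assms by (simp add: square_integrable_def)
qed

lemma integral_square_sum_le:
  assumes "square_integrable N f" "square_integrable N g"
  shows "(\<integral>x. (f x + g x)\<^sup>2 \<partial>N) \<le> 2 * (\<integral>x. (f x)\<^sup>2 \<partial>N) + 2 * (\<integral>x. (g x)\<^sup>2 \<partial>N)"
proof -
  have "0 \<le> (\<integral>x. (1 * f x + (-1) * g x)\<^sup>2 \<partial>N)" by (rule integral_nonneg_AE) simp
  then have "2 * (\<integral>x. f x * g x \<partial>N) \<le> (\<integral>x. (f x)\<^sup>2 \<partial>N) + (\<integral>x. (g x)\<^sup>2 \<partial>N)"
    unfolding integral_square_lincomb[OF assms] by simp
  then show ?thesis
    using integral_square_lincomb[OF assms, of 1 1] by simp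
qed

text \<open>The quadratic form \<open>q\<close> is nonnegative, and at \<open>(?C, - ?B)\<close> it
  equals \<open>?C * (?C * ?A - ?B\<^sup>2)\<close>. If \<open>?C = 0\<close>, the form is affine in
  \<open>b\<close>; were \<open>?B\<close> nonzero, the chosen \<open>b\<close> would give it the
  value -1.\<close>

lemma Cauchy_Schwarz_integral:
  assumes "square_integrable N f" "square_integrable N g"
  shows "(\<integral>x. f x * g x \<partial>N)\<^sup>2 \<le> (\<integral>x. (f x)\<^sup>2 \<partial>N) * (\<integral>x. (g x)\<^sup>2 \<partial>N)"
proof -
  let ?A = "\<integral>x. (f x)\<^sup>2 \<partial>N" and ?B = "\<integral>x. f x * g x \<partial>N" and ?C = "\<integral>x. (g x)\<^sup>2 \<partial>N"
  have q: "0 \<le> a\<^sup>2 * ?A + 2 * a * b * ?B + b\<^sup>2 * ?C" for a b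
    unfolding integral_square_lincomb[OF assms, symmetric] by simp
  have C: "0 \<le> ?C" by simp
  show ?thesis
  proof (cases "?C = 0")
    case False
    then have "0 < ?C" using C by linarith
    moreover have "0 \<le> ?C * (?C * ?A - ?B\<^sup>2)"
      using q[of ?C "- ?B"] by (simp add: power2_eq_square algebra_simps)
    ultimately show ?thesis by (simp add: zero_le_mult_iff mult.commute)
  next
    case True
    have "?B = 0"
    proof (rule ccontr)
      assume "?B \<noteq> 0"
      then have "2 * 1 * (- (?A + 1) / (2 * ?B)) * ?B = - (?A + 1)" by simp
      then show False using q[of 1 "- (?A + 1) / (2 * ?B)"] True by simp
    qed
    then show ?thesis using True by simp
  qed
qed

lemma L2_tendsto_integral_mult:
  assumes Z: "square_integrable N Z" and X: "\<And>n. square_integrable N (X n)" "square_integrable N Y"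
    and lim: "(\<lambda>n. \<integral>x. (X n x - Y x)\<^sup>2 \<partial>N) \<longlonglongrightarrow> 0"
  shows "(\<lambda>n. \<integral>x. Z x * X n x \<partial>N) \<longlonglongrightarrow> (\<integral>x. Z x * Y x \<partial>N)"
proof -
  have d: "square_integrable N (\<lambda>x. X n x - Y x)" for n by (rule square_integrable_diff[OF X])
  have "(\<lambda>n. sqrt ((\<integral>x. (Z x)\<^sup>2 \<partial>N) * (\<integral>x. (X n x - Y x)\<^sup>2 \<partial>N))) \<longlonglongrightarrow> sqrt ((\<integral>x. (Z x)\<^sup>2 \<partial>N) * 0)"
    by (intro tendsto_intros lim)
  then have "(\<lambda>n. sqrt ((\<integral>x. (Z x)\<^sup>2 \<partial>N) * (\<integral>x. (X n x - Y x)\<^sup>2 \<partial>N))) \<longlonglongrightarrow> 0" by simp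
  then have "(\<lambda>n. \<integral>x. Z x * (X n x - Y x) \<partial>N) \<longlonglongrightarrow> 0"
    by (rule Lim_null_comparison[rotated])
      (use Cauchy_Schwarz_integral[OF Z d] in \<open>auto intro!: always_eventually simp: real_le_rsqrt\<close>)
  moreover have "(\<integral>x. Z x * (X n x - Y x) \<partial>N) = (\<integral>x. Z x * X n x \<partial>N) - (\<integral>x. Z x * Y x \<partial>N)" for n
    using square_integrable_mult[OF Z X(1)[of n]] square_integrable_mult[OF Z X(2)] by (simp add: right_diff_distrib)
  ultimately show ?thesis by (simp add: LIM_zero_iff)
qed

lemma L2_tendsto_integral_square:
  assumes X: "\<And>n. square_integrable N (X n)" "square_integrable N Y"
    and lim: "(\<lambda>n. \<integral>x. (X n x - Y x)\<^sup>2 \<partial>N) \<longlonglongrightarrow> 0"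
  shows "(\<lambda>n. \<integral>x. (X n x)\<^sup>2 \<partial>N) \<longlonglongrightarrow> (\<integral>x. (Y x)\<^sup>2 \<partial>N)"
proof -
  have eq: "(\<integral>x. (X n x)\<^sup>2 \<partial>N) = (\<integral>x. (X n x - Y x)\<^sup>2 \<partial>N) + 2 * (\<integral>x. Y x * X n x \<partial>N) - (\<integral>x. (Y x)\<^sup>2 \<partial>N)" for n
    using integral_square_lincomb[OF X(1)[of n] X(2), of 1 "-1"] by (simp add: mult.commute)
  have "(\<lambda>n. (\<integral>x. (X n x - Y x)\<^sup>2 \<partial>N) + 2 * (\<integral>x. Y x * X n x \<partial>N) - (\<integral>x. (Y x)\<^sup>2 \<partial>N))
    \<longlonglongrightarrow> 0 + 2 * (\<integral>x. Y x * Y x \<partial>N) - (\<integral>x. (Y x)\<^sup>2 \<partial>N)"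
    by (intro tendsto_intros lim L2_tendsto_integral_mult X)
  then show ?thesis unfolding eq by (simp add: power2_eq_square)
qed

text \<open>The weight \<open>exp (- 2 * b * t)\<close> makes the integral operator a contraction
  with factor 1/2: if \<open>S\<close> is the weighted supremum, \<open>b\<close> times the integral
  of \<open>S * exp (2 * b * s)\<close> is at most \<open>S / 2 * exp (2 * b * t)\<close>, so
  \<open>S \<le> a + S / 2\<close>. The bound \<open>C\<close> makes \<open>S\<close> finite.
  Measurability of \<open>u\<close> is not assumed: comparison with the integrable majorant is valid
  for the integral with its default value 0 as well.\<close>

lemma gronwall_bounded:
  fixes u :: "real \<Rightarrow> real"
  assumes bdd: "\<And>t. 0 < t \<Longrightarrow> t \<le> T \<Longrightarrow> 0 \<le> u t \<and> u t \<le> C"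
    and a0: "0 \<le> a" and b: "0 < b" and le: "\<And>t. 0 < t \<Longrightarrow> t \<le> T \<Longrightarrow> u t \<le> a + b * (\<integral>s. u s \<partial>restrict_space lborel {0<..t})"
    and T: "0 < t" "t \<le> T"
  shows "u t \<le> 2 * a * exp (2 * b * t)"
proof -
  define S where "S = (SUP t\<in>{0<..T}. exp (- 2 * b * t) * u t)"
  have ne: "{0<..T} \<noteq> {}" using T by auto
  have C0: "0 \<le> C" using bdd[OF T] by simp
  have bd: "bdd_above ((\<lambda>t. exp (- 2 * b * t) * u t) ` {0<..T})"
  proof (rule bdd_aboveI2)
    fix t assume "t \<in> {0<..T}"
    then have t: "0 < t" "t \<le> T" by auto
    have "exp (- 2 * b * t) * u t \<le> 1 * C"
      using bdd[OF t] b t by (intro mult_mono) auto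
    then show "exp (- 2 * b * t) * u t \<le> C" by simp
  qed
  have uS: "u t \<le> S * exp (2 * b * t)" if "0 < t" "t \<le> T" for t
  proof -
    have "exp (- 2 * b * t) * u t \<le> S" unfolding S_def using that by (intro cSUP_upper bd) auto
    then have 1: "exp (2 * b * t) * (exp (- 2 * b * t) * u t) \<le> exp (2 * b * t) * S" by (intro mult_left_mono) auto
    have "exp (2 * b * t) * exp (- 2 * b * t) = 1" by (simp add: exp_add[symmetric])
    then have 2: "exp (2 * b * t) * (exp (- 2 * b * t) * u t) = u t" by (metis mult.assoc mult_1)
    show ?thesis using 1 unfolding 2 by (simp only: mult.commute)
  qed
  have "S \<le> a + S / 2"
    unfolding S_def
  proof (rule cSUP_least[OF ne])
    fix t assume "t \<in> {0<..T}"
    then have t: "0 < t" "t \<le> T" by auto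
    have S0: "0 \<le> S"
      using order_trans[OF conjunct1[OF bdd[OF t]] uS[OF t]] by (simp add: zero_le_mult_iff)
    have si: "set_integrable lborel {0..t} (\<lambda>s. S * exp (2 * b * s))"
      by (intro borel_integrable_atLeastAtMost') (auto intro!: continuous_intros)
    have "(\<integral>s. u s \<partial>restrict_space lborel {0<..t}) \<le> (\<integral>s. S * exp (2 * b * s) \<partial>restrict_space lborel {0<..t})"
    proof (rule integral_mono')
      show "integrable (restrict_space lborel {0<..t}) (\<lambda>s. S * exp (2 * b * s))"
      proof -
        from si have "set_integrable lborel {0<..t} (\<lambda>s. S * exp (2 * b * s))" by (rule set_integrable_subset) auto
        then show ?thesis unfolding set_integrable_def by (subst integrable_restrict_space) auto
      qed
    qed (use uS t S0 in \<open>auto simp: space_restrict_space\<close>)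
    also have "\<dots> \<le> (LINT s:{0..t}|lborel. S * exp (2 * b * s))"
      unfolding set_lebesgue_integral_def
      by (subst integral_restrict_space, simp, rule integral_mono'[OF si[unfolded set_integrable_def]])
        (use S0 in \<open>auto simp: indicator_def\<close>)
    also have "\<dots> = S / (2 * b) * exp (2 * b * t) - S / (2 * b) * exp (2 * b * 0)"
      unfolding set_lebesgue_integral_def
      using t b
      by (intro integral_FTC_atLeastAtMost[where F="\<lambda>s. S / (2 * b) * exp (2 * b * s)"])
        (auto intro!: derivative_eq_intros continuous_intros simp: has_real_derivative_iff_has_vector_derivative[symmetric])
    also have "\<dots> \<le> S / (2 * b) * exp (2 * b * t)" using S0 b by simp
    finally have "u t \<le> a + b * (S / (2 * b) * exp (2 * b * t))"
      using le[OF t] b by (meson add_left_mono less_imp_le mult_left_mono order_trans)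
    then have u: "u t \<le> a + S / 2 * exp (2 * b * t)" using b by simp
    have "exp (- 2 * b * t) * u t \<le> exp (- 2 * b * t) * (a + S / 2 * exp (2 * b * t))"
      by (rule mult_left_mono[OF u]) simp
    also have "\<dots> = exp (- 2 * b * t) * a + S / 2" by (simp add: distrib_left exp_minus field_simps)
    also have "\<dots> \<le> 1 * a + S / 2" using a0 b t by (intro add_right_mono mult_right_mono) auto
    finally show "exp (- 2 * b * t) * u t \<le> a + (SUP t\<in>{0<..T}. exp (- 2 * b * t) * u t) / 2"
      by (simp add: S_def)
  qed
  then have "S \<le> 2 * a" by simp
  then have "S * exp (2 * b * t) \<le> 2 * a * exp (2 * b * t)" by (intro mult_right_mono) auto
  then show ?thesis using uS[OF T] by linarith
qed

section \<open>Integrals of simple processes\<close>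

locale brownian_filtration = prob_space M for M :: "'a measure" +
  fixes F :: "real \<Rightarrow> 'a measure" and W :: "real \<Rightarrow> 'a \<Rightarrow> real"
  assumes filtered: "filtered M F" and brownian: "brownian_motion M F W"
begin

lemma space_F [simp]: "space (F t) = space M"
  using filtered by (auto simp: filtered_def filtration_def)

lemma measurable_F_mono: "Z \<in> borel_measurable (F s) \<Longrightarrow> s \<le> t \<Longrightarrow> Z \<in> borel_measurable (F t)"
  using filtered filtration.sets_F_mono[of "space M" F s t]
  by (auto simp: filtered_def measurable_def)

lemma measurable_F_M: "Z \<in> borel_measurable (F s) \<Longrightarrow> Z \<in> borel_measurable M"
  using filtered by (auto simp: filtered_def intro: measurable_from_subalg)

lemma W_measurable_F: "0 \<le> s \<Longrightarrow> s \<le> t \<Longrightarrow> W s \<in> borel_measurable (F t)"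
  using brownian measurable_F_mono unfolding brownian_motion_def adapted_def by blast

lemma W_measurable: "0 \<le> s \<Longrightarrow> W s \<in> borel_measurable M"
  using W_measurable_F measurable_F_M by blast

lemma increment_indep:
  assumes "0 \<le> s" "s < t" "Z \<in> borel_measurable (F s)"
  shows "indep_var borel Z borel (\<lambda>\<omega>. W t \<omega> - W s \<omega>)"
  unfolding indep_var_eq
proof (intro conjI)
  let ?D = "\<lambda>\<omega>. W t \<omega> - W s \<omega>"
  show "Z \<in> borel_measurable M" using assms measurable_F_M by blast
  show "?D \<in> borel_measurable M"
    using assms W_measurable by (intro borel_measurable_diff) auto
  have ind: "indep_set (sets (F s)) (sets (vimage_algebra (space M) ?D borel))"
    using brownian assms unfolding brownian_motion_def by blast
  have 1: "sigma_sets (space M) {Z -` A \<inter> space M |A. A \<in> sets borel} \<subseteq> sets (F s)"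
    using measurable_sets[OF assms(3)] sets.sigma_sets_subset[of "{Z -` A \<inter> space M |A. A \<in> sets borel}" "F s"]
    by auto
  have 2: "sigma_sets (space M) {?D -` A \<inter> space M |A. A \<in> sets borel} = sets (vimage_algebra (space M) ?D borel)"
    by (simp add: sets_vimage_algebra)
  show "indep_set (sigma_sets (space M) {Z -` A \<inter> space M |A. A \<in> sets borel})
     (sigma_sets (space M) {?D -` A \<inter> space M |A. A \<in> sets borel})"
    using ind 1 unfolding 2 indep_sets2_eq by blast
qed

lemma increment_moments:
  assumes "0 \<le> s" "s < t"
  shows "integrable M (\<lambda>\<omega>. W t \<omega> - W s \<omega>)" "(\<integral>\<omega>. W t \<omega> - W s \<omega> \<partial>M) = 0"
    "integrable M (\<lambda>\<omega>. (W t \<omega> - W s \<omega>)\<^sup>2)" "(\<integral>\<omega>. (W t \<omega> - W s \<omega>)\<^sup>2 \<partial>M) = t - s"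
proof -
  let ?D = "\<lambda>\<omega>. W t \<omega> - W s \<omega>"
  have D: "distributed M lborel ?D (\<lambda>x. ennreal (normal_density 0 (sqrt (t - s)) x))"
    using brownian assms unfolding brownian_motion_def by blast
  have pos: "0 < sqrt (t - s)" using assms by simp
  show "integrable M ?D"
    by (rule iffD1[OF distributed_integrable[OF D, of "\<lambda>x. x"]])
      (simp, simp, rule integrable_normal_moment_nz_1[OF pos, of 0])
  show m0: "(\<integral>\<omega>. ?D \<omega> \<partial>M) = 0"
    by (rule normal_distributed_expectation[OF pos D])
  show "integrable M (\<lambda>\<omega>. (?D \<omega>)\<^sup>2)"
    by (rule iffD1[OF distributed_integrable[OF D, of "\<lambda>x. x\<^sup>2"]])
      (simp, simp, use integrable_normal_moment[OF pos, of 0 2] in simp)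
  show "(\<integral>\<omega>. (?D \<omega>)\<^sup>2 \<partial>M) = t - s"
    using normal_distributed_variance[OF pos D] assms m0 by simp
qed

lemma increment_expectation:
  assumes "0 \<le> s" "s \<le> t" "Z \<in> borel_measurable (F s)" "integrable M Z"
  shows "integrable M (\<lambda>\<omega>. Z \<omega> * (W t \<omega> - W s \<omega>))" "(\<integral>\<omega>. Z \<omega> * (W t \<omega> - W s \<omega>) \<partial>M) = 0"
    "integrable M (\<lambda>\<omega>. Z \<omega> * (W t \<omega> - W s \<omega>)\<^sup>2)"
    "(\<integral>\<omega>. Z \<omega> * (W t \<omega> - W s \<omega>)\<^sup>2 \<partial>M) = (\<integral>\<omega>. Z \<omega> \<partial>M) * (t - s)"
proof (atomize (full), goal_cases)
  case 1
  show ?case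
  \<comment> \<open>Increments have a law only for \<open>s < t\<close> in
    \<open>brownian_motion\<close>; for \<open>s = t\<close> everything vanishes.\<close>
  proof (cases "s = t")
    case False
    then have st: "s < t" using assms by simp
    let ?D = "\<lambda>\<omega>. W t \<omega> - W s \<omega>"
    note ind = increment_indep[OF assms(1) st assms(3)]
    have ind2: "indep_var borel Z borel (\<lambda>\<omega>. (?D \<omega>)\<^sup>2)"
      using indep_var_compose[OF ind, of "\<lambda>x. x" borel "\<lambda>x. x\<^sup>2" borel] by (simp add: comp_def)
    note m = increment_moments[OF assms(1) st]
    show ?thesis
      by (intro conjI indep_var_integrable[OF ind assms(4) m(1)] indep_var_integrable[OF ind2 assms(4) m(3)])
        (simp_all only: indep_var_lebesgue_integral[OF ind assms(4) m(1)]
           indep_var_lebesgue_integral[OF ind2 assms(4) m(3)] m(2,4) mult_zero_right)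
  qed simp
qed

lemma simple_processD:
  assumes "simple_process F k \<tau> \<xi>"
  shows "i \<le> j \<Longrightarrow> j \<le> k \<Longrightarrow> \<tau> i \<le> \<tau> j" "i \<le> k \<Longrightarrow> 0 \<le> \<tau> i"
    "i < k \<Longrightarrow> \<xi> i \<in> borel_measurable (F (\<tau> i))" "i < k \<Longrightarrow> \<xi> i \<in> borel_measurable M"
    "i < k \<Longrightarrow> \<exists>C. \<forall>\<omega>\<in>space M. \<bar>\<xi> i \<omega>\<bar> \<le> C"
proof -
  show mono: "i \<le> j \<Longrightarrow> j \<le> k \<Longrightarrow> \<tau> i \<le> \<tau> j" for i j
  proof (induction j rule: dec_induct)
    case (step n)
    then show ?case using assms unfolding simple_process_def
      by (meson Suc_le_lessD Suc_leD order_trans)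
  qed simp
  show "i \<le> k \<Longrightarrow> 0 \<le> \<tau> i" using mono[of 0 i] assms unfolding simple_process_def by auto
  show "i < k \<Longrightarrow> \<xi> i \<in> borel_measurable (F (\<tau> i))" "i < k \<Longrightarrow> \<exists>C. \<forall>\<omega>\<in>space M. \<bar>\<xi> i \<omega>\<bar> \<le> C"
    using assms unfolding simple_process_def by (auto simp: space_F)
  then show "i < k \<Longrightarrow> \<xi> i \<in> borel_measurable M" using measurable_F_M by blast
qed

lemma simple_process_Suc: "simple_process F (Suc k) \<tau> \<xi> \<Longrightarrow> simple_process F k \<tau> \<xi>"
  by (simp add: simple_process_def)

text \<open>Closed form of the integral of the squared simple process over \<open>[0, t]\<close>, as
  \<open>energy_eq_integral\<close> confirms. As a finite sum it is visibly determined by the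
  coefficients used so far and monotone in \<open>k\<close>, which the cutoff in
  \<open>simple_integral_truncation\<close> exploits.\<close>

definition energy :: "nat \<Rightarrow> (nat \<Rightarrow> real) \<Rightarrow> (nat \<Rightarrow> 'a \<Rightarrow> real) \<Rightarrow> real \<Rightarrow> 'a \<Rightarrow> real" where
  "energy k \<tau> \<xi> t \<omega> = (\<Sum>i<k. (\<xi> i \<omega>)\<^sup>2 * (min (\<tau> (Suc i)) t - min (\<tau> i) t))"

text \<open>The instance \<open>u = \<tau> k\<close> says that the contribution of the first
  \<open>k\<close> steps is known before the next step begins; this makes the mixed terms of the
  isometry vanish.\<close>

lemma simple_integral_measurable_F:
  assumes "simple_process F k \<tau> \<xi>" "0 \<le> t" "\<tau> k \<le> u \<or> t \<le> u \<and> (\<forall>i<k. \<tau> i \<le> u)"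
  shows "simple_integral W k \<tau> \<xi> t \<in> borel_measurable (F u)"
proof -
  have "(\<lambda>\<omega>. \<xi> i \<omega> * (W (min (\<tau> (Suc i)) t) \<omega> - W (min (\<tau> i) t) \<omega>)) \<in> borel_measurable (F u)"
    if "i < k" for i
  proof -
    have "0 \<le> \<tau> i" "0 \<le> \<tau> (Suc i)" "\<tau> i \<le> u" "min (\<tau> (Suc i)) t \<le> u" "min (\<tau> i) t \<le> u"
      using simple_processD(1)[OF assms(1), of i k] simple_processD(1)[OF assms(1), of "Suc i" k]
        simple_processD(2)[OF assms(1), of i] simple_processD(2)[OF assms(1), of "Suc i"] that assms(3)
      by auto
    then show ?thesis
      using assms(2) measurable_F_mono[OF simple_processD(3)[OF assms(1) that], of u]
      by (intro borel_measurable_times borel_measurable_diff W_measurable_F) auto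
  qed
  then show ?thesis
    unfolding simple_integral_def[abs_def] by (intro borel_measurable_sum) auto
qed

lemma simple_integral_measurable:
  assumes "simple_process F k \<tau> \<xi>" "0 \<le> t"
  shows "simple_integral W k \<tau> \<xi> t \<in> borel_measurable M"
  by (rule measurable_F_M[of _ "\<tau> k"], rule simple_integral_measurable_F[OF assms]) auto

lemma integrable_bounded_mult:
  fixes f g :: "'a \<Rightarrow> real"
  assumes "f \<in> borel_measurable M" "\<exists>C. \<forall>\<omega>\<in>space M. \<bar>f \<omega>\<bar> \<le> C" "integrable M g"
  shows "integrable M (\<lambda>\<omega>. f \<omega> * g \<omega>)"
proof -
  obtain C where C: "\<And>\<omega>. \<omega> \<in> space M \<Longrightarrow> \<bar>f \<omega>\<bar> \<le> C" using assms(2) by auto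
  show ?thesis
  proof (rule Bochner_Integration.integrable_bound[of _ "\<lambda>\<omega>. C * g \<omega>"])
    show "AE x in M. norm (f x * g x) \<le> norm (C * g x)"
      using C by (intro AE_I2) (force simp: abs_mult intro!: mult_right_mono)
  qed (use assms in auto)
qed

text \<open>Induction on the number of steps. In the expanded square the mixed term is
  \<open>\<xi> k * ?S\<close>, known at time \<open>\<tau> k\<close>, times a later increment and so
  has mean 0; the square of the new step adds its expected energy.\<close>

lemma simple_integral_isometry:
  assumes "simple_process F k \<tau> \<xi>" "0 \<le> t"
  shows "integrable M (\<lambda>\<omega>. (simple_integral W k \<tau> \<xi> t \<omega>)\<^sup>2)"
    and "integrable M (energy k \<tau> \<xi> t)"
    and "(\<integral>\<omega>. (simple_integral W k \<tau> \<xi> t \<omega>)\<^sup>2 \<partial>M) = (\<integral>\<omega>. energy k \<tau> \<xi> t \<omega> \<partial>M)"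
  using assms(1)
proof (atomize (full), induction k)
  case 0
  then show ?case by (simp add: simple_integral_def energy_def)
next
  case (Suc k)
  let ?S = "simple_integral W k \<tau> \<xi> t"
  let ?c = "\<lambda>i. min (\<tau> i) t"
  let ?D = "\<lambda>\<omega>. W (?c (Suc k)) \<omega> - W (?c k) \<omega>"
  from Suc have sp: "simple_process F k \<tau> \<xi>" and sp': "simple_process F (Suc k) \<tau> \<xi>"
    using simple_process_Suc by auto
  with Suc.IH have IH: "integrable M (\<lambda>\<omega>. (?S \<omega>)\<^sup>2)" "integrable M (energy k \<tau> \<xi> t)"
    "(\<integral>\<omega>. (?S \<omega>)\<^sup>2 \<partial>M) = (\<integral>\<omega>. energy k \<tau> \<xi> t \<omega> \<partial>M)" by auto
  have S': "simple_integral W (Suc k) \<tau> \<xi> t = (\<lambda>\<omega>. ?S \<omega> + \<xi> k \<omega> * ?D \<omega>)"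
    by (simp add: simple_integral_def[abs_def])
  have E': "energy (Suc k) \<tau> \<xi> t = (\<lambda>\<omega>. energy k \<tau> \<xi> t \<omega> + (\<xi> k \<omega>)\<^sup>2 * (?c (Suc k) - ?c k))"
    by (simp add: energy_def[abs_def])
  have \<tau>: "0 \<le> \<tau> k" "\<tau> k \<le> \<tau> (Suc k)" "\<And>i. i \<le> k \<Longrightarrow> \<tau> i \<le> \<tau> k"
    using simple_processD(1,2)[OF sp'] by auto
  have \<xi>k: "\<xi> k \<in> borel_measurable (F (\<tau> k))" "\<exists>C. \<forall>\<omega>\<in>space M. \<bar>\<xi> k \<omega>\<bar> \<le> C" "\<xi> k \<in> borel_measurable M"
    using simple_processD(3,4,5)[OF sp'] by auto
  have Smeas: "?S \<in> borel_measurable M" by (rule simple_integral_measurable[OF sp assms(2)])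
  have Sint: "integrable M ?S" using square_integrable_imp_integrable[OF Smeas] IH(1) by (simp add: power2_eq_square)
  have \<xi>2: "\<exists>C. \<forall>\<omega>\<in>space M. \<bar>(\<xi> k \<omega>)\<^sup>2\<bar> \<le> C"
  proof -
    obtain C where "\<forall>\<omega>\<in>space M. \<bar>\<xi> k \<omega>\<bar> \<le> C" using \<xi>k by auto
    then have "\<forall>\<omega>\<in>space M. \<bar>(\<xi> k \<omega>)\<^sup>2\<bar> \<le> C\<^sup>2" by (metis abs_ge_zero power2_abs power_abs power_mono)
    then show ?thesis by blast
  qed
  have i\<xi>2: "integrable M (\<lambda>\<omega>. (\<xi> k \<omega>)\<^sup>2)"
    using integrable_bounded_mult[OF _ \<xi>2, of "\<lambda>_. 1"] \<xi>k by auto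
  have iS\<xi>: "integrable M (\<lambda>\<omega>. \<xi> k \<omega> * ?S \<omega>)"
    by (rule integrable_bounded_mult[OF \<xi>k(3,2) Sint])
  have key: "integrable M (\<lambda>\<omega>. \<xi> k \<omega> * ?S \<omega> * ?D \<omega>) \<and> (\<integral>\<omega>. \<xi> k \<omega> * ?S \<omega> * ?D \<omega> \<partial>M) = 0 \<and>
     integrable M (\<lambda>\<omega>. (\<xi> k \<omega>)\<^sup>2 * (?D \<omega>)\<^sup>2) \<and>
     (\<integral>\<omega>. (\<xi> k \<omega>)\<^sup>2 * (?D \<omega>)\<^sup>2 \<partial>M) = (\<integral>\<omega>. (\<xi> k \<omega>)\<^sup>2 \<partial>M) * (?c (Suc k) - ?c k)"
  \<comment> \<open>If \<open>\<tau> k > t\<close>, both clipped times equal \<open>t\<close> and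
    the new step contributes nothing.\<close>
  proof (cases "\<tau> k \<le> t")
    case True
    then have c: "?c k = \<tau> k" "0 \<le> ?c k" "?c k \<le> ?c (Suc k)" using \<tau> by auto
    have SF: "?S \<in> borel_measurable (F (\<tau> k))"
      by (rule simple_integral_measurable_F[OF sp assms(2)]) simp
    show ?thesis
      using increment_expectation[of "?c k" "?c (Suc k)" "\<lambda>\<omega>. \<xi> k \<omega> * ?S \<omega>"]
        increment_expectation[of "?c k" "?c (Suc k)" "\<lambda>\<omega>. (\<xi> k \<omega>)\<^sup>2"] c SF \<xi>k iS\<xi> i\<xi>2 by auto
  next
    case False
    then show ?thesis using \<tau> by auto
  qed
  have sq: "(?S \<omega> + \<xi> k \<omega> * ?D \<omega>)\<^sup>2 = (?S \<omega>)\<^sup>2 + 2 * (\<xi> k \<omega> * ?S \<omega> * ?D \<omega>) + (\<xi> k \<omega>)\<^sup>2 * (?D \<omega>)\<^sup>2" for \<omega>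
    by (simp add: power2_eq_square algebra_simps)
  show ?case
    unfolding S' E' sq using key IH i\<xi>2 by simp
qed

text \<open>A factor \<open>Z\<close> known at time 0 can be absorbed into each coefficient
  \<open>\<xi> i\<close>, so every summand is again a past factor times a later increment.\<close>

lemma simple_integral_orthogonal:
  assumes "simple_process F k \<tau> \<xi>" "0 \<le> t" "Z \<in> borel_measurable (F 0)" "integrable M Z"
  shows "integrable M (\<lambda>\<omega>. Z \<omega> * simple_integral W k \<tau> \<xi> t \<omega>)" "(\<integral>\<omega>. Z \<omega> * simple_integral W k \<tau> \<xi> t \<omega> \<partial>M) = 0"
proof -
  let ?c = "\<lambda>i. min (\<tau> i) t"
  have *: "integrable M (\<lambda>\<omega>. \<xi> i \<omega> * Z \<omega> * (W (?c (Suc i)) \<omega> - W (?c i) \<omega>)) \<and>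
    (\<integral>\<omega>. \<xi> i \<omega> * Z \<omega> * (W (?c (Suc i)) \<omega> - W (?c i) \<omega>) \<partial>M) = 0" if "i < k" for i
  proof (cases "\<tau> i \<le> t")
    case True
    have c: "?c i = \<tau> i" "0 \<le> ?c i" "?c i \<le> ?c (Suc i)"
      using True simple_processD(1)[OF assms(1), of i "Suc i"] simple_processD(2)[OF assms(1), of i] that by auto
    have m: "\<xi> i \<in> borel_measurable (F (?c i))" "Z \<in> borel_measurable (F (?c i))"
      using c simple_processD(3)[OF assms(1) that] measurable_F_mono[OF assms(3)] by auto
    have "integrable M (\<lambda>\<omega>. \<xi> i \<omega> * Z \<omega>)"
      by (rule integrable_bounded_mult[OF simple_processD(4,5)[OF assms(1) that] assms(4)])
    then show ?thesis
      using increment_expectation[OF c(2,3), of "\<lambda>\<omega>. \<xi> i \<omega> * Z \<omega>"] m by auto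
  next
    case False
    then show ?thesis using simple_processD(1)[OF assms(1), of i "Suc i"] that by auto
  qed
  have eq: "Z \<omega> * simple_integral W k \<tau> \<xi> t \<omega> = (\<Sum>i<k. \<xi> i \<omega> * Z \<omega> * (W (?c (Suc i)) \<omega> - W (?c i) \<omega>))" for \<omega>
    by (simp add: simple_integral_def sum_distrib_left mult_ac)
  show "integrable M (\<lambda>\<omega>. Z \<omega> * simple_integral W k \<tau> \<xi> t \<omega>)"
    unfolding eq using * by (intro Bochner_Integration.integrable_sum) auto
  show "(\<integral>\<omega>. Z \<omega> * simple_integral W k \<tau> \<xi> t \<omega> \<partial>M) = 0"
    unfolding eq using * by (subst Bochner_Integration.integral_sum) auto
qed

section \<open>Common refinements of simple processes\<close>

lemma indicator_Ioc_diff: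
  fixes a b s :: real
  assumes "a \<le> b"
  shows "indicator {a<..b} s = - (if b < s then 1 else 0) - - (if a < s then 1 else (0::real))"
  using assms by (auto simp: indicator_def)

text \<open>Gives the value of a simple process the same shape
  \<open>\<xi> i * (g (\<tau> (Suc i)) - g (\<tau> i))\<close> as its integral: here
  \<open>g\<close> is minus the indicator of \<open>x < s\<close>, there it is
  \<open>\<lambda>x. W (min x t)\<close>. Refinement can then be treated once, for arbitrary
  \<open>g\<close>.\<close>

lemma simple_value_telescope:
  assumes "simple_process F k \<tau> \<xi>"
  shows "simple_value k \<tau> \<xi> s \<omega> =
    (\<Sum>i<k. \<xi> i \<omega> * (- (if \<tau> (Suc i) < s then 1 else 0) - - (if \<tau> i < s then 1 else 0)))"
  unfolding simple_value_def
  by (intro sum.cong refl arg_cong2[where f=times] indicator_Ioc_diff simple_processD(1)[OF assms]) auto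

lemma telescope_refinement:
  fixes T :: "nat \<Rightarrow> real" and g :: "real \<Rightarrow> real"
  assumes mono: "\<And>i j. i < j \<Longrightarrow> j \<le> n \<Longrightarrow> T i < T j" and ab: "x \<in> T ` {..n}" "y \<in> T ` {..n}" "x \<le> y"
  shows "(\<Sum>j<n. (if x \<le> T j \<and> T (Suc j) \<le> y then 1 else 0) * (g (T (Suc j)) - g (T j))) = g y - g x"
proof -
  obtain a b where a: "x = T a" "a \<le> n" and b: "y = T b" "b \<le> n" using ab by auto
  have iff: "T i \<le> T j \<longleftrightarrow> i \<le> j" if "i \<le> n" "j \<le> n" for i j
    using mono[of i j] mono[of j i] that by (metis le_less linorder_not_le order_less_imp_not_less)
  have ab': "a \<le> b" using iff[of a b] a b ab(3) by auto
  have "(\<Sum>j<n. (if x \<le> T j \<and> T (Suc j) \<le> y then 1 else 0) * (g (T (Suc j)) - g (T j))) =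
    (\<Sum>j<n. if j \<in> {a..<b} then g (T (Suc j)) - g (T j) else 0)"
    using a b iff by (intro sum.cong) (auto simp: Suc_le_eq)
  also have "\<dots> = (\<Sum>j\<in>{a..<b}. g (T (Suc j)) - g (T j))"
    using b by (subst sum.inter_restrict[symmetric]) (auto intro!: sum.cong)
  also have "\<dots> = g (T b) - g (T a)" using ab' by (rule sum_Suc_diff')
  finally show ?thesis using a b by simp
qed

text \<open>\<open>\<eta> j\<close> collects the \<open>\<xi> i\<close> whose interval contains the
  cell from \<open>T j\<close> to \<open>T (Suc j)\<close>. The condition
  \<open>\<tau> i \<le> T j\<close> in the indicator is what makes these coefficients known at
  \<open>T j\<close>.\<close>

lemma simple_process_refinement:
  assumes sp: "simple_process F k \<tau> \<xi>" and T: "\<And>i j. i < j \<Longrightarrow> j \<le> n \<Longrightarrow> T i < T j" "\<tau> ` {..k} \<subseteq> T ` {..n}"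
  defines "\<eta> \<equiv> \<lambda>j \<omega>. \<Sum>i<k. \<xi> i \<omega> * (if \<tau> i \<le> T j \<and> T (Suc j) \<le> \<tau> (Suc i) then 1 else 0)"
  shows "\<And>j. j < n \<Longrightarrow> \<eta> j \<in> borel_measurable (F (T j))"
    "\<And>j. \<exists>C. \<forall>\<omega>\<in>space M. \<bar>\<eta> j \<omega>\<bar> \<le> C"
    "\<And>g :: real \<Rightarrow> real. (\<Sum>j<n. \<eta> j \<omega> * (g (T (Suc j)) - g (T j))) = (\<Sum>i<k. \<xi> i \<omega> * (g (\<tau> (Suc i)) - g (\<tau> i)))"
proof -
  fix j assume j: "j < n"
  have "(\<lambda>\<omega>. \<xi> i \<omega> * (if \<tau> i \<le> T j \<and> T (Suc j) \<le> \<tau> (Suc i) then 1 else 0)) \<in> borel_measurable (F (T j))"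
    if "i < k" for i
    using measurable_F_mono[OF simple_processD(3)[OF sp that], of "T j"] by auto
  then show "\<eta> j \<in> borel_measurable (F (T j))" unfolding \<eta>_def by (intro borel_measurable_sum) auto
next
  fix j
  have "\<forall>i\<in>{..<k}. \<exists>C. \<forall>\<omega>\<in>space M. \<bar>\<xi> i \<omega>\<bar> \<le> C" using simple_processD(5)[OF sp] by auto
  then obtain C where C: "\<And>i \<omega>. i < k \<Longrightarrow> \<omega> \<in> space M \<Longrightarrow> \<bar>\<xi> i \<omega>\<bar> \<le> C i" by (metis lessThan_iff)
  have "\<bar>\<eta> j \<omega>\<bar> \<le> (\<Sum>i<k. C i)" if "\<omega> \<in> space M" for \<omega>
    unfolding \<eta>_def
  proof (rule order_trans[OF sum_abs], rule sum_mono)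
    fix i assume "i \<in> {..<k}"
    then have "\<bar>\<xi> i \<omega>\<bar> \<le> C i" using C that by auto
    then show "\<bar>\<xi> i \<omega> * (if \<tau> i \<le> T j \<and> T (Suc j) \<le> \<tau> (Suc i) then 1 else 0)\<bar> \<le> C i" by auto
  qed
  then show "\<exists>C. \<forall>\<omega>\<in>space M. \<bar>\<eta> j \<omega>\<bar> \<le> C" by blast
next
  fix g :: "real \<Rightarrow> real"
  let ?b = "\<lambda>i j. (if \<tau> i \<le> T j \<and> T (Suc j) \<le> \<tau> (Suc i) then 1 else 0::real)"
  have "(\<Sum>j<n. \<eta> j \<omega> * (g (T (Suc j)) - g (T j))) =
    (\<Sum>j<n. \<Sum>i<k. \<xi> i \<omega> * (?b i j * (g (T (Suc j)) - g (T j))))"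
    by (simp add: \<eta>_def sum_distrib_right mult.assoc)
  also have "\<dots> = (\<Sum>i<k. \<xi> i \<omega> * (\<Sum>j<n. ?b i j * (g (T (Suc j)) - g (T j))))"
    by (subst sum.swap) (simp add: sum_distrib_left)
  also have "\<dots> = (\<Sum>i<k. \<xi> i \<omega> * (g (\<tau> (Suc i)) - g (\<tau> i)))"
  proof (intro sum.cong refl arg_cong2[where f=times])
    fix i assume "i \<in> {..<k}"
    then have i: "i < k" by simp
    show "(\<Sum>j<n. ?b i j * (g (T (Suc j)) - g (T j))) = g (\<tau> (Suc i)) - g (\<tau> i)"
      by (rule telescope_refinement[OF T(1)]) (use i T(2) simple_processD(1)[OF sp, of i "Suc i"] in auto)
  qed
  finally show "(\<Sum>j<n. \<eta> j \<omega> * (g (T (Suc j)) - g (T j))) = (\<Sum>i<k. \<xi> i \<omega> * (g (\<tau> (Suc i)) - g (\<tau> i)))" .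
qed

text \<open>The partition points of both processes, sorted without repetition, serve as a partition
  for each of them. Being simple, the difference is open to the isometry.\<close>

lemma simple_process_diff:
  assumes "simple_process F k \<tau> \<xi>" "simple_process F k' \<tau>' \<xi>'"
  shows "\<exists>n T \<eta>. simple_process F n T \<eta> \<and>
    (\<forall>s \<omega>. simple_value n T \<eta> s \<omega> = simple_value k \<tau> \<xi> s \<omega> - simple_value k' \<tau>' \<xi>' s \<omega>) \<and>
    (\<forall>t \<omega>. simple_integral W n T \<eta> t \<omega> = simple_integral W k \<tau> \<xi> t \<omega> - simple_integral W k' \<tau>' \<xi>' t \<omega>)"
proof -
  define Q where "Q = \<tau> ` {..k} \<union> \<tau>' ` {..k'}"
  define xs where "xs = sorted_list_of_set Q"
  \<comment> \<open>The number of cells; there are \<open>n + 1\<close> points.\<close>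
  define n where "n = length xs - 1"
  define T where "T = (\<lambda>j. xs ! j)"
  have Q: "finite Q" "Q \<noteq> {}" by (auto simp: Q_def)
  have setxs: "set xs = Q" using Q by (simp add: xs_def)
  have len: "length xs = Suc n" using setxs Q by (cases xs) (auto simp: n_def)
  have "sorted_wrt (<) xs" by (simp add: xs_def)
  then have T: "\<And>i j. i < j \<Longrightarrow> j \<le> n \<Longrightarrow> T i < T j"
    unfolding T_def using sorted_wrt_nth_less len by (metis less_Suc_eq_le)
  have TQ: "T ` {..n} = Q"
    using setxs len by (force simp: T_def set_conv_nth less_Suc_eq_le)
  have sub: "\<tau> ` {..k} \<subseteq> T ` {..n}" "\<tau>' ` {..k'} \<subseteq> T ` {..n}" using TQ by (auto simp: Q_def)
  note R = simple_process_refinement[OF assms(1) T sub(1)]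
  note R' = simple_process_refinement[OF assms(2) T sub(2)]
  define \<eta>1 where "\<eta>1 = (\<lambda>j \<omega>. \<Sum>i<k. \<xi> i \<omega> * (if \<tau> i \<le> T j \<and> T (Suc j) \<le> \<tau> (Suc i) then 1 else 0))"
  define \<eta>2 where "\<eta>2 = (\<lambda>j \<omega>. \<Sum>i<k'. \<xi>' i \<omega> * (if \<tau>' i \<le> T j \<and> T (Suc j) \<le> \<tau>' (Suc i) then 1 else 0))"
  let ?\<eta> = "\<lambda>j \<omega>. \<eta>1 j \<omega> - \<eta>2 j \<omega>"
  have sp: "simple_process F n T ?\<eta>"
    unfolding simple_process_def
  proof (intro conjI allI impI)
    have "T 0 \<in> Q" using TQ by auto
    then show "0 \<le> T 0" using simple_processD(2)[OF assms(1)] simple_processD(2)[OF assms(2)] by (auto simp: Q_def)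
    fix j assume j: "j < n"
    show "T j \<le> T (Suc j)" using T[of j "Suc j"] j by auto
    show "?\<eta> j \<in> borel_measurable (F (T j))"
      using R(1)[OF _ _ j] R'(1)[OF _ _ j] by (intro borel_measurable_diff) (auto simp: \<eta>1_def \<eta>2_def)
    obtain C D where "\<forall>\<omega>\<in>space M. \<bar>\<eta>1 j \<omega>\<bar> \<le> C" "\<forall>\<omega>\<in>space M. \<bar>\<eta>2 j \<omega>\<bar> \<le> D"
      using R(2)[of j] R'(2)[of j] unfolding \<eta>1_def \<eta>2_def by auto
    then have "\<forall>\<omega>\<in>space M. \<bar>\<eta>1 j \<omega> - \<eta>2 j \<omega>\<bar> \<le> C + D" by (force intro: order_trans[OF abs_triangle_ineq4])
    then show "\<exists>C. \<forall>\<omega>\<in>space (F (T j)). \<bar>?\<eta> j \<omega>\<bar> \<le> C" by (auto simp: space_F)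
  qed
  have tel: "(\<Sum>j<n. ?\<eta> j \<omega> * (g (T (Suc j)) - g (T j))) =
      (\<Sum>i<k. \<xi> i \<omega> * (g (\<tau> (Suc i)) - g (\<tau> i))) - (\<Sum>i<k'. \<xi>' i \<omega> * (g (\<tau>' (Suc i)) - g (\<tau>' i)))"
    for \<omega> and g :: "real \<Rightarrow> real"
    using R(3)[of \<omega> g] R'(3)[of \<omega> g] unfolding \<eta>1_def \<eta>2_def
    by (simp only: left_diff_distrib sum_subtractf)
  show ?thesis
  proof (intro exI conjI allI)
    show "simple_process F n T ?\<eta>" by fact
    show "simple_value n T ?\<eta> s \<omega> = simple_value k \<tau> \<xi> s \<omega> - simple_value k' \<tau>' \<xi>' s \<omega>" for s \<omega>
      unfolding simple_value_telescope[OF sp] simple_value_telescope[OF assms(1)] simple_value_telescope[OF assms(2)]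
      using tel[of \<omega> "\<lambda>x. - (if x < s then 1 else 0)"] by simp
    show "simple_integral W n T ?\<eta> t \<omega> = simple_integral W k \<tau> \<xi> t \<omega> - simple_integral W k' \<tau>' \<xi>' t \<omega>" for t \<omega>
      unfolding simple_integral_def using tel[of \<omega> "\<lambda>x. W (min x t) \<omega>"] by simp
  qed
qed

text \<open>Lets integrals up to \<open>s\<close> and up to \<open>t\<close> be compared at the
  single horizon \<open>t\<close>. Coefficients with \<open>\<tau> i > s\<close> are replaced by 0
  because they need not be known at the clipped time \<open>s\<close>.\<close>

lemma simple_process_restrict:
  assumes "simple_process F k \<tau> \<xi>" "0 \<le> s"
  defines "T \<equiv> \<lambda>i. min (\<tau> i) s" and "\<eta> \<equiv> \<lambda>i \<omega>. if \<tau> i \<le> s then \<xi> i \<omega> else 0"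
  shows "simple_process F k T \<eta>"
    "simple_value k T \<eta> r \<omega> = (if r \<le> s then simple_value k \<tau> \<xi> r \<omega> else 0)"
    "s \<le> t \<Longrightarrow> simple_integral W k T \<eta> t \<omega> = simple_integral W k \<tau> \<xi> s \<omega>"
proof -
  have mono: "\<tau> i \<le> \<tau> (Suc i)" if "i < k" for i using simple_processD(1)[OF assms(1)] that by auto
  show "simple_process F k T \<eta>"
    unfolding simple_process_def
  proof (intro conjI allI impI)
    show "0 \<le> T 0" using assms simple_processD(2)[OF assms(1), of 0] by (auto simp: T_def)
    fix i assume i: "i < k"
    show "T i \<le> T (Suc i)" using mono[OF i] by (auto simp: T_def)
    show "\<eta> i \<in> borel_measurable (F (T i))"
      using simple_processD(3)[OF assms(1) i] by (cases "\<tau> i \<le> s") (auto simp: T_def \<eta>_def)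
    show "\<exists>C. \<forall>\<omega>\<in>space (F (T i)). \<bar>\<eta> i \<omega>\<bar> \<le> C"
      using simple_processD(5)[OF assms(1) i] by (cases "\<tau> i \<le> s") (auto simp: \<eta>_def space_F)
  qed
  have "simple_value k T \<eta> r \<omega> = (\<Sum>i<k. if r \<le> s then \<xi> i \<omega> * indicator {\<tau> i<..\<tau> (Suc i)} r else 0)"
    unfolding simple_value_def by (intro sum.cong) (auto simp: T_def \<eta>_def indicator_def)
  then show "simple_value k T \<eta> r \<omega> = (if r \<le> s then simple_value k \<tau> \<xi> r \<omega> else 0)"
    by (simp add: simple_value_def)
  assume "s \<le> t"
  then show "simple_integral W k T \<eta> t \<omega> = simple_integral W k \<tau> \<xi> s \<omega>"
    unfolding simple_integral_def using mono
    by (intro sum.cong) (force simp: T_def \<eta>_def min_def)+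
qed

lemma energy_Suc_mono:
  assumes "simple_process F k \<tau> \<xi>" "m < k"
  shows "energy m \<tau> \<xi> t \<omega> \<le> energy (Suc m) \<tau> \<xi> t \<omega>"
  using simple_processD(1)[OF assms(1), of m "Suc m"] assms(2) by (simp add: energy_def)

lemma energy_mono:
  assumes "simple_process F k \<tau> \<xi>" "m \<le> n" "n \<le> k"
  shows "energy m \<tau> \<xi> t \<omega> \<le> energy n \<tau> \<xi> t \<omega>"
  using assms(2,3)
proof (induction n rule: dec_induct)
  case (step n)
  then show ?case using energy_Suc_mono[OF assms(1), of n t \<omega>] by auto
qed simp

lemma energy_measurable:
  assumes "simple_process F k \<tau> \<xi>"
  shows "energy k \<tau> \<xi> t \<in> borel_measurable M"
  using simple_processD(4)[OF assms] unfolding energy_def[abs_def]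
  by (intro borel_measurable_sum borel_measurable_times borel_measurable_power) auto

text \<open>The isometry needs the mean of the energy, whereas convergence in probability controls
  only the probability that the energy is large. A process cut off at energy \<open>\<delta>\<close>
  reconciles the two: Chebyshev's inequality bounds its integral by
  \<open>\<delta> / \<epsilon>\<^sup>2\<close>, and it has the same integral wherever the full
  energy is at most \<open>\<delta>\<close>.\<close>

lemma simple_integral_truncation:
  assumes sp: "simple_process F k \<tau> \<xi>" and t: "0 \<le> t" and "0 < \<epsilon>" "0 < \<delta>" and B[measurable]: "B \<in> events"
  shows "prob {\<omega>\<in>B. \<bar>simple_integral W k \<tau> \<xi> t \<omega>\<bar> > \<epsilon>} \<le> prob {\<omega>\<in>B. energy k \<tau> \<xi> t \<omega> > \<delta>} + \<delta> / \<epsilon>\<^sup>2"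
proof -
  \<comment> \<open>The energy up to step \<open>i + 1\<close> is known at time \<open>\<tau> i\<close>, so cutting \<open>\<xi>\<close> off just before its energy exceeds \<open>\<delta>\<close>
    keeps it adapted.\<close>
  define \<eta> where "\<eta> = (\<lambda>i \<omega>. if energy (Suc i) \<tau> \<xi> t \<omega> \<le> \<delta> then \<xi> i \<omega> else 0)"
  have sp': "simple_process F k \<tau> \<eta>"
    unfolding simple_process_def
  proof (intro conjI allI impI)
    show "0 \<le> \<tau> 0" using simple_processD(2)[OF sp, of 0] by simp
    fix i assume i: "i < k"
    show "\<tau> i \<le> \<tau> (Suc i)" using simple_processD(1)[OF sp, of i "Suc i"] i by simp
    have "\<xi> j \<in> borel_measurable (F (\<tau> i))" if "j < Suc i" for j
      using that i measurable_F_mono[OF simple_processD(3)[OF sp, of j], of "\<tau> i"] simple_processD(1)[OF sp, of j i]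
      by auto
    then have [measurable]: "energy (Suc i) \<tau> \<xi> t \<in> borel_measurable (F (\<tau> i))"
      unfolding energy_def[abs_def] by (intro borel_measurable_sum borel_measurable_times borel_measurable_power) auto
    have [measurable]: "\<xi> i \<in> borel_measurable (F (\<tau> i))" using simple_processD(3)[OF sp i] .
    show "\<eta> i \<in> borel_measurable (F (\<tau> i))" unfolding \<eta>_def by measurable
    obtain C where "\<forall>\<omega>\<in>space M. \<bar>\<xi> i \<omega>\<bar> \<le> C" using simple_processD(5)[OF sp i] by auto
    then have "\<forall>\<omega>\<in>space M. \<bar>\<eta> i \<omega>\<bar> \<le> \<bar>C\<bar>" by (auto simp: \<eta>_def)
    then show "\<exists>C. \<forall>\<omega>\<in>space (F (\<tau> i)). \<bar>\<eta> i \<omega>\<bar> \<le> C" by (auto simp: space_F)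
  qed
  have le: "energy m \<tau> \<eta> t \<omega> \<le> \<delta> \<and> energy m \<tau> \<eta> t \<omega> \<le> energy m \<tau> \<xi> t \<omega>" if "m \<le> k" for m \<omega>
    using that
  proof (induction m)
    case 0
    then show ?case using \<open>0 < \<delta>\<close> by (simp add: energy_def)
  next
    case (Suc m)
    then show ?case using energy_Suc_mono[OF sp, of m t \<omega>]
      by (cases "energy (Suc m) \<tau> \<xi> t \<omega> \<le> \<delta>") (auto simp: energy_def \<eta>_def)
  qed
  let ?I = "simple_integral W k \<tau> \<xi> t" and ?J = "simple_integral W k \<tau> \<eta> t"
  have eq: "?I \<omega> = ?J \<omega>" if "energy k \<tau> \<xi> t \<omega> \<le> \<delta>" for \<omega>
    unfolding simple_integral_def
  proof (intro sum.cong refl)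
    fix i assume "i \<in> {..<k}"
    then have "energy (Suc i) \<tau> \<xi> t \<omega> \<le> \<delta>" using energy_mono[OF sp, of "Suc i" k t \<omega>] that by auto
    then show "\<xi> i \<omega> * (W (min (\<tau> (Suc i)) t) \<omega> - W (min (\<tau> i) t) \<omega>) =
       \<eta> i \<omega> * (W (min (\<tau> (Suc i)) t) \<omega> - W (min (\<tau> i) t) \<omega>)" by (simp add: \<eta>_def)
  qed
  have [measurable]: "?I \<in> borel_measurable M" "?J \<in> borel_measurable M" "energy k \<tau> \<xi> t \<in> borel_measurable M"
    using simple_integral_measurable[OF sp t] simple_integral_measurable[OF sp' t] energy_measurable[OF sp] by auto
  have [simp]: "\<And>\<omega>. \<omega> \<in> B \<Longrightarrow> \<omega> \<in> space M" using sets.sets_into_space[OF B] by auto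
  have "prob {\<omega>\<in>B. \<bar>?I \<omega>\<bar> > \<epsilon>} \<le> prob ({\<omega>\<in>B. energy k \<tau> \<xi> t \<omega> > \<delta>} \<union> {\<omega>\<in>space M. (?J \<omega>)\<^sup>2 \<ge> \<epsilon>\<^sup>2})"
  proof (rule finite_measure_mono)
    show "{\<omega>\<in>B. \<bar>?I \<omega>\<bar> > \<epsilon>} \<subseteq> {\<omega>\<in>B. energy k \<tau> \<xi> t \<omega> > \<delta>} \<union> {\<omega>\<in>space M. (?J \<omega>)\<^sup>2 \<ge> \<epsilon>\<^sup>2}"
    proof (intro subsetI)
      fix \<omega> assume "\<omega> \<in> {\<omega>\<in>B. \<bar>?I \<omega>\<bar> > \<epsilon>}"
      moreover then have "(?J \<omega>)\<^sup>2 \<ge> \<epsilon>\<^sup>2" if "energy k \<tau> \<xi> t \<omega> \<le> \<delta>"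
        using eq[OF that] \<open>0 < \<epsilon>\<close> abs_le_square_iff[of \<epsilon> "?J \<omega>"] by auto
      ultimately show "\<omega> \<in> {\<omega>\<in>B. energy k \<tau> \<xi> t \<omega> > \<delta>} \<union> {\<omega>\<in>space M. (?J \<omega>)\<^sup>2 \<ge> \<epsilon>\<^sup>2}"
        by force
    qed
  qed measurable
  also have "\<dots> \<le> prob {\<omega>\<in>B. energy k \<tau> \<xi> t \<omega> > \<delta>} + prob {\<omega>\<in>space M. (?J \<omega>)\<^sup>2 \<ge> \<epsilon>\<^sup>2}"
    by (rule measure_Un_le) measurable
  also have "prob {\<omega>\<in>space M. (?J \<omega>)\<^sup>2 \<ge> \<epsilon>\<^sup>2} \<le> (\<integral>\<omega>. (?J \<omega>)\<^sup>2 \<partial>M) / \<epsilon>\<^sup>2"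
    using simple_integral_isometry(1)[OF sp' t] \<open>0 < \<epsilon>\<close>
    by (intro integral_Markov_inequality_measure[of M _ "space M"]) auto
  also have "(\<integral>\<omega>. (?J \<omega>)\<^sup>2 \<partial>M) = (\<integral>\<omega>. energy k \<tau> \<eta> t \<omega> \<partial>M)"
    by (rule simple_integral_isometry(3)[OF sp' t])
  also have "\<dots> \<le> (\<integral>\<omega>. \<delta> \<partial>M)"
    using simple_integral_isometry(2)[OF sp' t] le[of k] by (intro integral_mono) auto
  also have "\<dots> = \<delta>" by (simp add: prob_space)
  finally show ?thesis using \<open>0 < \<epsilon>\<close> by (simp add: divide_right_mono)
qed

section \<open>Pathwise integrals over a bounded time interval\<close>

text \<open>The left end is excluded because simple processes vanish there.\<close>

definition path_time :: "real \<Rightarrow> real measure" where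
  "path_time t = restrict_space lborel {0<..t}"

lemma set_integral_path_time:
  fixes f :: "real \<Rightarrow> real"
  assumes "set_borel_measurable borel {0..t} f"
  shows "(LINT s:{0..t}|lborel. f s) = (\<integral>s. f s \<partial>path_time t)"
proof -
  have eq: "indicator {0<..t} s *\<^sub>R f s = indicator {0<..t} s *\<^sub>R (indicator {0..t} s *\<^sub>R f s)" for s
    by (auto simp: indicator_def)
  have [measurable]: "(\<lambda>s. indicator {0..t} s *\<^sub>R f s) \<in> borel_measurable borel"
    using assms by (simp add: set_borel_measurable_def)
  have [measurable]: "(\<lambda>s. indicator {0<..t} s *\<^sub>R f s) \<in> borel_measurable borel"
    by (subst eq) measurable
  have "AE s in lborel. s \<noteq> (0::real)" by (rule AE_lborel_singleton)
  then have "AE s in lborel. indicator {0..t} s *\<^sub>R f s = indicator {0<..t} s *\<^sub>R f s"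
    by eventually_elim (auto simp: indicator_def)
  then have "(\<integral>s. indicator {0..t} s *\<^sub>R f s \<partial>lborel) = (\<integral>s. indicator {0<..t} s *\<^sub>R f s \<partial>lborel)"
    by (rule integral_cong_AE[rotated 2]) measurable
  then show ?thesis
    unfolding set_lebesgue_integral_def path_time_def
    by (subst integral_restrict_space) auto
qed

lemma simple_value_measurable [measurable]: "(\<lambda>s. simple_value k \<tau> \<xi> s \<omega>) \<in> borel_measurable borel"
  unfolding simple_value_def by measurable

lemma finite_measure_path_time [simp]: "finite_measure (path_time t)"
  unfolding path_time_def by (cases "0 \<le> t") (auto intro!: finite_measureI simp: space_restrict_space emeasure_restrict_space)

lemma space_path_time [simp]: "space (path_time t) = {0<..t}"
  by (simp add: path_time_def space_restrict_space)

lemma measurable_path_time: "f \<in> borel_measurable borel \<Longrightarrow> f \<in> borel_measurable (path_time t)"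
  by (simp add: path_time_def measurable_restrict_space1)

lemma energy_eq_integral:
  assumes "simple_process F k \<tau> \<xi>" "0 \<le> t"
  shows "integrable (path_time t) (\<lambda>s. (simple_value k \<tau> \<xi> s \<omega>)\<^sup>2) \<and>
    (\<integral>s. (simple_value k \<tau> \<xi> s \<omega>)\<^sup>2 \<partial>path_time t) = energy k \<tau> \<xi> t \<omega>"
  using assms(1)
proof (induction k)
  case 0
  then show ?case by (simp add: simple_value_def energy_def)
next
  case (Suc k)
  then have IH: "integrable (path_time t) (\<lambda>s. (simple_value k \<tau> \<xi> s \<omega>)\<^sup>2)"
    "(\<integral>s. (simple_value k \<tau> \<xi> s \<omega>)\<^sup>2 \<partial>path_time t) = energy k \<tau> \<xi> t \<omega>"
    using simple_process_Suc by auto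
  \<comment> \<open>The steps live on disjoint intervals: beyond \<open>\<tau> k\<close> the earlier
    ones vanish, so squaring produces no mixed term.\<close>
  have z: "simple_value k \<tau> \<xi> s \<omega> = 0" if "\<tau> k < s" for s
    unfolding simple_value_def
  proof (rule sum.neutral, intro ballI)
    fix i assume "i \<in> {..<k}"
    then have "\<tau> (Suc i) \<le> \<tau> k" using simple_processD(1)[OF Suc.prems, of "Suc i" k] by auto
    then show "\<xi> i \<omega> * indicator {\<tau> i<..\<tau> (Suc i)} s = 0" using that by (auto simp: indicator_def)
  qed
  have eq: "(simple_value (Suc k) \<tau> \<xi> s \<omega>)\<^sup>2 =
     (simple_value k \<tau> \<xi> s \<omega>)\<^sup>2 + (\<xi> k \<omega>)\<^sup>2 * indicator {\<tau> k<..\<tau> (Suc k)} s" for s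
    using z[of s] by (auto simp: simple_value_def indicator_def)
  have \<tau>: "0 \<le> \<tau> k" "\<tau> k \<le> \<tau> (Suc k)" using simple_processD(1,2)[OF Suc.prems] by auto
  interpret P: finite_measure "path_time t" by simp
  have [measurable]: "{\<tau> k<..\<tau> (Suc k)} \<inter> {0<..t} \<in> sets (path_time t)"
    by (auto simp: path_time_def sets_restrict_space)
  have sub: "{\<tau> k<..\<tau> (Suc k)} \<inter> {0<..t} = {min (\<tau> k) t<..min (\<tau> (Suc k)) t}" using \<tau> by auto
  have ind: "(\<lambda>s. indicator {\<tau> k<..\<tau> (Suc k)} s :: real) \<in> borel_measurable (path_time t)"
    by (rule measurable_path_time) measurable
  have int: "integrable (path_time t) (\<lambda>s. indicator {\<tau> k<..\<tau> (Suc k)} s :: real)"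
    by (rule P.integrable_const_bound[of _ 1]) (use ind in auto)
  have "(\<integral>s. indicator {\<tau> k<..\<tau> (Suc k)} s \<partial>path_time t) = (\<integral>s. indicator {0<..t} s *\<^sub>R (indicator {\<tau> k<..\<tau> (Suc k)} s :: real) \<partial>lborel)"
    unfolding path_time_def by (rule integral_restrict_space) auto
  also have "\<dots> = (\<integral>s. indicator {min (\<tau> k) t<..min (\<tau> (Suc k)) t} s \<partial>lborel)"
    by (intro Bochner_Integration.integral_cong) (auto simp: sub[symmetric] indicator_def)
  also have "\<dots> = min (\<tau> (Suc k)) t - min (\<tau> k) t"
    using \<tau> by simp
  finally have "(\<integral>s. indicator {\<tau> k<..\<tau> (Suc k)} s \<partial>path_time t) = min (\<tau> (Suc k)) t - min (\<tau> k) t" .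
  then show ?case
    unfolding eq using IH int by (simp add: energy_def)
qed

end

section \<open>Convergence in probability\<close>

lemma (in prob_space) prob_tendsto_0I:
  assumes [measurable]: "\<And>n. f n \<in> borel_measurable M" "B \<in> events"
    and lim: "\<And>\<omega>. \<omega> \<in> B \<Longrightarrow> (\<lambda>n. f n \<omega>) \<longlonglongrightarrow> (0::real)" and "0 < \<delta>"
  shows "(\<lambda>n. prob {\<omega>\<in>B. f n \<omega> > \<delta>}) \<longlonglongrightarrow> 0"
proof -
  have [simp]: "\<And>\<omega>. \<omega> \<in> B \<Longrightarrow> \<omega> \<in> space M" using sets.sets_into_space[OF assms(2)] by auto
  have "(\<lambda>n. \<integral>\<omega>. indicator {\<omega>\<in>B. f n \<omega> > \<delta>} \<omega> \<partial>M) \<longlonglongrightarrow> (\<integral>\<omega>. (0::real) \<partial>M)"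
  proof (rule integral_dominated_convergence[where w="\<lambda>_. 1"])
    show "AE \<omega> in M. (\<lambda>n. indicator {\<omega>\<in>B. f n \<omega> > \<delta>} \<omega>) \<longlonglongrightarrow> (0::real)"
    proof (rule AE_I2)
      fix \<omega> assume "\<omega> \<in> space M"
      show "(\<lambda>n. indicator {\<omega>\<in>B. f n \<omega> > \<delta>} \<omega>) \<longlonglongrightarrow> (0::real)"
      proof (cases "\<omega> \<in> B")
        case True
        have "\<forall>\<^sub>F n in sequentially. f n \<omega> < \<delta>" using order_tendstoD(2)[OF lim[OF True] \<open>0 < \<delta>\<close>] .
        then have "\<forall>\<^sub>F n in sequentially. indicator {\<omega>\<in>B. f n \<omega> > \<delta>} \<omega> = (0::real)"
          by eventually_elim (auto simp: indicator_def)
        then show ?thesis by (rule tendsto_eventually)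
      qed simp
    qed
  qed (auto simp: indicator_def)
  moreover have "{\<omega>\<in>B. f n \<omega> > \<delta>} \<in> events" for n by measurable
  ultimately show ?thesis by (simp add: measure_def)
qed

text \<open>The distances truncated at 1 converge to 0 in L1, hence almost surely along a
  subsequence; where the truncated distance tends to 0 the truncation is eventually
  inactive.\<close>

lemma (in prob_space) converges_in_prob_subseq:
  assumes "converges_in_prob M Y Z"
  shows "\<exists>r::nat\<Rightarrow>nat. strict_mono r \<and> (AE \<omega> in M. (\<lambda>n. Y (r n) \<omega>) \<longlonglongrightarrow> Z \<omega>)"
proof -
  have [measurable]: "\<And>n. Y n \<in> borel_measurable M" "Z \<in> borel_measurable M"
    and lim: "\<And>\<epsilon>. 0 < \<epsilon> \<Longrightarrow> (\<lambda>n. prob {\<omega>\<in>space M. \<bar>Y n \<omega> - Z \<omega>\<bar> > \<epsilon>}) \<longlonglongrightarrow> 0"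
    using assms unfolding converges_in_prob_def by auto
  define u where "u n \<omega> = min 1 \<bar>Y n \<omega> - Z \<omega>\<bar>" for n \<omega>
  have u[measurable]: "u n \<in> borel_measurable M" for n unfolding u_def[abs_def] by measurable
  have iu: "integrable M (u n)" for n
    by (rule integrable_const_bound[of _ 1]) (auto simp: u_def)
  have "(\<lambda>n. \<integral>\<omega>. norm (u n \<omega>) \<partial>M) \<longlonglongrightarrow> 0"
  proof (rule LIMSEQ_I)
    fix e :: real assume e: "0 < e"
    have "\<forall>\<^sub>F n in sequentially. prob {\<omega>\<in>space M. \<bar>Y n \<omega> - Z \<omega>\<bar> > e/2} < e/2"
      using order_tendstoD(2)[OF lim[of "e/2"], of "e/2"] e by auto
    then obtain N where N: "\<And>n. n \<ge> N \<Longrightarrow> prob {\<omega>\<in>space M. \<bar>Y n \<omega> - Z \<omega>\<bar> > e/2} < e/2"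
      by (auto simp: eventually_sequentially)
    show "\<exists>no. \<forall>n\<ge>no. norm ((\<integral>\<omega>. norm (u n \<omega>) \<partial>M) - 0) < e"
    proof (intro exI allI impI)
      fix n assume n: "N \<le> n"
      let ?A = "{\<omega>\<in>space M. \<bar>Y n \<omega> - Z \<omega>\<bar> > e/2}"
      have iA: "integrable M (\<lambda>\<omega>. indicator ?A \<omega> :: real)"
        by (intro integrable_real_indicator) (auto simp: emeasure_eq_measure)
      have "(\<integral>\<omega>. norm (u n \<omega>) \<partial>M) \<le> (\<integral>\<omega>. e/2 + indicator ?A \<omega> \<partial>M)"
      proof (rule integral_mono)
        show "integrable M (\<lambda>\<omega>. norm (u n \<omega>))" using iu by simp
        show "integrable M (\<lambda>\<omega>. e/2 + indicator ?A \<omega>)"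
          using iA by simp
      qed (use e in \<open>auto simp: u_def indicator_def min_le_iff_disj\<close>)
      also have "\<dots> = e/2 + prob ?A"
        by (subst Bochner_Integration.integral_add[OF _ iA]) (simp_all add: prob_space)
      also have "\<dots> < e" using N[OF n] by simp
      finally show "norm ((\<integral>\<omega>. norm (u n \<omega>) \<partial>M) - 0) < e" by (simp add: abs_of_nonneg)
    qed
  qed
  from tendsto_L1_AE_subseq[OF iu this] obtain r :: "nat \<Rightarrow> nat" where r: "strict_mono r"
    "AE \<omega> in M. (\<lambda>n. u (r n) \<omega>) \<longlonglongrightarrow> 0" by auto
  have "AE \<omega> in M. (\<lambda>n. Y (r n) \<omega>) \<longlonglongrightarrow> Z \<omega>"
    using r(2)
  proof eventually_elim
    case (elim \<omega>)
    then have "\<forall>\<^sub>F n in sequentially. u (r n) \<omega> < 1" by (rule order_tendstoD) simp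
    then have "\<forall>\<^sub>F n in sequentially. u (r n) \<omega> = \<bar>Y (r n) \<omega> - Z \<omega>\<bar>"
      by eventually_elim (auto simp: u_def)
    then have "(\<lambda>n. \<bar>Y (r n) \<omega> - Z \<omega>\<bar>) \<longlonglongrightarrow> 0"
      using elim by (rule Lim_transform_eventually[rotated])
    then show ?case by (simp add: tendsto_rabs_zero_iff LIM_zero_iff)
  qed
  then show ?thesis using r(1) by blast
qed

text \<open>Fatou's lemma along an almost surely convergent subsequence. This is how L2 bounds for
  simple integrals pass to an Ito integral that is known only as a limit in probability.\<close>

lemma (in prob_space) converges_in_prob_Fatou:
  assumes conv: "converges_in_prob M Y Z" and int: "\<And>n. integrable M (\<lambda>\<omega>. (Y n \<omega>)\<^sup>2)"
    and le: "\<And>n. (\<integral>\<omega>. (Y n \<omega>)\<^sup>2 \<partial>M) \<le> c n" and c: "c \<longlonglongrightarrow> C"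
  shows "integrable M (\<lambda>\<omega>. (Z \<omega>)\<^sup>2) \<and> (\<integral>\<omega>. (Z \<omega>)\<^sup>2 \<partial>M) \<le> C"
proof -
  have [measurable]: "\<And>n. Y n \<in> borel_measurable M" "Z \<in> borel_measurable M"
    using conv unfolding converges_in_prob_def by auto
  obtain r :: "nat \<Rightarrow> nat" where r: "strict_mono r" "AE \<omega> in M. (\<lambda>n. Y (r n) \<omega>) \<longlonglongrightarrow> Z \<omega>"
    using converges_in_prob_subseq[OF conv] by auto
  have c0: "0 \<le> c n" for n using le[of n] by (rule order_trans[rotated]) simp
  have C0: "0 \<le> C" by (rule LIMSEQ_le_const[OF c]) (use c0 in auto)
  have "(\<integral>\<^sup>+\<omega>. ennreal ((Z \<omega>)\<^sup>2) \<partial>M) \<le> (\<integral>\<^sup>+\<omega>. liminf (\<lambda>n. ennreal ((Y (r n) \<omega>)\<^sup>2)) \<partial>M)"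
  proof (rule nn_integral_mono_AE)
    show "AE \<omega> in M. ennreal ((Z \<omega>)\<^sup>2) \<le> liminf (\<lambda>n. ennreal ((Y (r n) \<omega>)\<^sup>2))"
      using r(2)
    proof eventually_elim
      case (elim \<omega>)
      have "(\<lambda>n. ennreal ((Y (r n) \<omega>)\<^sup>2)) \<longlonglongrightarrow> ennreal ((Z \<omega>)\<^sup>2)"
        by (intro tendsto_ennrealI tendsto_power elim)
      from lim_imp_Liminf[OF trivial_limit_sequentially this] show ?case by simp
    qed
  qed
  also have "\<dots> \<le> liminf (\<lambda>n. \<integral>\<^sup>+\<omega>. ennreal ((Y (r n) \<omega>)\<^sup>2) \<partial>M)"
    by (rule nn_integral_liminf) measurable
  also have "\<dots> \<le> liminf (\<lambda>n. ennreal (c (r n)))"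
  proof (rule Liminf_mono, rule always_eventually, rule allI)
    fix n
    show "(\<integral>\<^sup>+\<omega>. ennreal ((Y (r n) \<omega>)\<^sup>2) \<partial>M) \<le> ennreal (c (r n))"
      using int le by (subst nn_integral_eq_integral) (auto intro: ennreal_leI)
  qed
  also have "\<dots> = ennreal C"
    by (rule lim_imp_Liminf) (auto intro!: tendsto_ennrealI LIMSEQ_subseq_LIMSEQ[OF c r(1), unfolded comp_def])
  finally have fin: "(\<integral>\<^sup>+\<omega>. ennreal ((Z \<omega>)\<^sup>2) \<partial>M) \<le> ennreal C" .
  have iZ: "integrable M (\<lambda>\<omega>. (Z \<omega>)\<^sup>2)"
    using fin by (intro integrableI_bounded) (auto intro: le_less_trans)
  then show ?thesis using fin C0 by (auto simp: nn_integral_eq_integral)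
qed

context brownian_filtration
begin

text \<open>Uniqueness of the Ito integral, localised to an event \<open>B\<close>. The definition
  supplies some sequence \<open>S\<close>, while later arguments need a chosen one,
  \<open>G\<close>. The difference of the two is simple, and its energy is controlled by the
  distances of \<open>S\<close> and \<open>G\<close> from \<open>H\<close>, which are small in
  probability, for \<open>G\<close> on \<open>B\<close>. By
  \<open>simple_integral_truncation\<close> the integrals of \<open>S\<close> and \<open>G\<close>
  merge on \<open>B\<close>, and those of \<open>S\<close> tend to \<open>J\<close>.\<close>

lemma ito_integral_localized:
  assumes ito: "has_ito_integral M F W H t J" and t: "0 \<le> t" and B[measurable]: "B \<in> events"
    and H: "\<And>\<omega>. \<omega> \<in> space M \<Longrightarrow> set_borel_measurable borel {0..t} (\<lambda>s. H s \<omega>)"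
      "\<And>\<omega>. \<omega> \<in> space M \<Longrightarrow> integrable (path_time t) (\<lambda>s. (H s \<omega>)\<^sup>2)"
    and G: "\<And>n. simple_process F (k n) (\<tau> n) (\<xi> n)"
    and Gm: "\<And>n. (\<lambda>\<omega>. \<integral>s. (simple_value (k n) (\<tau> n) (\<xi> n) s \<omega> - H s \<omega>)\<^sup>2 \<partial>path_time t) \<in> borel_measurable M"
    and conv: "\<And>\<delta>. 0 < \<delta> \<Longrightarrow>
      (\<lambda>n. prob {\<omega>\<in>B. (\<integral>s. (simple_value (k n) (\<tau> n) (\<xi> n) s \<omega> - H s \<omega>)\<^sup>2 \<partial>path_time t) > \<delta>}) \<longlonglongrightarrow> 0"
  shows "converges_in_prob M (\<lambda>n \<omega>. indicator B \<omega> * simple_integral W (k n) (\<tau> n) (\<xi> n) t \<omega>) (\<lambda>\<omega>. indicator B \<omega> * J \<omega>)"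
proof -
  have Bs: "\<And>\<omega>. \<omega> \<in> B \<Longrightarrow> \<omega> \<in> space M" using sets.sets_into_space[OF B] by auto
  let ?G = "\<lambda>n s \<omega>. simple_value (k n) (\<tau> n) (\<xi> n) s \<omega>"
  let ?IG = "\<lambda>n. simple_integral W (k n) (\<tau> n) (\<xi> n) t"
  obtain k' \<tau>' \<xi>' where S: "\<And>n. simple_process F (k' n) (\<tau>' n) (\<xi>' n)"
    and c1: "converges_in_prob M
          (\<lambda>n \<omega>. LINT s:{0..t}|lborel. (simple_value (k' n) (\<tau>' n) (\<xi>' n) s \<omega> - H s \<omega>)\<^sup>2) (\<lambda>_. 0)"
    and c2: "converges_in_prob M (\<lambda>n. simple_integral W (k' n) (\<tau>' n) (\<xi>' n) t) J"
    using ito unfolding has_ito_integral_def by auto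
  let ?S = "\<lambda>n s \<omega>. simple_value (k' n) (\<tau>' n) (\<xi>' n) s \<omega>"
  let ?IS = "\<lambda>n. simple_integral W (k' n) (\<tau>' n) (\<xi>' n) t"
  define f where "f = (\<lambda>n \<omega>. LINT s:{0..t}|lborel. (?S n s \<omega> - H s \<omega>)\<^sup>2)"
  define g where "g = (\<lambda>n \<omega>. \<integral>s. (?G n s \<omega> - H s \<omega>)\<^sup>2 \<partial>path_time t)"
  have [measurable]: "\<And>n. f n \<in> borel_measurable M" "\<And>n. g n \<in> borel_measurable M" "J \<in> borel_measurable M"
    using c1 c2 Gm unfolding converges_in_prob_def f_def g_def by auto
  have [measurable]: "\<And>n. ?IG n \<in> borel_measurable M" "\<And>n. ?IS n \<in> borel_measurable M"
    using simple_integral_measurable[OF _ t] S G by auto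
  have lim_f: "(\<lambda>n. prob {\<omega>\<in>space M. f n \<omega> > \<delta>}) \<longlonglongrightarrow> 0" if "0 < \<delta>" for \<delta>
  proof -
    have "0 \<le> f n \<omega>" for n \<omega> unfolding f_def set_lebesgue_integral_def by (intro integral_nonneg_AE) auto
    then show ?thesis using c1 that unfolding converges_in_prob_def f_def[symmetric] by simp
  qed
  have feq: "f n \<omega> = (\<integral>s. (?S n s \<omega> - H s \<omega>)\<^sup>2 \<partial>path_time t)" if "\<omega> \<in> space M" for n \<omega>
    unfolding f_def
  proof (rule set_integral_path_time)
    have [measurable]: "(\<lambda>s. indicator {0..t} s * H s \<omega>) \<in> borel_measurable borel"
      using H(1)[OF that] by (simp add: set_borel_measurable_def)
    have "(\<lambda>s. indicator {0..t} s * (?S n s \<omega> - indicator {0..t} s * H s \<omega>)\<^sup>2) \<in> borel_measurable borel"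
      by measurable
    moreover have "indicator {0..t} s * (?S n s \<omega> - indicator {0..t} s * H s \<omega>)\<^sup>2 = indicator {0..t} s * (?S n s \<omega> - H s \<omega>)\<^sup>2" for s
      by (simp add: indicator_def)
    ultimately show "set_borel_measurable borel {0..t} (\<lambda>s. (?S n s \<omega> - H s \<omega>)\<^sup>2)"
      by (simp add: set_borel_measurable_def)
  qed
  have "\<forall>n. \<exists>N T \<eta>. simple_process F N T \<eta> \<and> (\<forall>s \<omega>. simple_value N T \<eta> s \<omega> = ?S n s \<omega> - ?G n s \<omega>) \<and>
    (\<forall>u \<omega>. simple_integral W N T \<eta> u \<omega> = simple_integral W (k' n) (\<tau>' n) (\<xi>' n) u \<omega> - simple_integral W (k n) (\<tau> n) (\<xi> n) u \<omega>)"
    using simple_process_diff[OF S G] by blast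
  then obtain N T \<eta> where D: "\<And>n. simple_process F (N n) (T n) (\<eta> n)"
    "\<And>n s \<omega>. simple_value (N n) (T n) (\<eta> n) s \<omega> = ?S n s \<omega> - ?G n s \<omega>"
    "\<And>n \<omega>. simple_integral W (N n) (T n) (\<eta> n) t \<omega> = ?IS n \<omega> - ?IG n \<omega>"
    by metis
  define e where "e n \<omega> = energy (N n) (T n) (\<eta> n) t \<omega>" for n \<omega>
  have [measurable]: "e n \<in> borel_measurable M" for n
    unfolding e_def[abs_def] using energy_measurable[OF D(1)] .
  interpret P: finite_measure "path_time t" by simp
  have e_le: "e n \<omega> \<le> 2 * f n \<omega> + 2 * g n \<omega>" if \<omega>: "\<omega> \<in> space M" for n \<omega>
  proof -
    have Hm: "(\<lambda>s. H s \<omega>) \<in> borel_measurable (path_time t)"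
    proof -
      have "(\<lambda>s. indicator {0..t} s * H s \<omega>) \<in> borel_measurable (path_time t)"
        using H(1)[OF \<omega>] by (intro measurable_path_time) (simp add: set_borel_measurable_def)
      then show ?thesis by (rule measurable_cong[THEN iffD1, rotated]) auto
    qed
    have sq: "integrable (path_time t) (\<lambda>s. (simple_value m T0 \<zeta> s \<omega> - H s \<omega>)\<^sup>2)" if "simple_process F m T0 \<zeta>" for m T0 \<zeta>
    proof (rule Bochner_Integration.integrable_bound)
      show "integrable (path_time t) (\<lambda>s. 2 * (simple_value m T0 \<zeta> s \<omega>)\<^sup>2 + 2 * (H s \<omega>)\<^sup>2)"
        using energy_eq_integral[OF that t, of \<omega>] H(2)[OF \<omega>] by auto
      show "(\<lambda>s. (simple_value m T0 \<zeta> s \<omega> - H s \<omega>)\<^sup>2) \<in> borel_measurable (path_time t)"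
        using Hm measurable_path_time[OF simple_value_measurable] by measurable
      show "AE s in path_time t. norm ((simple_value m T0 \<zeta> s \<omega> - H s \<omega>)\<^sup>2) \<le> norm (2 * (simple_value m T0 \<zeta> s \<omega>)\<^sup>2 + 2 * (H s \<omega>)\<^sup>2)"
      proof (rule AE_I2)
        fix s
        have "(simple_value m T0 \<zeta> s \<omega> - H s \<omega>)\<^sup>2 + (simple_value m T0 \<zeta> s \<omega> + H s \<omega>)\<^sup>2 = 2 * (simple_value m T0 \<zeta> s \<omega>)\<^sup>2 + 2 * (H s \<omega>)\<^sup>2"
          by (simp add: power2_eq_square algebra_simps)
        then have "(simple_value m T0 \<zeta> s \<omega> - H s \<omega>)\<^sup>2 \<le> 2 * (simple_value m T0 \<zeta> s \<omega>)\<^sup>2 + 2 * (H s \<omega>)\<^sup>2"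
          using zero_le_power2[of "simple_value m T0 \<zeta> s \<omega> + H s \<omega>"] by linarith
        then show "norm ((simple_value m T0 \<zeta> s \<omega> - H s \<omega>)\<^sup>2) \<le> norm (2 * (simple_value m T0 \<zeta> s \<omega>)\<^sup>2 + 2 * (H s \<omega>)\<^sup>2)"
          by simp
      qed
    qed
    have "e n \<omega> = (\<integral>s. (?S n s \<omega> - ?G n s \<omega>)\<^sup>2 \<partial>path_time t)"
      unfolding e_def using energy_eq_integral[OF D(1) t, of n \<omega>] D(2) by simp
    also have "\<dots> \<le> (\<integral>s. 2 * (?S n s \<omega> - H s \<omega>)\<^sup>2 + 2 * (?G n s \<omega> - H s \<omega>)\<^sup>2 \<partial>path_time t)"
    proof (rule integral_mono)
      show "integrable (path_time t) (\<lambda>s. (?S n s \<omega> - ?G n s \<omega>)\<^sup>2)"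
        using energy_eq_integral[OF D(1) t, of n \<omega>] D(2) by simp
      show "integrable (path_time t) (\<lambda>s. 2 * (?S n s \<omega> - H s \<omega>)\<^sup>2 + 2 * (?G n s \<omega> - H s \<omega>)\<^sup>2)"
        using sq[OF S] sq[OF G] by auto
      fix s
      have "2 * (?S n s \<omega> - H s \<omega>)\<^sup>2 + 2 * (?G n s \<omega> - H s \<omega>)\<^sup>2 = (?S n s \<omega> - ?G n s \<omega>)\<^sup>2 + (?S n s \<omega> + ?G n s \<omega> - 2 * H s \<omega>)\<^sup>2"
        by (simp add: power2_eq_square algebra_simps)
      then show "(?S n s \<omega> - ?G n s \<omega>)\<^sup>2 \<le> 2 * (?S n s \<omega> - H s \<omega>)\<^sup>2 + 2 * (?G n s \<omega> - H s \<omega>)\<^sup>2"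
        by simp
    qed
    also have "\<dots> = 2 * f n \<omega> + 2 * g n \<omega>"
      using sq[OF S] sq[OF G] by (simp add: feq[OF \<omega>] g_def)
    finally show ?thesis .
  qed
  show ?thesis
    unfolding converges_in_prob_def
  proof (intro conjI allI impI)
    fix \<epsilon> :: real assume \<epsilon>: "0 < \<epsilon>"
    let ?P = "\<lambda>n. prob {\<omega>\<in>space M. \<bar>indicator B \<omega> * ?IG n \<omega> - indicator B \<omega> * J \<omega>\<bar> > \<epsilon>}"
    have bound: "?P n \<le> prob {\<omega>\<in>space M. \<bar>?IS n \<omega> - J \<omega>\<bar> > \<epsilon>/2} +
        (prob {\<omega>\<in>space M. f n \<omega> > \<delta>/4} + prob {\<omega>\<in>B. g n \<omega> > \<delta>/4}) + \<delta> / (\<epsilon>/2)\<^sup>2" if \<delta>: "0 < \<delta>" for n \<delta>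
    proof -
      have "?P n \<le> prob ({\<omega>\<in>space M. \<bar>?IS n \<omega> - J \<omega>\<bar> > \<epsilon>/2} \<union> {\<omega>\<in>B. \<bar>?IS n \<omega> - ?IG n \<omega>\<bar> > \<epsilon>/2})"
      proof (rule finite_measure_mono)
        show "{\<omega>\<in>space M. \<bar>indicator B \<omega> * ?IG n \<omega> - indicator B \<omega> * J \<omega>\<bar> > \<epsilon>} \<subseteq>
          {\<omega>\<in>space M. \<bar>?IS n \<omega> - J \<omega>\<bar> > \<epsilon>/2} \<union> {\<omega>\<in>B. \<bar>?IS n \<omega> - ?IG n \<omega>\<bar> > \<epsilon>/2}"
        proof (intro subsetI)
          fix x assume "x \<in> {\<omega>\<in>space M. \<bar>indicator B \<omega> * ?IG n \<omega> - indicator B \<omega> * J \<omega>\<bar> > \<epsilon>}"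
          then have "x \<in> space M" "x \<in> B" "\<bar>?IG n x - J x\<bar> > \<epsilon>"
            using \<epsilon> by (cases "x \<in> B"; auto)+
          moreover have "\<bar>?IG n x - J x\<bar> \<le> \<bar>?IS n x - J x\<bar> + \<bar>?IS n x - ?IG n x\<bar>" by linarith
          ultimately have "\<bar>?IS n x - J x\<bar> > \<epsilon>/2 \<or> \<bar>?IS n x - ?IG n x\<bar> > \<epsilon>/2" by arith
          then show "x \<in> {\<omega>\<in>space M. \<bar>?IS n \<omega> - J \<omega>\<bar> > \<epsilon>/2} \<union> {\<omega>\<in>B. \<bar>?IS n \<omega> - ?IG n \<omega>\<bar> > \<epsilon>/2}"
            using \<open>x \<in> space M\<close> \<open>x \<in> B\<close> by auto
        qed
      qed measurable
      also have "\<dots> \<le> prob {\<omega>\<in>space M. \<bar>?IS n \<omega> - J \<omega>\<bar> > \<epsilon>/2} + prob {\<omega>\<in>B. \<bar>?IS n \<omega> - ?IG n \<omega>\<bar> > \<epsilon>/2}"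
        by (rule measure_Un_le) measurable
      also have "prob {\<omega>\<in>B. \<bar>?IS n \<omega> - ?IG n \<omega>\<bar> > \<epsilon>/2} \<le> prob {\<omega>\<in>B. e n \<omega> > \<delta>} + \<delta> / (\<epsilon>/2)\<^sup>2"
        using simple_integral_truncation[OF D(1) t, of "\<epsilon>/2" \<delta> B n] \<epsilon> \<delta> unfolding D(3) e_def by simp
      \<comment> \<open>Since \<open>e n \<le> 2 * f n + 2 * g n\<close>, one of \<open>f n\<close>
        and \<open>g n\<close> exceeds \<open>\<delta> / 4\<close> wherever \<open>e n\<close>
        exceeds \<open>\<delta>\<close>.\<close>
      also have "prob {\<omega>\<in>B. e n \<omega> > \<delta>} \<le> prob ({\<omega>\<in>space M. f n \<omega> > \<delta>/4} \<union> {\<omega>\<in>B. g n \<omega> > \<delta>/4})"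
      proof (rule finite_measure_mono)
        show "{\<omega>\<in>B. e n \<omega> > \<delta>} \<subseteq> {\<omega>\<in>space M. f n \<omega> > \<delta>/4} \<union> {\<omega>\<in>B. g n \<omega> > \<delta>/4}"
          using e_le[of _ n] Bs by force
      qed measurable
      also have "\<dots> \<le> prob {\<omega>\<in>space M. f n \<omega> > \<delta>/4} + prob {\<omega>\<in>B. g n \<omega> > \<delta>/4}"
        by (rule measure_Un_le) measurable
      finally show ?thesis by simp
    qed
    show "?P \<longlonglongrightarrow> 0"
    proof (rule LIMSEQ_I)
      fix r :: real assume r: "0 < r"
      \<comment> \<open>Chosen so that the truncation error
        \<open>\<delta> / (\<epsilon>/2)\<^sup>2\<close> uses half of \<open>r\<close>; the other
        half is left to the probabilities.\<close>
      define \<delta> where "\<delta> = r / 2 * (\<epsilon>/2)\<^sup>2"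
      have \<delta>: "0 < \<delta>" "\<delta> / (\<epsilon>/2)\<^sup>2 = r/2" using r \<epsilon> by (auto simp: \<delta>_def)
      have l2: "(\<lambda>n. prob {\<omega>\<in>space M. \<bar>?IS n \<omega> - J \<omega>\<bar> > \<epsilon>/2}) \<longlonglongrightarrow> 0"
        using c2 \<epsilon> unfolding converges_in_prob_def by (auto dest!: spec[of _ "\<epsilon>/2"])
      have l3: "(\<lambda>n. prob {\<omega>\<in>B. g n \<omega> > \<delta>/4}) \<longlonglongrightarrow> 0" using conv[of "\<delta>/4"] \<delta> by (simp add: g_def)
      have "(\<lambda>n. prob {\<omega>\<in>space M. \<bar>?IS n \<omega> - J \<omega>\<bar> > \<epsilon>/2} +
        (prob {\<omega>\<in>space M. f n \<omega> > \<delta>/4} + prob {\<omega>\<in>B. g n \<omega> > \<delta>/4})) \<longlonglongrightarrow> 0 + (0 + 0)"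
        using l2 l3 lim_f[of "\<delta>/4"] \<delta> by (intro tendsto_add) auto
      then have "\<forall>\<^sub>F n in sequentially. prob {\<omega>\<in>space M. \<bar>?IS n \<omega> - J \<omega>\<bar> > \<epsilon>/2} +
        (prob {\<omega>\<in>space M. f n \<omega> > \<delta>/4} + prob {\<omega>\<in>B. g n \<omega> > \<delta>/4}) < r/2"
        by (rule order_tendstoD(2)) (use r in simp)
      then have "\<forall>\<^sub>F n in sequentially. norm (?P n - 0) < r"
      proof eventually_elim
        case (elim n)
        then show ?case using bound[OF \<delta>(1), of n] \<delta>(2) by simp
      qed
      then show "\<exists>no. \<forall>n\<ge>no. norm (?P n - 0) < r" by (simp add: eventually_sequentially)
    qed
  qed measurable
qed

end

section \<open>The Ito integral of a continuous adapted integrand\<close>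

locale continuous_adapted = brownian_filtration M F W
  for M :: "'a measure" and F :: "real \<Rightarrow> 'a measure" and W :: "real \<Rightarrow> 'a \<Rightarrow> real" +
  fixes Y :: "real \<Rightarrow> 'a \<Rightarrow> real"
  assumes adapted_Y: "adapted F Y"
    and continuous_Y: "\<And>\<omega>. \<omega> \<in> space M \<Longrightarrow> continuous_on {0..} (\<lambda>t. Y t \<omega>)"
begin

lemma Y_measurable_F: "0 \<le> s \<Longrightarrow> s \<le> t \<Longrightarrow> Y s \<in> borel_measurable (F t)"
  using adapted_Y measurable_F_mono unfolding adapted_def by blast

lemma Y_measurable: "0 \<le> s \<Longrightarrow> Y s \<in> borel_measurable M"
  using Y_measurable_F measurable_F_M by blast

definition grid :: "nat \<Rightarrow> real \<Rightarrow> nat \<Rightarrow> real" where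
  "grid n t i = t * real i / real (Suc n)"

text \<open>Sampling at the left end of each cell. The cutoff inspects grid points up to
  \<open>i\<close> only, which keeps the coefficient adapted, and it makes the coefficient bounded,
  as \<open>simple_process\<close> demands.\<close>

definition grid_coef :: "(real \<Rightarrow> real) \<Rightarrow> real \<Rightarrow> nat \<Rightarrow> real \<Rightarrow> nat \<Rightarrow> 'a \<Rightarrow> real" where
  "grid_coef h K n t i \<omega> = (if \<forall>j\<le>i. \<bar>Y (grid n t j) \<omega>\<bar> \<le> K then h (Y (grid n t i) \<omega>) else 0)"

text \<open>Instead of being stopped, the process is set to 0 once \<open>Y\<close> has left \<open>[-K, K]\<close>; this keeps bounded
  integrands without stopping times.\<close>

definition stopped :: "(real \<Rightarrow> real) \<Rightarrow> real \<Rightarrow> real \<Rightarrow> 'a \<Rightarrow> real" where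
  "stopped h K r \<omega> = (if \<forall>u\<in>{0..r}. \<bar>Y u \<omega>\<bar> \<le> K then h (Y r \<omega>) else 0)"

abbreviation grid_value :: "(real \<Rightarrow> real) \<Rightarrow> real \<Rightarrow> nat \<Rightarrow> real \<Rightarrow> real \<Rightarrow> 'a \<Rightarrow> real" where
  "grid_value h K n t \<equiv> simple_value (Suc n) (grid n t) (grid_coef h K n t)"

lemma grid_nonneg: "0 \<le> t \<Longrightarrow> 0 \<le> grid n t i"
  by (simp add: grid_def)

lemma grid_mono: "0 \<le> t \<Longrightarrow> i \<le> j \<Longrightarrow> grid n t i \<le> grid n t j"
  by (auto simp: grid_def intro!: divide_right_mono mult_left_mono)

lemma continuous_bounded_Icc:
  assumes "continuous_on UNIV (h::real \<Rightarrow> real)"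
  shows "\<exists>C\<ge>0. \<forall>x. \<bar>x\<bar> \<le> K \<longrightarrow> \<bar>h x\<bar> \<le> C"
proof -
  have "compact (h ` {-K..K})"
    by (rule compact_continuous_image) (use assms continuous_on_subset in auto)
  then have "bounded (h ` {-K..K})" by (rule compact_imp_bounded)
  then obtain C where C: "\<forall>x\<in>h ` {-K..K}. norm x \<le> C" unfolding bounded_iff by auto
  then have "\<bar>h x\<bar> \<le> \<bar>C\<bar>" if "\<bar>x\<bar> \<le> K" for x
  proof -
    have "h x \<in> h ` {-K..K}" using that by (intro imageI) auto
    then have "norm (h x) \<le> C" using C by blast
    then show ?thesis by simp
  qed
  then show ?thesis by (intro exI[of _ "\<bar>C\<bar>"]) auto
qed

lemma grid_simple_process:
  assumes h: "continuous_on UNIV h" and t: "0 \<le> t"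
  shows "simple_process F (Suc n) (grid n t) (grid_coef h K n t)"
  unfolding simple_process_def
proof (intro conjI allI impI)
  fix i
  show "0 \<le> grid n t 0" by (simp add: grid_def)
  show "grid n t i \<le> grid n t (Suc i)" using grid_mono[OF t, of i "Suc i"] by simp
  have m[measurable]: "Y (grid n t j) \<in> borel_measurable (F (grid n t i))" if "j \<le> i" for j
    using that grid_mono[OF t] grid_nonneg[OF t] by (intro Y_measurable_F) auto
  have [measurable]: "h \<in> borel_measurable borel" using h by (rule borel_measurable_continuous_onI)
  have 1: "Measurable.pred (F (grid n t i)) (\<lambda>\<omega>. \<forall>j\<in>{..i}. \<bar>Y (grid n t j) \<omega>\<bar> \<le> K)"
    by (rule pred_intros_finite) (use m in \<open>auto\<close>)
  have 2: "(\<lambda>\<omega>. h (Y (grid n t i) \<omega>)) \<in> borel_measurable (F (grid n t i))"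
    using m[of i] by measurable
  have "(\<lambda>\<omega>. if \<forall>j\<in>{..i}. \<bar>Y (grid n t j) \<omega>\<bar> \<le> K then h (Y (grid n t i) \<omega>) else 0) \<in> borel_measurable (F (grid n t i))"
    using 1 2 by (intro measurable_If) (auto simp: pred_def)
  then show "grid_coef h K n t i \<in> borel_measurable (F (grid n t i))"
    by (simp add: grid_coef_def[abs_def])
  obtain C where "C \<ge> 0" "\<And>x. \<bar>x\<bar> \<le> K \<Longrightarrow> \<bar>h x\<bar> \<le> C" using continuous_bounded_Icc[OF h, of K] by auto
  then have "\<bar>grid_coef h K n t i \<omega>\<bar> \<le> C" for \<omega> by (auto simp: grid_coef_def)
  then show "\<exists>C. \<forall>\<omega>\<in>space (F (grid n t i)). \<bar>grid_coef h K n t i \<omega>\<bar> \<le> C" by blast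
qed

text \<open>The cells are open on the left and closed on the right, so the index of the cell
  containing \<open>r\<close> is a ceiling minus 1 and not a floor.\<close>

definition grid_index :: "nat \<Rightarrow> real \<Rightarrow> real \<Rightarrow> nat" where
  "grid_index n t r = nat \<lceil>r * real (Suc n) / t\<rceil> - 1"

lemma grid_index:
  assumes "0 < r" "r \<le> t"
  shows "grid_index n t r < Suc n" "grid n t (grid_index n t r) < r" "r \<le> grid n t (Suc (grid_index n t r))"
    "r - grid n t (grid_index n t r) \<le> t / real (Suc n)"
proof -
  have t: "0 < t" using assms by simp
  let ?x = "r * real (Suc n) / t"
  have x: "0 < ?x" "?x \<le> real (Suc n)" using assms t
    by (simp_all only: pos_divide_le_eq zero_less_divide_iff zero_less_mult_iff mult_right_mono)
      (auto simp: mult.commute[of _ t] intro!: mult_right_mono)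
  have c: "1 \<le> \<lceil>?x\<rceil>" "\<lceil>?x\<rceil> \<le> int (Suc n)" using x by (auto simp: le_ceiling_iff ceiling_le_iff)
  have ri: "real (grid_index n t r) = of_int \<lceil>?x\<rceil> - 1" "real (Suc (grid_index n t r)) = of_int \<lceil>?x\<rceil>"
  proof -
    have "real (nat z - 1) = of_int z - 1 \<and> real (Suc (nat z - 1)) = of_int z" if "1 \<le> z" for z :: int
    proof -
      have "1 \<le> nat z" using that by simp
      then show ?thesis using that by (simp add: of_nat_diff)
    qed
    from this[OF c(1)] show "real (grid_index n t r) = of_int \<lceil>?x\<rceil> - 1" "real (Suc (grid_index n t r)) = of_int \<lceil>?x\<rceil>"
      unfolding grid_index_def by auto
  qed
  have b: "of_int \<lceil>?x\<rceil> - 1 < ?x" "?x \<le> of_int \<lceil>?x\<rceil>" using ceiling_correct[of ?x] by auto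
  show "grid_index n t r < Suc n" using c unfolding grid_index_def by auto
  have g: "grid n t i < r \<longleftrightarrow> real i < ?x" "r \<le> grid n t i \<longleftrightarrow> ?x \<le> real i" for i
    using t by (auto simp: grid_def field_simps)
  show "grid n t (grid_index n t r) < r" using g b ri by simp
  show *: "r \<le> grid n t (Suc (grid_index n t r))" using g b ri by simp
  have "grid n t (Suc (grid_index n t r)) - grid n t (grid_index n t r) = t / real (Suc n)"
    unfolding grid_def diff_divide_distrib[symmetric] by (simp add: algebra_simps)
  then show "r - grid n t (grid_index n t r) \<le> t / real (Suc n)" using * by linarith
qed

lemma grid_index_mono:
  assumes "0 < u" "u \<le> r" "r \<le> t"
  shows "grid_index n t u \<le> grid_index n t r"
  using assms unfolding grid_index_def
  by (intro diff_le_mono nat_mono ceiling_mono divide_right_mono mult_right_mono) auto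

lemma grid_index_tendsto:
  assumes "0 < r" "r \<le> t"
  shows "(\<lambda>n. grid n t (grid_index n t r)) \<longlonglongrightarrow> r"
proof (rule tendsto_sandwich)
  have "(\<lambda>n. r - t * inverse (real (Suc n))) \<longlonglongrightarrow> r - t * 0"
    by (intro tendsto_intros LIMSEQ_inverse_real_of_nat)
  then show "(\<lambda>n. r - t / real (Suc n)) \<longlonglongrightarrow> r" by (simp add: divide_inverse)
  show "\<forall>\<^sub>F n in sequentially. r - t / real (Suc n) \<le> grid n t (grid_index n t r)"
    using grid_index(4)[OF assms] by (intro always_eventually) (simp add: algebra_simps)
  show "\<forall>\<^sub>F n in sequentially. grid n t (grid_index n t r) \<le> r"
    using grid_index(2)[OF assms] by (intro always_eventually) (auto intro: less_imp_le)
qed simp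

lemma Y_tendsto:
  assumes "\<omega> \<in> space M" "a \<longlonglongrightarrow> r" "\<And>n. 0 \<le> a n" "0 \<le> r"
  shows "(\<lambda>n. Y (a n) \<omega>) \<longlonglongrightarrow> Y r \<omega>"
  using continuous_on_tendsto_compose[OF continuous_Y[OF assms(1)] assms(2)] assms(3,4) by auto

lemma grid_value_eq:
  assumes "0 < r" "r \<le> t"
  shows "grid_value h K n t r \<omega> = grid_coef h K n t (grid_index n t r) \<omega>"
proof -
  have t: "0 \<le> t" using assms by simp
  let ?i = "grid_index n t r"
  have "indicator {grid n t i<..grid n t (Suc i)} r = (if i = ?i then 1 else 0::real)" for i
  proof -
    have "r \<le> grid n t i" if "Suc ?i \<le> i" using grid_mono[OF t that, of n] grid_index(3)[OF assms, of n] by simp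
    moreover have "grid n t (Suc i) < r" if "Suc i \<le> ?i" using grid_mono[OF t that, of n] grid_index(2)[OF assms, of n] by simp
    ultimately show ?thesis using grid_index(2,3)[OF assms, of n]
      by (cases i ?i rule: linorder_cases) (force simp: indicator_def Suc_le_eq)+
  qed
  then have "grid_value h K n t r \<omega> = (\<Sum>i<Suc n. if i = ?i then grid_coef h K n t i \<omega> else 0)"
    unfolding simple_value_def by (intro sum.cong) auto
  also have "\<dots> = grid_coef h K n t ?i \<omega>"
    using grid_index(1)[OF assms, of n] by (subst sum.delta) auto
  finally show ?thesis .
qed

text \<open>If the path stays in \<open>[-K, K]\<close> up to \<open>r\<close>, no cutoff occurs and
  continuity gives the limit. Otherwise \<open>\<bar>Y u\<bar> > K\<close> for some
  \<open>u \<le> r\<close>; this is an open condition, so the grid point just before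
  \<open>u\<close> eventually detects it and the grid value is eventually 0.\<close>

lemma grid_value_tendsto:
  assumes h: "continuous_on UNIV h" and \<omega>: "\<omega> \<in> space M" and r: "0 < r" "r \<le> t"
  shows "(\<lambda>n. grid_value h K n t r \<omega>) \<longlonglongrightarrow> stopped h K r \<omega>"
proof -
  have t: "0 \<le> t" using r by simp
  let ?i = "\<lambda>n. grid_index n t r"
  have lim: "(\<lambda>n. Y (grid n t (grid_index n t u)) \<omega>) \<longlonglongrightarrow> Y u \<omega>" if "0 < u" "u \<le> t" for u
    by (rule Y_tendsto[OF \<omega> grid_index_tendsto[OF that]]) (use that t grid_nonneg in auto)
  show ?thesis
  proof (cases "\<forall>u\<in>{0..r}. \<bar>Y u \<omega>\<bar> \<le> K")
    case True
    have "grid n t j \<le> r" if "j \<le> ?i n" for n j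
      using grid_mono[OF t that, of n] grid_index(2)[OF r, of n] by simp
    then have "\<forall>j\<le>?i n. \<bar>Y (grid n t j) \<omega>\<bar> \<le> K" for n using True grid_nonneg[OF t] by auto
    then have "grid_value h K n t r \<omega> = h (Y (grid n t (?i n)) \<omega>)" for n
      unfolding grid_value_eq[OF r] grid_coef_def by simp
    moreover have "(\<lambda>n. h (Y (grid n t (?i n)) \<omega>)) \<longlonglongrightarrow> h (Y r \<omega>)"
      using continuous_on_tendsto_compose[OF h lim[OF r]] by simp
    ultimately show ?thesis using True by (simp add: stopped_def)
  next
    case False
    then obtain u where u: "0 \<le> u" "u \<le> r" "\<bar>Y u \<omega>\<bar> > K" by force
    have "\<forall>\<^sub>F n in sequentially. \<exists>j\<le>?i n. \<bar>Y (grid n t j) \<omega>\<bar> > K"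
    \<comment> \<open>\<open>grid_index\<close> is meaningful at positive times only; time 0 is a
      grid point for every \<open>n\<close>.\<close>
    proof (cases "u = 0")
      case True
      then show ?thesis using u by (intro always_eventually allI exI[of _ 0]) (auto simp: grid_def)
    next
      case False
      then have u0: "0 < u" "u \<le> t" using u r by auto
      have "(\<lambda>n. \<bar>Y (grid n t (grid_index n t u)) \<omega>\<bar>) \<longlonglongrightarrow> \<bar>Y u \<omega>\<bar>"
        by (intro tendsto_rabs lim u0)
      then have "\<forall>\<^sub>F n in sequentially. \<bar>Y (grid n t (grid_index n t u)) \<omega>\<bar> > K"
        using u(3) by (rule order_tendstoD)
      then show ?thesis
        by eventually_elim (use grid_index_mono[OF u0(1) u(2) r(2)] in blast)
    qed
    then have "\<forall>\<^sub>F n in sequentially. grid_value h K n t r \<omega> = 0"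
      by eventually_elim (auto simp: grid_value_eq[OF r] grid_coef_def not_le[symmetric])
    then have "(\<lambda>n. grid_value h K n t r \<omega>) \<longlonglongrightarrow> 0" by (rule tendsto_eventually)
    then show ?thesis using False by (auto simp: stopped_def)
  qed
qed

section \<open>Integration over time and outcome\<close>

abbreviation path_prob :: "real \<Rightarrow> (real \<times> 'a) measure" where
  "path_prob t \<equiv> path_time t \<Otimes>\<^sub>M M"

lemma pair_path_prob: "pair_sigma_finite (path_time t) M"
  by (intro pair_sigma_finite.intro finite_measure.axioms(1) finite_measure_path_time sigma_finite_measure_axioms)

lemma finite_measure_path_prob: "finite_measure (path_prob t)"
  using finite_measure_pair_measure[OF finite_measure_axioms finite_measure_path_time] .

lemma simple_value_measurable_pair:
  assumes "simple_process F k \<tau> \<xi>"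
  shows "(\<lambda>(r, \<omega>). simple_value k \<tau> \<xi> r \<omega>) \<in> borel_measurable (path_prob t)"
proof -
  have "(\<lambda>z. \<xi> i (snd z) * indicator {\<tau> i<..\<tau> (Suc i)} (fst z)) \<in> borel_measurable (path_prob t)" if "i < k" for i
  proof -
    have [measurable]: "\<xi> i \<in> borel_measurable M" by (rule simple_processD(4)[OF assms that])
    have [measurable]: "(\<lambda>s. indicator {\<tau> i<..\<tau> (Suc i)} s :: real) \<in> borel_measurable (path_time t)"
      by (rule measurable_path_time) measurable
    show ?thesis by measurable
  qed
  then show ?thesis
    unfolding simple_value_def split_beta by (intro borel_measurable_sum) auto
qed

text \<open>Joint measurability is inherited from the grid processes, of which
  \<open>stopped\<close> is the pointwise limit; letting \<open>K\<close> grow yields it for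
  \<open>h (Y r)\<close> in \<open>Y_measurable_pair\<close>.\<close>

lemma stopped_measurable_pair:
  fixes h :: "real \<Rightarrow> real"
  assumes h: "continuous_on UNIV h"
  shows "(\<lambda>(r, \<omega>). stopped h K r \<omega>) \<in> borel_measurable (path_prob t)"
proof (cases "0 \<le> t")
  case True
  show ?thesis
    by (rule borel_measurable_LIMSEQ_real[where u="\<lambda>n (r, \<omega>). grid_value h K n t r \<omega>"])
      (auto simp: space_pair_measure intro!: grid_value_tendsto[OF h] simple_value_measurable_pair grid_simple_process[OF h True])
next
  case False
  then have "space (path_prob t) = {}" by (simp add: space_pair_measure)
  then show ?thesis by (intro measurableI) auto
qed

lemma stopped_measurable:
  assumes h: "continuous_on UNIV h" and t: "0 < t"
  shows "stopped h K t \<in> borel_measurable M"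
proof (rule borel_measurable_LIMSEQ_real[where u="\<lambda>n. grid_value h K n t t"])
  show "grid_value h K n t t \<in> borel_measurable M" for n
    using simple_processD(4)[OF grid_simple_process[OF h, of t]] t unfolding simple_value_def[abs_def]
    by (intro borel_measurable_sum borel_measurable_times) auto
qed (use grid_value_tendsto[OF h] t in auto)

definition bounded_until :: "real \<Rightarrow> real \<Rightarrow> 'a set" where
  "bounded_until K t = {\<omega>\<in>space M. \<forall>u\<in>{0..t}. \<bar>Y u \<omega>\<bar> \<le> K}"

text \<open>The definition intersects over uncountably many times, but the indicator of the event is
  \<open>stopped (\<lambda>_. 1) K t\<close>, a limit of random variables that look at finitely many
  times.\<close>

lemma bounded_until_events:
  assumes t: "0 < t"
  shows "bounded_until K t \<in> events"
proof -
  have [measurable]: "stopped (\<lambda>_. 1) K t \<in> borel_measurable M" by (rule stopped_measurable[OF _ t]) auto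
  have "bounded_until K t = {\<omega>\<in>space M. stopped (\<lambda>_. 1) K t \<omega> = 1}"
    by (auto simp: bounded_until_def stopped_def)
  also have "\<dots> \<in> events" by measurable
  finally show ?thesis .
qed

text \<open>A continuous path is bounded on \<open>{0..r}\<close>, so from some \<open>N\<close> on
  the cutoff does not act.\<close>

lemma stopped_tendsto:
  assumes \<omega>: "\<omega> \<in> space M"
  shows "\<forall>\<^sub>F N in sequentially. stopped h (real N) r \<omega> = h (Y r \<omega>)"
proof -
  have "compact ((\<lambda>u. Y u \<omega>) ` {0..r})"
    by (rule compact_continuous_image[OF continuous_on_subset[OF continuous_Y[OF \<omega>]]]) auto
  then have "bounded ((\<lambda>u. Y u \<omega>) ` {0..r})" by (rule compact_imp_bounded)
  then obtain C where C: "\<forall>x\<in>(\<lambda>u. Y u \<omega>) ` {0..r}. norm x \<le> C" unfolding bounded_iff by auto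
  obtain N0 :: nat where "C \<le> real N0" using real_arch_simple by blast
  then have "stopped h (real N) r \<omega> = h (Y r \<omega>)" if "N0 \<le> N" for N
    using C that by (force simp: stopped_def)
  then show ?thesis by (auto simp: eventually_sequentially)
qed

lemma Y_measurable_pair:
  fixes h :: "real \<Rightarrow> real"
  assumes h: "continuous_on UNIV h"
  shows "(\<lambda>(r, \<omega>). h (Y r \<omega>)) \<in> borel_measurable (path_prob t)"
proof (rule borel_measurable_LIMSEQ_real[where u="\<lambda>N (r, \<omega>). stopped h (real N) r \<omega>"])
  fix z assume "z \<in> space (path_prob t)"
  then show "(\<lambda>N. case z of (r, \<omega>) \<Rightarrow> stopped h (real N) r \<omega>) \<longlonglongrightarrow> (case z of (r, \<omega>) \<Rightarrow> h (Y r \<omega>))"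
    by (auto simp: space_pair_measure intro!: tendsto_eventually stopped_tendsto)
qed (use stopped_measurable_pair[OF h] in auto)

lemma path_continuous:
  fixes h :: "real \<Rightarrow> real"
  assumes h: "continuous_on UNIV h" and \<omega>: "\<omega> \<in> space M"
  shows "continuous_on {0..t} (\<lambda>s. h (Y s \<omega>))"
  by (rule continuous_on_compose2[OF h continuous_on_subset[OF continuous_Y[OF \<omega>]]]) auto

lemma path_set_measurable:
  fixes h :: "real \<Rightarrow> real"
  assumes h: "continuous_on UNIV h" and \<omega>: "\<omega> \<in> space M"
  shows "set_borel_measurable borel {0..t} (\<lambda>s. h (Y s \<omega>))"
  using borel_measurable_continuous_on_indicator[OF _ path_continuous[OF h \<omega>], of t]
  by (simp add: set_borel_measurable_def)

lemma path_integrable: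
  fixes h :: "real \<Rightarrow> real"
  assumes h: "continuous_on UNIV h" and \<omega>: "\<omega> \<in> space M"
  shows "integrable (path_time t) (\<lambda>s. h (Y s \<omega>))"
proof -
  have "integrable lborel (\<lambda>s. indicator {0..t} s *\<^sub>R h (Y s \<omega>))"
    by (rule borel_integrable_compact[OF _ path_continuous[OF h \<omega>]]) simp
  then have "set_integrable lborel {0..t} (\<lambda>s. h (Y s \<omega>))" by (simp add: set_integrable_def)
  then have "set_integrable lborel {0<..t} (\<lambda>s. h (Y s \<omega>))"
    by (rule set_integrable_subset) auto
  then show ?thesis
    unfolding path_time_def set_integrable_def by (subst integrable_restrict_space) auto
qed

lemmas borel_intros = borel_measurable_power borel_measurable_diff borel_measurable_const

lemma path_prob_Fubini:
  fixes f :: "real \<Rightarrow> 'a \<Rightarrow> real"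
  assumes "integrable (path_prob t) (\<lambda>z. f (fst z) (snd z))"
  shows "integrable M (\<lambda>\<omega>. \<integral>r. f r \<omega> \<partial>path_time t)"
    "(\<integral>\<omega>. (\<integral>r. f r \<omega> \<partial>path_time t) \<partial>M) = (\<integral>z. f (fst z) (snd z) \<partial>path_prob t)"
    "integrable (path_time t) (\<lambda>r. \<integral>\<omega>. f r \<omega> \<partial>M)"
    "(\<integral>r. (\<integral>\<omega>. f r \<omega> \<partial>M) \<partial>path_time t) = (\<integral>z. f (fst z) (snd z) \<partial>path_prob t)"
proof -
  interpret P: pair_sigma_finite "path_time t" M by (rule pair_path_prob)
  have i: "integrable (path_prob t) (case_prod f)" using assms by (simp add: split_beta')
  show "integrable M (\<lambda>\<omega>. \<integral>r. f r \<omega> \<partial>path_time t)" using P.integrable_snd[OF i] .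
  show "(\<integral>\<omega>. (\<integral>r. f r \<omega> \<partial>path_time t) \<partial>M) = (\<integral>z. f (fst z) (snd z) \<partial>path_prob t)"
    using P.integral_snd[OF i] by (simp add: split_beta')
  show "integrable (path_time t) (\<lambda>r. \<integral>\<omega>. f r \<omega> \<partial>M)" using P.integrable_fst[OF i] .
  show "(\<integral>r. (\<integral>\<omega>. f r \<omega> \<partial>M) \<partial>path_time t) = (\<integral>z. f (fst z) (snd z) \<partial>path_prob t)"
    using P.integral_fst[OF i] by (simp add: split_beta')
qed

lemma path_integral_measurable:
  fixes f :: "real \<Rightarrow> 'a \<Rightarrow> real"
  assumes "(\<lambda>z. f (fst z) (snd z)) \<in> borel_measurable (path_prob t)"
  shows "(\<lambda>\<omega>. \<integral>r. f r \<omega> \<partial>path_time t) \<in> borel_measurable M"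
proof -
  interpret P: pair_sigma_finite "path_time t" M by (rule pair_path_prob)
  have "(\<lambda>(\<omega>, r). f r \<omega>) \<in> borel_measurable (M \<Otimes>\<^sub>M path_time t)"
    using measurable_pair_swap[OF assms] by (simp add: split_beta')
  then show ?thesis by (rule P.M1.borel_measurable_lebesgue_integral)
qed

lemma simple_value_measurable_pair':
  "simple_process F k \<tau> \<xi> \<Longrightarrow> (\<lambda>z. simple_value k \<tau> \<xi> (fst z) (snd z)) \<in> borel_measurable (path_prob t)"
  using simple_value_measurable_pair by (simp add: split_beta')

lemma simple_value_square_integrable:
  assumes "simple_process F k \<tau> \<xi>"
  shows "square_integrable (path_prob t) (\<lambda>z. simple_value k \<tau> \<xi> (fst z) (snd z))"
proof -
  note m[measurable] = simple_value_measurable_pair'[OF assms, of t]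
  interpret P: finite_measure "path_prob t" by (rule finite_measure_path_prob)
  have "\<forall>i\<in>{..<k}. \<exists>C. \<forall>\<omega>\<in>space M. \<bar>\<xi> i \<omega>\<bar> \<le> C" using simple_processD(5)[OF assms] by auto
  then obtain C where C: "\<And>i \<omega>. i < k \<Longrightarrow> \<omega> \<in> space M \<Longrightarrow> \<bar>\<xi> i \<omega>\<bar> \<le> C i" by (metis lessThan_iff)
  have "\<bar>simple_value k \<tau> \<xi> r \<omega>\<bar> \<le> (\<Sum>i<k. C i)" if "\<omega> \<in> space M" for r \<omega>
    unfolding simple_value_def
  proof (rule order_trans[OF sum_abs], rule sum_mono)
    fix i assume "i \<in> {..<k}"
    then have "\<bar>\<xi> i \<omega>\<bar> \<le> C i" using C that by auto
    then show "\<bar>\<xi> i \<omega> * indicator {\<tau> i<..\<tau> (Suc i)} r\<bar> \<le> C i" by (auto simp: indicator_def)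
  qed
  then have "integrable (path_prob t) (\<lambda>z. (simple_value k \<tau> \<xi> (fst z) (snd z))\<^sup>2)"
    by (intro P.integrable_const_bound[of _ "(\<Sum>i<k. C i)\<^sup>2"] AE_I2 borel_measurable_power m)
      (auto simp: space_pair_measure abs_le_square_iff[symmetric] intro: order_trans[OF _ abs_ge_self])
  then show ?thesis using m by (simp add: square_integrable_def)
qed

lemma simple_integral_L2:
  assumes "simple_process F k \<tau> \<xi>" "0 \<le> t"
  shows "square_integrable M (simple_integral W k \<tau> \<xi> t)"
    "(\<integral>\<omega>. (simple_integral W k \<tau> \<xi> t \<omega>)\<^sup>2 \<partial>M) = (\<integral>z. (simple_value k \<tau> \<xi> (fst z) (snd z))\<^sup>2 \<partial>path_prob t)"
proof -
  show "square_integrable M (simple_integral W k \<tau> \<xi> t)"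
    using simple_integral_isometry[OF assms] simple_integral_measurable[OF assms] by (simp add: square_integrable_def)
  have "(\<integral>\<omega>. (simple_integral W k \<tau> \<xi> t \<omega>)\<^sup>2 \<partial>M) = (\<integral>\<omega>. energy k \<tau> \<xi> t \<omega> \<partial>M)"
    by (rule simple_integral_isometry[OF assms])
  also have "\<dots> = (\<integral>\<omega>. (\<integral>r. (simple_value k \<tau> \<xi> r \<omega>)\<^sup>2 \<partial>path_time t) \<partial>M)"
    using energy_eq_integral[OF assms] by simp
  also have "\<dots> = (\<integral>z. (simple_value k \<tau> \<xi> (fst z) (snd z))\<^sup>2 \<partial>path_prob t)"
    using simple_value_square_integrable[OF assms(1), of t] by (intro path_prob_Fubini) (simp add: square_integrable_def)
  finally show "(\<integral>\<omega>. (simple_integral W k \<tau> \<xi> t \<omega>)\<^sup>2 \<partial>M) = (\<integral>z. (simple_value k \<tau> \<xi> (fst z) (snd z))\<^sup>2 \<partial>path_prob t)" .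
qed

text \<open>The isometry for the simple process that represents the difference on a common
  refinement.\<close>

lemma simple_integral_diff_L2:
  assumes "simple_process F k \<tau> \<xi>" "simple_process F k' \<tau>' \<xi>'" "0 \<le> t"
  shows "(\<integral>\<omega>. (simple_integral W k \<tau> \<xi> t \<omega> - simple_integral W k' \<tau>' \<xi>' t \<omega>)\<^sup>2 \<partial>M) =
    (\<integral>z. (simple_value k \<tau> \<xi> (fst z) (snd z) - simple_value k' \<tau>' \<xi>' (fst z) (snd z))\<^sup>2 \<partial>path_prob t)"
proof -
  obtain n T \<eta> where D: "simple_process F n T \<eta>"
    "\<And>s \<omega>. simple_value n T \<eta> s \<omega> = simple_value k \<tau> \<xi> s \<omega> - simple_value k' \<tau>' \<xi>' s \<omega>"
    "\<And>t \<omega>. simple_integral W n T \<eta> t \<omega> = simple_integral W k \<tau> \<xi> t \<omega> - simple_integral W k' \<tau>' \<xi>' t \<omega>"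
    using simple_process_diff[OF assms(1,2)] by blast
  show ?thesis using simple_integral_L2(2)[OF D(1) assms(3)] unfolding D(2,3) .
qed

end

locale ito_path = continuous_adapted M F W Y
  for M :: "'a measure" and F :: "real \<Rightarrow> 'a measure" and W :: "real \<Rightarrow> 'a \<Rightarrow> real" and Y :: "real \<Rightarrow> 'a \<Rightarrow> real" +
  fixes h :: "real \<Rightarrow> real" and J :: "real \<Rightarrow> 'a \<Rightarrow> real"
  assumes continuous_h: "continuous_on UNIV h"
    and ito: "\<And>t. 0 \<le> t \<Longrightarrow> has_ito_integral M F W (\<lambda>r \<omega>. h (Y r \<omega>)) t (J t)"
begin

lemma J_measurable: "0 \<le> t \<Longrightarrow> J t \<in> borel_measurable M"
  using ito[of t] unfolding has_ito_integral_def converges_in_prob_def by auto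

lemma hY_measurable: "(\<lambda>z. h (Y (fst z) (snd z))) \<in> borel_measurable (path_prob t)"
  using Y_measurable_pair[OF continuous_h] by (simp add: split_beta')

lemma stopped_hY_measurable: "(\<lambda>z. stopped h K (fst z) (snd z)) \<in> borel_measurable (path_prob t)"
  using stopped_measurable_pair[OF continuous_h] by (simp add: split_beta')

lemma hY_square_path_integrable: "\<omega> \<in> space M \<Longrightarrow> integrable (path_time t) (\<lambda>s. (h (Y s \<omega>))\<^sup>2)"
  using path_integrable[of "\<lambda>x. (h x)\<^sup>2"] continuous_h by (auto intro: continuous_intros)

lemma grid_value_bound:
  assumes t: "0 \<le> t"
  shows "\<exists>C\<ge>0. \<forall>n r \<omega>. 0 < r \<longrightarrow> r \<le> t \<longrightarrow> \<bar>grid_value h K n t r \<omega>\<bar> \<le> C \<and> \<bar>stopped h K r \<omega>\<bar> \<le> C"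
proof -
  obtain C where C: "C \<ge> 0" "\<And>x. \<bar>x\<bar> \<le> K \<Longrightarrow> \<bar>h x\<bar> \<le> C" using continuous_bounded_Icc[OF continuous_h, of K] by auto
  show ?thesis
    using C by (intro exI[of _ C]) (auto simp: grid_value_eq grid_coef_def stopped_def)
qed

lemma grid_value_L2_tendsto:
  assumes t: "0 \<le> t"
  shows "(\<lambda>n. \<integral>z. (grid_value h K n t (fst z) (snd z) - stopped h K (fst z) (snd z))\<^sup>2 \<partial>path_prob t) \<longlonglongrightarrow> 0"
    "square_integrable (path_prob t) (\<lambda>z. stopped h K (fst z) (snd z))"
proof -
  obtain C where C: "C \<ge> 0" "\<And>n r \<omega>. 0 < r \<Longrightarrow> r \<le> t \<Longrightarrow> \<bar>grid_value h K n t r \<omega>\<bar> \<le> C"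
    "\<And>r \<omega>. 0 < r \<Longrightarrow> r \<le> t \<Longrightarrow> \<bar>stopped h K r \<omega>\<bar> \<le> C" using grid_value_bound[OF t, of K] by blast
  interpret P: finite_measure "path_prob t" by (rule finite_measure_path_prob)
  note m = stopped_hY_measurable[of K t] simple_value_measurable_pair'[OF grid_simple_process[OF continuous_h t], of _ K t]
  have "(\<lambda>n. \<integral>z. (grid_value h K n t (fst z) (snd z) - stopped h K (fst z) (snd z))\<^sup>2 \<partial>path_prob t) \<longlonglongrightarrow> (\<integral>z. 0 \<partial>path_prob t)"
  proof (rule integral_dominated_convergence[where w="\<lambda>_. (2 * C)\<^sup>2"])
    show "AE z in path_prob t. (\<lambda>n. (grid_value h K n t (fst z) (snd z) - stopped h K (fst z) (snd z))\<^sup>2) \<longlonglongrightarrow> 0"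
    proof (rule AE_I2)
      fix z assume "z \<in> space (path_prob t)"
      then have "(\<lambda>n. grid_value h K n t (fst z) (snd z)) \<longlonglongrightarrow> stopped h K (fst z) (snd z)"
        by (intro grid_value_tendsto[OF continuous_h]) (auto simp: space_pair_measure)
      from tendsto_power[OF tendsto_diff[OF this tendsto_const[of "stopped h K (fst z) (snd z)"]], of 2]
      show "(\<lambda>n. (grid_value h K n t (fst z) (snd z) - stopped h K (fst z) (snd z))\<^sup>2) \<longlonglongrightarrow> 0" by simp
    qed
    show "AE z in path_prob t. norm ((grid_value h K n t (fst z) (snd z) - stopped h K (fst z) (snd z))\<^sup>2) \<le> (2 * C)\<^sup>2" for n
    proof (rule AE_I2)
      fix z assume "z \<in> space (path_prob t)"
      then have "0 < fst z" "fst z \<le> t" by (auto simp: space_pair_measure)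
      then have "\<bar>grid_value h K n t (fst z) (snd z) - stopped h K (fst z) (snd z)\<bar> \<le> C + C"
        by (intro order_trans[OF abs_triangle_ineq4] add_mono C)
      then have "\<bar>grid_value h K n t (fst z) (snd z) - stopped h K (fst z) (snd z)\<bar> \<le> \<bar>2 * C\<bar>" by simp
      then show "norm ((grid_value h K n t (fst z) (snd z) - stopped h K (fst z) (snd z))\<^sup>2) \<le> (2 * C)\<^sup>2"
        unfolding abs_le_square_iff by simp
    qed
  qed (auto intro!: borel_intros m)
  then show "(\<lambda>n. \<integral>z. (grid_value h K n t (fst z) (snd z) - stopped h K (fst z) (snd z))\<^sup>2 \<partial>path_prob t) \<longlonglongrightarrow> 0" by simp
  have "integrable (path_prob t) (\<lambda>z. (stopped h K (fst z) (snd z))\<^sup>2)"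
  proof (rule P.integrable_const_bound[of _ "C\<^sup>2"])
    show "AE z in path_prob t. norm ((stopped h K (fst z) (snd z))\<^sup>2) \<le> C\<^sup>2"
      using C(1) by (intro AE_I2) (auto simp: space_pair_measure abs_le_square_iff[symmetric] intro: C(3))
  qed (intro borel_intros m)
  then show "square_integrable (path_prob t) (\<lambda>z. stopped h K (fst z) (snd z))"
    by (simp add: square_integrable_def stopped_hY_measurable)
qed

text \<open>On \<open>bounded_until K t\<close> the integrand agrees with
  \<open>stopped h K\<close>, to which the bounded grid processes converge, so localised uniqueness
  identifies the limit of their integrals with \<open>J t\<close> there. The isometry and Fatou's
  lemma give the bound, without any prior integrability of \<open>h (Y r)\<close>; this feeds the
  Gronwall argument.\<close>

lemma ito_integral_stopped_le:
  assumes t: "0 < t"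
  shows "integrable M (\<lambda>\<omega>. (indicator (bounded_until K t) \<omega> * J t \<omega>)\<^sup>2)"
    "(\<integral>\<omega>. (indicator (bounded_until K t) \<omega> * J t \<omega>)\<^sup>2 \<partial>M) \<le> (\<integral>z. (stopped h K (fst z) (snd z))\<^sup>2 \<partial>path_prob t)"
proof -
  let ?B = "bounded_until K t"
  have t0: "0 \<le> t" using t by simp
  note B[measurable] = bounded_until_events[OF t, of K]
  let ?G = "\<lambda>n. grid_value h K n t"
  let ?I = "\<lambda>n. simple_integral W (Suc n) (grid n t) (grid_coef h K n t) t"
  note sp = grid_simple_process[OF continuous_h t0]
  have [measurable]: "?I n \<in> borel_measurable M" for n by (rule simple_integral_measurable[OF sp t0])
  obtain C where C: "C \<ge> 0" "\<And>n r \<omega>. 0 < r \<Longrightarrow> r \<le> t \<Longrightarrow> \<bar>?G n r \<omega>\<bar> \<le> C"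
    "\<And>r \<omega>. 0 < r \<Longrightarrow> r \<le> t \<Longrightarrow> \<bar>stopped h K r \<omega>\<bar> \<le> C" using grid_value_bound[OF t0, of K] by blast
  interpret T: finite_measure "path_time t" by simp
  have m: "(\<lambda>\<omega>. \<integral>s. (?G n s \<omega> - h (Y s \<omega>))\<^sup>2 \<partial>path_time t) \<in> borel_measurable M" for n
    by (intro path_integral_measurable borel_intros simple_value_measurable_pair'[OF sp] hY_measurable)
  have conv: "converges_in_prob M (\<lambda>n \<omega>. indicator ?B \<omega> * ?I n \<omega>) (\<lambda>\<omega>. indicator ?B \<omega> * J t \<omega>)"
  proof (rule ito_integral_localized[OF ito[OF t0] t0 B])
    show "(\<lambda>n. prob {\<omega>\<in>?B. \<delta> < (\<integral>s. (?G n s \<omega> - h (Y s \<omega>))\<^sup>2 \<partial>path_time t)}) \<longlonglongrightarrow> 0" if "0 < \<delta>" for \<delta>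
    proof (rule prob_tendsto_0I[OF m B _ that])
      fix \<omega> assume "\<omega> \<in> ?B"
      then have \<omega>: "\<omega> \<in> space M" "\<And>r. 0 < r \<Longrightarrow> r \<le> t \<Longrightarrow> stopped h K r \<omega> = h (Y r \<omega>)"
        by (auto simp: bounded_until_def stopped_def)
      have "(\<lambda>n. \<integral>s. (?G n s \<omega> - h (Y s \<omega>))\<^sup>2 \<partial>path_time t) \<longlonglongrightarrow> (\<integral>s. 0 \<partial>path_time t)"
      proof (rule integral_dominated_convergence[where w="\<lambda>_. (2 * C)\<^sup>2"])
        have hm: "(\<lambda>s. h (Y s \<omega>)) \<in> borel_measurable (path_time t)"
          using path_integrable[OF continuous_h \<omega>(1), of t] by auto
        show "(\<lambda>s. (?G n s \<omega> - h (Y s \<omega>))\<^sup>2) \<in> borel_measurable (path_time t)" for n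
          by (intro borel_intros hm measurable_path_time[OF simple_value_measurable])
        show "AE s in path_time t. (\<lambda>n. (?G n s \<omega> - h (Y s \<omega>))\<^sup>2) \<longlonglongrightarrow> 0"
        proof (rule AE_I2)
          fix s assume "s \<in> space (path_time t)"
          then have s: "0 < s" "s \<le> t" by auto
          from tendsto_power[OF tendsto_diff[OF grid_value_tendsto[OF continuous_h \<omega>(1) s, of K] tendsto_const[of "stopped h K s \<omega>"]], of 2]
          show "(\<lambda>n. (?G n s \<omega> - h (Y s \<omega>))\<^sup>2) \<longlonglongrightarrow> 0" using \<omega>(2)[OF s] by simp
        qed
        show "AE s in path_time t. norm ((?G n s \<omega> - h (Y s \<omega>))\<^sup>2) \<le> (2 * C)\<^sup>2" for n
        proof (rule AE_I2)
          fix s assume "s \<in> space (path_time t)"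
          then have s: "0 < s" "s \<le> t" by auto
          then have "\<bar>?G n s \<omega> - stopped h K s \<omega>\<bar> \<le> C + C"
            by (intro order_trans[OF abs_triangle_ineq4] add_mono C)
          then have "\<bar>?G n s \<omega> - h (Y s \<omega>)\<bar> \<le> \<bar>2 * C\<bar>" using \<omega>(2)[OF s] by simp
          then show "norm ((?G n s \<omega> - h (Y s \<omega>))\<^sup>2) \<le> (2 * C)\<^sup>2"
            unfolding abs_le_square_iff by simp
        qed
      qed simp_all
      then show "(\<lambda>n. \<integral>s. (?G n s \<omega> - h (Y s \<omega>))\<^sup>2 \<partial>path_time t) \<longlonglongrightarrow> 0" by simp
    qed
  qed (use path_set_measurable[OF continuous_h] hY_square_path_integrable sp m in auto)
  have int: "integrable M (\<lambda>\<omega>. (?I n \<omega>)\<^sup>2)" for n by (rule simple_integral_isometry(1)[OF sp t0])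
  have int': "integrable M (\<lambda>\<omega>. (indicator ?B \<omega> * ?I n \<omega>)\<^sup>2)" for n
    by (rule Bochner_Integration.integrable_bound[OF int[of n]]) (auto simp: power_mult_distrib indicator_def)
  have le: "(\<integral>\<omega>. (indicator ?B \<omega> * ?I n \<omega>)\<^sup>2 \<partial>M) \<le> (\<integral>z. (?G n (fst z) (snd z))\<^sup>2 \<partial>path_prob t)" for n
    unfolding simple_integral_L2(2)[OF sp t0, symmetric]
    by (rule integral_mono[OF int' int]) (auto simp: power_mult_distrib indicator_def)
  have "(\<lambda>n. \<integral>z. (?G n (fst z) (snd z))\<^sup>2 \<partial>path_prob t) \<longlonglongrightarrow> (\<integral>z. (stopped h K (fst z) (snd z))\<^sup>2 \<partial>path_prob t)"
    by (rule L2_tendsto_integral_square[OF simple_value_square_integrable[OF sp] grid_value_L2_tendsto(2,1)[OF t0]])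
  from converges_in_prob_Fatou[OF conv int' le this]
  show "integrable M (\<lambda>\<omega>. (indicator ?B \<omega> * J t \<omega>)\<^sup>2)"
    "(\<integral>\<omega>. (indicator ?B \<omega> * J t \<omega>)\<^sup>2 \<partial>M) \<le> (\<integral>z. (stopped h K (fst z) (snd z))\<^sup>2 \<partial>path_prob t)" by auto
qed

text \<open>Two limits in succession: the cutoff \<open>N\<close> is made large by dominated
  convergence with majorant \<open>(h (Y r))\<^sup>2\<close>, and then, for this \<open>N\<close>,
  the mesh is made small. Choosing both for each accuracy gives a single sequence.\<close>

lemma simple_approximation:
  assumes t: "0 \<le> t" and sq: "square_integrable (path_prob t) (\<lambda>z. h (Y (fst z) (snd z)))"
  shows "\<exists>k \<tau> \<xi>. (\<forall>n. simple_process F (k n) (\<tau> n) (\<xi> n)) \<and>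
    (\<lambda>n. \<integral>z. (simple_value (k n) (\<tau> n) (\<xi> n) (fst z) (snd z) - h (Y (fst z) (snd z)))\<^sup>2 \<partial>path_prob t) \<longlonglongrightarrow> 0"
proof -
  note m = stopped_hY_measurable[of _ t] hY_measurable[of t]
  have lim: "(\<lambda>N. \<integral>z. (stopped h (real N) (fst z) (snd z) - h (Y (fst z) (snd z)))\<^sup>2 \<partial>path_prob t) \<longlonglongrightarrow> (\<integral>z. 0 \<partial>path_prob t)"
  proof (rule integral_dominated_convergence[where w="\<lambda>z. (h (Y (fst z) (snd z)))\<^sup>2"])
    show "AE z in path_prob t. (\<lambda>N. (stopped h (real N) (fst z) (snd z) - h (Y (fst z) (snd z)))\<^sup>2) \<longlonglongrightarrow> 0"
    proof (rule AE_I2)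
      fix z assume "z \<in> space (path_prob t)"
      then have "\<forall>\<^sub>F N in sequentially. stopped h (real N) (fst z) (snd z) = h (Y (fst z) (snd z))"
        by (intro stopped_tendsto) (auto simp: space_pair_measure)
      then have "\<forall>\<^sub>F N in sequentially. (stopped h (real N) (fst z) (snd z) - h (Y (fst z) (snd z)))\<^sup>2 = 0"
        by eventually_elim simp
      then show "(\<lambda>N. (stopped h (real N) (fst z) (snd z) - h (Y (fst z) (snd z)))\<^sup>2) \<longlonglongrightarrow> 0"
        by (rule tendsto_eventually)
    qed
    show "integrable (path_prob t) (\<lambda>z. (h (Y (fst z) (snd z)))\<^sup>2)" using sq by (simp add: square_integrable_def)
    show "AE z in path_prob t. norm ((stopped h (real N) (fst z) (snd z) - h (Y (fst z) (snd z)))\<^sup>2) \<le> (h (Y (fst z) (snd z)))\<^sup>2" for N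
      by (intro AE_I2) (auto simp: stopped_def)
  qed (intro borel_intros m)+
  then have lim': "(\<lambda>N. \<integral>z. (stopped h (real N) (fst z) (snd z) - h (Y (fst z) (snd z)))\<^sup>2 \<partial>path_prob t) \<longlonglongrightarrow> 0" by simp
  define a where "a N = (\<integral>z. (stopped h (real N) (fst z) (snd z) - h (Y (fst z) (snd z)))\<^sup>2 \<partial>path_prob t)" for N
  define b where "b N n = (\<integral>z. (grid_value h (real N) n t (fst z) (snd z) - stopped h (real N) (fst z) (snd z))\<^sup>2 \<partial>path_prob t)" for N n
  have lims: "a \<longlonglongrightarrow> 0" "b N \<longlonglongrightarrow> 0" for N
    using lim' grid_value_L2_tendsto(1)[OF t, of "real N"] unfolding a_def b_def .
  define c where "c N n = (\<integral>z. (grid_value h (real N) n t (fst z) (snd z) - h (Y (fst z) (snd z)))\<^sup>2 \<partial>path_prob t)" for N n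
  \<comment> \<open>The square of a sum costs a factor 2 on each of the two errors, hence 4.\<close>
  have "\<exists>N n. c N n \<le> 4 * inverse (real (Suc m))" for m
  proof -
    let ?e = "inverse (real (Suc m))"
    have e: "0 < ?e" by simp
    obtain N where N: "a N < ?e"
      using order_tendstoD(2)[OF lims(1) e] eventually_happens'[OF sequentially_bot] by blast
    obtain n where n: "b N n < ?e"
      using order_tendstoD(2)[OF lims(2) e] eventually_happens'[OF sequentially_bot] by blast
    have "c N n =
      (\<integral>z. ((grid_value h (real N) n t (fst z) (snd z) - stopped h (real N) (fst z) (snd z)) +
        (stopped h (real N) (fst z) (snd z) - h (Y (fst z) (snd z))))\<^sup>2 \<partial>path_prob t)" by (simp add: c_def)
    also have "\<dots> \<le> 2 * (\<integral>z. (grid_value h (real N) n t (fst z) (snd z) - stopped h (real N) (fst z) (snd z))\<^sup>2 \<partial>path_prob t) +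
       2 * (\<integral>z. (stopped h (real N) (fst z) (snd z) - h (Y (fst z) (snd z)))\<^sup>2 \<partial>path_prob t)"
      by (intro integral_square_sum_le square_integrable_diff sq grid_value_L2_tendsto(2)[OF t]
        simple_value_square_integrable[OF grid_simple_process[OF continuous_h t]])
    also have "\<dots> \<le> 4 * ?e" using N n unfolding a_def b_def by linarith
    finally show ?thesis by blast
  qed
  then obtain N n where Nn: "\<And>m. c (N m) (n m) \<le> 4 * inverse (real (Suc m))"
    by metis
  have "(\<lambda>m. 4 * inverse (real (Suc m))) \<longlonglongrightarrow> 4 * 0" by (intro tendsto_intros LIMSEQ_inverse_real_of_nat)
  then have up: "(\<lambda>m. 4 * inverse (real (Suc m))) \<longlonglongrightarrow> 0" by simp
  have "0 \<le> c N n" for N n unfolding c_def by (rule integral_nonneg_AE) simp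
  then have "(\<lambda>m. c (N m) (n m)) \<longlonglongrightarrow> 0"
    by (intro tendsto_sandwich[OF _ _ tendsto_const up]) (use Nn in \<open>auto intro!: always_eventually\<close>)
  then show ?thesis unfolding c_def
    by (intro exI[of _ "\<lambda>m. Suc (n m)"] exI[of _ "\<lambda>m. grid (n m) t"] exI[of _ "\<lambda>m. grid_coef h (real (N m)) (n m) t"])
      (auto intro: grid_simple_process[OF continuous_h t])
qed

text \<open>Markov's inequality turns L2 convergence of the integrands into the convergence in
  probability that \<open>ito_integral_localized\<close> requires, so the simple integrals tend to
  \<open>J t\<close> in probability. The isometry makes them Cauchy in L2, and Fatou's lemma
  upgrades the mode of convergence.\<close>

lemma ito_L2_approximation:
  assumes t: "0 \<le> t" and sq: "square_integrable (path_prob t) (\<lambda>z. h (Y (fst z) (snd z)))"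
  shows "square_integrable M (J t)" "\<exists>k \<tau> \<xi>. (\<forall>n. simple_process F (k n) (\<tau> n) (\<xi> n)) \<and>
    (\<lambda>n. \<integral>z. (simple_value (k n) (\<tau> n) (\<xi> n) (fst z) (snd z) - h (Y (fst z) (snd z)))\<^sup>2 \<partial>path_prob t) \<longlonglongrightarrow> 0 \<and>
    (\<lambda>n. \<integral>\<omega>. (simple_integral W (k n) (\<tau> n) (\<xi> n) t \<omega> - J t \<omega>)\<^sup>2 \<partial>M) \<longlonglongrightarrow> 0"
proof -
  obtain k \<tau> \<xi> where sp: "\<And>n. simple_process F (k n) (\<tau> n) (\<xi> n)"
    and lim: "(\<lambda>n. \<integral>z. (simple_value (k n) (\<tau> n) (\<xi> n) (fst z) (snd z) - h (Y (fst z) (snd z)))\<^sup>2 \<partial>path_prob t) \<longlonglongrightarrow> 0"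
    using simple_approximation[OF assms] by auto
  let ?G = "\<lambda>n. simple_value (k n) (\<tau> n) (\<xi> n)" and ?I = "\<lambda>n. simple_integral W (k n) (\<tau> n) (\<xi> n) t"
  define d where "d n = (\<integral>z. (?G n (fst z) (snd z) - h (Y (fst z) (snd z)))\<^sup>2 \<partial>path_prob t)" for n
  have limd: "d \<longlonglongrightarrow> 0" using lim by (simp add: d_def[abs_def])
  note [measurable] = J_measurable[OF t]
  have [measurable]: "?I n \<in> borel_measurable M" for n by (rule simple_integral_measurable[OF sp t])
  have sqd: "square_integrable (path_prob t) (\<lambda>z. ?G n (fst z) (snd z) - h (Y (fst z) (snd z)))" for n
    by (intro square_integrable_diff sq simple_value_square_integrable[OF sp])
  have m: "(\<lambda>\<omega>. \<integral>s. (?G n s \<omega> - h (Y s \<omega>))\<^sup>2 \<partial>path_time t) \<in> borel_measurable M" for n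
    by (intro path_integral_measurable borel_intros simple_value_measurable_pair'[OF sp] hY_measurable)
  have conv: "converges_in_prob M (\<lambda>n \<omega>. indicator (space M) \<omega> * ?I n \<omega>) (\<lambda>\<omega>. indicator (space M) \<omega> * J t \<omega>)"
  proof (rule ito_integral_localized[OF ito[OF t] t sets.top])
    fix \<delta> :: real assume \<delta>: "0 < \<delta>"
    show "(\<lambda>n. prob {\<omega>\<in>space M. \<delta> < (\<integral>s. (?G n s \<omega> - h (Y s \<omega>))\<^sup>2 \<partial>path_time t)}) \<longlonglongrightarrow> 0"
    proof (rule tendsto_sandwich[OF _ _ tendsto_const])
      show "\<forall>\<^sub>F n in sequentially. prob {\<omega>\<in>space M. \<delta> < (\<integral>s. (?G n s \<omega> - h (Y s \<omega>))\<^sup>2 \<partial>path_time t)} \<le> d n / \<delta>"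
      proof (intro always_eventually allI)
        fix n
        have i: "integrable (path_prob t) (\<lambda>z. (?G n (fst z) (snd z) - h (Y (fst z) (snd z)))\<^sup>2)"
          using sqd by (simp add: square_integrable_def)
        have "prob {\<omega>\<in>space M. \<delta> < (\<integral>s. (?G n s \<omega> - h (Y s \<omega>))\<^sup>2 \<partial>path_time t)} \<le>
           prob {\<omega>\<in>space M. \<delta> \<le> (\<integral>s. (?G n s \<omega> - h (Y s \<omega>))\<^sup>2 \<partial>path_time t)}"
          using m[of n] by (intro finite_measure_mono) auto
        also have "\<dots> \<le> (\<integral>\<omega>. (\<integral>s. (?G n s \<omega> - h (Y s \<omega>))\<^sup>2 \<partial>path_time t) \<partial>M) / \<delta>"
          using path_prob_Fubini(1)[OF i] \<delta> by (intro integral_Markov_inequality_measure[of _ _ "space M"]) auto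
        also have "\<dots> = d n / \<delta>" using path_prob_Fubini(2)[OF i] by (simp add: d_def)
        finally show "prob {\<omega>\<in>space M. \<delta> < (\<integral>s. (?G n s \<omega> - h (Y s \<omega>))\<^sup>2 \<partial>path_time t)} \<le> d n / \<delta>" .
      qed
      show "(\<lambda>n. d n / \<delta>) \<longlonglongrightarrow> 0" using tendsto_divide[OF limd tendsto_const[of \<delta>]] \<delta> by simp
    qed simp
  qed (use path_set_measurable[OF continuous_h] hY_square_path_integrable sp m in auto)
  have conv': "converges_in_prob M (\<lambda>l \<omega>. ?I l \<omega> - ?I n \<omega>) (\<lambda>\<omega>. J t \<omega> - ?I n \<omega>)" for n
    unfolding converges_in_prob_def
  proof (intro conjI allI impI)
    fix \<epsilon> :: real assume "0 < \<epsilon>"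
    then have "(\<lambda>l. prob {\<omega>\<in>space M. \<epsilon> < \<bar>indicator (space M) \<omega> * ?I l \<omega> - indicator (space M) \<omega> * J t \<omega>\<bar>}) \<longlonglongrightarrow> 0"
      using conv unfolding converges_in_prob_def by blast
    moreover have "{\<omega>\<in>space M. \<epsilon> < \<bar>indicator (space M) \<omega> * ?I l \<omega> - indicator (space M) \<omega> * J t \<omega>\<bar>} =
      {\<omega>\<in>space M. \<epsilon> < \<bar>(?I l \<omega> - ?I n \<omega>) - (J t \<omega> - ?I n \<omega>)\<bar>}" for l by auto
    ultimately show "(\<lambda>l. prob {\<omega>\<in>space M. \<epsilon> < \<bar>(?I l \<omega> - ?I n \<omega>) - (J t \<omega> - ?I n \<omega>)\<bar>}) \<longlonglongrightarrow> 0" by simp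
  qed measurable
  have sqI: "square_integrable M (?I n)" for n by (rule simple_integral_L2(1)[OF sp t])
  have bnd: "(\<integral>\<omega>. (?I l \<omega> - ?I n \<omega>)\<^sup>2 \<partial>M) \<le> 2 * d l + 2 * d n" for l n
  proof -
    have "(\<integral>\<omega>. (?I l \<omega> - ?I n \<omega>)\<^sup>2 \<partial>M) = (\<integral>z. (?G l (fst z) (snd z) - ?G n (fst z) (snd z))\<^sup>2 \<partial>path_prob t)"
      by (rule simple_integral_diff_L2[OF sp sp t])
    also have "\<dots> = (\<integral>z. ((?G l (fst z) (snd z) - h (Y (fst z) (snd z))) + (-1) * (?G n (fst z) (snd z) - h (Y (fst z) (snd z))))\<^sup>2 \<partial>path_prob t)"
      by simp
    also have "\<dots> \<le> 2 * d l + 2 * (\<integral>z. ((-1) * (?G n (fst z) (snd z) - h (Y (fst z) (snd z))))\<^sup>2 \<partial>path_prob t)"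
      unfolding d_def by (intro integral_square_sum_le square_integrable_cmult sqd)
    also have "\<dots> = 2 * d l + 2 * d n" by (simp only: d_def power_mult_distrib) simp
    finally show ?thesis .
  qed
  \<comment> \<open>Fatou as \<open>l\<close> grows with \<open>n\<close> fixed: the Cauchy bound
    \<open>2 * d l + 2 * d n\<close> becomes a bound on the distance from \<open>?I n\<close> to the
    limit.\<close>
  have F: "integrable M (\<lambda>\<omega>. (J t \<omega> - ?I n \<omega>)\<^sup>2) \<and> (\<integral>\<omega>. (J t \<omega> - ?I n \<omega>)\<^sup>2 \<partial>M) \<le> 2 * d n" for n
  proof (rule converges_in_prob_Fatou[OF conv' _ bnd])
    show "integrable M (\<lambda>\<omega>. (?I l \<omega> - ?I n \<omega>)\<^sup>2)" for l
      using square_integrable_diff[OF sqI sqI] by (simp add: square_integrable_def)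
    have "(\<lambda>l. 2 * d l + 2 * d n) \<longlonglongrightarrow> 2 * 0 + 2 * d n" by (intro tendsto_intros limd)
    then show "(\<lambda>l. 2 * d l + 2 * d n) \<longlonglongrightarrow> 2 * d n" by simp
  qed
  have "square_integrable M (\<lambda>\<omega>. (J t \<omega> - ?I 0 \<omega>) + ?I 0 \<omega>)"
    using F[of 0] by (intro square_integrable_add sqI) (auto simp: square_integrable_def)
  then show "square_integrable M (J t)" by simp
  have "(\<lambda>n. 2 * d n) \<longlonglongrightarrow> 2 * 0" by (intro tendsto_intros limd)
  then have up: "(\<lambda>n. 2 * d n) \<longlonglongrightarrow> 0" by simp
  have "(\<lambda>n. \<integral>\<omega>. (?I n \<omega> - J t \<omega>)\<^sup>2 \<partial>M) \<longlonglongrightarrow> 0"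
    by (rule tendsto_sandwich[OF _ _ tendsto_const up])
      (use F in \<open>auto intro!: always_eventually simp: power2_commute\<close>)
  then show "\<exists>k \<tau> \<xi>. (\<forall>n. simple_process F (k n) (\<tau> n) (\<xi> n)) \<and>
    (\<lambda>n. \<integral>z. (simple_value (k n) (\<tau> n) (\<xi> n) (fst z) (snd z) - h (Y (fst z) (snd z)))\<^sup>2 \<partial>path_prob t) \<longlonglongrightarrow> 0 \<and>
    (\<lambda>n. \<integral>\<omega>. (simple_integral W (k n) (\<tau> n) (\<xi> n) t \<omega> - J t \<omega>)\<^sup>2 \<partial>M) \<longlonglongrightarrow> 0"
    using sp lim by blast
qed

end

context continuous_adapted
begin

text \<open>For a nonnegative integrand both claims follow from one identity of nonnegative
  integrals.\<close>

lemma path_prob_restrict: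
  fixes f :: "real \<times> 'a \<Rightarrow> real"
  assumes st: "s \<le> t" and f: "f \<in> borel_measurable (path_prob s)" "\<And>z. 0 \<le> f z"
    and g: "(\<lambda>z. if fst z \<le> s then f z else 0) \<in> borel_measurable (path_prob t)"
  shows "(\<integral>z. (if fst z \<le> s then f z else 0) \<partial>path_prob t) = (\<integral>z. f z \<partial>path_prob s)"
    "integrable (path_prob t) (\<lambda>z. if fst z \<le> s then f z else 0) \<longleftrightarrow> integrable (path_prob s) f"
proof -
  have "(\<integral>\<^sup>+z. ennreal (if fst z \<le> s then f z else 0) \<partial>path_prob t) =
    (\<integral>\<^sup>+r. \<integral>\<^sup>+\<omega>. ennreal (if r \<le> s then f (r, \<omega>) else 0) \<partial>M \<partial>path_time t)"
    using g by (subst nn_integral_fst[symmetric]) simp_all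
  also have "\<dots> = (\<integral>\<^sup>+r. \<integral>\<^sup>+\<omega>. ennreal (f (r, \<omega>)) \<partial>M \<partial>path_time s)"
    unfolding path_time_def using st
    by (subst (1 2) nn_integral_restrict_space) (auto intro!: nn_integral_cong simp: indicator_def)
  also have "\<dots> = (\<integral>\<^sup>+z. ennreal (f z) \<partial>path_prob s)"
    using f by (subst nn_integral_fst[symmetric]) simp_all
  finally have eq: "(\<integral>\<^sup>+z. ennreal (if fst z \<le> s then f z else 0) \<partial>path_prob t) = (\<integral>\<^sup>+z. ennreal (f z) \<partial>path_prob s)" .
  show "(\<integral>z. (if fst z \<le> s then f z else 0) \<partial>path_prob t) = (\<integral>z. f z \<partial>path_prob s)"
    using f g by (simp add: integral_eq_nn_integral eq)
  show "integrable (path_prob t) (\<lambda>z. if fst z \<le> s then f z else 0) \<longleftrightarrow> integrable (path_prob s) f"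
  proof -
    have n: "norm (if fst z \<le> s then f z else 0) = (if fst z \<le> s then f z else 0)" "norm (f z) = f z" for z
      using f(2) by auto
    show ?thesis unfolding integrable_iff_bounded n eq using f g by auto
  qed
qed

lemma measurable_fst_le: "Measurable.pred (path_prob t) (\<lambda>z. fst z \<le> s)"
proof -
  have "(\<lambda>x::real. x) \<in> borel_measurable (path_time t)" by (rule measurable_path_time) simp
  then have "fst \<in> borel_measurable (path_prob t)" by (rule measurable_compose[OF measurable_fst, of "\<lambda>x. x", simplified])
  then show ?thesis by measurable
qed

lemma square_integrable_snd:
  assumes "square_integrable M Z"
  shows "square_integrable (path_prob t) (\<lambda>z. Z (snd z))"
proof -
  interpret P: pair_sigma_finite "path_time t" M by (rule pair_path_prob)
  interpret T: finite_measure "path_time t" by simp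
  have [measurable]: "Z \<in> borel_measurable M" and i: "integrable M (\<lambda>\<omega>. (Z \<omega>)\<^sup>2)" using assms by (auto simp: square_integrable_def)
  have "integrable (path_prob t) (\<lambda>z. (Z (snd z))\<^sup>2)"
    by (rule P.Fubini_integrable) (use i in simp_all)
  then show ?thesis by (simp add: square_integrable_def)
qed

lemma converges_everywhere_Fatou:
  assumes m: "\<And>n. X n \<in> borel_measurable M" "Z \<in> borel_measurable M"
    and lim: "\<And>\<omega>. \<omega> \<in> space M \<Longrightarrow> (\<lambda>n. X n \<omega>) \<longlonglongrightarrow> Z \<omega>"
    and int: "\<And>n. integrable M (\<lambda>\<omega>. (X n \<omega>)\<^sup>2)" "\<And>n. (\<integral>\<omega>. (X n \<omega>)\<^sup>2 \<partial>M) \<le> C"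
  shows "square_integrable M Z" "(\<integral>\<omega>. (Z \<omega>)\<^sup>2 \<partial>M) \<le> C"
proof -
  note [measurable] = m
  have "converges_in_prob M X Z"
    unfolding converges_in_prob_def
  proof (intro conjI allI impI m)
    fix \<epsilon> :: real assume "0 < \<epsilon>"
    show "(\<lambda>n. prob {\<omega> \<in> space M. \<epsilon> < \<bar>X n \<omega> - Z \<omega>\<bar>}) \<longlonglongrightarrow> 0"
    proof (rule prob_tendsto_0I[OF _ sets.top _ \<open>0 < \<epsilon>\<close>])
      fix \<omega> assume "\<omega> \<in> space M"
      from tendsto_rabs[OF tendsto_diff[OF lim[OF this] tendsto_const[of "Z \<omega>"]]]
      show "(\<lambda>n. \<bar>X n \<omega> - Z \<omega>\<bar>) \<longlonglongrightarrow> 0" by simp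
    qed measurable
  qed
  from converges_in_prob_Fatou[OF this int tendsto_const]
  show "square_integrable M Z" "(\<integral>\<omega>. (Z \<omega>)\<^sup>2 \<partial>M) \<le> C" using m by (auto simp: square_integrable_def)
qed

end

section \<open>Orthogonality, isometry and covariance of the Ito integrals\<close>

context ito_path
begin

lemma ito_orthogonal:
  assumes t: "0 \<le> t" and sq: "square_integrable (path_prob t) (\<lambda>z. h (Y (fst z) (snd z)))"
    and Z: "Z \<in> borel_measurable (F 0)" "square_integrable M Z"
  shows "(\<integral>\<omega>. Z \<omega> * J t \<omega> \<partial>M) = 0"
proof -
  obtain k \<tau> \<xi> where sp: "\<And>n. simple_process F (k n) (\<tau> n) (\<xi> n)"
    and lim: "(\<lambda>n. \<integral>\<omega>. (simple_integral W (k n) (\<tau> n) (\<xi> n) t \<omega> - J t \<omega>)\<^sup>2 \<partial>M) \<longlonglongrightarrow> 0"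
    using ito_L2_approximation(2)[OF t sq] by auto
  have "integrable M Z" using Z(2) square_integrable_mult[OF Z(2), of "\<lambda>_. 1"] by (simp add: square_integrable_def)
  then have "(\<integral>\<omega>. Z \<omega> * simple_integral W (k n) (\<tau> n) (\<xi> n) t \<omega> \<partial>M) = 0" for n
    by (rule simple_integral_orthogonal(2)[OF sp t Z(1)])
  then show ?thesis
    using L2_tendsto_integral_mult[OF Z(2) simple_integral_L2(1)[OF sp t] ito_L2_approximation(1)[OF t sq] lim]
    by (simp add: LIMSEQ_const_iff)
qed

lemma ito_isometry:
  assumes t: "0 \<le> t" and sq: "square_integrable (path_prob t) (\<lambda>z. h (Y (fst z) (snd z)))"
  shows "(\<integral>\<omega>. (J t \<omega>)\<^sup>2 \<partial>M) = (\<integral>z. (h (Y (fst z) (snd z)))\<^sup>2 \<partial>path_prob t)"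
proof -
  obtain k \<tau> \<xi> where sp: "\<And>n. simple_process F (k n) (\<tau> n) (\<xi> n)"
    and lim1: "(\<lambda>n. \<integral>z. (simple_value (k n) (\<tau> n) (\<xi> n) (fst z) (snd z) - h (Y (fst z) (snd z)))\<^sup>2 \<partial>path_prob t) \<longlonglongrightarrow> 0"
    and lim2: "(\<lambda>n. \<integral>\<omega>. (simple_integral W (k n) (\<tau> n) (\<xi> n) t \<omega> - J t \<omega>)\<^sup>2 \<partial>M) \<longlonglongrightarrow> 0"
    using ito_L2_approximation(2)[OF t sq] by auto
  have 1: "(\<lambda>n. \<integral>z. (simple_value (k n) (\<tau> n) (\<xi> n) (fst z) (snd z))\<^sup>2 \<partial>path_prob t) \<longlonglongrightarrow> (\<integral>z. (h (Y (fst z) (snd z)))\<^sup>2 \<partial>path_prob t)"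
    by (rule L2_tendsto_integral_square[OF simple_value_square_integrable[OF sp] sq lim1])
  have 2: "(\<lambda>n. \<integral>\<omega>. (simple_integral W (k n) (\<tau> n) (\<xi> n) t \<omega>)\<^sup>2 \<partial>M) \<longlonglongrightarrow> (\<integral>\<omega>. (J t \<omega>)\<^sup>2 \<partial>M)"
    by (rule L2_tendsto_integral_square[OF simple_integral_L2(1)[OF sp t] ito_L2_approximation(1)[OF t sq] lim2])
  show ?thesis using LIMSEQ_unique[OF 2] 1 unfolding simple_integral_L2(2)[OF sp t] by auto
qed

text \<open>The integral up to \<open>s\<close> is the integral up to \<open>t\<close> of the
  integrand cut off at \<open>s\<close>. With both approximating sequences placed on the horizon
  \<open>t\<close>, the isometry for differences leaves the part of the squared integrand after
  \<open>s\<close>.\<close>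

lemma ito_increment_isometry:
  assumes st: "0 \<le> s" "s \<le> t" and sqs: "\<And>t. 0 \<le> t \<Longrightarrow> square_integrable (path_prob t) (\<lambda>z. h (Y (fst z) (snd z)))"
  shows "(\<integral>\<omega>. (J t \<omega> - J s \<omega>)\<^sup>2 \<partial>M) =
    (\<integral>z. (h (Y (fst z) (snd z)))\<^sup>2 \<partial>path_prob t) - (\<integral>z. (h (Y (fst z) (snd z)))\<^sup>2 \<partial>path_prob s)"
proof -
  have t: "0 \<le> t" using st by simp
  note sq = sqs[OF t] and sq' = sqs[OF st(1)]
  let ?H = "\<lambda>z. h (Y (fst z) (snd z))" and ?r = "\<lambda>f z. if fst z \<le> s then f z else (0::real)"
  obtain k \<tau> \<xi> where sp: "\<And>n. simple_process F (k n) (\<tau> n) (\<xi> n)"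
    and lim1: "(\<lambda>n. \<integral>z. (simple_value (k n) (\<tau> n) (\<xi> n) (fst z) (snd z) - ?H z)\<^sup>2 \<partial>path_prob t) \<longlonglongrightarrow> 0"
    and lim2: "(\<lambda>n. \<integral>\<omega>. (simple_integral W (k n) (\<tau> n) (\<xi> n) t \<omega> - J t \<omega>)\<^sup>2 \<partial>M) \<longlonglongrightarrow> 0"
    using ito_L2_approximation(2)[OF t sq] by auto
  obtain k' \<tau>' \<xi>' where sp'': "\<And>n. simple_process F (k' n) (\<tau>' n) (\<xi>' n)"
    and lim1': "(\<lambda>n. \<integral>z. (simple_value (k' n) (\<tau>' n) (\<xi>' n) (fst z) (snd z) - ?H z)\<^sup>2 \<partial>path_prob s) \<longlonglongrightarrow> 0"
    and lim2': "(\<lambda>n. \<integral>\<omega>. (simple_integral W (k' n) (\<tau>' n) (\<xi>' n) s \<omega> - J s \<omega>)\<^sup>2 \<partial>M) \<longlonglongrightarrow> 0"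
    using ito_L2_approximation(2)[OF st(1) sq'] by auto
  define T where "T n i = min (\<tau>' n i) s" for n i
  define \<eta> where "\<eta> n i \<omega> = (if \<tau>' n i \<le> s then \<xi>' n i \<omega> else 0)" for n i \<omega>
  note R = simple_process_restrict[OF sp'' st(1)]
  have sp': "simple_process F (k' n) (T n) (\<eta> n)" for n
    using R(1)[of n] by (simp add: T_def[abs_def] \<eta>_def[abs_def])
  have val: "simple_value (k' n) (T n) (\<eta> n) r \<omega> = (if r \<le> s then simple_value (k' n) (\<tau>' n) (\<xi>' n) r \<omega> else 0)" for n r \<omega>
    using R(2)[of n r \<omega>] by (simp add: T_def[abs_def] \<eta>_def[abs_def])
  have int: "simple_integral W (k' n) (T n) (\<eta> n) t \<omega> = simple_integral W (k' n) (\<tau>' n) (\<xi>' n) s \<omega>" for n \<omega>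
    using R(3)[of t n \<omega>] st by (simp add: T_def[abs_def] \<eta>_def[abs_def])
  let ?G = "\<lambda>n z. simple_value (k n) (\<tau> n) (\<xi> n) (fst z) (snd z)"
  let ?G' = "\<lambda>n z. simple_value (k' n) (T n) (\<eta> n) (fst z) (snd z)"
  let ?G'' = "\<lambda>n z. simple_value (k' n) (\<tau>' n) (\<xi>' n) (fst z) (snd z)"
  have mr: "?r f \<in> borel_measurable (path_prob t)" if "f \<in> borel_measurable (path_prob t)" for f
    using that measurable_fst_le by (intro measurable_If) (auto simp: pred_def)
  have H2s: "(\<lambda>z. (?H z)\<^sup>2) \<in> borel_measurable (path_prob u)" for u using hY_measurable by (intro borel_measurable_power)
  have Heq: "(\<integral>z. ?r (\<lambda>z. (?H z)\<^sup>2) z \<partial>path_prob t) = (\<integral>z. (?H z)\<^sup>2 \<partial>path_prob s)"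
    by (rule path_prob_restrict(1)[OF st(2) H2s _ mr[OF H2s]]) simp
  have rsq: "(?r ?H z)\<^sup>2 = ?r (\<lambda>z. (?H z)\<^sup>2) z" for z by simp
  have sqr: "square_integrable (path_prob t) (?r ?H)"
    unfolding square_integrable_def
  proof
    show "?r ?H \<in> borel_measurable (path_prob t)" by (rule mr[OF hY_measurable])
    have "integrable (path_prob t) (?r (\<lambda>z. (?H z)\<^sup>2))"
      using path_prob_restrict(2)[OF st(2) H2s _ mr[OF H2s]] sq' by (simp add: square_integrable_def)
    then show "integrable (path_prob t) (\<lambda>z. (?r ?H z)\<^sup>2)" unfolding rsq .
  qed
  have lim1r: "(\<lambda>n. \<integral>z. (?G' n z - ?r ?H z)\<^sup>2 \<partial>path_prob t) \<longlonglongrightarrow> 0"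
  proof -
    have m: "(\<lambda>z. (?G'' n z - ?H z)\<^sup>2) \<in> borel_measurable (path_prob u)" for n u
      by (intro borel_intros simple_value_measurable_pair'[OF sp''] hY_measurable)
    have "(\<integral>z. (?G' n z - ?r ?H z)\<^sup>2 \<partial>path_prob t) = (\<integral>z. ?r (\<lambda>z. (?G'' n z - ?H z)\<^sup>2) z \<partial>path_prob t)" for n
      by (intro Bochner_Integration.integral_cong refl) (simp add: val)
    also have "\<dots> n = (\<integral>z. (?G'' n z - ?H z)\<^sup>2 \<partial>path_prob s)" for n
      by (rule path_prob_restrict(1)[OF st(2) m _ mr[OF m]]) simp
    finally show ?thesis using lim1' by simp
  qed
  define a where "a n = (\<integral>\<omega>. (simple_integral W (k n) (\<tau> n) (\<xi> n) t \<omega> - simple_integral W (k' n) (T n) (\<eta> n) t \<omega>)\<^sup>2 \<partial>M)" for n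
  \<comment> \<open>L2 limits may be subtracted; stated for a general measure because it is applied
    both on \<open>M\<close> and on \<open>path_prob t\<close>.\<close>
  have sqd: "(\<lambda>n. \<integral>x. ((f n x - g n x) - (f' x - g' x))\<^sup>2 \<partial>N) \<longlonglongrightarrow> 0"
    if "(\<lambda>n. \<integral>x. (f n x - f' x)\<^sup>2 \<partial>N) \<longlonglongrightarrow> 0" "(\<lambda>n. \<integral>x. (g n x - g' x)\<^sup>2 \<partial>N) \<longlonglongrightarrow> 0"
      "\<And>n. square_integrable N (f n)" "\<And>n. square_integrable N (g n)" "square_integrable N f'" "square_integrable N g'"
    for f g :: "nat \<Rightarrow> 'c \<Rightarrow> real" and f' g' N
  proof (rule tendsto_sandwich[OF _ _ tendsto_const])
    have le: "(\<integral>x. ((f n x - g n x) - (f' x - g' x))\<^sup>2 \<partial>N) \<le> 2 * (\<integral>x. (f n x - f' x)\<^sup>2 \<partial>N) + 2 * (\<integral>x. (g n x - g' x)\<^sup>2 \<partial>N)" for n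
    proof -
      have "(\<integral>x. ((f n x - g n x) - (f' x - g' x))\<^sup>2 \<partial>N) = (\<integral>x. ((f n x - f' x) + (g' x - g n x))\<^sup>2 \<partial>N)"
        by (simp add: algebra_simps)
      also have "\<dots> \<le> 2 * (\<integral>x. (f n x - f' x)\<^sup>2 \<partial>N) + 2 * (\<integral>x. (g' x - g n x)\<^sup>2 \<partial>N)"
        by (intro integral_square_sum_le square_integrable_diff that)
      finally show ?thesis by (simp add: power2_commute[of "g' _"])
    qed
    show "\<forall>\<^sub>F n in sequentially. (\<integral>x. ((f n x - g n x) - (f' x - g' x))\<^sup>2 \<partial>N) \<le> 2 * (\<integral>x. (f n x - f' x)\<^sup>2 \<partial>N) + 2 * (\<integral>x. (g n x - g' x)\<^sup>2 \<partial>N)"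
      using le by (intro always_eventually) blast
    have "(\<lambda>n. 2 * (\<integral>x. (f n x - f' x)\<^sup>2 \<partial>N) + 2 * (\<integral>x. (g n x - g' x)\<^sup>2 \<partial>N)) \<longlonglongrightarrow> 2 * 0 + 2 * 0"
      by (intro tendsto_intros that)
    then show "(\<lambda>n. 2 * (\<integral>x. (f n x - f' x)\<^sup>2 \<partial>N) + 2 * (\<integral>x. (g n x - g' x)\<^sup>2 \<partial>N)) \<longlonglongrightarrow> 0" by simp
  qed simp
  note sJ = ito_L2_approximation(1)[OF t sq] ito_L2_approximation(1)[OF st(1) sq']
  have A: "a \<longlonglongrightarrow> (\<integral>\<omega>. (J t \<omega> - J s \<omega>)\<^sup>2 \<partial>M)"
    unfolding a_def
  proof (rule L2_tendsto_integral_square)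
    show "(\<lambda>n. \<integral>\<omega>. (simple_integral W (k n) (\<tau> n) (\<xi> n) t \<omega> - simple_integral W (k' n) (T n) (\<eta> n) t \<omega> - (J t \<omega> - J s \<omega>))\<^sup>2 \<partial>M) \<longlonglongrightarrow> 0"
      by (rule sqd[OF lim2 lim2'[folded int] simple_integral_L2(1)[OF sp t] simple_integral_L2(1)[OF sp' t] sJ])
  qed (intro square_integrable_diff simple_integral_L2(1)[OF _ t] sp sp' sJ)+
  have "a = (\<lambda>n. \<integral>z. (?G n z - ?G' n z)\<^sup>2 \<partial>path_prob t)"
    unfolding a_def using simple_integral_diff_L2[OF sp sp' t] by blast
  moreover have "(\<lambda>n. \<integral>z. (?G n z - ?G' n z)\<^sup>2 \<partial>path_prob t) \<longlonglongrightarrow> (\<integral>z. (?H z - ?r ?H z)\<^sup>2 \<partial>path_prob t)"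
  proof (rule L2_tendsto_integral_square)
    show "(\<lambda>n. \<integral>z. (?G n z - ?G' n z - (?H z - ?r ?H z))\<^sup>2 \<partial>path_prob t) \<longlonglongrightarrow> 0"
      by (rule sqd[OF lim1 lim1r simple_value_square_integrable[OF sp] simple_value_square_integrable[OF sp'] sq sqr])
  qed (intro square_integrable_diff simple_value_square_integrable sp sp' sq sqr)+
  ultimately have "(\<integral>\<omega>. (J t \<omega> - J s \<omega>)\<^sup>2 \<partial>M) = (\<integral>z. (?H z - ?r ?H z)\<^sup>2 \<partial>path_prob t)"
    using A LIMSEQ_unique by blast
  also have "\<dots> = (\<integral>z. (?H z)\<^sup>2 - ?r (\<lambda>z. (?H z)\<^sup>2) z \<partial>path_prob t)"
    by (intro Bochner_Integration.integral_cong refl) simp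
  also have "\<dots> = (\<integral>z. (?H z)\<^sup>2 \<partial>path_prob t) - (\<integral>z. ?r (\<lambda>z. (?H z)\<^sup>2) z \<partial>path_prob t)"
    using sq sqr unfolding square_integrable_def rsq by (intro Bochner_Integration.integral_diff) auto
  finally show ?thesis unfolding Heq .
qed

text \<open>Polarisation: the isometry evaluates the mean square of \<open>J t - J s\<close> as the
  difference of the two mean squares, which determines the mixed moment. It is the form in which the
  martingale property of \<open>J\<close> enters below.\<close>

lemma ito_covariance:
  assumes st: "0 \<le> s" "s \<le> t" and sqs: "\<And>t. 0 \<le> t \<Longrightarrow> square_integrable (path_prob t) (\<lambda>z. h (Y (fst z) (snd z)))"
  shows "(\<integral>\<omega>. J s \<omega> * J t \<omega> \<partial>M) = (\<integral>\<omega>. (J s \<omega>)\<^sup>2 \<partial>M)"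
proof -
  have t: "0 \<le> t" using st by simp
  note sJ = ito_L2_approximation(1)[OF t sqs[OF t]] ito_L2_approximation(1)[OF st(1) sqs[OF st(1)]]
  have "(\<integral>\<omega>. (J t \<omega> - J s \<omega>)\<^sup>2 \<partial>M) = (\<integral>\<omega>. (J t \<omega>)\<^sup>2 \<partial>M) - (\<integral>\<omega>. (J s \<omega>)\<^sup>2 \<partial>M)"
    using ito_increment_isometry[OF assms] ito_isometry[OF t sqs[OF t]] ito_isometry[OF st(1) sqs[OF st(1)]] by simp
  moreover have "(\<integral>\<omega>. (J t \<omega> - J s \<omega>)\<^sup>2 \<partial>M) = (\<integral>\<omega>. (J t \<omega>)\<^sup>2 \<partial>M) - 2 * (\<integral>\<omega>. J t \<omega> * J s \<omega> \<partial>M) + (\<integral>\<omega>. (J s \<omega>)\<^sup>2 \<partial>M)"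
    using integral_square_lincomb[OF sJ, of 1 "-1"] by simp
  ultimately show ?thesis by (simp add: mult.commute)
qed

end

section \<open>Moments of a diffusion with linear drift\<close>

text \<open>\<open>Y\<close> is the centred diffusion and \<open>J\<close> its martingale part.
  Formally the second moment solves \<open>v' = A + D * v - 2 * \<theta> * v\<close>, where
  \<open>B\<close> drops out because the mean is 0; \<open>balance\<close> says that the initial
  value is a rest point of this equation.\<close>

locale linear_drift_path = ito_path M F W Y h J
  for M :: "'a measure" and F W Y h J +
  fixes \<theta> A B D :: real
  assumes \<theta>: "0 < \<theta>"
    and sde: "\<And>t. 0 \<le> t \<Longrightarrow> AE \<omega> in M. Y t \<omega> = Y 0 \<omega> + (LINT r:{0..t}|lborel. - \<theta> * Y r \<omega>) + J t \<omega>"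
    and variance_coef: "\<And>t \<omega>. 0 \<le> t \<Longrightarrow> \<omega> \<in> space M \<Longrightarrow> (h (Y t \<omega>))\<^sup>2 = A + B * Y t \<omega> + D * (Y t \<omega>)\<^sup>2"
    and start: "integrable M (\<lambda>\<omega>. (Y 0 \<omega>)\<^sup>2)" "(\<integral>\<omega>. Y 0 \<omega> \<partial>M) = 0"
    and balance: "A + D * (\<integral>\<omega>. (Y 0 \<omega>)\<^sup>2 \<partial>M) = 2 * \<theta> * (\<integral>\<omega>. (Y 0 \<omega>)\<^sup>2 \<partial>M)"
begin

definition area :: "real \<Rightarrow> 'a \<Rightarrow> real" where
  "area t \<omega> = (\<integral>r. Y r \<omega> \<partial>path_time t)"

definition v0 :: real where "v0 = (\<integral>\<omega>. (Y 0 \<omega>)\<^sup>2 \<partial>M)"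

lemma Y_pair: "(\<lambda>z. Y (fst z) (snd z)) \<in> borel_measurable (path_prob t)"
  using Y_measurable_pair[OF continuous_on_id] by (simp add: split_beta')

lemma area_measurable: "area t \<in> borel_measurable M"
  unfolding area_def[abs_def] by (rule path_integral_measurable[OF Y_pair])

lemma Y_eq:
  assumes "0 \<le> t"
  shows "AE \<omega> in M. Y t \<omega> = Y 0 \<omega> - \<theta> * area t \<omega> + J t \<omega>"
  using sde[OF assms] AE_space
proof eventually_elim
  case (elim \<omega>)
  have "(LINT r:{0..t}|lborel. - \<theta> * Y r \<omega>) = (\<integral>r. - \<theta> * Y r \<omega> \<partial>path_time t)"
    by (rule set_integral_path_time, rule path_set_measurable[OF _ elim(2)]) (intro continuous_intros)
  then show ?case using elim by (simp add: area_def)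
qed

lemma Y0_sq: "square_integrable M (Y 0)"
  using start(1) Y_measurable[of 0] by (simp add: square_integrable_def)

lemma stopped_id: "\<omega> \<in> space M \<Longrightarrow> stopped (\<lambda>x. x) K r \<omega> = indicator (bounded_until K r) \<omega> * Y r \<omega>"
  by (auto simp: stopped_def bounded_until_def)

lemma area_square_le:
  assumes \<omega>: "\<omega> \<in> space M" and t: "0 \<le> t"
  shows "(area t \<omega>)\<^sup>2 \<le> t * (\<integral>r. (Y r \<omega>)\<^sup>2 \<partial>path_time t)"
proof -
  have Y: "square_integrable (path_time t) (\<lambda>r. Y r \<omega>)"
  proof -
    have "continuous_on UNIV (\<lambda>x::real. x\<^sup>2)" by (intro continuous_intros)
    from path_integrable[OF continuous_on_id \<omega>, of t] path_integrable[OF this \<omega>, of t]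
    show ?thesis by (simp add: square_integrable_def)
  qed
  interpret T: finite_measure "path_time t" by simp
  have 1: "square_integrable (path_time t) (\<lambda>_. 1)" by (simp add: square_integrable_def)
  have "measure (path_time t) {0<..t} = t"
    using t unfolding path_time_def by (simp add: measure_restrict_space)
  then show ?thesis using Cauchy_Schwarz_integral[OF 1 Y] by (simp add: area_def)
qed

definition stopped_moment :: "real \<Rightarrow> real \<Rightarrow> real" where
  "stopped_moment K t = (\<integral>\<omega>. (stopped (\<lambda>x. x) K t \<omega>)\<^sup>2 \<partial>M)"

lemma stopped_abs_le: "\<bar>stopped (\<lambda>x. x) K t \<omega>\<bar> \<le> \<bar>K\<bar>" if "0 \<le> t"
  using that by (auto simp: stopped_def dest!: bspec[of _ _ t])

lemma stopped_sq_le: "0 \<le> t \<Longrightarrow> (stopped (\<lambda>x. x) K t \<omega>)\<^sup>2 \<le> K\<^sup>2"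
  using stopped_abs_le abs_le_square_iff by blast

lemma stopped_pair: "(\<lambda>z. stopped (\<lambda>x. x) K (fst z) (snd z)) \<in> borel_measurable (path_prob t)"
  using stopped_measurable_pair[OF continuous_on_id] by (simp add: split_beta')

lemma stopped_pair_sq_integrable: "integrable (path_prob t) (\<lambda>z. (stopped (\<lambda>x. x) K (fst z) (snd z))\<^sup>2)"
proof -
  interpret P: finite_measure "path_prob t" by (rule finite_measure_path_prob)
  show ?thesis
    by (rule P.integrable_const_bound[of _ "K\<^sup>2"])
      (auto intro!: AE_I2 stopped_sq_le borel_intros stopped_pair simp: space_pair_measure)
qed

lemma stopped_sq_integrable: "0 < t \<Longrightarrow> integrable M (\<lambda>\<omega>. (stopped (\<lambda>x. x) K t \<omega>)\<^sup>2)"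
  by (rule integrable_const_bound[of _ "K\<^sup>2"])
    (auto intro!: AE_I2 stopped_sq_le borel_intros stopped_measurable continuous_on_id)

text \<open>Only \<open>Y 0\<close> is known to be square integrable, hence the truncation; the bound is uniform in \<open>K\<close>.\<close>

lemma stopped_moment_gronwall:
  assumes T: "0 < t" "t \<le> T"
  shows "stopped_moment K t \<le> 2 * (3 * v0 + 3 * ((\<bar>A\<bar> + \<bar>B\<bar>) * T)) * exp (2 * (3 * \<theta>\<^sup>2 * T + 3 * (\<bar>B\<bar> + \<bar>D\<bar>) + 1) * t)"
proof (rule gronwall_bounded[where T=T and C="K\<^sup>2" and u="stopped_moment K"])
  let ?X = "stopped (\<lambda>x. x) K"
  show "0 \<le> stopped_moment K t \<and> stopped_moment K t \<le> K\<^sup>2" if "0 < t" for t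
  proof
    show "0 \<le> stopped_moment K t" by (simp add: stopped_moment_def)
    have "stopped_moment K t \<le> (\<integral>\<omega>. K\<^sup>2 \<partial>M)"
      unfolding stopped_moment_def
      by (rule integral_mono) (use that stopped_sq_integrable stopped_sq_le in auto)
    then show "stopped_moment K t \<le> K\<^sup>2" by (simp add: prob_space)
  qed
  have v0: "0 \<le> v0" by (simp add: v0_def)
  show "0 \<le> 3 * v0 + 3 * ((\<bar>A\<bar> + \<bar>B\<bar>) * T)" using v0 T by simp
  show "0 < 3 * \<theta>\<^sup>2 * T + 3 * (\<bar>B\<bar> + \<bar>D\<bar>) + 1" using T by (intro add_nonneg_pos) auto
  show "0 < t" "t \<le> T" by fact+
  fix t assume t: "0 < t" "t \<le> T"
  then have t0: "0 \<le> t" by simp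
  let ?B = "bounded_until K t"
  note [measurable] = bounded_until_events[OF t(1), of K]
  define I where "I = (\<integral>s. stopped_moment K s \<partial>path_time t)"
  have I: "(\<integral>z. (?X (fst z) (snd z))\<^sup>2 \<partial>path_prob t) = I"
    unfolding I_def stopped_moment_def by (rule path_prob_Fubini(4)[OF stopped_pair_sq_integrable, symmetric])
  have I0: "0 \<le> I" unfolding I_def by (intro integral_nonneg_AE) (simp add: stopped_moment_def)
  \<comment> \<open>On \<open>?B\<close> the equation splits the truncated \<open>Y t\<close> into
    \<open>X1 - X2 + X3\<close>, and off \<open>?B\<close> all terms vanish. The three mean squares
    are bounded by \<open>v0\<close> and by the time integral of the truncated moment.\<close>
  define X1 where "X1 \<omega> = indicator ?B \<omega> * Y 0 \<omega>" for \<omega>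
  define X2 where "X2 \<omega> = \<theta> * (indicator ?B \<omega> * area t \<omega>)" for \<omega>
  define X3 where "X3 \<omega> = indicator ?B \<omega> * J t \<omega>" for \<omega>
  have [measurable]: "Y 0 \<in> borel_measurable M" "area t \<in> borel_measurable M" "J t \<in> borel_measurable M"
    using Y_measurable[of 0] area_measurable J_measurable[OF t0] by auto
  have i1: "integrable M (\<lambda>\<omega>. (X1 \<omega>)\<^sup>2)"
    unfolding X1_def by (rule Bochner_Integration.integrable_bound[OF start(1)]) (auto simp: indicator_def)
  have e1: "(\<integral>\<omega>. (X1 \<omega>)\<^sup>2 \<partial>M) \<le> v0"
    unfolding v0_def by (rule integral_mono[OF i1 start(1)]) (auto simp: X1_def indicator_def)
  have F: "integrable M (\<lambda>\<omega>. \<integral>r. (?X r \<omega>)\<^sup>2 \<partial>path_time t)" "(\<integral>\<omega>. (\<integral>r. (?X r \<omega>)\<^sup>2 \<partial>path_time t) \<partial>M) = I"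
    using path_prob_Fubini(1,2)[OF stopped_pair_sq_integrable] I by auto
  have le2: "(X2 \<omega>)\<^sup>2 \<le> \<theta>\<^sup>2 * T * (\<integral>r. (?X r \<omega>)\<^sup>2 \<partial>path_time t)" if \<omega>: "\<omega> \<in> space M" for \<omega>
  proof (cases "\<omega> \<in> ?B")
    case True
    then have "?X r \<omega> = Y r \<omega>" if "r \<in> {0<..t}" for r
      using that by (auto simp: stopped_def bounded_until_def)
    then have eq: "(\<integral>r. (?X r \<omega>)\<^sup>2 \<partial>path_time t) = (\<integral>r. (Y r \<omega>)\<^sup>2 \<partial>path_time t)"
      by (intro Bochner_Integration.integral_cong) auto
    have "(area t \<omega>)\<^sup>2 \<le> t * (\<integral>r. (Y r \<omega>)\<^sup>2 \<partial>path_time t)" by (rule area_square_le[OF \<omega> t0])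
    also have "\<dots> \<le> T * (\<integral>r. (Y r \<omega>)\<^sup>2 \<partial>path_time t)" using t by (intro mult_right_mono) auto
    finally have "\<theta>\<^sup>2 * (area t \<omega>)\<^sup>2 \<le> \<theta>\<^sup>2 * (T * (\<integral>r. (Y r \<omega>)\<^sup>2 \<partial>path_time t))" by (intro mult_left_mono) auto
    then show ?thesis using True by (simp add: X2_def power_mult_distrib eq mult.assoc)
  next
    case False
    then show ?thesis using t by (simp add: X2_def)
  qed
  have i2: "integrable M (\<lambda>\<omega>. (X2 \<omega>)\<^sup>2)"
  proof (rule Bochner_Integration.integrable_bound)
    show "integrable M (\<lambda>\<omega>. \<theta>\<^sup>2 * T * (\<integral>r. (?X r \<omega>)\<^sup>2 \<partial>path_time t))" using F(1) by simp
    show "AE \<omega> in M. norm ((X2 \<omega>)\<^sup>2) \<le> norm (\<theta>\<^sup>2 * T * (\<integral>r. (?X r \<omega>)\<^sup>2 \<partial>path_time t))"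
      using le2 by (intro AE_I2) (auto intro: order_trans[OF _ abs_ge_self])
  qed (simp add: X2_def)
  have e2: "(\<integral>\<omega>. (X2 \<omega>)\<^sup>2 \<partial>M) \<le> \<theta>\<^sup>2 * T * I"
  proof -
    have "(\<integral>\<omega>. (X2 \<omega>)\<^sup>2 \<partial>M) \<le> (\<integral>\<omega>. \<theta>\<^sup>2 * T * (\<integral>r. (?X r \<omega>)\<^sup>2 \<partial>path_time t) \<partial>M)"
      by (rule integral_mono[OF i2]) (use F le2 in auto)
    then show ?thesis using F by simp
  qed
  have i3: "integrable M (\<lambda>\<omega>. (X3 \<omega>)\<^sup>2)" using ito_integral_stopped_le(1)[OF t(1), of K] by (simp add: X3_def)
  have e3: "(\<integral>\<omega>. (X3 \<omega>)\<^sup>2 \<partial>M) \<le> (\<bar>A\<bar> + \<bar>B\<bar>) * T + (\<bar>B\<bar> + \<bar>D\<bar>) * I"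
  proof -
    interpret P: finite_measure "path_prob t" by (rule finite_measure_path_prob)
    have mP: "measure (path_prob t) (space (path_prob t)) = t"
    proof -
      have "emeasure (path_prob t) (space (path_prob t)) = emeasure (path_time t) {0<..t} * emeasure M (space M)"
        unfolding space_pair_measure by (subst emeasure_pair_measure_Times) (auto simp: space_path_time[symmetric] simp del: space_path_time)
      also have "\<dots> = ennreal t" using t0 unfolding path_time_def by (simp add: emeasure_restrict_space emeasure_space_1)
      finally show ?thesis using t0 by (simp add: measure_def)
    qed
    \<comment> \<open>The linear term is absorbed by
      \<open>\<bar>y\<bar> \<le> 1 + y\<^sup>2\<close>, which puts \<open>\<bar>B\<bar>\<close> into
      both coefficients.\<close>
    have le: "(stopped h K r \<omega>)\<^sup>2 \<le> (\<bar>A\<bar> + \<bar>B\<bar>) + (\<bar>B\<bar> + \<bar>D\<bar>) * (?X r \<omega>)\<^sup>2" if "\<omega> \<in> space M" "0 \<le> r" for r \<omega>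
    proof (cases "\<forall>u\<in>{0..r}. \<bar>Y u \<omega>\<bar> \<le> K")
      case True
      let ?y = "Y r \<omega>"
      have "2 * \<bar>?y\<bar> \<le> 1 + ?y\<^sup>2" using sum_squares_bound[of 1 "\<bar>?y\<bar>"] by simp
      then have "\<bar>?y\<bar> \<le> 1 + ?y\<^sup>2" by simp
      then have "\<bar>B\<bar> * \<bar>?y\<bar> \<le> \<bar>B\<bar> * (1 + ?y\<^sup>2)" by (intro mult_left_mono) auto
      moreover have "B * ?y \<le> \<bar>B\<bar> * \<bar>?y\<bar>" using abs_ge_self[of "B * ?y"] by (simp add: abs_mult)
      moreover have "D * ?y\<^sup>2 \<le> \<bar>D\<bar> * ?y\<^sup>2" by (intro mult_right_mono) auto
      moreover have "(stopped h K r \<omega>)\<^sup>2 = A + B * ?y + D * ?y\<^sup>2" using True variance_coef[OF that(2,1)] by (simp add: stopped_def)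
      moreover have "(?X r \<omega>)\<^sup>2 = ?y\<^sup>2" using True by (simp add: stopped_def)
      ultimately show ?thesis using abs_ge_self[of A] by (simp only: distrib_left distrib_right mult_1_right)
    next
      case False
      then have "stopped h K r \<omega> = 0" by (auto simp: stopped_def)
      then show ?thesis by simp
    qed
    have "(\<integral>\<omega>. (X3 \<omega>)\<^sup>2 \<partial>M) \<le> (\<integral>z. (stopped h K (fst z) (snd z))\<^sup>2 \<partial>path_prob t)"
      using ito_integral_stopped_le(2)[OF t(1), of K] by (simp add: X3_def)
    also have "\<dots> \<le> (\<integral>z. (\<bar>A\<bar> + \<bar>B\<bar>) + (\<bar>B\<bar> + \<bar>D\<bar>) * (?X (fst z) (snd z))\<^sup>2 \<partial>path_prob t)"
      using grid_value_L2_tendsto(2)[OF t0, of K] stopped_pair_sq_integrable le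
      by (intro integral_mono) (auto simp: square_integrable_def space_pair_measure)
    also have "\<dots> = (\<bar>A\<bar> + \<bar>B\<bar>) * t + (\<bar>B\<bar> + \<bar>D\<bar>) * I"
      using stopped_pair_sq_integrable I mP by (simp add: mult.commute)
    also have "\<dots> \<le> (\<bar>A\<bar> + \<bar>B\<bar>) * T + (\<bar>B\<bar> + \<bar>D\<bar>) * I" using t by (intro add_right_mono mult_left_mono) auto
    finally show ?thesis .
  qed
  have "stopped_moment K t \<le> (\<integral>\<omega>. 3 * (X1 \<omega>)\<^sup>2 + 3 * (X2 \<omega>)\<^sup>2 + 3 * (X3 \<omega>)\<^sup>2 \<partial>M)"
    unfolding stopped_moment_def
  proof (rule integral_mono_AE)
    show "AE \<omega> in M. (?X t \<omega>)\<^sup>2 \<le> 3 * (X1 \<omega>)\<^sup>2 + 3 * (X2 \<omega>)\<^sup>2 + 3 * (X3 \<omega>)\<^sup>2"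
      using Y_eq[OF t0] AE_space
    proof eventually_elim
      case (elim \<omega>)
      have "?X t \<omega> = X1 \<omega> - X2 \<omega> + X3 \<omega>"
        using elim by (cases "\<omega> \<in> ?B") (simp_all add: stopped_id X1_def X2_def X3_def)
      moreover have "(a - b + c)\<^sup>2 \<le> 3 * a\<^sup>2 + 3 * b\<^sup>2 + 3 * c\<^sup>2" for a b c :: real
      proof -
        have "3 * a\<^sup>2 + 3 * b\<^sup>2 + 3 * c\<^sup>2 = (a - b + c)\<^sup>2 + (a + b)\<^sup>2 + (b + c)\<^sup>2 + (a - c)\<^sup>2"
          by (simp add: power2_eq_square algebra_simps)
        then show ?thesis using zero_le_power2[of "a + b"] zero_le_power2[of "b + c"] zero_le_power2[of "a - c"] by linarith
      qed
      ultimately show ?case by simp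
    qed
  qed (use stopped_sq_integrable t i1 i2 i3 in auto)
  also have "\<dots> = 3 * (\<integral>\<omega>. (X1 \<omega>)\<^sup>2 \<partial>M) + 3 * (\<integral>\<omega>. (X2 \<omega>)\<^sup>2 \<partial>M) + 3 * (\<integral>\<omega>. (X3 \<omega>)\<^sup>2 \<partial>M)"
    using i1 i2 i3 by simp
  also have "\<dots> \<le> 3 * v0 + 3 * (\<theta>\<^sup>2 * T * I) + 3 * ((\<bar>A\<bar> + \<bar>B\<bar>) * T + (\<bar>B\<bar> + \<bar>D\<bar>) * I)"
    by (intro add_mono mult_left_mono e1 e2 e3) auto
  also have "\<dots> \<le> 3 * v0 + 3 * ((\<bar>A\<bar> + \<bar>B\<bar>) * T) + (3 * \<theta>\<^sup>2 * T + 3 * (\<bar>B\<bar> + \<bar>D\<bar>) + 1) * I"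
    using I0 by (simp add: algebra_simps)
  finally show "stopped_moment K t \<le> 3 * v0 + 3 * ((\<bar>A\<bar> + \<bar>B\<bar>) * T) + (3 * \<theta>\<^sup>2 * T + 3 * (\<bar>B\<bar> + \<bar>D\<bar>) + 1) *
    (\<integral>s. stopped_moment K s \<partial>restrict_space lborel {0<..t})"
    by (simp add: I_def path_time_def)
qed

lemma second_moment_bound:
  "\<exists>C\<ge>0. \<forall>t. 0 \<le> t \<and> t \<le> T \<longrightarrow> square_integrable M (Y t) \<and> (\<integral>\<omega>. (Y t \<omega>)\<^sup>2 \<partial>M) \<le> C"
proof -
  define C where "C = \<bar>2 * (3 * v0 + 3 * ((\<bar>A\<bar> + \<bar>B\<bar>) * T))\<bar> * exp (2 * (3 * \<theta>\<^sup>2 * T + 3 * (\<bar>B\<bar> + \<bar>D\<bar>) + 1) * T)"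
  have v0: "0 \<le> v0" by (simp add: v0_def)
  have C0: "0 \<le> C" by (simp add: C_def)
  have main: "square_integrable M (Y t) \<and> (\<integral>\<omega>. (Y t \<omega>)\<^sup>2 \<partial>M) \<le> C" if t: "0 < t" "t \<le> T" for t
  proof -
    have b: "stopped_moment (real N) t \<le> C" for N
    proof -
      have c: "0 \<le> 2 * (3 * \<theta>\<^sup>2 * T + 3 * (\<bar>B\<bar> + \<bar>D\<bar>) + 1)" using t by simp
      note stopped_moment_gronwall[OF t, of "real N"]
      also have "2 * (3 * v0 + 3 * ((\<bar>A\<bar> + \<bar>B\<bar>) * T)) * exp (2 * (3 * \<theta>\<^sup>2 * T + 3 * (\<bar>B\<bar> + \<bar>D\<bar>) + 1) * t) \<le> C"
        unfolding C_def using t c v0 by (intro mult_mono) (auto intro: mult_left_mono)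
      finally show ?thesis .
    qed
    have lim: "(\<lambda>N. stopped (\<lambda>x. x) (real N) t \<omega>) \<longlonglongrightarrow> Y t \<omega>" if "\<omega> \<in> space M" for \<omega>
      using stopped_tendsto[OF that, of "\<lambda>x. x" t] by (rule tendsto_eventually)
    show ?thesis
      using converges_everywhere_Fatou[of "\<lambda>N. stopped (\<lambda>x. x) (real N) t" "Y t" C] t lim b
        stopped_measurable[OF continuous_on_id t(1)] Y_measurable[of t] stopped_sq_integrable[OF t(1)]
      by (auto simp: stopped_moment_def)
  qed
  show ?thesis
  \<comment> \<open>\<open>C\<close> bounds the moments at positive times; adding \<open>v0\<close>
    covers time 0.\<close>
  proof (intro exI[of _ "C + v0"] conjI allI impI)
    show "0 \<le> C + v0" using C0 v0 by simp
    fix t assume "0 \<le> t \<and> t \<le> T"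
    then show "square_integrable M (Y t)" "(\<integral>\<omega>. (Y t \<omega>)\<^sup>2 \<partial>M) \<le> C + v0"
      using main[of t] Y0_sq C0 v0 by (cases "t = 0"; auto simp: v0_def intro: add_increasing2)+
  qed
qed

lemma Y_sq: "0 \<le> t \<Longrightarrow> square_integrable M (Y t)"
  using second_moment_bound[of t] by auto

lemma Y_path_sq: "square_integrable (path_prob t) (\<lambda>z. Y (fst z) (snd z))"
proof -
  interpret P: pair_sigma_finite "path_time t" M by (rule pair_path_prob)
  interpret T: finite_measure "path_time t" by simp
  note [measurable] = Y_pair[of t]
  obtain C where C: "C \<ge> 0" "\<And>r. 0 \<le> r \<Longrightarrow> r \<le> t \<Longrightarrow> (\<integral>\<omega>. (Y r \<omega>)\<^sup>2 \<partial>M) \<le> C" using second_moment_bound[of t] by blast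
  have m: "(\<lambda>z. (Y (fst z) (snd z))\<^sup>2) \<in> borel_measurable (path_prob t)" by (intro borel_intros Y_pair)
  have "integrable (path_prob t) (\<lambda>z. (Y (fst z) (snd z))\<^sup>2)"
  proof (rule P.Fubini_integrable[OF m])
    show "AE r in path_time t. integrable M (\<lambda>\<omega>. (Y (fst (r, \<omega>)) (snd (r, \<omega>)))\<^sup>2)"
      using Y_sq by (intro AE_I2) (auto simp: square_integrable_def)
    have m2: "(\<lambda>r. \<integral>\<omega>. (Y r \<omega>)\<^sup>2 \<partial>M) \<in> borel_measurable (path_time t)"
      by (rule borel_measurable_lebesgue_integral) (use m in \<open>simp add: split_beta'\<close>)
    have "integrable (path_time t) (\<lambda>r. \<integral>\<omega>. (Y r \<omega>)\<^sup>2 \<partial>M)"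
      by (rule T.integrable_const_bound[of _ C, OF _ m2]) (use C in \<open>auto intro!: AE_I2\<close>)
    then show "integrable (path_time t) (\<lambda>r. \<integral>\<omega>. norm ((Y (fst (r, \<omega>)) (snd (r, \<omega>)))\<^sup>2) \<partial>M)" by simp
  qed
  then show ?thesis by (simp add: square_integrable_def Y_pair)
qed

text \<open>This is the hypothesis \<open>sq\<close> of the L2 results on \<open>J\<close>; from
  here on they are available without truncation.\<close>

lemma hY_path_sq: "square_integrable (path_prob t) (\<lambda>z. h (Y (fst z) (snd z)))"
proof -
  interpret P: finite_measure "path_prob t" by (rule finite_measure_path_prob)
  have 1: "square_integrable (path_prob t) (\<lambda>_. 1)" by (simp add: square_integrable_def)
  have "integrable (path_prob t) (\<lambda>z. A + B * Y (fst z) (snd z) + D * (Y (fst z) (snd z))\<^sup>2)"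
    using Y_path_sq[of t] square_integrable_mult[OF 1 Y_path_sq[of t]] by (simp add: square_integrable_def)
  then have "integrable (path_prob t) (\<lambda>z. (h (Y (fst z) (snd z)))\<^sup>2)"
    by (rule Bochner_Integration.integrable_cong[OF refl, THEN iffD1, rotated])
      (auto simp: space_pair_measure variance_coef)
  then show ?thesis by (simp add: square_integrable_def hY_measurable)
qed

lemmas J_sq = ito_L2_approximation(1)[OF _ hY_path_sq]

lemma area_sq: assumes "0 \<le> t" shows "square_integrable M (area t)"
proof -
  have i: "integrable M (\<lambda>\<omega>. \<integral>r. (Y r \<omega>)\<^sup>2 \<partial>path_time t)"
    using path_prob_Fubini(1)[of t "\<lambda>r \<omega>. (Y r \<omega>)\<^sup>2"] Y_path_sq[of t] by (simp add: square_integrable_def)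
  have "integrable M (\<lambda>\<omega>. (area t \<omega>)\<^sup>2)"
  proof (rule Bochner_Integration.integrable_bound)
    show "integrable M (\<lambda>\<omega>. t * (\<integral>r. (Y r \<omega>)\<^sup>2 \<partial>path_time t))" using i by simp
    show "AE \<omega> in M. norm ((area t \<omega>)\<^sup>2) \<le> norm (t * (\<integral>r. (Y r \<omega>)\<^sup>2 \<partial>path_time t))"
      using area_square_le[OF _ assms] by (intro AE_I2) (auto intro: order_trans[OF _ abs_ge_self])
  qed (intro borel_intros area_measurable)
  then show ?thesis by (simp add: square_integrable_def area_measurable)
qed

text \<open>Testing the equation against a fixed \<open>Z\<close> and exchanging expectation and
  time integral gives a linear Volterra equation for \<open>t \<mapsto> E (Z * Y t)\<close>, with
  forcing term \<open>E (Z * J t)\<close>. It is used with \<open>Z\<close> equal to 1, to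
  \<open>Y 0\<close>, to an increment of \<open>J\<close>, and to \<open>Y 0 + J t\<close>.\<close>

lemma expectation_mult_Y:
  assumes Z: "square_integrable M Z" and t: "0 \<le> t"
  shows "integrable (path_time t) (\<lambda>r. \<integral>\<omega>. Z \<omega> * Y r \<omega> \<partial>M)"
    "(\<integral>\<omega>. Z \<omega> * area t \<omega> \<partial>M) = (\<integral>r. (\<integral>\<omega>. Z \<omega> * Y r \<omega> \<partial>M) \<partial>path_time t)"
    "(\<integral>\<omega>. Z \<omega> * Y t \<omega> \<partial>M) = (\<integral>\<omega>. Z \<omega> * Y 0 \<omega> \<partial>M) - \<theta> * (\<integral>r. (\<integral>\<omega>. Z \<omega> * Y r \<omega> \<partial>M) \<partial>path_time t)
      + (\<integral>\<omega>. Z \<omega> * J t \<omega> \<partial>M)"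
proof -
  have i: "integrable (path_prob t) (\<lambda>z. Z (snd z) * Y (fst z) (snd z))"
    by (rule square_integrable_mult[OF square_integrable_snd[OF Z] Y_path_sq])
  note F = path_prob_Fubini[of t "\<lambda>r \<omega>. Z \<omega> * Y r \<omega>", OF i]
  show "integrable (path_time t) (\<lambda>r. \<integral>\<omega>. Z \<omega> * Y r \<omega> \<partial>M)" by (rule F(3))
  have "(\<integral>\<omega>. Z \<omega> * area t \<omega> \<partial>M) = (\<integral>\<omega>. (\<integral>r. Z \<omega> * Y r \<omega> \<partial>path_time t) \<partial>M)"
    by (simp add: area_def)
  then show 1: "(\<integral>\<omega>. Z \<omega> * area t \<omega> \<partial>M) = (\<integral>r. (\<integral>\<omega>. Z \<omega> * Y r \<omega> \<partial>M) \<partial>path_time t)"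
    using F(2,4) by simp
  have m: "Z \<in> borel_measurable M" using Z by (simp add: square_integrable_def)
  have "(\<integral>\<omega>. Z \<omega> * Y t \<omega> \<partial>M) = (\<integral>\<omega>. Z \<omega> * Y 0 \<omega> - \<theta> * (Z \<omega> * area t \<omega>) + Z \<omega> * J t \<omega> \<partial>M)"
  proof (rule integral_cong_AE)
    show "AE \<omega> in M. Z \<omega> * Y t \<omega> = Z \<omega> * Y 0 \<omega> - \<theta> * (Z \<omega> * area t \<omega>) + Z \<omega> * J t \<omega>"
      using Y_eq[OF t]
    proof eventually_elim
      case (elim \<omega>)
      show ?case unfolding elim by (simp add: algebra_simps)
    qed
  qed (intro borel_measurable_add borel_measurable_diff borel_measurable_times borel_measurable_const m
        Y_measurable area_measurable J_measurable t order_refl)+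
  also have "\<dots> = (\<integral>\<omega>. Z \<omega> * Y 0 \<omega> \<partial>M) - \<theta> * (\<integral>\<omega>. Z \<omega> * area t \<omega> \<partial>M) + (\<integral>\<omega>. Z \<omega> * J t \<omega> \<partial>M)"
    using square_integrable_mult[OF Z Y0_sq] square_integrable_mult[OF Z area_sq[OF t]] square_integrable_mult[OF Z J_sq[OF t]]
    by simp
  finally show "(\<integral>\<omega>. Z \<omega> * Y t \<omega> \<partial>M) = (\<integral>\<omega>. Z \<omega> * Y 0 \<omega> \<partial>M) - \<theta> * (\<integral>r. (\<integral>\<omega>. Z \<omega> * Y r \<omega> \<partial>M) \<partial>path_time t)
      + (\<integral>\<omega>. Z \<omega> * J t \<omega> \<partial>M)" unfolding 1 .
qed

section \<open>Solving the Volterra equations of the moments\<close>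

lemma path_time_zero_unique:
  fixes g :: "real \<Rightarrow> real"
  assumes bdd: "\<And>t. 0 < t \<Longrightarrow> t \<le> T \<Longrightarrow> \<bar>g t\<bar> \<le> C" and c: "0 < c"
    and eq: "\<And>t. 0 < t \<Longrightarrow> t \<le> T \<Longrightarrow> \<bar>g t\<bar> \<le> c * \<bar>\<integral>s. g s \<partial>path_time t\<bar>"
    and T: "0 < t" "t \<le> T"
  shows "g t = 0"
proof -
  have "\<bar>g t\<bar> \<le> 2 * 0 * exp (2 * c * t)"
  proof (rule gronwall_bounded[where T=T and C=C and u="\<lambda>t. \<bar>g t\<bar>"])
    fix t assume t: "0 < t" "t \<le> T"
    have "\<bar>g t\<bar> \<le> c * \<bar>\<integral>s. g s \<partial>path_time t\<bar>" by (rule eq[OF t])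
    also have "\<dots> \<le> c * (\<integral>s. \<bar>g s\<bar> \<partial>path_time t)" using c by (intro mult_left_mono integral_abs_bound) auto
    finally show "\<bar>g t\<bar> \<le> 0 + c * (\<integral>s. \<bar>g s\<bar> \<partial>restrict_space lborel {0<..t})" by (simp add: path_time_def)
  qed (use bdd c T in auto)
  then show ?thesis by simp
qed

lemma expectation_mult_Y_bound:
  assumes Z: "square_integrable M Z"
  shows "\<exists>C\<ge>0. \<forall>t. 0 \<le> t \<and> t \<le> T \<longrightarrow> \<bar>\<integral>\<omega>. Z \<omega> * Y t \<omega> \<partial>M\<bar> \<le> C"
proof -
  obtain C where C: "C \<ge> 0" "\<And>t. 0 \<le> t \<Longrightarrow> t \<le> T \<Longrightarrow> square_integrable M (Y t) \<and> (\<integral>\<omega>. (Y t \<omega>)\<^sup>2 \<partial>M) \<le> C"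
    using second_moment_bound[of T] by blast
  let ?z = "\<integral>\<omega>. (Z \<omega>)\<^sup>2 \<partial>M"
  show ?thesis
  proof (intro exI[of _ "sqrt (?z * C)"] conjI allI impI)
    show "0 \<le> sqrt (?z * C)" using C by simp
    fix t assume t: "0 \<le> t \<and> t \<le> T"
    have "(\<integral>\<omega>. Z \<omega> * Y t \<omega> \<partial>M)\<^sup>2 \<le> ?z * (\<integral>\<omega>. (Y t \<omega>)\<^sup>2 \<partial>M)"
      using C(2)[of t] t Z by (intro Cauchy_Schwarz_integral) auto
    also have "\<dots> \<le> ?z * C" using C(2)[of t] t by (intro mult_left_mono) auto
    finally show "\<bar>\<integral>\<omega>. Z \<omega> * Y t \<omega> \<partial>M\<bar> \<le> sqrt (?z * C)" by (intro real_le_rsqrt) simp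
  qed
qed

lemma expectation_mult_Y_eq_0:
  assumes Z: "square_integrable M Z" and z: "(\<integral>\<omega>. Z \<omega> * Y 0 \<omega> \<partial>M) = 0"
    and J: "\<And>t. 0 < t \<Longrightarrow> t \<le> T \<Longrightarrow> (\<integral>\<omega>. Z \<omega> * J t \<omega> \<partial>M) = 0" and t: "0 \<le> t" "t \<le> T"
  shows "(\<integral>\<omega>. Z \<omega> * Y t \<omega> \<partial>M) = 0"
proof (cases "t = 0")
  case False
  obtain C where C: "\<And>t. 0 \<le> t \<Longrightarrow> t \<le> T \<Longrightarrow> \<bar>\<integral>\<omega>. Z \<omega> * Y t \<omega> \<partial>M\<bar> \<le> C"
    using expectation_mult_Y_bound[OF Z, of T] by blast
  show ?thesis
  proof (rule path_time_zero_unique[where g="\<lambda>t. \<integral>\<omega>. Z \<omega> * Y t \<omega> \<partial>M" and T=T and C=C and c=\<theta>])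
    show "\<bar>\<integral>\<omega>. Z \<omega> * Y t \<omega> \<partial>M\<bar> \<le> \<theta> * \<bar>\<integral>r. (\<integral>\<omega>. Z \<omega> * Y r \<omega> \<partial>M) \<partial>path_time t\<bar>" if "0 < t" "t \<le> T" for t
      using expectation_mult_Y(3)[OF Z, of t] that z J[OF that] \<theta> by (simp add: abs_mult)
  qed (use C t False \<theta> in auto)
qed (use z in simp)

lemma const_sq: "square_integrable M (\<lambda>_. c)"
  by (simp add: square_integrable_def)

lemma expectation_J: "0 \<le> t \<Longrightarrow> (\<integral>\<omega>. J t \<omega> \<partial>M) = 0"
  using ito_orthogonal[OF _ hY_path_sq, of t "\<lambda>_. 1"] const_sq[of 1] by simp

lemma expectation_Y0_J: "0 \<le> t \<Longrightarrow> (\<integral>\<omega>. Y 0 \<omega> * J t \<omega> \<partial>M) = 0"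
  by (rule ito_orthogonal[OF _ hY_path_sq Y_measurable_F Y0_sq]) auto

lemma expectation_Y:
  assumes t: "0 \<le> t"
  shows "(\<integral>\<omega>. Y t \<omega> \<partial>M) = 0"
  using expectation_mult_Y_eq_0[OF const_sq[of 1], of t t] start(2) expectation_J t by simp

text \<open>As \<open>Y 0\<close> is orthogonal to \<open>J t\<close>, the moment satisfies an
  unforced equation, of which \<open>v0 * exp (- \<theta> * t)\<close> is a solution; uniqueness is
  applied to the difference \<open>g\<close>.\<close>

lemma expectation_Y_Y0:
  assumes t: "0 \<le> t"
  shows "(\<integral>\<omega>. Y 0 \<omega> * Y t \<omega> \<partial>M) = v0 * exp (- \<theta> * t)"
proof (cases "t = 0")
  case True
  then show ?thesis by (simp add: v0_def power2_eq_square)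
next
  case False
  define g where "g t = (\<integral>\<omega>. Y 0 \<omega> * Y t \<omega> \<partial>M) - v0 * exp (- \<theta> * t)" for t
  obtain C where C: "\<And>s. 0 \<le> s \<Longrightarrow> s \<le> t \<Longrightarrow> \<bar>\<integral>\<omega>. Y 0 \<omega> * Y s \<omega> \<partial>M\<bar> \<le> C"
    using expectation_mult_Y_bound[OF Y0_sq, of t] by blast
  have "g t = 0"
  proof (rule path_time_zero_unique[where g=g and T=t and C="C + \<bar>v0\<bar>" and c=\<theta>])
    fix s assume s: "0 < s" "s \<le> t"
    have "\<bar>v0 * exp (- \<theta> * s)\<bar> \<le> \<bar>v0\<bar> * 1" unfolding abs_mult using \<theta> s by (intro mult_left_mono) auto
    then show "\<bar>g s\<bar> \<le> C + \<bar>v0\<bar>" using C[of s] s unfolding g_def by linarith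
    have e: "integrable (path_time s) (\<lambda>r. v0 * exp (- \<theta> * r)) \<and> (\<integral>r. v0 * exp (- \<theta> * r) \<partial>path_time s) = v0 / \<theta> * (1 - exp (- \<theta> * s))"
    proof
      have c: "continuous_on {0..s} (\<lambda>r. v0 * exp (- \<theta> * r))" by (intro continuous_intros)
      have si: "set_integrable lborel {0..s} (\<lambda>r. v0 * exp (- \<theta> * r))" by (rule borel_integrable_atLeastAtMost'[OF c])
      then have "set_integrable lborel {0<..s} (\<lambda>r. v0 * exp (- \<theta> * r))" by (rule set_integrable_subset) auto
      then show "integrable (path_time s) (\<lambda>r. v0 * exp (- \<theta> * r))"
        unfolding path_time_def set_integrable_def by (subst integrable_restrict_space) auto
      have "(\<integral>r. v0 * exp (- \<theta> * r) \<partial>path_time s) = (LINT r:{0..s}|lborel. v0 * exp (- \<theta> * r))"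
        by (rule set_integral_path_time[symmetric]) (simp add: set_borel_measurable_def)
      also have "\<dots> = (- v0 / \<theta> * exp (- \<theta> * s)) - (- v0 / \<theta> * exp (- \<theta> * 0))"
        unfolding set_lebesgue_integral_def
        using s \<theta> c
        by (intro integral_FTC_atLeastAtMost[where F="\<lambda>r. - v0 / \<theta> * exp (- \<theta> * r)"])
          (auto intro!: derivative_eq_intros simp: has_real_derivative_iff_has_vector_derivative[symmetric])
      also have "\<dots> = v0 / \<theta> * (1 - exp (- \<theta> * s))" using \<theta> by (simp add: field_simps)
      finally show "(\<integral>r. v0 * exp (- \<theta> * r) \<partial>path_time s) = v0 / \<theta> * (1 - exp (- \<theta> * s))" .
    qed
    have s0: "0 \<le> s" using s by simp
    have eq: "(\<integral>r. g r \<partial>path_time s) = (\<integral>r. (\<integral>\<omega>. Y 0 \<omega> * Y r \<omega> \<partial>M) \<partial>path_time s) - v0 / \<theta> * (1 - exp (- \<theta> * s))"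
      unfolding g_def using e expectation_mult_Y(1)[OF Y0_sq s0] by (simp add: Bochner_Integration.integral_diff)
    have "\<theta> * (v0 / \<theta> * (1 - exp (- \<theta> * s))) = v0 - v0 * exp (- \<theta> * s)" using \<theta> by (simp add: field_simps)
    then have "g s = - \<theta> * (\<integral>r. g r \<partial>path_time s)"
      unfolding eq right_diff_distrib
      using expectation_mult_Y(3)[OF Y0_sq s0] expectation_Y0_J[OF s0] by (simp add: g_def v0_def power2_eq_square)
    then show "\<bar>g s\<bar> \<le> \<theta> * \<bar>\<integral>r. g r \<partial>path_time s\<bar>" using \<theta> by (simp add: abs_mult)
  qed (use False t \<theta> in auto)
  then show ?thesis by (simp add: g_def)
qed

text \<open>Let \<open>Z = J t - J r\<close> be fixed. For \<open>s \<le> r\<close> the moments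
  \<open>E (Z * Y s)\<close> solve a homogeneous Volterra equation, because \<open>Z\<close> is
  orthogonal to \<open>Y 0\<close> and, by \<open>ito_covariance\<close>, to every
  \<open>J s\<close>.\<close>

lemma expectation_increment_Y:
  assumes "0 \<le> r" "r \<le> t"
  shows "(\<integral>\<omega>. (J t \<omega> - J r \<omega>) * Y r \<omega> \<partial>M) = 0"
proof -
  have t: "0 \<le> t" using assms by simp
  note sJ = J_sq[OF t] J_sq[OF assms(1)]
  show ?thesis
  proof (rule expectation_mult_Y_eq_0[where T=r, OF square_integrable_diff[OF sJ]])
    show "(\<integral>\<omega>. (J t \<omega> - J r \<omega>) * Y 0 \<omega> \<partial>M) = 0"
      unfolding left_diff_distrib
        Bochner_Integration.integral_diff[OF square_integrable_mult[OF sJ(1) Y0_sq] square_integrable_mult[OF sJ(2) Y0_sq]]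
      using expectation_Y0_J[OF t] expectation_Y0_J[OF assms(1)] by (simp add: mult.commute)
    show "(\<integral>\<omega>. (J t \<omega> - J r \<omega>) * J s \<omega> \<partial>M) = 0" if s: "0 < s" "s \<le> r" for s
    proof -
      have s0: "0 \<le> s" using s by simp
      note sJs = J_sq[OF s0]
      have "(\<integral>\<omega>. J s \<omega> * J t \<omega> \<partial>M) = (\<integral>\<omega>. J s \<omega> * J r \<omega> \<partial>M)"
        using ito_covariance[OF s0 _ hY_path_sq] s assms by simp
      then show ?thesis
        unfolding left_diff_distrib
          Bochner_Integration.integral_diff[OF square_integrable_mult[OF sJ(1) sJs] square_integrable_mult[OF sJ(2) sJs]]
        by (simp add: mult.commute)
    qed
  qed (use assms in auto)
qed

text \<open>The chain rule along one path: \<open>area\<close> is a primitive of the continuous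
  path, so its square has derivative \<open>2 * area r * Y r\<close>.\<close>

lemma area_square_eq:
  assumes \<omega>: "\<omega> \<in> space M" and t: "0 \<le> t"
  shows "(area t \<omega>)\<^sup>2 = 2 * (\<integral>r. area r \<omega> * Y r \<omega> \<partial>path_time t)"
proof -
  have cY: "continuous_on {0..t} (\<lambda>r. Y r \<omega>)" using path_continuous[OF continuous_on_id \<omega>] .
  define G where "G u = integral {0..u} (\<lambda>r. Y r \<omega>)" for u
  have aG: "area u \<omega> = G u" if "0 \<le> u" "u \<le> t" for u
  proof -
    have cu: "continuous_on {0..u} (\<lambda>r. Y r \<omega>)" using path_continuous[OF continuous_on_id \<omega>] .
    have "area u \<omega> = (LINT r:{0..u}|lborel. Y r \<omega>)"
      unfolding area_def by (rule set_integral_path_time[symmetric, OF path_set_measurable[OF continuous_on_id \<omega>]])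
    also have "\<dots> = G u" unfolding G_def
      by (rule set_borel_integral_eq_integral(2)[OF borel_integrable_atLeastAtMost'[OF cu]])
    finally show ?thesis .
  qed
  have dG: "(G has_vector_derivative Y r \<omega>) (at r within {0..t})" if "0 \<le> r" "r \<le> t" for r
    unfolding G_def by (rule integral_has_vector_derivative[OF cY]) (use that in auto)
  have cG: "continuous_on {0..t} G"
    using dG by (intro continuous_on_vector_derivative) auto
  have c2: "continuous_on {0..t} (\<lambda>r. 2 * (G r * Y r \<omega>))" by (intro continuous_intros cG cY)
  have "(\<integral>r. 2 * (area r \<omega> * Y r \<omega>) \<partial>path_time t) = (\<integral>r. 2 * (G r * Y r \<omega>) \<partial>path_time t)"
    by (intro Bochner_Integration.integral_cong) (auto simp: aG)
  also have "\<dots> = (LINT r:{0..t}|lborel. 2 * (G r * Y r \<omega>))"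
    using borel_measurable_continuous_on_indicator[OF _ c2] by (intro set_integral_path_time[symmetric]) (simp add: set_borel_measurable_def)
  also have "\<dots> = (G t)\<^sup>2 - (G 0)\<^sup>2"
    unfolding set_lebesgue_integral_def
  proof (rule integral_FTC_atLeastAtMost[OF t _ c2, where F="\<lambda>r. (G r)\<^sup>2"])
    fix r assume r: "0 \<le> r" "r \<le> t"
    from dG[OF r] have "(G has_real_derivative Y r \<omega>) (at r within {0..t})"
      by (simp add: has_real_derivative_iff_has_vector_derivative)
    from DERIV_power[OF this, of 2] show "((\<lambda>r. (G r)\<^sup>2) has_vector_derivative 2 * (G r * Y r \<omega>)) (at r within {0..t})"
      by (simp add: has_real_derivative_iff_has_vector_derivative[symmetric] mult_ac)
  qed
  also have "\<dots> = (area t \<omega>)\<^sup>2" using aG[of t] t by (simp add: G_def)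
  finally show ?thesis by simp
qed

lemma area_pair_measurable: "(\<lambda>z. area (fst z) (snd z)) \<in> borel_measurable (path_prob t)"
proof -
  interpret P: pair_sigma_finite "path_time t" M by (rule pair_path_prob)
  have id: "(\<lambda>x::real. x) \<in> borel_measurable (path_time t)" by (rule measurable_path_time) simp
  have m1: "(\<lambda>p. Y (snd p) (snd (fst p))) \<in> borel_measurable (path_prob t \<Otimes>\<^sub>M path_time t)"
    by (rule measurable_compose[where f="\<lambda>p. (snd p, snd (fst p))" and N="path_prob t", OF _ Y_pair, simplified]) measurable
  have m2: "(\<lambda>p. snd p) \<in> borel_measurable (path_prob t \<Otimes>\<^sub>M path_time t)"
    by (rule measurable_compose[OF measurable_snd id])
  have m3: "(\<lambda>p. fst (fst p)) \<in> borel_measurable (path_prob t \<Otimes>\<^sub>M path_time t)"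
    by (rule measurable_compose[OF measurable_fst measurable_compose[OF measurable_fst id]])
  \<comment> \<open>The horizon of \<open>area\<close> varies with \<open>fst z\<close>. Moved into
    the integrand, it leaves an integral over the fixed space \<open>path_time t\<close>, to which
    the measurability of parameter integrals applies.\<close>
  have "(\<lambda>(z, s). if s \<le> fst z then Y s (snd z) else 0) \<in> borel_measurable (path_prob t \<Otimes>\<^sub>M path_time t)"
    using m1 m2 m3 by (simp add: split_beta')
  then have m: "(\<lambda>z. \<integral>s. (if s \<le> fst z then Y s (snd z) else 0) \<partial>path_time t) \<in> borel_measurable (path_prob t)"
    by (rule P.M1.borel_measurable_lebesgue_integral)
  have "(\<integral>s. (if s \<le> fst z then Y s (snd z) else 0) \<partial>path_time t) = area (fst z) (snd z)" if "z \<in> space (path_prob t)" for z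
    using that unfolding area_def path_time_def
    by (subst (1 2) integral_restrict_space) (auto simp: space_pair_measure space_restrict_space indicator_def intro!: Bochner_Integration.integral_cong)
  then show ?thesis by (rule measurable_cong[THEN iffD1, OF _ m])
qed

lemma area_pair_sq: "square_integrable (path_prob t) (\<lambda>z. area (fst z) (snd z))"
proof (cases "0 \<le> t")
  case True
  have "integrable (path_prob t) (\<lambda>z. (area (fst z) (snd z))\<^sup>2)"
  proof (rule Bochner_Integration.integrable_bound)
    \<comment> \<open>Up to the factor \<open>t\<close>, the square of \<open>N\<close> dominates
      \<open>(area r)\<^sup>2\<close> for all \<open>r \<le> t\<close> at once, and it depends on
      the outcome only.\<close>
    define N where "N \<omega> = sqrt (\<integral>r. (Y r \<omega>)\<^sup>2 \<partial>path_time t)" for \<omega>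
    have N2: "(N \<omega>)\<^sup>2 = (\<integral>r. (Y r \<omega>)\<^sup>2 \<partial>path_time t)" for \<omega> by (simp add: N_def)
    have i: "integrable M (\<lambda>\<omega>. \<integral>r. (Y r \<omega>)\<^sup>2 \<partial>path_time t)"
      using path_prob_Fubini(1)[of t "\<lambda>r \<omega>. (Y r \<omega>)\<^sup>2"] Y_path_sq[of t] by (simp add: square_integrable_def)
    then have "square_integrable M N"
      unfolding square_integrable_def N2 by (auto simp: N_def[abs_def])
    then have "integrable (path_prob t) (\<lambda>z. (N (snd z))\<^sup>2)" using square_integrable_snd by (auto simp: square_integrable_def)
    then show "integrable (path_prob t) (\<lambda>z. t * (N (snd z))\<^sup>2)" by simp
    show "AE z in path_prob t. norm ((area (fst z) (snd z))\<^sup>2) \<le> norm (t * (N (snd z))\<^sup>2)"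
    proof (rule AE_I2)
      fix z assume "z \<in> space (path_prob t)"
      then have z: "0 \<le> fst z" "fst z \<le> t" "snd z \<in> space M" by (auto simp: space_pair_measure)
      have "continuous_on UNIV (\<lambda>x::real. x\<^sup>2)" by (intro continuous_intros)
      note ip = path_integrable[OF this z(3)]
      have "(area (fst z) (snd z))\<^sup>2 \<le> fst z * (\<integral>r. (Y r (snd z))\<^sup>2 \<partial>path_time (fst z))" by (rule area_square_le[OF z(3,1)])
      also have "\<dots> \<le> t * (\<integral>r. (Y r (snd z))\<^sup>2 \<partial>path_time t)"
      proof (rule mult_mono)
        show "(\<integral>r. (Y r (snd z))\<^sup>2 \<partial>path_time (fst z)) \<le> (\<integral>r. (Y r (snd z))\<^sup>2 \<partial>path_time t)"
          using ip[of t] z unfolding path_time_def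
          by (subst (1 2) integral_restrict_space, simp, simp, intro integral_mono')
            (auto simp: integrable_restrict_space indicator_def)
      qed (use z in \<open>auto intro: integral_nonneg_AE\<close>)
      finally show "norm ((area (fst z) (snd z))\<^sup>2) \<le> norm (t * (N (snd z))\<^sup>2)" by (simp add: N2)
    qed
  qed (intro borel_intros area_pair_measurable)
  then show ?thesis by (simp add: square_integrable_def area_pair_measurable)
next
  case False
  then have "space (path_prob t) = {}" by (simp add: space_pair_measure)
  then have "(\<integral>\<^sup>+z. f z \<partial>path_prob t) = 0" for f :: "_ \<Rightarrow> ennreal"
    by (subst nn_integral_cong[where v="\<lambda>_. 0"]) auto
  then show ?thesis
    by (simp add: square_integrable_def area_pair_measurable borel_measurable_power integrable_iff_bounded)
qed

text \<open>Ito's formula for \<open>Y\<^sup>2\<close> is not available. With \<open>U t = Y 0 + J t\<close> one has \<open>Y t = U t - \<theta> * area t\<close>; the square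
  is expanded, and \<open>E (U t * Y r) = E (U r * Y r)\<close> for \<open>r \<le> t\<close> since the increments of \<open>J\<close> are orthogonal to the past.\<close>

lemma second_moment_eq:
  assumes t: "0 < t"
  shows "(\<integral>\<omega>. (Y t \<omega>)\<^sup>2 \<partial>M) - v0 = (D - 2 * \<theta>) * (\<integral>r. (\<integral>\<omega>. (Y r \<omega>)\<^sup>2 \<partial>M) - v0 \<partial>path_time t)"
proof -
  have t0: "0 \<le> t" using t by simp
  interpret T: finite_measure "path_time t" by simp
  define v where "v r = (\<integral>\<omega>. (Y r \<omega>)\<^sup>2 \<partial>M)" for r
  define U where "U r \<omega> = Y 0 \<omega> + J r \<omega>" for r \<omega>
  have Usq: "square_integrable M (U r)" if "0 \<le> r" for r
    unfolding U_def by (intro square_integrable_add Y0_sq J_sq that)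
  have iv: "integrable (path_time t) v"
    using path_prob_Fubini(3)[of t "\<lambda>r \<omega>. (Y r \<omega>)\<^sup>2"] Y_path_sq[of t] by (simp add: square_integrable_def v_def[abs_def])
  have UU: "(\<integral>\<omega>. (U t \<omega>)\<^sup>2 \<partial>M) = v0 + (\<integral>\<omega>. (J t \<omega>)\<^sup>2 \<partial>M)"
    using integral_square_lincomb[OF Y0_sq J_sq[OF t0], of 1 1] expectation_Y0_J[OF t0] by (simp add: U_def v0_def)
  have J2: "(\<integral>\<omega>. (J t \<omega>)\<^sup>2 \<partial>M) = (\<integral>r. A + D * v r \<partial>path_time t)"
  proof -
    have i: "integrable (path_prob t) (\<lambda>z. (h (Y (fst z) (snd z)))\<^sup>2)" using hY_path_sq by (simp add: square_integrable_def)
    have "(\<integral>\<omega>. (J t \<omega>)\<^sup>2 \<partial>M) = (\<integral>r. (\<integral>\<omega>. (h (Y r \<omega>))\<^sup>2 \<partial>M) \<partial>path_time t)"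
      using ito_isometry[OF t0 hY_path_sq] path_prob_Fubini(4)[of t "\<lambda>r \<omega>. (h (Y r \<omega>))\<^sup>2", OF i] by simp
    also have "\<dots> = (\<integral>r. A + D * v r \<partial>path_time t)"
    proof (rule Bochner_Integration.integral_cong[OF refl])
      fix r assume "r \<in> space (path_time t)"
      then have r: "0 \<le> r" by simp
      have iY: "integrable M (Y r)" using square_integrable_mult[OF const_sq[of 1] Y_sq[OF r]] by simp
      have "(\<integral>\<omega>. (h (Y r \<omega>))\<^sup>2 \<partial>M) = (\<integral>\<omega>. A + B * Y r \<omega> + D * (Y r \<omega>)\<^sup>2 \<partial>M)"
        by (intro Bochner_Integration.integral_cong refl variance_coef r)
      also have "\<dots> = A + D * v r"
        using iY Y_sq[OF r] expectation_Y[OF r] by (simp add: square_integrable_def v_def prob_space)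
      finally show "(\<integral>\<omega>. (h (Y r \<omega>))\<^sup>2 \<partial>M) = A + D * v r" .
    qed
    finally show ?thesis .
  qed
  define w where "w r = (\<integral>\<omega>. U r \<omega> * Y r \<omega> \<partial>M)" for r
  have wt: "(\<integral>\<omega>. U t \<omega> * Y r \<omega> \<partial>M) = w r" if r: "0 \<le> r" "r \<le> t" for r
  proof -
    have "(\<integral>\<omega>. U t \<omega> * Y r \<omega> \<partial>M) - w r = (\<integral>\<omega>. U t \<omega> * Y r \<omega> - U r \<omega> * Y r \<omega> \<partial>M)"
      unfolding w_def using square_integrable_mult[OF Usq Y_sq] t0 r by simp
    also have "\<dots> = (\<integral>\<omega>. (J t \<omega> - J r \<omega>) * Y r \<omega> \<partial>M)"
      by (intro Bochner_Integration.integral_cong refl) (simp add: U_def algebra_simps)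
    finally show ?thesis using expectation_increment_Y[OF r] by simp
  qed
  have iw: "integrable (path_time t) w"
    using expectation_mult_Y(1)[OF Usq[OF t0] t0]
    by (rule Bochner_Integration.integrable_cong[OF refl, THEN iffD1, rotated]) (auto simp: wt)
  have UA: "(\<integral>\<omega>. U t \<omega> * area t \<omega> \<partial>M) = (\<integral>r. w r \<partial>path_time t)"
    unfolding expectation_mult_Y(2)[OF Usq[OF t0] t0] by (intro Bochner_Integration.integral_cong) (auto simp: wt)
  define x where "x r = (\<integral>\<omega>. area r \<omega> * Y r \<omega> \<partial>M)" for r
  have ip: "integrable (path_prob t) (\<lambda>z. area (fst z) (snd z) * Y (fst z) (snd z))"
    by (rule square_integrable_mult[OF area_pair_sq Y_path_sq])
  note Fx = path_prob_Fubini[of t "\<lambda>r \<omega>. area r \<omega> * Y r \<omega>", OF ip]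
  have ix: "integrable (path_time t) x" using Fx(3) by (simp add: x_def[abs_def])
  have AA: "(\<integral>\<omega>. (area t \<omega>)\<^sup>2 \<partial>M) = 2 * (\<integral>r. x r \<partial>path_time t)"
  proof -
    have "(\<integral>\<omega>. (area t \<omega>)\<^sup>2 \<partial>M) = (\<integral>\<omega>. 2 * (\<integral>r. area r \<omega> * Y r \<omega> \<partial>path_time t) \<partial>M)"
      by (intro Bochner_Integration.integral_cong refl area_square_eq t0)
    then show ?thesis using Fx(2,4) by (simp add: x_def)
  qed
  \<comment> \<open>Recombining \<open>U r\<close> and \<open>area r\<close> into \<open>Y r\<close>
    closes the equation: \<open>w\<close> and \<open>x\<close> will occur only in this
    combination.\<close>
  have wx: "w r - \<theta> * x r = v r" if r: "0 \<le> r" for r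
  proof -
    have "w r - \<theta> * x r = (\<integral>\<omega>. U r \<omega> * Y r \<omega> - \<theta> * (area r \<omega> * Y r \<omega>) \<partial>M)"
      unfolding w_def x_def
      using square_integrable_mult[OF Usq[OF r] Y_sq[OF r]] square_integrable_mult[OF area_sq[OF r] Y_sq[OF r]] by simp
    also have "\<dots> = v r"
      unfolding v_def
    proof (rule integral_cong_AE)
      show "AE \<omega> in M. U r \<omega> * Y r \<omega> - \<theta> * (area r \<omega> * Y r \<omega>) = (Y r \<omega>)\<^sup>2"
        using Y_eq[OF r]
      proof eventually_elim
        case (elim \<omega>)
        then have U: "U r \<omega> = Y r \<omega> + \<theta> * area r \<omega>" by (simp add: U_def)
        show ?case unfolding U by (simp add: power2_eq_square algebra_simps)
      qed
    qed (use square_integrable_mult[OF Usq[OF r] Y_sq[OF r]] square_integrable_mult[OF area_sq[OF r] Y_sq[OF r]] Y_sq[OF r]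
       in \<open>auto simp: square_integrable_def\<close>)
    finally show ?thesis .
  qed
  have "v t = (\<integral>\<omega>. (1 * U t \<omega> + (- \<theta>) * area t \<omega>)\<^sup>2 \<partial>M)"
    unfolding v_def
  proof (rule integral_cong_AE)
    show "AE \<omega> in M. (Y t \<omega>)\<^sup>2 = (1 * U t \<omega> + (- \<theta>) * area t \<omega>)\<^sup>2"
      using Y_eq[OF t0]
    proof eventually_elim
      case (elim \<omega>)
      then have "Y t \<omega> = 1 * U t \<omega> + (- \<theta>) * area t \<omega>" by (simp add: U_def)
      then show ?case by (simp only:)
    qed
    show "(\<lambda>\<omega>. (1 * U t \<omega> + (- \<theta>) * area t \<omega>)\<^sup>2) \<in> borel_measurable M"
      by (rule borel_measurable_integrable[OF square_integrableD(2)[OF square_integrable_lincomb[OF Usq[OF t0] area_sq[OF t0]]]])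
  qed (use Y_sq[OF t0] in \<open>auto simp: square_integrable_def\<close>)
  also have "\<dots> = (v0 + (\<integral>r. A + D * v r \<partial>path_time t)) - 2 * \<theta> * (\<integral>r. w r \<partial>path_time t) + \<theta>\<^sup>2 * (2 * (\<integral>r. x r \<partial>path_time t))"
    unfolding integral_square_lincomb[OF Usq[OF t0] area_sq[OF t0]] UU J2 UA AA by simp
  also have "\<dots> = v0 + (\<integral>r. A + D * v r \<partial>path_time t) - 2 * \<theta> * (\<integral>r. w r - \<theta> * x r \<partial>path_time t)"
    using iw ix by (simp add: power2_eq_square algebra_simps)
  also have "(\<integral>r. w r - \<theta> * x r \<partial>path_time t) = (\<integral>r. v r \<partial>path_time t)"
    by (intro Bochner_Integration.integral_cong) (auto simp: wx)
  also have "v0 + (\<integral>r. A + D * v r \<partial>path_time t) - 2 * \<theta> * (\<integral>r. v r \<partial>path_time t) =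
    v0 + (\<integral>r. (A + D * v r) - 2 * \<theta> * v r \<partial>path_time t)"
    using iv by (simp add: Bochner_Integration.integral_diff)
  \<comment> \<open>\<open>balance\<close> reads \<open>A = (2 * \<theta> - D) * v0\<close>, so the
    constant term disappears when \<open>v\<close> is centred at \<open>v0\<close>.\<close>
  also have "(\<lambda>r. (A + D * v r) - 2 * \<theta> * v r) = (\<lambda>r. (D - 2 * \<theta>) * (v r - v0))"
    using balance by (auto simp: v0_def[symmetric] algebra_simps)
  finally show ?thesis by (simp add: v_def)
qed

lemma second_moment:
  assumes t: "0 \<le> t"
  shows "(\<integral>\<omega>. (Y t \<omega>)\<^sup>2 \<partial>M) = v0"
proof (cases "t = 0")
  case False
  obtain C where C: "\<And>s. 0 \<le> s \<Longrightarrow> s \<le> t \<Longrightarrow> (\<integral>\<omega>. (Y s \<omega>)\<^sup>2 \<partial>M) \<le> C" using second_moment_bound[of t] by blast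
  have "(\<integral>\<omega>. (Y t \<omega>)\<^sup>2 \<partial>M) - v0 = 0"
  \<comment> \<open>The added 1 keeps \<open>c\<close> positive when
    \<open>D = 2 * \<theta>\<close>.\<close>
  proof (rule path_time_zero_unique[where g="\<lambda>t. (\<integral>\<omega>. (Y t \<omega>)\<^sup>2 \<partial>M) - v0" and T=t and C="C + \<bar>v0\<bar>" and c="\<bar>D - 2 * \<theta>\<bar> + 1"])
    fix s assume s: "0 < s" "s \<le> t"
    have "0 \<le> (\<integral>\<omega>. (Y s \<omega>)\<^sup>2 \<partial>M)" by (intro integral_nonneg_AE) simp
    then show "\<bar>(\<integral>\<omega>. (Y s \<omega>)\<^sup>2 \<partial>M) - v0\<bar> \<le> C + \<bar>v0\<bar>" using C[of s] s by linarith
    show "\<bar>(\<integral>\<omega>. (Y s \<omega>)\<^sup>2 \<partial>M) - v0\<bar> \<le> (\<bar>D - 2 * \<theta>\<bar> + 1) * \<bar>\<integral>r. (\<integral>\<omega>. (Y r \<omega>)\<^sup>2 \<partial>M) - v0 \<partial>path_time s\<bar>"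
      unfolding second_moment_eq[OF s(1)] abs_mult by (intro mult_right_mono) auto
  qed (use False t in auto)
  then show ?thesis by simp
qed (simp add: v0_def)

end

section \<open>Integrals of derivatives over unbounded and open intervals\<close>

lemma set_integral_derivative_Icc:
  fixes G g :: "real \<Rightarrow> real"
  assumes "a \<le> b" and G: "\<And>x. a \<le> x \<Longrightarrow> x \<le> b \<Longrightarrow> (G has_real_derivative g x) (at x)"
    "\<And>x. a \<le> x \<Longrightarrow> x \<le> b \<Longrightarrow> isCont g x"
  shows "(LINT x:{a..b}|lborel. g x) = G b - G a"
  unfolding set_lebesgue_integral_def
proof (rule integral_FTC_atLeastAtMost[OF assms(1)])
  show "(G has_vector_derivative g x) (at x within {a..b})" if "a \<le> x" "x \<le> b" for x
    using has_field_derivative_at_within[OF G(1)[OF that]]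
    by (simp add: has_real_derivative_iff_has_vector_derivative)
  show "continuous_on {a..b} g" using G(2) by (intro continuous_at_imp_continuous_on) auto
qed

lemma inverse_not_set_integrable_at_top:
  assumes "(0::real) < d"
  shows "\<not> set_integrable lborel {d..} (\<lambda>x. 1 / x)"
proof
  assume i: "set_integrable lborel {d..} (\<lambda>x::real. 1 / x)"
  have lim: "((\<lambda>b. LINT x:{d..b}|lborel. 1 / x) \<longlongrightarrow> (LINT x:{d..}|lborel. 1 / x)) at_top"
    by (rule tendsto_set_lebesgue_integral_at_top[OF _ i]) simp
  have "\<forall>\<^sub>F b in at_top. (LINT x:{d..b}|lborel. 1 / x) = ln b - ln d"
    using eventually_ge_at_top[of d]
  proof eventually_elim
    case (elim b)
    show ?case
      unfolding set_lebesgue_integral_def using assms elim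
      by (intro integral_FTC_atLeastAtMost[where F=ln])
        (auto intro!: derivative_eq_intros continuous_intros simp: has_real_derivative_iff_has_vector_derivative[symmetric])
  qed
  from Lim_transform_eventually[OF lim this]
  have "((\<lambda>b. ln b - ln d) \<longlongrightarrow> (LINT x:{d..}|lborel. 1 / x)) at_top" .
  from tendsto_add[OF this tendsto_const[of "ln d"]]
  have "(ln \<longlongrightarrow> (LINT x:{d..}|lborel. 1 / x) + ln d) at_top" by simp
  then show False using ln_at_top not_tendsto_and_filterlim_at_infinity[of at_top ln]
    by (meson filterlim_at_top_imp_at_infinity trivial_limit_at_top_linorder)
qed

lemma eventually_Ioc_at_right: "(e::real) < c \<Longrightarrow> \<forall>\<^sub>F b in at_right e. e < b \<and> b \<le> c"
  by (subst eventually_at_right) (auto intro!: exI[of _ c])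

lemma inverse_not_set_integrable_at_right:
  assumes "(e::real) < c"
  shows "\<not> set_integrable lborel {e<..c} (\<lambda>x. 1 / (x - e))"
proof
  assume i: "set_integrable lborel {e<..c} (\<lambda>x. 1 / (x - e))"
  have lim: "((\<lambda>b. LINT x:{b..c}|lborel. 1 / (x - e)) \<longlongrightarrow> (LINT x:{e<..c}|lborel. 1 / (x - e))) (at_right e)"
    by (rule tendsto_set_lebesgue_integral_at_right[OF assms _ i]) simp
  have "\<forall>\<^sub>F b in at_right e. (LINT x:{b..c}|lborel. 1 / (x - e)) = ln (c - e) - ln (b - e)"
    using eventually_Ioc_at_right[OF assms]
  proof eventually_elim
    case (elim b)
    show ?case
      unfolding set_lebesgue_integral_def using assms elim
      by (intro integral_FTC_atLeastAtMost[where F="\<lambda>x. ln (x - e)"])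
        (auto intro!: derivative_eq_intros continuous_intros simp: has_real_derivative_iff_has_vector_derivative[symmetric])
  qed
  from Lim_transform_eventually[OF lim this]
  have "((\<lambda>b. ln (c - e) - ln (b - e)) \<longlongrightarrow> (LINT x:{e<..c}|lborel. 1 / (x - e))) (at_right e)" .
  from tendsto_diff[OF tendsto_const[of "ln (c - e)"] this]
  have 1: "((\<lambda>b. ln (b - e)) \<longlongrightarrow> ln (c - e) - (LINT x:{e<..c}|lborel. 1 / (x - e))) (at_right e)" by simp
  have "filterlim (\<lambda>b. b - e) (at_right 0) (at_right e)"
    unfolding filterlim_at
    by (auto intro!: tendsto_eq_intros simp: eventually_at_filter)
  then have "filterlim (\<lambda>b. ln (b - e)) at_bot (at_right e)" by (rule filterlim_compose[OF ln_at_0])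
  then show False using 1 not_tendsto_and_filterlim_at_infinity[of "at_right e" "\<lambda>b. ln (b - e)"]
    by (meson filterlim_at_bot_imp_at_infinity trivial_limit_at_right_real)
qed

text \<open>Integrability of \<open>G x / x\<close> forces the limit of \<open>G\<close> at infinity to be 0, as \<open>1 / x\<close> is not integrable.\<close>

lemma set_integral_derivative_at_top:
  fixes G g :: "real \<Rightarrow> real"
  assumes G: "\<And>x. c \<le> x \<Longrightarrow> (G has_real_derivative g x) (at x)" "\<And>x. c \<le> x \<Longrightarrow> isCont g x"
    and g: "set_integrable lborel {c..} g" and d: "0 < d" "set_integrable lborel {d..} (\<lambda>x. G x / x)"
  shows "(LINT x:{c..}|lborel. g x) = - G c"
proof -
  let ?I = "LINT x:{c..}|lborel. g x"
  have lim: "((\<lambda>b. LINT x:{c..b}|lborel. g x) \<longlongrightarrow> ?I) at_top"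
    by (rule tendsto_set_lebesgue_integral_at_top[OF _ g]) simp
  have "\<forall>\<^sub>F b in at_top. (LINT x:{c..b}|lborel. g x) = G b - G c"
    using eventually_ge_at_top[of c]
  proof eventually_elim
    case (elim b)
    show ?case by (rule set_integral_derivative_Icc) (use G elim in auto)
  qed
  from Lim_transform_eventually[OF lim this] have "((\<lambda>b. G b - G c) \<longlongrightarrow> ?I) at_top" .
  from tendsto_add[OF this tendsto_const[of "G c"]] have L: "(G \<longlongrightarrow> ?I + G c) at_top" by simp
  define L where "L = ?I + G c"
  have "L = 0"
  proof (rule ccontr)
    assume "L \<noteq> 0"
    have "((\<lambda>x. \<bar>G x\<bar>) \<longlongrightarrow> \<bar>L\<bar>) at_top" using L by (intro tendsto_rabs) (simp add: L_def)
    then have "\<forall>\<^sub>F x in at_top. \<bar>G x\<bar> > \<bar>L\<bar> / 2" by (rule order_tendstoD) (use \<open>L \<noteq> 0\<close> in simp)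
    then obtain N where N: "\<And>x. x \<ge> N \<Longrightarrow> \<bar>G x\<bar> > \<bar>L\<bar> / 2" by (auto simp: eventually_at_top_linorder)
    define e where "e = max N d"
    have e: "0 < e" using d by (simp add: e_def)
    have i: "set_integrable lborel {e..} (\<lambda>x. G x / x)" by (rule set_integrable_subset[OF d(2)]) (auto simp: e_def)
    have "set_integrable lborel {e..} (\<lambda>x. (\<bar>L\<bar> / 2) * (1 / x))"
      unfolding set_integrable_def
    proof (rule Bochner_Integration.integrable_bound[OF i[unfolded set_integrable_def]])
      show "AE x in lborel. norm (indicator {e..} x *\<^sub>R ((\<bar>L\<bar> / 2) * (1 / x))) \<le> norm (indicator {e..} x *\<^sub>R (G x / x))"
      proof (rule AE_I2)
        fix x
        show "norm (indicator {e..} x *\<^sub>R ((\<bar>L\<bar> / 2) * (1 / x))) \<le> norm (indicator {e..} x *\<^sub>R (G x / x))"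
        proof (cases "e \<le> x")
          case True
          then have "0 < x" "\<bar>L\<bar> / 2 \<le> \<bar>G x\<bar>" using N[of x] e by (auto simp: e_def)
          then have "\<bar>L\<bar> / 2 * (1 / x) \<le> \<bar>G x\<bar> * (1 / x)" by (intro mult_right_mono) auto
          then show ?thesis using True \<open>0 < x\<close> by (simp add: abs_mult)
        qed simp
      qed
    qed measurable
    then have "set_integrable lborel {e..} (\<lambda>x. 1 / x)"
      using \<open>L \<noteq> 0\<close> by (subst (asm) set_integrable_mult_right_iff) auto
    then show False using inverse_not_set_integrable_at_top[OF e] by simp
  qed
  then show ?thesis by (simp add: L_def)
qed

text \<open>At a finite end \<open>1 / (x - e)\<close> takes over the part of \<open>1 / x\<close>
  at infinity: it is not integrable, which excludes a nonzero limit of \<open>G\<close> at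
  \<open>e\<close>.\<close>

lemma set_integral_derivative_at_right:
  fixes G g :: "real \<Rightarrow> real"
  assumes ec: "e < c" and G: "\<And>x. e < x \<Longrightarrow> x \<le> c \<Longrightarrow> (G has_real_derivative g x) (at x)" "\<And>x. e < x \<Longrightarrow> x \<le> c \<Longrightarrow> isCont g x"
    and g: "set_integrable lborel {e<..c} g" and d: "set_integrable lborel {e<..c} (\<lambda>x. G x / (x - e))"
  shows "(LINT x:{e<..c}|lborel. g x) = G c"
proof -
  let ?I = "LINT x:{e<..c}|lborel. g x"
  have lim: "((\<lambda>b. LINT x:{b..c}|lborel. g x) \<longlongrightarrow> ?I) (at_right e)"
    by (rule tendsto_set_lebesgue_integral_at_right[OF ec _ g]) simp
  have "\<forall>\<^sub>F b in at_right e. (LINT x:{b..c}|lborel. g x) = G c - G b"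
    using eventually_Ioc_at_right[OF ec]
  proof eventually_elim
    case (elim b)
    show ?case by (rule set_integral_derivative_Icc) (use G elim in auto)
  qed
  from Lim_transform_eventually[OF lim this] have "((\<lambda>b. G c - G b) \<longlongrightarrow> ?I) (at_right e)" .
  from tendsto_diff[OF tendsto_const[of "G c"] this] have L: "(G \<longlongrightarrow> G c - ?I) (at_right e)" by simp
  define L where "L = G c - ?I"
  have "L = 0"
  proof (rule ccontr)
    assume "L \<noteq> 0"
    have "((\<lambda>x. \<bar>G x\<bar>) \<longlongrightarrow> \<bar>L\<bar>) (at_right e)" using L by (intro tendsto_rabs) (simp add: L_def)
    then have "\<forall>\<^sub>F x in at_right e. \<bar>G x\<bar> > \<bar>L\<bar> / 2" by (rule order_tendstoD) (use \<open>L \<noteq> 0\<close> in simp)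
    then obtain N where N: "e < N" "\<And>x. x > e \<Longrightarrow> x < N \<Longrightarrow> \<bar>G x\<bar> > \<bar>L\<bar> / 2"
      using eventually_at_right[OF ec] by auto
    define k where "k = min ((e + N) / 2) c"
    have k: "e < k" "k < N" "k \<le> c" using N ec by (auto simp: k_def min_def)
    have i: "set_integrable lborel {e<..k} (\<lambda>x. G x / (x - e))" by (rule set_integrable_subset[OF d]) (use k in auto)
    have "set_integrable lborel {e<..k} (\<lambda>x. (\<bar>L\<bar> / 2) * (1 / (x - e)))"
      unfolding set_integrable_def
    proof (rule Bochner_Integration.integrable_bound[OF i[unfolded set_integrable_def]])
      show "AE x in lborel. norm (indicator {e<..k} x *\<^sub>R ((\<bar>L\<bar> / 2) * (1 / (x - e)))) \<le> norm (indicator {e<..k} x *\<^sub>R (G x / (x - e)))"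
      proof (rule AE_I2)
        fix x
        show "norm (indicator {e<..k} x *\<^sub>R ((\<bar>L\<bar> / 2) * (1 / (x - e)))) \<le> norm (indicator {e<..k} x *\<^sub>R (G x / (x - e)))"
        proof (cases "e < x \<and> x \<le> k")
          case True
          then have x: "0 < x - e" "\<bar>L\<bar> / 2 \<le> \<bar>G x\<bar>" using N(2)[of x] k by auto
          then have "\<bar>L\<bar> / 2 * (1 / (x - e)) \<le> \<bar>G x\<bar> * (1 / (x - e))" by (intro mult_right_mono) auto
          then show ?thesis using True x(1) by (simp add: abs_mult)
        qed auto
      qed
    qed measurable
    then have "set_integrable lborel {e<..k} (\<lambda>x. 1 / (x - e))"
      using \<open>L \<noteq> 0\<close> by (subst (asm) set_integrable_mult_right_iff) auto
    then show False using inverse_not_set_integrable_at_right[OF k(1)] by simp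
  qed
  then show ?thesis by (simp add: L_def)
qed

text \<open>Reflection transfers the results at infinity and at \<open>e\<close> from the right to
  minus infinity and to \<open>e\<close> from the left.\<close>

lemma set_integral_uminus:
  fixes f :: "real \<Rightarrow> real"
  shows "(LINT x:uminus ` A|lborel. f x) = (LINT x:A|lborel. f (- x))"
    "set_integrable lborel (uminus ` A) f \<longleftrightarrow> set_integrable lborel A (\<lambda>x. f (- x))"
proof -
  have ind: "indicator (uminus ` A) (- x) = (indicator A x :: real)" for x by (auto simp: indicator_def)
  show "(LINT x:uminus ` A|lborel. f x) = (LINT x:A|lborel. f (- x))"
    using lborel_integral_real_affine[of "-1" "\<lambda>x. indicator (uminus ` A) x *\<^sub>R f x" 0]
    by (simp add: set_lebesgue_integral_def ind)
  show "set_integrable lborel (uminus ` A) f \<longleftrightarrow> set_integrable lborel A (\<lambda>x. f (- x))"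
    using lborel_integrable_real_affine_iff[of "-1" "\<lambda>x. indicator (uminus ` A) x *\<^sub>R f x" 0]
    by (simp add: set_integrable_def ind)
qed

lemma reflect_derivative:
  fixes G g :: "real \<Rightarrow> real"
  assumes "(G has_real_derivative g (- x)) (at (- x))" "isCont g (- x)"
  shows "((\<lambda>x. G (- x)) has_real_derivative - g (- x)) (at x)" "isCont (\<lambda>x. - g (- x)) x"
proof -
  have "((\<lambda>x. G (- x)) has_real_derivative g (- x) * (- 1)) (at x)"
    by (rule DERIV_chain'[where f=uminus and g=G, OF _ assms(1)]) (auto intro!: derivative_eq_intros)
  then show "((\<lambda>x. G (- x)) has_real_derivative - g (- x)) (at x)" by simp
  show "isCont (\<lambda>x. - g (- x)) x"
    by (intro continuous_minus isCont_o2[where f=uminus and g=g] assms(2)) auto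
qed

lemma set_integral_derivative_at_bot:
  fixes G g :: "real \<Rightarrow> real"
  assumes G: "\<And>x. x \<le> c \<Longrightarrow> (G has_real_derivative g x) (at x)" "\<And>x. x \<le> c \<Longrightarrow> isCont g x"
    and g: "set_integrable lborel {..c} g" and d: "d < 0" "set_integrable lborel {..d} (\<lambda>x. G x / x)"
  shows "(LINT x:{..c}|lborel. g x) = G c"
proof -
  have S: "{..c} = uminus ` {-c..}" "{..d} = uminus ` {-d..}" by simp_all
  have "(LINT x:{-c..}|lborel. - g (- x)) = - G (- (- c))"
  proof (rule set_integral_derivative_at_top[where d="- d"])
    show "((\<lambda>x. G (- x)) has_real_derivative - g (- x)) (at x)" "isCont (\<lambda>x. - g (- x)) x" if "- c \<le> x" for x
      by (rule reflect_derivative; use G[of "- x"] that in simp)+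
    show "set_integrable lborel {-c..} (\<lambda>x. - g (- x))"
      using g unfolding S set_integral_uminus by (simp add: set_integrable_def)
    have "set_integrable lborel {-d..} (\<lambda>x. G (- x) / (- x))" using d(2) unfolding S set_integral_uminus .
    then show "set_integrable lborel {-d..} (\<lambda>x. G (- x) / x)" by (simp add: set_integrable_def)
  qed (use d in simp)
  then show ?thesis unfolding S set_integral_uminus by (simp add: set_lebesgue_integral_def)
qed

lemma set_integral_derivative_at_left:
  fixes G g :: "real \<Rightarrow> real"
  assumes ec: "c < e" and G: "\<And>x. c \<le> x \<Longrightarrow> x < e \<Longrightarrow> (G has_real_derivative g x) (at x)" "\<And>x. c \<le> x \<Longrightarrow> x < e \<Longrightarrow> isCont g x"
    and g: "set_integrable lborel {c..<e} g" and d: "set_integrable lborel {c..<e} (\<lambda>x. G x / (e - x))"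
  shows "(LINT x:{c..<e}|lborel. g x) = - G c"
proof -
  have S: "{c..<e} = uminus ` {-e<..-c}" by simp
  have "(LINT x:{-e<..-c}|lborel. - g (- x)) = G (- (- c))"
  proof (rule set_integral_derivative_at_right)
    show "((\<lambda>x. G (- x)) has_real_derivative - g (- x)) (at x)" "isCont (\<lambda>x. - g (- x)) x" if "- e < x" "x \<le> - c" for x
      by (rule reflect_derivative; use G[of "- x"] that in simp)+
    show "set_integrable lborel {-e<..-c} (\<lambda>x. - g (- x))"
      using g unfolding S set_integral_uminus by (simp add: set_integrable_def)
    have "set_integrable lborel {-e<..-c} (\<lambda>x. G (- x) / (e - (- x)))" using d unfolding S set_integral_uminus .
    then show "set_integrable lborel {-e<..-c} (\<lambda>x. G (- x) / (x - - e))" by (simp add: add.commute)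
  qed (use ec in simp)
  then show ?thesis unfolding S set_integral_uminus by (simp add: set_lebesgue_integral_def)
qed

lemma set_integral_glue:
  fixes g :: "real \<Rightarrow> real"
  assumes E: "E = A \<union> B" "A \<inter> B \<subseteq> {c}" "A \<in> sets borel" "B \<in> sets borel" and g: "set_integrable lborel E g"
  shows "(LINT x:E|lborel. g x) = (LINT x:A|lborel. g x) + (LINT x:B|lborel. g x)"
  unfolding E(1)
proof (rule set_integral_Un_AE)
  have "AE x in lborel. x \<noteq> c" by (rule AE_lborel_singleton)
  then show "AE x in lborel. \<not> (x \<in> A \<and> x \<in> B)" by eventually_elim (use E(2) in auto)
  show "set_integrable lborel A g" "set_integrable lborel B g" using E by (auto intro: set_integrable_subset[OF g])
qed (use E in auto)

text \<open>The weight \<open>1 / x\<close> is wanted near the infinite ends only;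
  \<open>1 \<le> \<bar>x\<bar>\<close> keeps it away from its singularity at the interior point
  0.\<close>

lemma integral_derivative_UNIV:
  fixes G g :: "real \<Rightarrow> real"
  assumes G: "\<And>x. (G has_real_derivative g x) (at x)" "\<And>x. isCont g x"
    and g: "integrable lborel g" and d: "set_integrable lborel {x. 1 \<le> \<bar>x\<bar>} (\<lambda>x. G x / x)"
  shows "(LINT x:UNIV|lborel. g x) = 0"
proof -
  have gs: "set_integrable lborel A g" if "A \<in> sets borel" for A
    using integrable_mult_indicator[OF _ g, of A] that by (simp add: set_integrable_def)
  have "(LINT x:UNIV|lborel. g x) = (LINT x:{..0}|lborel. g x) + (LINT x:{0..}|lborel. g x)"
    by (rule set_integral_glue[where c=0]) (use gs in auto)
  also have "(LINT x:{..0}|lborel. g x) = G 0"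
    by (rule set_integral_derivative_at_bot[where d="-1"]) (use G gs in \<open>auto intro!: set_integrable_subset[OF d]\<close>)
  also have "(LINT x:{0..}|lborel. g x) = - G 0"
    by (rule set_integral_derivative_at_top[where d=1]) (use G gs in \<open>auto intro!: set_integrable_subset[OF d]\<close>)
  finally show ?thesis by simp
qed

text \<open>One weight serves both ends, as \<open>1 / x\<close> is integrable neither at 0 nor at
  infinity.\<close>

lemma integral_derivative_Ioi:
  fixes G g :: "real \<Rightarrow> real"
  assumes G: "\<And>x. 0 < x \<Longrightarrow> (G has_real_derivative g x) (at x)" "\<And>x. 0 < x \<Longrightarrow> isCont g x"
    and g: "set_integrable lborel {0<..} g" and d: "set_integrable lborel {0<..} (\<lambda>x. G x / x)"
  shows "(LINT x:{0<..}|lborel. g x) = 0"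
proof -
  have "(LINT x:{0<..}|lborel. g x) = (LINT x:{0<..1}|lborel. g x) + (LINT x:{1..}|lborel. g x)"
    by (rule set_integral_glue[where c=1]) (use g in auto)
  also have "(LINT x:{0<..1}|lborel. g x) = G 1"
    by (rule set_integral_derivative_at_right) (use G in \<open>auto intro!: set_integrable_subset[OF d] set_integrable_subset[OF g]\<close>)
  also have "(LINT x:{1..}|lborel. g x) = - G 1"
    by (rule set_integral_derivative_at_top[where d=1]) (use G in \<open>auto intro!: set_integrable_subset[OF d] set_integrable_subset[OF g]\<close>)
  finally show ?thesis by simp
qed

lemma integral_derivative_Ioo:
  fixes G g :: "real \<Rightarrow> real"
  assumes G: "\<And>x. -1 < x \<Longrightarrow> x < 1 \<Longrightarrow> (G has_real_derivative g x) (at x)" "\<And>x. -1 < x \<Longrightarrow> x < 1 \<Longrightarrow> isCont g x"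
    and g: "set_integrable lborel {-1<..<1} g"
    and d: "set_integrable lborel {-1<..<1} (\<lambda>x. G x / (1 - x))" "set_integrable lborel {-1<..<1} (\<lambda>x. G x / (x - (-1)))"
  shows "(LINT x:{-1<..<1}|lborel. g x) = 0"
proof -
  have "(LINT x:{-1<..<1}|lborel. g x) = (LINT x:{-1<..0}|lborel. g x) + (LINT x:{0..<1}|lborel. g x)"
    by (rule set_integral_glue[where c=0]) (use g in auto)
  also have "(LINT x:{-1<..0}|lborel. g x) = G 0"
  proof (rule set_integral_derivative_at_right)
    show "set_integrable lborel {-1<..0} (\<lambda>x. G x / (x - (-1)))" by (rule set_integrable_subset[OF d(2)]) auto
  qed (use G in \<open>auto intro!: set_integrable_subset[OF g]\<close>)
  also have "(LINT x:{0..<1}|lborel. g x) = - G 0"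
    by (rule set_integral_derivative_at_left) (use G in \<open>auto intro!: set_integrable_subset[OF d(1)] set_integrable_subset[OF g]\<close>)
  finally show ?thesis by simp
qed

section \<open>Moments of the Pearson densities\<close>

text \<open>With \<open>q x = q0 + q1 * x + q2 * x\<^sup>2\<close> the integrands are the derivatives of \<open>q * f\<close> and \<open>(x - \<mu>) * q * f\<close>.
  The last assumption says that \<open>q\<close> vanishes at the finite ends of \<open>E\<close>.\<close>

lemma pearson_equation_integrals:
  fixes f r :: "real \<Rightarrow> real"
  assumes f: "\<And>x. x \<in> E \<Longrightarrow> (f has_real_derivative f x * r x) (at x)"
    and eq: "\<And>x. x \<in> E \<Longrightarrow> q1 + 2 * q2 * x + (q0 + q1 * x + q2 * x\<^sup>2) * r x = - \<theta> * (x - \<mu>)"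
    and i0: "integrable lborel (\<lambda>x. f x * indicator E x)" and i2: "integrable lborel (\<lambda>x. x\<^sup>2 * (f x * indicator E x))"
    and shape: "E = UNIV \<or> E = {0<..} \<and> q0 = 0 \<or> E = {-1<..<1} \<and> q0 = - q2 \<and> q1 = 0"
  shows "(\<integral>x. - \<theta> * (x - \<mu>) * (f x * indicator E x) \<partial>lborel) = 0"
    "(\<integral>x. (q0 + q1 * x + q2 * x\<^sup>2 - \<theta> * (x - \<mu>)\<^sup>2) * (f x * indicator E x) \<partial>lborel) = 0"
proof -
  define q where "q x = q0 + q1 * x + q2 * x\<^sup>2" for x
  have [measurable]: "(\<lambda>x. f x * indicator E x) \<in> borel_measurable borel" using i0 by auto
  have i1: "integrable lborel (\<lambda>x. x * (f x * indicator E x))"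
  proof (rule Bochner_Integration.integrable_bound[OF Bochner_Integration.integrable_add[OF i0 i2]])
    show "AE x in lborel. norm (x * (f x * indicator E x)) \<le> norm (f x * indicator E x + x\<^sup>2 * (f x * indicator E x))"
    proof (rule AE_I2)
      fix x :: real
      have "2 * \<bar>x\<bar> \<le> 1 + x\<^sup>2" using sum_squares_bound[of 1 "\<bar>x\<bar>"] by simp
      then have "\<bar>x\<bar> \<le> 1 + x\<^sup>2" by simp
      then have "\<bar>x\<bar> * \<bar>f x * indicator E x\<bar> \<le> (1 + x\<^sup>2) * \<bar>f x * indicator E x\<bar>" by (intro mult_right_mono) auto
      also have "\<dots> = \<bar>(1 + x\<^sup>2) * (f x * indicator E x)\<bar>" unfolding abs_mult[of "1 + x\<^sup>2"] by simp
      also have "(1 + x\<^sup>2) * (f x * indicator E x) = f x * indicator E x + x\<^sup>2 * (f x * indicator E x)" by (simp add: distrib_right)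
      finally show "norm (x * (f x * indicator E x)) \<le> norm (f x * indicator E x + x\<^sup>2 * (f x * indicator E x))"
        by (simp only: abs_mult[symmetric] real_norm_def)
    qed
  qed measurable
  have poly: "set_integrable lborel E (\<lambda>x. (a + b * x + c * x\<^sup>2) * f x)" for a b c
  proof -
    have "integrable lborel (\<lambda>x. a * (f x * indicator E x) + b * (x * (f x * indicator E x)) + c * (x\<^sup>2 * (f x * indicator E x)))"
      using i0 i1 i2 by simp
    then show ?thesis
      unfolding set_integrable_def
      by (rule Bochner_Integration.integrable_cong[OF refl, THEN iffD1, rotated]) (simp add: algebra_simps)
  qed
  \<comment> \<open>All integrability conditions below reduce to this: a polynomial of degree at
    most 2 times \<open>f\<close>.\<close>
  have polyI: "set_integrable lborel E g" if "\<And>x. x \<in> E \<Longrightarrow> g x = (a + b * x + c * x\<^sup>2) * f x" for g a b c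
    using poly[of a b c] unfolding set_integrable_def
    by (rule Bochner_Integration.integrable_cong[OF refl, THEN iffD1, rotated]) (use that in \<open>auto simp: indicator_def\<close>)
  define g1 where "g1 x = - \<theta> * (x - \<mu>) * f x" for x
  define g2 where "g2 x = (q x - \<theta> * (x - \<mu>)\<^sup>2) * f x" for x
  have D1: "((\<lambda>x. q x * f x) has_real_derivative g1 x) (at x)" if x: "x \<in> E" for x
  proof -
    have "(q has_real_derivative q1 + 2 * q2 * x) (at x)"
      unfolding q_def[abs_def] by (auto intro!: derivative_eq_intros)
    from DERIV_mult[OF this f[OF x]]
    have "((\<lambda>x. q x * f x) has_real_derivative (q1 + 2 * q2 * x + q x * r x) * f x) (at x)"
      by (simp add: algebra_simps)
    then show ?thesis using eq[OF x] by (simp add: g1_def q_def)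
  qed
  have D2: "((\<lambda>x. (x - \<mu>) * (q x * f x)) has_real_derivative g2 x) (at x)" if x: "x \<in> E" for x
  proof -
    have "((\<lambda>x. x - \<mu>) has_real_derivative 1) (at x)" by (auto intro!: derivative_eq_intros)
    from DERIV_mult[OF this D1[OF x]] show ?thesis
      by (simp add: g1_def g2_def power2_eq_square algebra_simps)
  qed
  have c: "isCont f x" if "x \<in> E" for x using DERIV_isCont[OF f[OF that]] .
  have c1: "isCont g1 x" if "x \<in> E" for x unfolding g1_def[abs_def] by (intro continuous_intros c[OF that])
  have c2: "isCont g2 x" if "x \<in> E" for x unfolding g2_def[abs_def] q_def by (intro continuous_intros c[OF that])
  have s1: "set_integrable lborel E g1"
    by (rule polyI[of _ "\<theta> * \<mu>" "- \<theta>" 0]) (simp add: g1_def algebra_simps)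
  have s2: "set_integrable lborel E g2"
    by (rule polyI[of _ "q0 - \<theta> * \<mu>\<^sup>2" "q1 + 2 * \<theta> * \<mu>" "q2 - \<theta>"]) (simp add: g2_def q_def power2_eq_square algebra_simps)
  have "(LINT x:E|lborel. g1 x) = 0 \<and> (LINT x:E|lborel. g2 x) = 0"
    using shape
  proof (elim disjE conjE)
    assume E: "E = UNIV"
    have fm[measurable]: "f \<in> borel_measurable borel" using \<open>(\<lambda>x. f x * indicator E x) \<in> borel_measurable borel\<close> E by simp
    have iq: "integrable lborel (\<lambda>x. (1 + \<bar>\<mu>\<bar>) * (q x * f x))"
      using poly[of q0 q1 q2] E by (simp add: set_integrable_def q_def)
    have qm[measurable]: "q \<in> borel_measurable borel" unfolding q_def[abs_def] by measurable
    \<comment> \<open>The two primitives are \<open>k x * (q x * f x)\<close> with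
      \<open>k x\<close> equal to 1 or to \<open>x - \<mu>\<close>; in both cases
      \<open>\<bar>k x / x\<bar>\<close> is at most \<open>1 + \<bar>\<mu>\<bar>\<close> on
      \<open>1 \<le> \<bar>x\<bar>\<close>.\<close>
    have ratio: "set_integrable lborel {x. 1 \<le> \<bar>x\<bar>} (\<lambda>x. k x * (q x * f x) / x)"
      if k: "\<And>x. 1 \<le> \<bar>x\<bar> \<Longrightarrow> \<bar>k x / x\<bar> \<le> 1 + \<bar>\<mu>\<bar>" and [measurable]: "k \<in> borel_measurable borel" for k
      unfolding set_integrable_def
    proof (rule Bochner_Integration.integrable_bound[OF iq])
      show "AE x in lborel. norm (indicator {x. 1 \<le> \<bar>x\<bar>} x *\<^sub>R (k x * (q x * f x) / x)) \<le> norm ((1 + \<bar>\<mu>\<bar>) * (q x * f x))"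
      proof (rule AE_I2)
        fix x :: real
        show "norm (indicator {x. 1 \<le> \<bar>x\<bar>} x *\<^sub>R (k x * (q x * f x) / x)) \<le> norm ((1 + \<bar>\<mu>\<bar>) * (q x * f x))"
        proof (cases "1 \<le> \<bar>x\<bar>")
          case True
          have "norm (indicator {x. 1 \<le> \<bar>x\<bar>} x *\<^sub>R (k x * (q x * f x) / x)) = \<bar>k x / x\<bar> * \<bar>q x * f x\<bar>"
            using True by (simp add: abs_mult)
          also have "\<dots> \<le> (1 + \<bar>\<mu>\<bar>) * \<bar>q x * f x\<bar>" by (intro mult_right_mono k True) auto
          also have "\<dots> = norm ((1 + \<bar>\<mu>\<bar>) * (q x * f x))" by (simp add: abs_mult)
          finally show ?thesis .
        qed simp
      qed
    qed measurable
    have "(LINT x:UNIV|lborel. g1 x) = 0"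
    proof (rule integral_derivative_UNIV[OF D1 c1])
      show "integrable lborel g1" using s1 E by (simp add: set_integrable_def)
      have "set_integrable lborel {x. 1 \<le> \<bar>x\<bar>} (\<lambda>x. 1 * (q x * f x) / x)"
      proof (rule ratio)
        fix x :: real assume "1 \<le> \<bar>x\<bar>"
        then have "1 / \<bar>x\<bar> \<le> 1" by (simp add: divide_le_eq)
        then show "\<bar>1 / x\<bar> \<le> 1 + \<bar>\<mu>\<bar>" by simp
      qed simp
      then show "set_integrable lborel {x. 1 \<le> \<bar>x\<bar>} (\<lambda>x. q x * f x / x)" by simp
    qed (simp_all add: E)
    moreover have "(LINT x:UNIV|lborel. g2 x) = 0"
    proof (rule integral_derivative_UNIV[OF D2 c2])
      show "integrable lborel g2" using s2 E by (simp add: set_integrable_def)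
      show "set_integrable lborel {x. 1 \<le> \<bar>x\<bar>} (\<lambda>x. (x - \<mu>) * (q x * f x) / x)"
      proof (rule ratio)
        fix x :: real assume x: "1 \<le> \<bar>x\<bar>"
        have "\<bar>(x - \<mu>) / x\<bar> = \<bar>1 - \<mu> / x\<bar>" using x by (simp add: diff_divide_distrib)
        also have "\<dots> \<le> 1 + \<bar>\<mu>\<bar> / \<bar>x\<bar>" by (rule order_trans[OF abs_triangle_ineq4]) simp
        also have "\<dots> \<le> 1 + \<bar>\<mu>\<bar>" using x by (auto simp: divide_le_eq mult_le_cancel_left1)
        finally show "\<bar>(x - \<mu>) / x\<bar> \<le> 1 + \<bar>\<mu>\<bar>" .
      qed measurable
    qed (simp_all add: E)
    ultimately show ?thesis by (simp add: E)
  next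
    assume E: "E = {0<..}" and q0: "q0 = 0"
    have "(LINT x:{0<..}|lborel. g1 x) = 0"
    proof (rule integral_derivative_Ioi[OF D1 c1])
      \<comment> \<open>Since \<open>q0 = 0\<close>, dividing \<open>q\<close> by \<open>x\<close>
        leaves a polynomial. The boundary term is thus controlled through \<open>q * f\<close> even
        where \<open>f\<close> itself is unbounded, as for CIR with \<open>b < 1\<close>.\<close>
      show "set_integrable lborel {0<..} (\<lambda>x. q x * f x / x)"
        unfolding E[symmetric]
        by (rule polyI[of _ q1 q2 0]) (auto simp: E q_def q0 power2_eq_square field_simps)
    qed (use s1 in \<open>simp_all add: E\<close>)
    moreover have "(LINT x:{0<..}|lborel. g2 x) = 0"
    proof (rule integral_derivative_Ioi[OF D2 c2])
      show "set_integrable lborel {0<..} (\<lambda>x. (x - \<mu>) * (q x * f x) / x)"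
        unfolding E[symmetric]
        by (rule polyI[of _ "- \<mu> * q1" "q1 - \<mu> * q2" q2]) (auto simp: E q_def q0 power2_eq_square field_simps)
    qed (use s2 in \<open>simp_all add: E\<close>)
    ultimately show ?thesis by (simp add: E)
  next
    assume E: "E = {-1<..<1}" and q: "q0 = - q2" "q1 = 0"
    \<comment> \<open>\<open>q\<close> vanishes at both ends, so either boundary weight cancels
      against one of its factors.\<close>
    have qf: "q x = - q2 * (1 + x) * (1 - x)" for x by (simp add: q_def q power2_eq_square algebra_simps)
    have l: "q x * y / (1 - x) = - q2 * (1 + x) * y" "q x * y / (x - (-1)) = - q2 * (1 - x) * y" if "x \<in> E" for x y
    proof -
      have n: "1 - x \<noteq> 0" "x - (-1) \<noteq> 0" using that E by auto
      show "q x * y / (1 - x) = - q2 * (1 + x) * y" "q x * y / (x - (-1)) = - q2 * (1 - x) * y"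
        unfolding nonzero_divide_eq_eq[OF n(1)] nonzero_divide_eq_eq[OF n(2)] qf by (simp_all add: algebra_simps)
    qed
    have l': "z * (q x * y) / (1 - x) = z * (- q2 * (1 + x) * y)" "z * (q x * y) / (x - (-1)) = z * (- q2 * (1 - x) * y)" if "x \<in> E" for x y z
      using l[OF that, of y] by (metis times_divide_eq_right)+
    have "(LINT x:{-1<..<1}|lborel. g1 x) = 0"
    proof (rule integral_derivative_Ioo[OF D1 c1])
      show "set_integrable lborel {-1<..<1} (\<lambda>x. q x * f x / (1 - x))"
        unfolding E[symmetric] by (rule polyI[of _ "- q2" "- q2" 0]) (simp only: l, simp add: algebra_simps)
      show "set_integrable lborel {-1<..<1} (\<lambda>x. q x * f x / (x - (-1)))"
        unfolding E[symmetric] by (rule polyI[of _ "- q2" "q2" 0]) (simp only: l, simp add: algebra_simps)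
    qed (use s1 in \<open>simp_all add: E\<close>)
    moreover have "(LINT x:{-1<..<1}|lborel. g2 x) = 0"
    proof (rule integral_derivative_Ioo[OF D2 c2])
      show "set_integrable lborel {-1<..<1} (\<lambda>x. (x - \<mu>) * (q x * f x) / (1 - x))"
        unfolding E[symmetric] by (rule polyI[of _ "\<mu> * q2" "\<mu> * q2 - q2" "- q2"]) (simp only: l', simp add: power2_eq_square algebra_simps)
      show "set_integrable lborel {-1<..<1} (\<lambda>x. (x - \<mu>) * (q x * f x) / (x - (-1)))"
        unfolding E[symmetric] by (rule polyI[of _ "\<mu> * q2" "- q2 - \<mu> * q2" "q2"]) (simp only: l', simp add: power2_eq_square algebra_simps)
    qed (use s2 in \<open>simp_all add: E\<close>)
    ultimately show ?thesis by (simp add: E)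
  qed
  then show "(\<integral>x. - \<theta> * (x - \<mu>) * (f x * indicator E x) \<partial>lborel) = 0"
    "(\<integral>x. (q0 + q1 * x + q2 * x\<^sup>2 - \<theta> * (x - \<mu>)\<^sup>2) * (f x * indicator E x) \<partial>lborel) = 0"
    by (simp_all add: set_lebesgue_integral_def g1_def g2_def q_def mult_ac)
qed

text \<open>Derivatives are carried as \<open>f x * r\<close> because logarithmic derivatives add
  under multiplication: the ratio \<open>r\<close> in the Pearson equation can be assembled factor
  by factor, and normalising constants leave it unchanged.\<close>

lemma logderiv_mult:
  fixes f g :: "real \<Rightarrow> real"
  assumes "(f has_real_derivative f x * r) (at x)" "(g has_real_derivative g x * s) (at x)"
  shows "((\<lambda>x. f x * g x) has_real_derivative f x * g x * (r + s)) (at x)"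
  using DERIV_mult[OF assms] by (simp add: algebra_simps)

lemma logderiv_powr:
  fixes g :: "real \<Rightarrow> real"
  assumes "0 < g x" "(g has_real_derivative g') (at x)"
  shows "((\<lambda>x. g x powr c) has_real_derivative g x powr c * (c * g' / g x)) (at x)"
  using DERIV_fun_powr[OF assms(2,1), of c] assms(1) by (simp add: powr_diff field_simps)

lemma logderiv_exp:
  fixes g :: "real \<Rightarrow> real"
  assumes "(g has_real_derivative g') (at x)"
  shows "((\<lambda>x. exp (g x)) has_real_derivative exp (g x) * g') (at x)"
  using DERIV_fun_exp[OF assms] .

lemma logderiv_cmult:
  fixes g :: "real \<Rightarrow> real"
  assumes "(g has_real_derivative g x * r) (at x)"
  shows "((\<lambda>x. c * g x) has_real_derivative c * g x * r) (at x)"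
  using DERIV_cmult[OF assms, of c] by (simp add: mult.assoc)

lemma logderiv_multc:
  fixes g :: "real \<Rightarrow> real"
  assumes "(g has_real_derivative g x * r) (at x)"
  shows "((\<lambda>x. g x * c) has_real_derivative g x * c * r) (at x)"
  using logderiv_cmult[OF assms, of c] by (simp add: mult_ac)

text \<open>The last two clauses are the first-moment identity and the variance balance, which
  equates half the mean squared diffusion coefficient with \<open>\<theta>\<close> times the mean
  square of \<open>x - \<mu>\<close>. The coefficient is required to be quadratic on the closure
  only, as the radicand can be negative outside.\<close>

definition pearson_moments :: "real \<Rightarrow> pearson \<Rightarrow> real \<Rightarrow> real \<Rightarrow> real \<Rightarrow> real \<Rightarrow> bool" where
  "pearson_moments \<theta> p \<mu> d0 d1 d2 \<longleftrightarrow>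
     (\<forall>x. drift \<theta> p x = - \<theta> * (x - \<mu>)) \<and>
     (\<forall>x\<in>closure (state_space p). (diffusion \<theta> p x)\<^sup>2 = d0 + d1 * x + d2 * x\<^sup>2) \<and>
     (\<integral>x. - \<theta> * (x - \<mu>) * stationary_density p x \<partial>lborel) = 0 \<and>
     (\<integral>x. (d0 / 2 + d1 / 2 * x + d2 / 2 * x\<^sup>2 - \<theta> * (x - \<mu>)\<^sup>2) * stationary_density p x \<partial>lborel) = 0"

text \<open>\<open>q\<close> is half the squared diffusion coefficient, and \<open>eq\<close> is the
  stationary equation \<open>(q * f)' = - \<theta> * (x - \<mu>) * f\<close>, the vanishing of the
  probability flux, divided by \<open>f\<close>.\<close>

lemma pearson_momentsI:
  assumes i: "integrable lborel (stationary_density p)" "integrable lborel (\<lambda>x. x\<^sup>2 * stationary_density p x)"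
    and dr: "\<And>x. drift \<theta> p x = - \<theta> * (x - \<mu>)"
    and di: "\<And>x. x \<in> closure (state_space p) \<Longrightarrow> (diffusion \<theta> p x)\<^sup>2 = 2 * (q0 + q1 * x + q2 * x\<^sup>2)"
    and f: "\<And>x. x \<in> state_space p \<Longrightarrow> (density_formula p has_real_derivative density_formula p x * r x) (at x)"
    and eq: "\<And>x. x \<in> state_space p \<Longrightarrow> q1 + 2 * q2 * x + (q0 + q1 * x + q2 * x\<^sup>2) * r x = - \<theta> * (x - \<mu>)"
    and shape: "state_space p = UNIV \<or> state_space p = {0<..} \<and> q0 = 0 \<or> state_space p = {-1<..<1} \<and> q0 = - q2 \<and> q1 = 0"
  shows "pearson_moments \<theta> p \<mu> (2 * q0) (2 * q1) (2 * q2)"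
proof -
  have m: "stationary_density p = (\<lambda>x. density_formula p x * indicator (state_space p) x)"
    by (simp add: stationary_density_def[abs_def])
  show ?thesis
    unfolding pearson_moments_def
    using dr di pearson_equation_integrals[OF f eq i[unfolded m] shape] by (auto simp: m algebra_simps)
qed

text \<open>Each family contributes its logarithmic derivative \<open>r\<close> and its polynomial
  \<open>q\<close>. Where \<open>k\<close> occurs it is a common factor of the coefficients of
  \<open>q\<close>; the product relation recorded with it recovers \<open>\<theta>\<close> at the
  end of the computation.\<close>

lemma pearson_moments_exist:
  assumes \<theta>: "0 < \<theta>" and p: "admissible p"
    and i: "integrable lborel (stationary_density p)" "integrable lborel (\<lambda>x. x\<^sup>2 * stationary_density p x)"
  shows "\<exists>\<mu> d0 d1 d2. pearson_moments \<theta> p \<mu> d0 d1 d2"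
proof (cases p)
  case (OU \<mu> \<sigma>)
  have s: "\<sigma> \<noteq> 0" using p OU by simp
  have "pearson_moments \<theta> p \<mu> (2 * (\<theta> * \<sigma>\<^sup>2)) (2 * 0) (2 * 0)"
  proof (rule pearson_momentsI[OF i, where r="\<lambda>x. - (x - \<mu>) / \<sigma>\<^sup>2"])
    fix x
    show "(density_formula p has_real_derivative density_formula p x * (- (x - \<mu>) / \<sigma>\<^sup>2)) (at x)"
      unfolding OU density_formula.simps(1)[abs_def] normal_density_def[abs_def]
      by (rule logderiv_cmult, rule logderiv_exp) (use s in \<open>auto intro!: derivative_eq_intros simp: field_simps\<close>)
  qed (use s \<theta> in \<open>simp_all add: OU field_simps\<close>)
  then show ?thesis by blast
next
  case (CIR a b)
  have s: "0 < a" "0 < b" using p CIR by auto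
  have "pearson_moments \<theta> p (b / a) (2 * 0) (2 * (\<theta> / a)) (2 * 0)"
  proof (rule pearson_momentsI[OF i, where r="\<lambda>x. (b - 1) * 1 / x + - a"])
    fix x assume "x \<in> state_space p"
    then have x: "0 < x" by (simp add: CIR)
    have "((\<lambda>x. a powr b / Gamma b * x powr (b - 1) * exp (- a * x)) has_real_derivative
      a powr b / Gamma b * x powr (b - 1) * exp (- a * x) * ((b - 1) * 1 / x + - a)) (at x)"
      by (rule logderiv_mult, rule logderiv_cmult, rule logderiv_powr[where g="\<lambda>x. x", OF x DERIV_ident], rule logderiv_exp)
        (auto intro!: derivative_eq_intros)
    then show "(density_formula p has_real_derivative density_formula p x * ((b - 1) * 1 / x + - a)) (at x)"
      by (simp add: CIR density_formula.simps(2)[abs_def])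
    show "\<theta> / a + 2 * 0 * x + (0 + \<theta> / a * x + 0 * x\<^sup>2) * ((b - 1) * 1 / x + - a) = - \<theta> * (x - b / a)"
      using x s by (simp add: field_simps)
  qed (use s \<theta> in \<open>simp_all add: CIR\<close>)
  then show ?thesis by blast
next
  case (Jacobi a b)
  have s: "-1 < a" "-1 < b" using p Jacobi by auto
  define k where "k = \<theta> / (a + b + 2)"
  have k: "0 < k" "k * (a + b + 2) = \<theta>" using s \<theta> by (auto simp: k_def)
  have "pearson_moments \<theta> p ((b - a) / (a + b + 2)) (2 * k) (2 * 0) (2 * (- k))"
  proof (rule pearson_momentsI[OF i, where r="\<lambda>x. a * (- 1) / (1 - x) + b * 1 / (1 + x)"])
    fix x assume "x \<in> state_space p"
    then have x: "0 < 1 - x" "0 < 1 + x" by (auto simp: Jacobi)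
    have A: "((\<lambda>x. (1 - x) powr a) has_real_derivative (1 - x) powr a * (a * (- 1) / (1 - x))) (at x)"
      by (rule logderiv_powr[where g="\<lambda>x. 1 - x"]) (use x in \<open>auto intro!: derivative_eq_intros\<close>)
    have B: "((\<lambda>x. (1 + x) powr b) has_real_derivative (1 + x) powr b * (b * 1 / (1 + x))) (at x)"
      by (rule logderiv_powr[where g="\<lambda>x. 1 + x"]) (use x in \<open>auto intro!: derivative_eq_intros\<close>)
    have "((\<lambda>x. (1 - x) powr a * (1 + x) powr b *
     (Gamma (a + b + 2) / (Gamma (a + 1) * Gamma (b + 1) * 2 powr (a + b + 1)))) has_real_derivative
     (1 - x) powr a * (1 + x) powr b *
     (Gamma (a + b + 2) / (Gamma (a + 1) * Gamma (b + 1) * 2 powr (a + b + 1))) * (a * (- 1) / (1 - x) + b * 1 / (1 + x))) (at x)"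
      by (rule logderiv_multc[where g="\<lambda>x. (1 - x) powr a * (1 + x) powr b",
          OF logderiv_mult[where f="\<lambda>x. (1 - x) powr a" and g="\<lambda>x. (1 + x) powr b", OF A B]])
    then show "(density_formula p has_real_derivative density_formula p x * (a * (- 1) / (1 - x) + b * 1 / (1 + x))) (at x)"
      by (simp add: Jacobi density_formula.simps(3)[abs_def])
    have g: "0 + 2 * - k * x + (k + 0 * x + - k * x\<^sup>2) * y = - 2 * k * x + k * ((1 - x\<^sup>2) * y)" for y
      by (simp add: algebra_simps)
    have "(1 - x\<^sup>2) * (a * (- 1) / (1 - x) + b * 1 / (1 + x)) = (1 - x) * (1 + x) * (a * (- 1) / (1 - x)) + (1 - x) * (1 + x) * (b * 1 / (1 + x))"
      by (simp add: power2_eq_square algebra_simps)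
    also have "\<dots> = - a * (1 + x) + b * (1 - x)" using x by simp
    finally have "(1 - x\<^sup>2) * (a * (- 1) / (1 - x) + b * 1 / (1 + x)) = - a * (1 + x) + b * (1 - x)" .
    then have "0 + 2 * - k * x + (k + 0 * x + - k * x\<^sup>2) * (a * (- 1) / (1 - x) + b * 1 / (1 + x)) = - 2 * k * x + k * (- a * (1 + x) + b * (1 - x))"
      unfolding g by (simp only:)
    also have "\<dots> = - (k * (a + b + 2)) * x + k * (b - a)" by (simp add: algebra_simps)
    also have "\<dots> = - \<theta> * (x - (b - a) / (a + b + 2))" unfolding k(2) using s by (simp add: k_def field_simps)
    finally show "0 + 2 * - k * x + (k + 0 * x + - k * x\<^sup>2) * (a * (- 1) / (1 - x) + b * 1 / (1 + x)) = - \<theta> * (x - (b - a) / (a + b + 2))" .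
  next
    fix x assume "x \<in> closure (state_space p)"
    then have "\<bar>x\<bar> \<le> 1" by (auto simp: Jacobi)
    then have "x\<^sup>2 \<le> 1" by (simp add: abs_square_le_1)
    then have "0 \<le> 2 * (k * (1 - x\<^sup>2))" using k by simp
    moreover have "2 * \<theta> / (a + b + 2) * (1 - x\<^sup>2) = 2 * (k * (1 - x\<^sup>2))" by (simp add: k_def)
    ultimately have "(diffusion \<theta> p x)\<^sup>2 = 2 * (k * (1 - x\<^sup>2))"
      by (simp only: Jacobi diffusion.simps real_sqrt_pow2)
    then show "(diffusion \<theta> p x)\<^sup>2 = 2 * (k + 0 * x + - k * x\<^sup>2)" by (simp add: algebra_simps)
  qed (simp_all add: Jacobi)
  then show ?thesis by blast
next
  case (Fisher_Snedecor \<alpha> \<beta>)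
  have s: "0 < \<alpha>" "2 < \<beta>" using p Fisher_Snedecor by auto
  define k where "k = 2 * \<theta> / (\<alpha> * (\<beta> - 2))"
  have k: "0 < k" "k * (\<alpha> * (\<beta> - 2)) = 2 * \<theta>" using s \<theta> by (auto simp: k_def)
  have "pearson_moments \<theta> p (\<beta> / (\<beta> - 2)) (2 * 0) (2 * (k * \<beta>)) (2 * (k * \<alpha>))"
  proof (rule pearson_momentsI[OF i, where r="\<lambda>x. - (1 / x) + \<alpha> / 2 * (\<alpha> * \<beta> / (\<alpha> * x + \<beta>)\<^sup>2) / (\<alpha> * x / (\<alpha> * x + \<beta>)) +
      \<beta> / 2 * (- \<alpha> * \<beta> / (\<alpha> * x + \<beta>)\<^sup>2) / (\<beta> / (\<alpha> * x + \<beta>))"])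
    fix x assume "x \<in> state_space p"
    then have x: "0 < x" by (simp add: Fisher_Snedecor)
    let ?r = "- (1 / x) + \<alpha> / 2 * (\<alpha> * \<beta> / (\<alpha> * x + \<beta>)\<^sup>2) / (\<alpha> * x / (\<alpha> * x + \<beta>)) +
      \<beta> / 2 * (- \<alpha> * \<beta> / (\<alpha> * x + \<beta>)\<^sup>2) / (\<beta> / (\<alpha> * x + \<beta>))"
    define y where "y = \<alpha> * x + \<beta>"
    have y: "0 < y" using x s by (simp add: y_def add_pos_pos)
    have "((\<lambda>x. 1 / (x * Beta (\<alpha> / 2) (\<beta> / 2)) * (\<alpha> * x / (\<alpha> * x + \<beta>)) powr (\<alpha> / 2) * (\<beta> / (\<alpha> * x + \<beta>)) powr (\<beta> / 2))
      has_real_derivative 1 / (x * Beta (\<alpha> / 2) (\<beta> / 2)) * (\<alpha> * x / (\<alpha> * x + \<beta>)) powr (\<alpha> / 2) * (\<beta> / (\<alpha> * x + \<beta>)) powr (\<beta> / 2) * ?r) (at x)"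
    proof (rule logderiv_mult, rule logderiv_mult)
      have "((\<lambda>x. 1 / Beta (\<alpha> / 2) (\<beta> / 2) * (1 / x)) has_real_derivative 1 / Beta (\<alpha> / 2) (\<beta> / 2) * (1 / x) * (- (1 / x))) (at x)"
        by (rule logderiv_cmult) (use x in \<open>auto intro!: derivative_eq_intros simp: power2_eq_square field_simps\<close>)
      then show "((\<lambda>x. 1 / (x * Beta (\<alpha> / 2) (\<beta> / 2))) has_real_derivative 1 / (x * Beta (\<alpha> / 2) (\<beta> / 2)) * - (1 / x)) (at x)"
        by (simp add: mult.commute)
      show "((\<lambda>x. (\<alpha> * x / (\<alpha> * x + \<beta>)) powr (\<alpha> / 2)) has_real_derivative
        (\<alpha> * x / (\<alpha> * x + \<beta>)) powr (\<alpha> / 2) * (\<alpha> / 2 * (\<alpha> * \<beta> / (\<alpha> * x + \<beta>)\<^sup>2) / (\<alpha> * x / (\<alpha> * x + \<beta>)))) (at x)"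
        by (rule logderiv_powr) (use x s y in \<open>auto intro!: derivative_eq_intros simp: y_def[symmetric] power2_eq_square field_simps\<close>, auto simp: y_def algebra_simps)
      show "((\<lambda>x. (\<beta> / (\<alpha> * x + \<beta>)) powr (\<beta> / 2)) has_real_derivative
        (\<beta> / (\<alpha> * x + \<beta>)) powr (\<beta> / 2) * (\<beta> / 2 * (- \<alpha> * \<beta> / (\<alpha> * x + \<beta>)\<^sup>2) / (\<beta> / (\<alpha> * x + \<beta>)))) (at x)"
      proof (rule logderiv_powr)
        show "0 < \<beta> / (\<alpha> * x + \<beta>)" using y s by (simp add: y_def)
        have n: "\<alpha> * x + \<beta> \<noteq> 0" using y by (simp add: y_def)
        show "((\<lambda>x. \<beta> / (\<alpha> * x + \<beta>)) has_real_derivative - \<alpha> * \<beta> / (\<alpha> * x + \<beta>)\<^sup>2) (at x)"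
          using n by (auto intro!: derivative_eq_intros simp: power2_eq_square)
      qed
    qed
    then show "(density_formula p has_real_derivative density_formula p x * ?r) (at x)"
      by (simp add: Fisher_Snedecor density_formula.simps(4)[abs_def])
    have r: "?r = - (1 / x) + \<alpha> * \<beta> / (2 * x * y) - \<alpha> * \<beta> / (2 * y)"
      unfolding y_def[symmetric] using x y s by (simp add: field_simps power2_eq_square)
    have "(0 + k * \<beta> * x + k * \<alpha> * x\<^sup>2) * ?r = k * (x * y) * (- (1 / x) + \<alpha> * \<beta> / (2 * x * y) - \<alpha> * \<beta> / (2 * y))"
      unfolding r by (simp add: y_def power2_eq_square algebra_simps)
    also have "\<dots> = - k * y + k * (\<alpha> * \<beta> / 2) - k * (\<alpha> * \<beta> / 2) * x" using x y by (simp add: field_simps)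
    finally have e: "(0 + k * \<beta> * x + k * \<alpha> * x\<^sup>2) * ?r = - k * y + k * (\<alpha> * \<beta> / 2) - k * (\<alpha> * \<beta> / 2) * x" .
    have "k * \<beta> + 2 * (k * \<alpha>) * x + (0 + k * \<beta> * x + k * \<alpha> * x\<^sup>2) * ?r = k * \<alpha> * x + k * (\<alpha> * \<beta> / 2) - k * (\<alpha> * \<beta> / 2) * x"
      unfolding e by (simp add: y_def algebra_simps)
    also have "\<dots> = - (k * (\<alpha> * (\<beta> - 2))) / 2 * x + k * \<alpha> * \<beta> / 2" by (simp add: field_simps)
    also have "\<dots> = - \<theta> * (x - \<beta> / (\<beta> - 2))" unfolding k(2) using s by (simp add: k_def field_simps)
    finally show "k * \<beta> + 2 * (k * \<alpha>) * x + (0 + k * \<beta> * x + k * \<alpha> * x\<^sup>2) * ?r = - \<theta> * (x - \<beta> / (\<beta> - 2))" .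
  next
    fix x assume "x \<in> closure (state_space p)"
    then have x: "0 \<le> x" by (simp add: Fisher_Snedecor)
    have "4 * \<theta> / (\<alpha> * (\<beta> - 2)) * x * (\<alpha> * x + \<beta>) = 2 * k * x * (\<alpha> * x + \<beta>)" by (simp add: k_def)
    moreover have "0 \<le> 2 * k * x * (\<alpha> * x + \<beta>)" using k s x by simp
    ultimately show "(diffusion \<theta> p x)\<^sup>2 = 2 * (0 + k * \<beta> * x + k * \<alpha> * x\<^sup>2)"
      by (simp add: Fisher_Snedecor power2_eq_square algebra_simps)
  qed (simp_all add: Fisher_Snedecor)
  then show ?thesis by blast
next
  case (Reciprocal_Gamma \<alpha> \<beta>)
  have s: "0 < \<alpha>" "1 < \<beta>" using p Reciprocal_Gamma by auto
  have "pearson_moments \<theta> p (\<alpha> / (\<beta> - 1)) (2 * 0) (2 * 0) (2 * (\<theta> / (\<beta> - 1)))"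
  proof (rule pearson_momentsI[OF i, where r="\<lambda>x. (- \<beta> - 1) * 1 / x + \<alpha> / x\<^sup>2"])
    fix x assume "x \<in> state_space p"
    then have x: "0 < x" by (simp add: Reciprocal_Gamma)
    have "((\<lambda>x. \<alpha> powr \<beta> / Gamma \<beta> * x powr (- \<beta> - 1) * exp (- \<alpha> / x)) has_real_derivative
      \<alpha> powr \<beta> / Gamma \<beta> * x powr (- \<beta> - 1) * exp (- \<alpha> / x) * ((- \<beta> - 1) * 1 / x + \<alpha> / x\<^sup>2)) (at x)"
      by (rule logderiv_mult, rule logderiv_cmult, rule logderiv_powr[where g="\<lambda>x. x", OF x DERIV_ident], rule logderiv_exp)
        (use x in \<open>auto intro!: derivative_eq_intros simp: power2_eq_square\<close>)
    then show "(density_formula p has_real_derivative density_formula p x * ((- \<beta> - 1) * 1 / x + \<alpha> / x\<^sup>2)) (at x)"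
      by (simp add: Reciprocal_Gamma density_formula.simps(5)[abs_def])
    show "0 + 2 * (\<theta> / (\<beta> - 1)) * x + (0 + 0 * x + \<theta> / (\<beta> - 1) * x\<^sup>2) * ((- \<beta> - 1) * 1 / x + \<alpha> / x\<^sup>2) = - \<theta> * (x - \<alpha> / (\<beta> - 1))"
    proof -
      define k where "k = \<theta> / (\<beta> - 1)"
      have k: "k * (\<beta> - 1) = \<theta>" using s by (simp add: k_def)
      have e: "x\<^sup>2 * ((- \<beta> - 1) * 1 / x + \<alpha> / x\<^sup>2) = (- \<beta> - 1) * x + \<alpha>"
        using x by (simp add: distrib_left power2_eq_square)
      have "0 + 2 * k * x + (0 + 0 * x + k * x\<^sup>2) * y = 2 * k * x + k * (x\<^sup>2 * y)" for y by simp
      from this[of "(- \<beta> - 1) * 1 / x + \<alpha> / x\<^sup>2"]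
      have "0 + 2 * k * x + (0 + 0 * x + k * x\<^sup>2) * ((- \<beta> - 1) * 1 / x + \<alpha> / x\<^sup>2) = - (k * (\<beta> - 1)) * x + k * \<alpha>"
        unfolding e by (simp add: algebra_simps)
      also have "\<dots> = - \<theta> * (x - \<alpha> / (\<beta> - 1))" unfolding k by (simp add: k_def algebra_simps)
      finally show ?thesis by (simp only: k_def)
    qed
  qed (use s \<theta> in \<open>simp_all add: Reciprocal_Gamma\<close>)
  then show ?thesis by blast
next
  case (Student \<delta> \<mu> \<mu>' \<nu>)
  have s: "0 < \<delta>" "1 < \<nu>" using p Student by auto
  define k where "k = \<theta> / (\<nu> - 1)"
  have k: "0 < k" "k * (\<nu> - 1) = \<theta>" using s \<theta> by (auto simp: k_def)
  have "pearson_moments \<theta> p \<mu> (2 * (k * (\<delta>\<^sup>2 + \<mu>'\<^sup>2))) (2 * (- 2 * k * \<mu>')) (2 * k)"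
  proof (rule pearson_momentsI[OF i, where r="\<lambda>x. (\<mu> - \<mu>') * (\<nu> - 1) / \<delta> * ((1 / \<delta>) / (1 + ((x - \<mu>') / \<delta>)\<^sup>2)) +
       (- (\<nu> + 1) / 2) * (2 * ((x - \<mu>') / \<delta>) / \<delta>) / (1 + ((x - \<mu>') / \<delta>)\<^sup>2)"])
    fix x
    \<comment> \<open>In the standardised variable \<open>q\<close> becomes
      \<open>k * \<delta>\<^sup>2 * (1 + u\<^sup>2)\<close>, which cancels the denominators of
      \<open>r\<close>.\<close>
    define u where "u = (x - \<mu>') / \<delta>"
    have x: "x = \<mu>' + \<delta> * u" using s by (simp add: u_def)
    have u: "0 < 1 + u\<^sup>2" by (simp add: add_pos_nonneg)
    let ?r = "(\<mu> - \<mu>') * (\<nu> - 1) / \<delta> * ((1 / \<delta>) / (1 + ((x - \<mu>') / \<delta>)\<^sup>2)) +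
       (- (\<nu> + 1) / 2) * (2 * ((x - \<mu>') / \<delta>) / \<delta>) / (1 + ((x - \<mu>') / \<delta>)\<^sup>2)"
    have "(student_weight \<delta> \<mu> \<mu>' \<nu> has_real_derivative student_weight \<delta> \<mu> \<mu>' \<nu> x * ?r) (at x)"
      unfolding student_weight_def[abs_def]
    proof (rule logderiv_mult, rule logderiv_exp)
      show "((\<lambda>x. (\<mu> - \<mu>') * (\<nu> - 1) / \<delta> * arctan ((x - \<mu>') / \<delta>)) has_real_derivative
        (\<mu> - \<mu>') * (\<nu> - 1) / \<delta> * ((1 / \<delta>) / (1 + ((x - \<mu>') / \<delta>)\<^sup>2))) (at x)"
        using s by (intro DERIV_cmult) (auto intro!: derivative_eq_intros simp: divide_inverse)
      show "((\<lambda>x. (1 + ((x - \<mu>') / \<delta>)\<^sup>2) powr (- (\<nu> + 1) / 2)) has_real_derivative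
        (1 + ((x - \<mu>') / \<delta>)\<^sup>2) powr (- (\<nu> + 1) / 2) * (- (\<nu> + 1) / 2 * (2 * ((x - \<mu>') / \<delta>) / \<delta>) / (1 + ((x - \<mu>') / \<delta>)\<^sup>2))) (at x)"
        by (rule logderiv_powr) (use u s in \<open>auto intro!: derivative_eq_intros simp: u_def\<close>)
    qed
    from logderiv_cmult[OF this, of "1 / (LINT y|lborel. student_weight \<delta> \<mu> \<mu>' \<nu> y)"]
    show "(density_formula p has_real_derivative density_formula p x * ?r) (at x)"
      by (simp add: Student density_formula.simps(6)[abs_def])
    have q: "k * (\<delta>\<^sup>2 + \<mu>'\<^sup>2) + - 2 * k * \<mu>' * x + k * x\<^sup>2 = k * \<delta>\<^sup>2 * (1 + u\<^sup>2)"
      by (simp add: x power2_eq_square algebra_simps)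
    have "k * \<delta>\<^sup>2 * (1 + u\<^sup>2) * ?r = k * \<delta>\<^sup>2 * ((\<mu> - \<mu>') * (\<nu> - 1) / \<delta> * (1 / \<delta>) + (- (\<nu> + 1) / 2) * (2 * u / \<delta>))"
    proof -
      have g: "w * (c1 * (c2 / w) + c3 / w) = c1 * c2 + c3" if "0 < w" for w c1 c2 c3 :: real
        using that by (simp add: distrib_left)
      show ?thesis unfolding u_def[symmetric] mult.assoc[of "k * \<delta>\<^sup>2"] g[OF u] ..
    qed
    also have "\<dots> = (k * (\<nu> - 1)) * (\<mu> - \<mu>') - k * \<delta> * (\<nu> + 1) * u" using s by (simp add: field_simps power2_eq_square)
    finally have e: "k * \<delta>\<^sup>2 * (1 + u\<^sup>2) * ?r = \<theta> * (\<mu> - \<mu>') - k * \<delta> * (\<nu> + 1) * u" unfolding k(2) .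
    have "- 2 * k * \<mu>' + 2 * k * x + (\<theta> * (\<mu> - \<mu>') - k * \<delta> * (\<nu> + 1) * u) = \<theta> * (\<mu> - \<mu>') - (k * (\<nu> - 1)) * (\<delta> * u)"
      by (simp add: x algebra_simps)
    also have "\<dots> = - \<theta> * (x - \<mu>)" unfolding k(2) by (simp add: x algebra_simps)
    finally show "- 2 * k * \<mu>' + 2 * k * x + (k * (\<delta>\<^sup>2 + \<mu>'\<^sup>2) + - 2 * k * \<mu>' * x + k * x\<^sup>2) * ?r = - \<theta> * (x - \<mu>)"
      unfolding q e .
    have "2 * \<theta> * \<delta>\<^sup>2 / (\<nu> - 1) * (1 + ((x - \<mu>') / \<delta>)\<^sup>2) = 2 * (k * \<delta>\<^sup>2 * (1 + u\<^sup>2))" by (simp add: k_def u_def)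
    moreover have "0 \<le> 2 * (k * \<delta>\<^sup>2 * (1 + u\<^sup>2))" using k by simp
    ultimately show "(diffusion \<theta> p x)\<^sup>2 = 2 * (k * (\<delta>\<^sup>2 + \<mu>'\<^sup>2) + - 2 * k * \<mu>' * x + k * x\<^sup>2)"
      unfolding q by (simp only: Student diffusion.simps real_sqrt_pow2)
  qed (simp_all add: Student)
  then show ?thesis by blast
qed

section \<open>The inverse subordinator\<close>

text \<open>Time is approximated from the right by grid points; for each mesh only countably many of
  them occur, so joint measurability reduces to that of \<open>Z\<close> at fixed times. The
  \<open>max 0\<close> extends the process to all real times.\<close>

lemma right_continuous_measurable_pair:
  fixes Z :: "real \<Rightarrow> 'b \<Rightarrow> real"
  assumes m: "\<And>y. 0 \<le> y \<Longrightarrow> Z y \<in> borel_measurable N"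
    and c: "\<And>\<omega> y. \<omega> \<in> space N \<Longrightarrow> 0 \<le> y \<Longrightarrow> continuous (at_right y) (\<lambda>y. Z y \<omega>)"
  shows "(\<lambda>z. Z (max 0 (fst z)) (snd z)) \<in> borel_measurable (borel \<Otimes>\<^sub>M N)"
proof -
  \<comment> \<open>Floor plus 1, so that the grid point lies strictly to the right of
    \<open>max 0 y\<close> even when that is a grid point itself; \<open>at_right\<close> asks for
    this.\<close>
  define a where "a n y = real (nat \<lfloor>max 0 y * real (Suc n)\<rfloor> + 1) / real (Suc n)" for n and y :: real
  have a: "max 0 y < a n y" "a n y \<le> max 0 y + inverse (real (Suc n))" for n y
  proof -
    define m where "m = max 0 y"
    have "0 \<le> m" by (simp add: m_def)
    let ?x = "m * real (Suc n)"
    have "0 \<le> ?x" using \<open>0 \<le> m\<close> by simp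
    then have "real (nat \<lfloor>?x\<rfloor>) = of_int \<lfloor>?x\<rfloor>" by simp
    then have "?x < real (nat \<lfloor>?x\<rfloor> + 1)" "real (nat \<lfloor>?x\<rfloor> + 1) \<le> ?x + 1" by linarith+
    then show "max 0 y < a n y" "a n y \<le> max 0 y + inverse (real (Suc n))"
      unfolding a_def m_def[symmetric] by (simp_all add: pos_less_divide_eq pos_divide_le_eq distrib_right del: of_nat_Suc of_nat_add)
  qed
  have lim: "filterlim (\<lambda>n. a n y) (at_right (max 0 y)) sequentially" for y
    unfolding filterlim_at
  proof (intro conjI)
    show "\<forall>\<^sub>F n in sequentially. a n y \<in> {max 0 y<..} \<and> a n y \<noteq> max 0 y" using a(1) by (simp add: less_imp_neq[symmetric] less_imp_neq)
    have "(\<lambda>n. max 0 y + inverse (real (Suc n))) \<longlonglongrightarrow> max 0 y + 0" by (intro tendsto_intros LIMSEQ_inverse_real_of_nat)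
    then have up: "(\<lambda>n. max 0 y + inverse (real (Suc n))) \<longlonglongrightarrow> max 0 y" by simp
    show "(\<lambda>n. a n y) \<longlonglongrightarrow> max 0 y"
      by (rule tendsto_sandwich[OF _ _ tendsto_const up]) (use a in \<open>auto intro!: always_eventually less_imp_le\<close>)
  qed
  show ?thesis
  proof (rule borel_measurable_LIMSEQ_real[where u="\<lambda>n z. Z (a n (fst z)) (snd z)"])
    fix z :: "real \<times> 'b" assume "z \<in> space (borel \<Otimes>\<^sub>M N)"
    then have "snd z \<in> space N" by (auto simp: space_pair_measure)
    from c[OF this, of "max 0 (fst z)"] have "((\<lambda>y. Z y (snd z)) \<longlongrightarrow> Z (max 0 (fst z)) (snd z)) (at_right (max 0 (fst z)))"
      by (simp add: continuous_within)
    then show "(\<lambda>n. Z (a n (fst z)) (snd z)) \<longlonglongrightarrow> Z (max 0 (fst z)) (snd z)"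
      by (rule filterlim_compose[OF _ lim])
  next
    fix n
    have "(\<lambda>z. Z (real (nat \<lfloor>max 0 (fst z) * real (Suc n)\<rfloor> + 1) / real (Suc n)) (snd z)) \<in> borel_measurable (borel \<Otimes>\<^sub>M N)"
    proof (rule measurable_compose_countable[where g="\<lambda>z. nat \<lfloor>max 0 (fst z) * real (Suc n)\<rfloor>" and f="\<lambda>i z. Z (real (i + 1) / real (Suc n)) (snd z)"])
      show "(\<lambda>z. Z (real (i + 1) / real (Suc n)) (snd z)) \<in> borel_measurable (borel \<Otimes>\<^sub>M N)" for i
        by (rule measurable_compose[OF measurable_snd m]) simp
      show "(\<lambda>z. nat \<lfloor>max 0 (fst z) * real (Suc n)\<rfloor>) \<in> measurable (borel \<Otimes>\<^sub>M N) (count_space UNIV)"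
        by measurable
    qed
    then show "(\<lambda>z. Z (a n (fst z)) (snd z)) \<in> borel_measurable (borel \<Otimes>\<^sub>M N)" by (simp add: a_def)
  qed
qed

lemma nn_integral_exp_Ici:
  assumes "0 < \<theta>"
  shows "(\<integral>\<^sup>+y. ennreal (\<theta> * exp (- \<theta> * y)) * indicator {a..} y \<partial>lborel) = ennreal (exp (- \<theta> * a))"
proof -
  have "filterlim (\<lambda>y. - \<theta> * y) at_bot at_top"
    by (rule filterlim_tendsto_neg_mult_at_bot[OF tendsto_const _ filterlim_ident]) (use assms in simp)
  then have "((\<lambda>y. - exp (- \<theta> * y)) \<longlongrightarrow> - 0) at_top"
    by (intro tendsto_minus filterlim_compose[OF exp_at_bot])
  then have "(\<integral>\<^sup>+y. ennreal (\<theta> * exp (- \<theta> * y)) * indicator {a..} y \<partial>lborel) = ennreal (0 - - exp (- \<theta> * a))"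
    using assms by (intro nn_integral_FTC_atLeast[where F="\<lambda>y. - exp (- \<theta> * y)"]) (auto intro!: derivative_eq_intros)
  then show ?thesis by simp
qed

section \<open>The Laplace exponent\<close>

lemma levy_integrable:
  assumes "levy_triplet \<Phi> 0 0 \<nu>" "0 < x"
  shows "integrable \<nu> (\<lambda>t. 1 - exp (- x * t))" "AE t in \<nu>. 0 < t" "\<Phi> x = (\<integral>t. (1 - exp (- x * t)) \<partial>\<nu>)"
    "integrable \<nu> (\<lambda>t. min 1 t)"
proof -
  have s[measurable_cong]: "sets \<nu> = sets borel" and z: "emeasure \<nu> {..0} = 0" and f: "(\<integral>\<^sup>+t. ennreal (min 1 t) \<partial>\<nu>) < \<infinity>"
    and eq: "\<Phi> x = (\<integral>t. (1 - exp (- x * t)) \<partial>\<nu>)"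
    using assms by (auto simp: levy_triplet_def)
  show pos: "AE t in \<nu>. 0 < t"
    by (rule AE_I[OF _ z]) (auto simp: s)
  show im: "integrable \<nu> (\<lambda>t. min 1 t)"
  proof (rule integrableI_bounded)
    have "(\<integral>\<^sup>+t. ennreal (norm (min 1 t)) \<partial>\<nu>) = (\<integral>\<^sup>+t. ennreal (min 1 t) \<partial>\<nu>)"
    proof (rule nn_integral_cong_AE)
      show "AE t in \<nu>. ennreal (norm (min 1 t)) = ennreal (min 1 t)" using pos by eventually_elim simp
    qed
    then show "(\<integral>\<^sup>+t. ennreal (norm (min 1 t)) \<partial>\<nu>) < \<infinity>" using f by simp
  qed measurable
  \<comment> \<open>For \<open>t \<ge> 1\<close> the summand 1 of the constant suffices, for
    \<open>t < 1\<close> the summand \<open>x\<close>.\<close>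
  have bd: "1 - exp (- x * t) \<le> (1 + x) * min 1 t" if "0 < t" for t
  proof (cases "1 \<le> t")
    case True
    have "1 - exp (- x * t) \<le> 1" by simp
    also have "1 \<le> (1 + x) * min 1 t" using True assms(2) by simp
    finally show ?thesis .
  next
    case False
    have "1 + (- x * t) \<le> exp (- x * t)" by (rule exp_ge_add_one_self)
    then show ?thesis using False that by (simp add: distrib_right)
  qed
  show "integrable \<nu> (\<lambda>t. 1 - exp (- x * t))"
  proof (rule Bochner_Integration.integrable_bound)
    show "integrable \<nu> (\<lambda>t. (1 + x) * min 1 t)" using im by simp
    show "AE t in \<nu>. norm (1 - exp (- x * t)) \<le> norm ((1 + x) * min 1 t)"
      using pos
    proof eventually_elim
      case (elim t)
      then have "0 \<le> 1 - exp (- x * t)" using assms by simp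
      then show ?case using bd[OF elim] by simp
    qed
  qed measurable
  show "\<Phi> x = (\<integral>t. (1 - exp (- x * t)) \<partial>\<nu>)" by (rule eq)
qed

text \<open>Dominated convergence with majorant \<open>min 1 t\<close>, valid for arguments up to 1;
  the limit is taken along \<open>inverse x\<close> at infinity.\<close>

lemma levy_tendsto_0:
  assumes "levy_triplet \<Phi> 0 0 \<nu>"
  shows "(\<Phi> \<longlongrightarrow> 0) (at_right 0)"
proof -
  have s[measurable_cong]: "sets \<nu> = sets borel" using assms by (simp add: levy_triplet_def)
  have "((\<lambda>x. \<integral>t. (1 - exp (- inverse x * t)) \<partial>\<nu>) \<longlongrightarrow> (\<integral>t. 0 \<partial>\<nu>)) at_top"
  proof (rule integral_dominated_convergence_at_top[where w="\<lambda>t. min 1 t"])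
    show "integrable \<nu> (\<lambda>t. min 1 t)" by (rule levy_integrable(4)[OF assms zero_less_one])
    show "AE t in \<nu>. ((\<lambda>x. 1 - exp (- inverse x * t)) \<longlongrightarrow> 0) at_top"
    proof (rule AE_I2)
      fix t :: real
      have "((\<lambda>x. 1 - exp (- inverse x * t)) \<longlongrightarrow> 1 - exp (- 0 * t)) at_top"
        by (intro tendsto_intros tendsto_inverse_0_at_top filterlim_ident)
      then show "((\<lambda>x. 1 - exp (- inverse x * t)) \<longlongrightarrow> 0) at_top" by simp
    qed
    show "\<forall>\<^sub>F x in at_top. AE t in \<nu>. norm (1 - exp (- inverse x * t)) \<le> min 1 t"
      using eventually_ge_at_top[of 1]
    proof eventually_elim
      case (elim x)
      show ?case
        using levy_integrable(2)[OF assms zero_less_one]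
      proof eventually_elim
        case (elim t)
        have x: "0 < inverse x" "inverse x \<le> 1" using \<open>1 \<le> x\<close> by (auto simp: inverse_le_1_iff)
        have "1 + (- inverse x * t) \<le> exp (- inverse x * t)" by (rule exp_ge_add_one_self)
        moreover have "inverse x * t \<le> 1 * t" using x elim by (intro mult_right_mono) auto
        moreover have "0 \<le> 1 - exp (- inverse x * t)" using x elim by simp
        ultimately show ?case by simp
      qed
    qed
  qed measurable
  then have "((\<lambda>x. \<integral>t. (1 - exp (- inverse x * t)) \<partial>\<nu>) \<longlongrightarrow> 0) at_top" by simp
  moreover have "\<forall>\<^sub>F x in at_top. (\<integral>t. (1 - exp (- inverse x * t)) \<partial>\<nu>) = \<Phi> (inverse x)"
    using eventually_gt_at_top[of 0]
  proof eventually_elim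
    case (elim x)
    show ?case using levy_integrable(3)[OF assms, of "inverse x"] elim by simp
  qed
  ultimately have "((\<lambda>x. \<Phi> (inverse x)) \<longlongrightarrow> 0) at_top" by (rule Lim_transform_eventually)
  then show ?thesis by (subst filterlim_at_right_to_top)
qed

locale subordination = prob_space M for M :: "'a measure" +
  fixes \<Phi> :: "real \<Rightarrow> real" and \<nu> :: "real measure" and \<sigma> :: "real \<Rightarrow> 'a \<Rightarrow> real"
  assumes levy: "levy_triplet \<Phi> 0 0 \<nu>" and infinite_levy: "emeasure \<nu> {0<..} = \<infinity>"
    and subordinator: "subordinator M \<Phi> \<sigma>"
begin

lemma Phi_pos:
  assumes "0 < x"
  shows "0 < \<Phi> x"
proof -
  note l = levy_integrable[OF levy assms]
  have nn: "AE t in \<nu>. 0 \<le> 1 - exp (- x * t)" using l(2) by eventually_elim (use assms in simp)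
  have "\<Phi> x \<noteq> 0"
  proof
    assume "\<Phi> x = 0"
    then have "AE t in \<nu>. 1 - exp (- x * t) = 0"
      using l(3) integral_nonneg_eq_0_iff_AE[OF l(1) nn] by simp
    then have "AE t in \<nu>. False" using l(2) by eventually_elim (use assms in simp)
    then have "emeasure \<nu> (space \<nu>) = 0" by (simp add: AE_iff_measurable[OF sets.top])
    moreover have "{0<..} \<subseteq> space \<nu>" using levy sets_eq_imp_space_eq[of \<nu> borel] by (simp add: levy_triplet_def)
    ultimately have "emeasure \<nu> {0<..} = 0" using emeasure_mono[of "{0<..}" "space \<nu>" \<nu>] by simp
    then show False using infinite_levy by simp
  qed
  moreover have "0 \<le> \<Phi> x" unfolding l(3) by (rule integral_nonneg_AE[OF nn])
  ultimately show ?thesis by simp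
qed

text \<open>Fatou's lemma: the integrands tend to 1 on \<open>{0<..}\<close>, which has infinite
  mass. This is where the infinite Levy measure forces \<open>\<sigma>\<close> to leave 0 at
  once.\<close>

lemma Phi_at_top: "filterlim (\<lambda>n. \<Phi> (real (Suc n))) at_top sequentially"
proof -
  have s[measurable_cong]: "sets \<nu> = sets borel" using levy by (simp add: levy_triplet_def)
  have e: "ennreal (\<Phi> (real (Suc n))) = (\<integral>\<^sup>+t. ennreal (1 - exp (- real (Suc n) * t)) \<partial>\<nu>)" for n
  proof -
    have p: "0 < real (Suc n)" by simp
    note l = levy_integrable[OF levy p]
    have "AE t in \<nu>. 0 \<le> 1 - exp (- real (Suc n) * t)"
      using l(2) by eventually_elim (simp del: of_nat_Suc)
    then show ?thesis unfolding l(3)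
      by (rule nn_integral_eq_integral[symmetric, OF l(1)])
  qed
  have "\<infinity> = (\<integral>\<^sup>+t. indicator {0<..} t \<partial>\<nu>)" using infinite_levy s by simp
  also have "(\<integral>\<^sup>+t. indicator {0<..} t \<partial>\<nu>) \<le> (\<integral>\<^sup>+t. liminf (\<lambda>n. ennreal (1 - exp (- real (Suc n) * t))) \<partial>\<nu>)"
  proof (rule nn_integral_mono)
    fix t :: real
    show "indicator {0<..} t \<le> liminf (\<lambda>n. ennreal (1 - exp (- real (Suc n) * t)))"
    proof (cases "0 < t")
      case True
      have "filterlim (\<lambda>n. - t * real (Suc n)) at_bot sequentially"
        using True by (intro filterlim_tendsto_neg_mult_at_bot[OF tendsto_const] filterlim_compose[OF filterlim_real_sequentially filterlim_Suc]) auto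
      then have "(\<lambda>n. exp (- t * real (Suc n))) \<longlonglongrightarrow> 0" by (rule filterlim_compose[OF exp_at_bot])
      moreover have "- real (Suc n) * t = - t * real (Suc n)" for n by (simp add: algebra_simps)
      ultimately have "(\<lambda>n. 1 - exp (- real (Suc n) * t)) \<longlonglongrightarrow> 1 - 0" by (intro tendsto_diff tendsto_const) (simp only:)
      then have "(\<lambda>n. ennreal (1 - exp (- real (Suc n) * t))) \<longlonglongrightarrow> ennreal 1" by (intro tendsto_ennrealI) simp
      from lim_imp_Liminf[OF trivial_limit_sequentially this] show ?thesis using True by simp
    qed simp
  qed
  also have "\<dots> \<le> liminf (\<lambda>n. \<integral>\<^sup>+t. ennreal (1 - exp (- real (Suc n) * t)) \<partial>\<nu>)"
    by (rule nn_integral_liminf) measurable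
  finally have li: "liminf (\<lambda>n. ennreal (\<Phi> (real (Suc n)))) = \<infinity>" unfolding e by (simp add: top_unique)
  show ?thesis
    unfolding filterlim_at_top
  proof
    fix Z :: real
    have "ennreal Z < liminf (\<lambda>n. ennreal (\<Phi> (real (Suc n))))" unfolding li by simp
    from less_LiminfD[OF this] have "\<forall>\<^sub>F n in sequentially. ennreal Z < ennreal (\<Phi> (real (Suc n)))" .
    then show "\<forall>\<^sub>F n in sequentially. Z \<le> \<Phi> (real (Suc n))"
    proof eventually_elim
      case (elim n)
      then show ?case using Phi_pos[of "real (Suc n)"] by (cases "0 \<le> Z") (auto simp: ennreal_less_iff)
    qed
  qed
qed

section \<open>Paths of the subordinator and of its inverse\<close>

lemma sigma_measurable: "0 \<le> y \<Longrightarrow> \<sigma> y \<in> borel_measurable M"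
  using subordinator by (simp add: subordinator_def)

lemma sigma_path:
  assumes "\<omega> \<in> space M"
  shows "\<sigma> 0 \<omega> = 0" "0 \<le> y \<Longrightarrow> y \<le> y' \<Longrightarrow> \<sigma> y \<omega> \<le> \<sigma> y' \<omega>" "0 \<le> y \<Longrightarrow> 0 \<le> \<sigma> y \<omega>"
    "0 \<le> y \<Longrightarrow> continuous (at_right y) (\<lambda>y. \<sigma> y \<omega>)"
proof -
  have s: "\<sigma> 0 \<omega> = 0" "mono_on {0..} (\<lambda>y. \<sigma> y \<omega>)" "\<forall>y\<ge>0. continuous (at_right y) (\<lambda>y. \<sigma> y \<omega>)"
    using subordinator assms unfolding subordinator_def by blast+
  show "\<sigma> 0 \<omega> = 0" by (rule s)
  show m: "\<sigma> y \<omega> \<le> \<sigma> y' \<omega>" if "0 \<le> y" "y \<le> y'" for y y' using s(2) that unfolding mono_on_def by auto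
  show "0 \<le> \<sigma> y \<omega>" if "0 \<le> y" using m[of 0 y] that s(1) by simp
  show "0 \<le> y \<Longrightarrow> continuous (at_right y) (\<lambda>y. \<sigma> y \<omega>)" using s(3) by blast
qed

lemma sigma_laplace: "0 \<le> y \<Longrightarrow> 0 < x \<Longrightarrow> (\<integral>\<omega>. exp (- x * \<sigma> y \<omega>) \<partial>M) = exp (- y * \<Phi> x)"
  using subordinator by (simp add: subordinator_def)

lemma sigma_laplace_integrable:
  assumes "0 \<le> y" "0 < x"
  shows "integrable M (\<lambda>\<omega>. exp (- x * \<sigma> y \<omega>))"
proof (rule integrable_const_bound[of _ 1])
  show "AE \<omega> in M. norm (exp (- x * \<sigma> y \<omega>)) \<le> 1" using sigma_path(3) assms by (intro AE_I2) auto
qed (use sigma_measurable[OF assms(1)] in measurable)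

text \<open>The exponential Markov inequality with two free parameters: large \<open>x\<close> at
  level 0 gives positivity of \<open>\<sigma> y\<close>, and large \<open>y\<close> at
  \<open>x = 1\<close> gives unboundedness of the path.\<close>

lemma prob_sigma_le:
  assumes "0 \<le> y" "0 < x"
  shows "prob {\<omega>\<in>space M. \<sigma> y \<omega> \<le> t} \<le> exp (x * t) * exp (- y * \<Phi> x)"
proof -
  have "prob {\<omega>\<in>space M. \<sigma> y \<omega> \<le> t} = prob {\<omega>\<in>space M. exp (- x * t) \<le> exp (- x * \<sigma> y \<omega>)}"
    using assms by (intro arg_cong[where f=prob] Collect_cong) auto
  also have "\<dots> \<le> (\<integral>\<omega>. exp (- x * \<sigma> y \<omega>) \<partial>M) / exp (- x * t)"
    by (intro integral_Markov_inequality_measure[of _ _ "space M"] sigma_laplace_integrable[OF assms]) auto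
  also have "\<dots> = exp (x * t) * exp (- y * \<Phi> x)"
    unfolding sigma_laplace[OF assms] by (simp add: exp_minus field_simps)
  finally show ?thesis .
qed

lemma sigma_pos: "0 < y \<Longrightarrow> AE \<omega> in M. 0 < \<sigma> y \<omega>"
proof -
  assume y: "0 < y"
  then have [measurable]: "\<sigma> y \<in> borel_measurable M" using sigma_measurable by simp
  have le: "prob {\<omega>\<in>space M. \<sigma> y \<omega> \<le> 0} \<le> exp (- y * \<Phi> (real (Suc n)))" for n
    using prob_sigma_le[of y "real (Suc n)" 0] y by simp
  have "(\<lambda>n. exp (- y * \<Phi> (real (Suc n)))) \<longlonglongrightarrow> 0"
    using y by (intro filterlim_compose[OF exp_at_bot] filterlim_tendsto_neg_mult_at_bot[OF tendsto_const _ Phi_at_top]) auto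
  then have "prob {\<omega>\<in>space M. \<sigma> y \<omega> \<le> 0} \<le> 0" by (rule LIMSEQ_le_const) (use le in auto)
  then have "prob {\<omega>\<in>space M. \<not> 0 < \<sigma> y \<omega>} = 0" by (simp add: not_less measure_le_0_iff)
  then show ?thesis by (subst AE_iff_measurable[OF _ refl]) (auto simp: emeasure_eq_measure)
qed

lemma sigma_unbounded: "AE \<omega> in M. \<forall>t. \<exists>y>0. t < \<sigma> y \<omega>"
proof -
  have "AE \<omega> in M. \<exists>n. real k < \<sigma> (real (Suc n)) \<omega>" for k
  proof -
    let ?A = "{\<omega>\<in>space M. \<not> (\<exists>n. real k < \<sigma> (real (Suc n)) \<omega>)}"
    have [measurable]: "\<sigma> (real (Suc n)) \<in> borel_measurable M" for n by (rule sigma_measurable) simp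
    have le: "prob ?A \<le> exp (1 * real k) * exp (- \<Phi> 1 * real (Suc n))" for n
    proof -
      have "prob ?A \<le> prob {\<omega>\<in>space M. \<sigma> (real (Suc n)) \<omega> \<le> real k}"
        by (rule finite_measure_mono) (auto simp: not_less simp del: of_nat_Suc)
      also have "\<dots> \<le> exp (1 * real k) * exp (- real (Suc n) * \<Phi> 1)" by (rule prob_sigma_le) auto
      also have "- real (Suc n) * \<Phi> 1 = - \<Phi> 1 * real (Suc n)" by (simp add: algebra_simps)
      finally show ?thesis .
    qed
    have "(\<lambda>n. exp (1 * real k) * exp (- \<Phi> 1 * real (Suc n))) \<longlonglongrightarrow> exp (1 * real k) * 0"
      using Phi_pos[of 1]
      by (intro tendsto_mult tendsto_const filterlim_compose[OF exp_at_bot] filterlim_tendsto_neg_mult_at_bot[OF tendsto_const]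
          filterlim_compose[OF filterlim_real_sequentially filterlim_Suc]) auto
    then have "prob ?A \<le> exp (1 * real k) * 0" by (rule LIMSEQ_le_const) (use le in auto)
    then have "prob ?A = 0" by (simp add: measure_le_0_iff)
    then show ?thesis by (subst AE_iff_measurable[OF _ refl]) (auto simp: emeasure_eq_measure simp del: of_nat_Suc)
  qed
  then have "AE \<omega> in M. \<forall>k. \<exists>n. real k < \<sigma> (real (Suc n)) \<omega>" by (simp add: AE_all_countable)
  then show ?thesis
  proof eventually_elim
    case (elim \<omega>)
    show ?case
    proof
      fix t
      obtain k where "t < real k" using reals_Archimedean2 by blast
      moreover obtain n where "real k < \<sigma> (real (Suc n)) \<omega>" using elim by blast
      ultimately show "\<exists>y>0. t < \<sigma> y \<omega>" by (intro exI[of _ "real (Suc n)"]) auto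
    qed
  qed
qed

abbreviation L :: "real \<Rightarrow> 'a \<Rightarrow> real" where "L \<equiv> inverse_subordinator \<sigma>"

lemma L_nonneg: "0 \<le> L t \<omega>"
  unfolding inverse_subordinator_def by (auto intro!: cInf_greatest)

text \<open>Almost surely \<open>\<sigma>\<close> is already positive at every time
  \<open>1 / Suc n\<close>; restricting to these countably many times keeps the exceptional set
  null.\<close>

lemma L_0: "AE \<omega> in M. L 0 \<omega> = 0"
proof -
  have "AE \<omega> in M. \<forall>n. 0 < \<sigma> (inverse (real (Suc n))) \<omega>" by (simp add: AE_all_countable sigma_pos)
  then show ?thesis
  proof eventually_elim
    case (elim \<omega>)
    have le: "L 0 \<omega> \<le> inverse (real (Suc n))" for n
    proof -
      have "\<exists>y>0. 0 < \<sigma> y \<omega>" using elim[rule_format, of n] by (intro exI[of _ "inverse (real (Suc n))"]) auto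
      moreover have "Inf {y. y > 0 \<and> \<sigma> y \<omega> > 0} \<le> inverse (real (Suc n))"
        by (rule cInf_lower) (use elim[rule_format, of n] in \<open>auto intro!: bdd_belowI[of _ 0]\<close>)
      ultimately show ?thesis by (simp add: inverse_subordinator_def)
    qed
    have "L 0 \<omega> \<le> 0" by (rule LIMSEQ_le_const[OF LIMSEQ_inverse_real_of_nat]) (use le in auto)
    then show "L 0 \<omega> = 0" using L_nonneg[of 0 \<omega>] by simp
  qed
qed

definition sigma' :: "real \<Rightarrow> 'a \<Rightarrow> real" where "sigma' y \<omega> = \<sigma> (max 0 y) \<omega>"

lemma sigma'_measurable [measurable]: "(\<lambda>z. sigma' (fst z) (snd z)) \<in> borel_measurable (borel \<Otimes>\<^sub>M M)"
  unfolding sigma'_def by (rule right_continuous_measurable_pair[OF sigma_measurable sigma_path(4)])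

lemma exp_L:
  assumes \<omega>: "\<omega> \<in> space M" and unb: "\<forall>t. \<exists>y>0. t < \<sigma> y \<omega>" and \<theta>: "0 < \<theta>"
  shows "(\<integral>\<^sup>+y. ennreal (\<theta> * exp (- \<theta> * y)) * indicator {z. 0 < fst z \<and> snd z < sigma' (fst z) \<omega>} (y, t) \<partial>lborel) = ennreal (exp (- \<theta> * L t \<omega>))"
proof -
  let ?S = "{y. y > 0 \<and> \<sigma> y \<omega> > t}"
  have L: "L t \<omega> = Inf ?S" using unb by (auto simp: inverse_subordinator_def)
  have ne: "?S \<noteq> {}" using unb by auto
  have bd: "bdd_below ?S" by (intro bdd_belowI[of _ 0]) auto
  have "AE y in lborel. y \<noteq> L t \<omega>" by (rule AE_lborel_singleton)
  then have "AE y in lborel. ennreal (\<theta> * exp (- \<theta> * y)) * indicator {z. 0 < fst z \<and> snd z < sigma' (fst z) \<omega>} (y, t) = ennreal (\<theta> * exp (- \<theta> * y)) * indicator {L t \<omega>..} y"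
  proof eventually_elim
    case (elim y)
    \<comment> \<open>\<open>?S\<close> is upward closed as \<open>\<sigma>\<close> is monotone,
      hence a half-line starting at its infimum \<open>L t\<close>; only the end point is undecided,
      and \<open>elim\<close> excludes it.\<close>
    have "y \<in> ?S \<longleftrightarrow> L t \<omega> \<le> y"
    proof
      assume "y \<in> ?S"
      then show "L t \<omega> \<le> y" unfolding L using bd by (rule cInf_lower)
    next
      assume "L t \<omega> \<le> y"
      then have "Inf ?S < y" using elim L by simp
      then obtain y' where y': "y' \<in> ?S" "y' < y" using cInf_lessD[OF ne] by blast
      then have "\<sigma> y' \<omega> \<le> \<sigma> y \<omega>" by (intro sigma_path(2)[OF \<omega>]) auto
      then show "y \<in> ?S" using y' by auto
    qed
    then show ?case by (auto simp: sigma'_def indicator_def)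
  qed
  then show ?thesis by (rule trans[OF nn_integral_cong_AE nn_integral_exp_Ici[OF \<theta>]])
qed

definition decay :: "real \<Rightarrow> real \<Rightarrow> real" where
  "decay \<theta> t = (\<integral>\<omega>. exp (- \<theta> * L t \<omega>) \<partial>M)"

lemma L_mono: "AE \<omega> in M. \<forall>s t. s \<le> t \<longrightarrow> L s \<omega> \<le> L t \<omega>"
  using sigma_unbounded
proof eventually_elim
  case (elim \<omega>)
  show ?case
  proof (intro allI impI)
    fix s t :: real assume st: "s \<le> t"
    have "L s \<omega> = Inf {y. y > 0 \<and> \<sigma> y \<omega> > s}" "L t \<omega> = Inf {y. y > 0 \<and> \<sigma> y \<omega> > t}"
      using elim by (auto simp: inverse_subordinator_def)
    moreover have "Inf {y. y > 0 \<and> \<sigma> y \<omega> > s} \<le> Inf {y. y > 0 \<and> \<sigma> y \<omega> > t}"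
      by (rule cInf_superset_mono) (use elim st in \<open>auto intro!: bdd_belowI[of _ 0]\<close>)
    ultimately show "L s \<omega> \<le> L t \<omega>" by simp
  qed
qed

end

text \<open>Measurability of \<open>L t\<close> is taken as an assumption here; in the theorem it is
  part of the independence of \<open>X\<close> and \<open>L\<close>.\<close>

locale inverse_subordination = subordination +
  assumes L_measurable [measurable]: "0 \<le> t \<Longrightarrow> L t \<in> borel_measurable M"
begin

lemma sigma'_measurable_compose [measurable (raw)]:
  assumes "f \<in> borel_measurable N" "g \<in> measurable N M"
  shows "(\<lambda>x. sigma' (f x) (g x)) \<in> borel_measurable N"
  using measurable_compose[OF measurable_Pair[OF assms] sigma'_measurable] by simp

lemma exp_L_integrable: "0 < \<theta> \<Longrightarrow> 0 \<le> t \<Longrightarrow> integrable M (\<lambda>\<omega>. exp (- \<theta> * L t \<omega>))"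
  by (rule integrable_const_bound[of _ 1]) (use L_nonneg in auto)

lemma decay_bounds:
  assumes "0 < \<theta>" "0 \<le> t"
  shows "0 \<le> decay \<theta> t" "decay \<theta> t \<le> 1"
proof -
  show "0 \<le> decay \<theta> t" unfolding decay_def by (intro integral_nonneg_AE) simp
  have "decay \<theta> t \<le> (\<integral>\<omega>. 1 \<partial>M)" unfolding decay_def
    by (rule integral_mono[OF exp_L_integrable[OF assms]]) (use assms L_nonneg in auto)
  then show "decay \<theta> t \<le> 1" by (simp add: prob_space)
qed

lemma decay_antimono:
  assumes "0 < \<theta>" "0 \<le> s" "s \<le> t"
  shows "decay \<theta> t \<le> decay \<theta> s"
  unfolding decay_def
proof (rule integral_mono_AE)
  show "AE \<omega> in M. exp (- \<theta> * L t \<omega>) \<le> exp (- \<theta> * L s \<omega>)"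
    using L_mono by eventually_elim (use assms in auto)
qed (use exp_L_integrable assms in auto)

text \<open>Indicator of the region below the graph of \<open>\<sigma>\<close>, as a function of
  level, outcome and time jointly, so that the three integrals can be interchanged.\<close>

definition jump :: "real \<Rightarrow> 'a \<Rightarrow> real \<Rightarrow> ennreal" where
  "jump t \<omega> y = (if 0 < y \<and> t < sigma' y \<omega> then 1 else 0)"

lemma jump_measurable [measurable (raw)]:
  assumes [measurable]: "f \<in> borel_measurable N" "g \<in> measurable N M" "h \<in> borel_measurable N"
  shows "(\<lambda>x. jump (f x) (g x) (h x)) \<in> borel_measurable N"
  unfolding jump_def by measurable

text \<open>\<open>exp (- \<theta> * L t)\<close> is the integral of \<open>\<theta> * exp (- \<theta> * y)\<close> over \<open>y > L t\<close>, which is the event \<open>\<sigma> y > t\<close> up to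
  a null set of \<open>y\<close>.\<close>

lemma decay_nn_integral:
  assumes "0 < \<theta>" "0 \<le> t"
  shows "ennreal (decay \<theta> t) = (\<integral>\<^sup>+\<omega>. \<integral>\<^sup>+y. ennreal (\<theta> * exp (- \<theta> * y)) * jump t \<omega> y \<partial>lborel \<partial>M)"
proof -
  have "ennreal (decay \<theta> t) = (\<integral>\<^sup>+\<omega>. ennreal (exp (- \<theta> * L t \<omega>)) \<partial>M)"
    unfolding decay_def by (rule nn_integral_eq_integral[symmetric, OF exp_L_integrable[OF assms]]) simp
  also have "\<dots> = (\<integral>\<^sup>+\<omega>. \<integral>\<^sup>+y. ennreal (\<theta> * exp (- \<theta> * y)) * jump t \<omega> y \<partial>lborel \<partial>M)"
  proof (rule nn_integral_cong_AE)
    show "AE \<omega> in M. ennreal (exp (- \<theta> * L t \<omega>)) = (\<integral>\<^sup>+y. ennreal (\<theta> * exp (- \<theta> * y)) * jump t \<omega> y \<partial>lborel)"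
      using sigma_unbounded AE_space
    proof eventually_elim
      case (elim \<omega>)
      show ?case
        unfolding exp_L[OF elim(2,1) assms(1), of t, symmetric]
        by (intro nn_integral_cong) (auto simp: jump_def indicator_def)
    qed
  qed
  finally show ?thesis .
qed

lemma nn_integral_exp_below:
  assumes z: "0 < z" and s: "0 \<le> s"
  shows "(\<integral>\<^sup>+t. ennreal (exp (- z * t)) * indicator {0<..<s} t \<partial>lborel) = ennreal ((1 - exp (- z * s)) / z)"
proof -
  have "(\<integral>\<^sup>+t. ennreal (exp (- z * t)) * indicator {0<..<s} t \<partial>lborel) = (\<integral>\<^sup>+t. ennreal (exp (- z * t)) * indicator {0..s} t \<partial>lborel)"
  proof (rule nn_integral_cong_AE)
    have "AE t in lborel. t \<noteq> 0 \<and> t \<noteq> s" using AE_lborel_singleton[of 0] AE_lborel_singleton[of s] by eventually_elim simp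
    then show "AE t in lborel. ennreal (exp (- z * t)) * indicator {0<..<s} t = ennreal (exp (- z * t)) * indicator {0..s} t"
      by eventually_elim (auto simp: indicator_def)
  qed
  also have "\<dots> = ennreal (- exp (- z * s) / z - (- exp (- z * 0) / z))"
    using z s by (intro nn_integral_FTC_Icc[where F="\<lambda>t. - exp (- z * t) / z"]) (auto intro!: derivative_eq_intros)
  also have "- exp (- z * s) / z - (- exp (- z * 0) / z) = (1 - exp (- z * s)) / z" by (simp add: diff_divide_distrib)
  finally show ?thesis .
qed

text \<open>Tonelli. After the exchange the integral over \<open>t < \<sigma> y\<close> comes first
  and gives \<open>(1 - exp (- z * \<sigma> y)) / z\<close>; its expectation is
  \<open>(1 - exp (- y * \<Phi> z)) / z\<close> by the Laplace exponent; integrating this against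
  \<open>\<theta> * exp (- \<theta> * y)\<close> gives the rational expression in
  \<open>\<Phi> z\<close>.\<close>

lemma decay_laplace_nn:
  assumes \<theta>: "0 < \<theta>" and z: "0 < z"
  shows "(\<integral>\<^sup>+t. ennreal (exp (- z * t)) * indicator {0<..} t * ennreal (decay \<theta> t) \<partial>lborel) = ennreal (\<Phi> z / (z * (\<theta> + \<Phi> z)))"
proof -
  interpret P: pair_sigma_finite lborel M by unfold_locales
  note Pz = Phi_pos[OF z]
  let ?e1 = "\<lambda>t. ennreal (exp (- z * t)) * indicator {0<..} t" and ?e2 = "\<lambda>y. ennreal (\<theta> * exp (- \<theta> * y))"
  have "(\<integral>\<^sup>+t. ?e1 t * ennreal (decay \<theta> t) \<partial>lborel) = (\<integral>\<^sup>+t. \<integral>\<^sup>+\<omega>. \<integral>\<^sup>+y. ?e1 t * (?e2 y * jump t \<omega> y) \<partial>lborel \<partial>M \<partial>lborel)"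
  proof (rule nn_integral_cong)
    fix t :: real
    show "?e1 t * ennreal (decay \<theta> t) = (\<integral>\<^sup>+\<omega>. \<integral>\<^sup>+y. ?e1 t * (?e2 y * jump t \<omega> y) \<partial>lborel \<partial>M)"
    proof (cases "0 < t")
      case True
      have "(\<integral>\<^sup>+\<omega>. \<integral>\<^sup>+y. ?e1 t * (?e2 y * jump t \<omega> y) \<partial>lborel \<partial>M) = (\<integral>\<^sup>+\<omega>. ?e1 t * (\<integral>\<^sup>+y. ?e2 y * jump t \<omega> y \<partial>lborel) \<partial>M)"
        by (intro nn_integral_cong nn_integral_cmult) measurable
      also have "\<dots> = ?e1 t * (\<integral>\<^sup>+\<omega>. \<integral>\<^sup>+y. ?e2 y * jump t \<omega> y \<partial>lborel \<partial>M)"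
        by (rule nn_integral_cmult) measurable
      finally show ?thesis
        unfolding decay_nn_integral[OF \<theta> less_imp_le[OF True]] ..
    qed simp
  qed
  also have "\<dots> = (\<integral>\<^sup>+\<omega>. \<integral>\<^sup>+t. \<integral>\<^sup>+y. ?e1 t * (?e2 y * jump t \<omega> y) \<partial>lborel \<partial>lborel \<partial>M)"
    by (rule P.Fubini'[symmetric]) measurable
  also have "\<dots> = (\<integral>\<^sup>+\<omega>. \<integral>\<^sup>+y. \<integral>\<^sup>+t. ?e1 t * (?e2 y * jump t \<omega> y) \<partial>lborel \<partial>lborel \<partial>M)"
    by (rule nn_integral_cong, rule lborel_pair.Fubini'[symmetric]) measurable
  also have "\<dots> = (\<integral>\<^sup>+\<omega>. \<integral>\<^sup>+y. ?e2 y * (indicator {0<..} y * ennreal ((1 - exp (- z * sigma' y \<omega>)) / z)) \<partial>lborel \<partial>M)"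
  proof (intro nn_integral_cong)
    fix \<omega> y assume \<omega>: "\<omega> \<in> space M"
    have s: "0 \<le> sigma' y \<omega>" unfolding sigma'_def by (rule sigma_path(3)[OF \<omega>]) simp
    have "(\<integral>\<^sup>+t. ?e1 t * (?e2 y * jump t \<omega> y) \<partial>lborel) =
      (\<integral>\<^sup>+t. (?e2 y * indicator {0<..} y) * (ennreal (exp (- z * t)) * indicator {0<..<sigma' y \<omega>} t) \<partial>lborel)"
      by (intro nn_integral_cong) (auto simp: jump_def indicator_def mult_ac)
    also have "\<dots> = (?e2 y * indicator {0<..} y) * ennreal ((1 - exp (- z * sigma' y \<omega>)) / z)"
      unfolding nn_integral_exp_below[OF z s, symmetric] by (rule nn_integral_cmult) measurable
    finally show "(\<integral>\<^sup>+t. ?e1 t * (?e2 y * jump t \<omega> y) \<partial>lborel) = ?e2 y * (indicator {0<..} y * ennreal ((1 - exp (- z * sigma' y \<omega>)) / z))"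
      by (simp only: mult.assoc)
  qed
  also have "\<dots> = (\<integral>\<^sup>+y. \<integral>\<^sup>+\<omega>. ?e2 y * (indicator {0<..} y * ennreal ((1 - exp (- z * sigma' y \<omega>)) / z)) \<partial>M \<partial>lborel)"
    by (rule P.Fubini') measurable
  also have "\<dots> = (\<integral>\<^sup>+y. ennreal (\<theta> * exp (- \<theta> * y) * ((1 - exp (- y * \<Phi> z)) / z)) * indicator {0..} y \<partial>lborel)"
  proof (rule nn_integral_cong)
    fix y :: real
    show "(\<integral>\<^sup>+\<omega>. ?e2 y * (indicator {0<..} y * ennreal ((1 - exp (- z * sigma' y \<omega>)) / z)) \<partial>M) =
      ennreal (\<theta> * exp (- \<theta> * y) * ((1 - exp (- y * \<Phi> z)) / z)) * indicator {0..} y"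
    proof (cases "0 < y")
      case True
      then have y: "0 \<le> y" by simp
      have s: "sigma' y \<omega> = \<sigma> y \<omega>" for \<omega> using True by (simp add: sigma'_def)
      have i: "integrable M (\<lambda>\<omega>. (1 - exp (- z * \<sigma> y \<omega>)) / z)" using sigma_laplace_integrable[OF y z] by simp
      have "(\<integral>\<^sup>+\<omega>. ennreal ((1 - exp (- z * \<sigma> y \<omega>)) / z) \<partial>M) = ennreal (\<integral>\<omega>. (1 - exp (- z * \<sigma> y \<omega>)) / z \<partial>M)"
        by (rule nn_integral_eq_integral[OF i]) (use sigma_path(3) y z in \<open>auto intro!: AE_I2 divide_nonneg_pos\<close>)
      also have "(\<integral>\<omega>. (1 - exp (- z * \<sigma> y \<omega>)) / z \<partial>M) = (1 - exp (- y * \<Phi> z)) / z"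
        unfolding sigma_laplace[OF y z, symmetric] using sigma_laplace_integrable[OF y z] by (simp add: prob_space)
      finally have e: "(\<integral>\<^sup>+\<omega>. ennreal ((1 - exp (- z * \<sigma> y \<omega>)) / z) \<partial>M) = ennreal ((1 - exp (- y * \<Phi> z)) / z)" .
      have m: "\<sigma> y \<in> borel_measurable M" by (rule sigma_measurable[OF y])
      have "(\<integral>\<^sup>+\<omega>. ?e2 y * (indicator {0<..} y * ennreal ((1 - exp (- z * sigma' y \<omega>)) / z)) \<partial>M) =
        ?e2 y * (\<integral>\<^sup>+\<omega>. ennreal ((1 - exp (- z * \<sigma> y \<omega>)) / z) \<partial>M)"
        using True m by (simp add: s nn_integral_cmult)
      also have "\<dots> = ennreal (\<theta> * exp (- \<theta> * y) * ((1 - exp (- y * \<Phi> z)) / z))"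
        unfolding e using \<theta> by (intro ennreal_mult'[symmetric]) simp
      finally show ?thesis using True by simp
    next
      case False
      then show ?thesis by (cases "y = 0") auto
    qed
  qed
  also have "\<dots> = ennreal (0 - - (\<Phi> z / (z * (\<theta> + \<Phi> z))))"
  proof -
    let ?F = "\<lambda>y. (- exp (- \<theta> * y) + \<theta> / (\<theta> + \<Phi> z) * exp (- (\<theta> + \<Phi> z) * y)) / z"
    have lim: "((\<lambda>y. exp (- c * y)) \<longlongrightarrow> 0) at_top" if "0 < c" for c :: real
      by (rule filterlim_compose[OF exp_at_bot], rule filterlim_tendsto_neg_mult_at_bot[OF tendsto_const _ filterlim_ident]) (use that in simp)
    have "(?F \<longlongrightarrow> (- 0 + \<theta> / (\<theta> + \<Phi> z) * 0) / z) at_top"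
      using \<theta> Pz z by (intro tendsto_divide tendsto_add tendsto_minus tendsto_mult tendsto_const lim) auto
    then have F: "(?F \<longlongrightarrow> 0) at_top" by simp
    have D: "(?F has_real_derivative \<theta> * exp (- \<theta> * y) * ((1 - exp (- y * \<Phi> z)) / z)) (at y)" for y
    proof -
      have e: "exp (- (\<theta> + \<Phi> z) * y) = exp (- \<theta> * y) * exp (- y * \<Phi> z)" by (simp add: exp_add[symmetric] algebra_simps)
      have "(?F has_real_derivative (- (exp (- \<theta> * y) * (- \<theta>)) + \<theta> / (\<theta> + \<Phi> z) * (exp (- (\<theta> + \<Phi> z) * y) * (- (\<theta> + \<Phi> z)))) / z) (at y)"
        using \<theta> Pz z by (auto intro!: derivative_eq_intros)
      also have "\<theta> / (\<theta> + \<Phi> z) * (exp (- (\<theta> + \<Phi> z) * y) * (- (\<theta> + \<Phi> z))) = - \<theta> * exp (- (\<theta> + \<Phi> z) * y)"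
      proof -
        have "\<theta> / c * (k * (- c)) = - \<theta> * k" if "c \<noteq> 0" for c k :: real using that by (simp add: field_simps)
        from this[of "\<theta> + \<Phi> z"] show ?thesis using \<theta> Pz by (simp only: add_pos_pos less_imp_neq[symmetric] simp_thms not_False_eq_True)
      qed
      finally show ?thesis unfolding e by (simp add: algebra_simps)
    qed
    have F0: "?F 0 = - (\<Phi> z / (z * (\<theta> + \<Phi> z)))" using \<theta> Pz z by (simp add: field_simps)
    show ?thesis
      unfolding F0[symmetric]
      by (rule nn_integral_FTC_atLeast[OF _ D _ F]) (use \<theta> Pz z in \<open>auto intro!: mult_nonneg_nonneg divide_nonneg_pos\<close>)
  qed
  finally show ?thesis by simp
qed

lemma decay_laplace:
  assumes \<theta>: "0 < \<theta>" and z: "0 < z"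
  shows "set_integrable lborel {0<..} (\<lambda>t. exp (- z * t) * decay \<theta> t)"
    "(LINT t:{0<..}|lborel. exp (- z * t) * decay \<theta> t) = \<Phi> z / (z * (\<theta> + \<Phi> z))"
proof -
  have d: "0 \<le> decay \<theta> t" if "0 < t" for t using decay_bounds(1)[OF \<theta>, of t] that by simp
  have eq: "ennreal (indicator {0<..} t *\<^sub>R (exp (- z * t) * decay \<theta> t)) = ennreal (exp (- z * t)) * indicator {0<..} t * ennreal (decay \<theta> t)" for t
    using d by (cases "0 < t") (auto simp: ennreal_mult)
  have nn: "(\<integral>\<^sup>+t. ennreal (indicator {0<..} t *\<^sub>R (exp (- z * t) * decay \<theta> t)) \<partial>lborel) = ennreal (\<Phi> z / (z * (\<theta> + \<Phi> z)))"
    unfolding eq by (rule decay_laplace_nn[OF assms])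
  \<comment> \<open>Measurability of \<open>decay\<close> in time is read off from its
    representation as a parameter integral.\<close>
  have "(\<lambda>t. enn2real (indicator {0<..} t * (\<integral>\<^sup>+\<omega>. \<integral>\<^sup>+y. ennreal (\<theta> * exp (- \<theta> * y)) * jump t \<omega> y \<partial>lborel \<partial>M))) \<in> borel_measurable borel"
    by measurable
  moreover have "enn2real (indicator {0<..} t * (\<integral>\<^sup>+\<omega>. \<integral>\<^sup>+y. ennreal (\<theta> * exp (- \<theta> * y)) * jump t \<omega> y \<partial>lborel \<partial>M)) = indicator {0<..} t * decay \<theta> t" for t
  proof (cases "0 < t")
    case True
    then have i: "indicator {0<..} t = (1::ennreal)" "indicator {0<..} t = (1::real)" by auto
    show ?thesis
      unfolding i mult_1 decay_nn_integral[OF \<theta> less_imp_le[OF True], symmetric] using d[OF True] by simp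
  qed simp
  ultimately have [measurable]: "(\<lambda>t. indicator {0<..} t * decay \<theta> t) \<in> borel_measurable borel" by (simp only:)
  have "(\<lambda>t. exp (- z * t) * (indicator {0<..} t * decay \<theta> t)) \<in> borel_measurable borel" by measurable
  then have m: "(\<lambda>t. indicator {0<..} t *\<^sub>R (exp (- z * t) * decay \<theta> t)) \<in> borel_measurable lborel" by (simp add: mult_ac)
  have nonneg: "AE t in lborel. 0 \<le> indicator {0<..} t *\<^sub>R (exp (- z * t) * decay \<theta> t)" using d by (intro AE_I2) (auto simp: indicator_def)
  have v: "0 \<le> \<Phi> z / (z * (\<theta> + \<Phi> z))" using Phi_pos[OF z] z \<theta> by simp
  show "set_integrable lborel {0<..} (\<lambda>t. exp (- z * t) * decay \<theta> t)"
    unfolding set_integrable_def by (rule integrableI_nonneg[OF m nonneg]) (simp only: nn ennreal_less_top infinity_ennreal_def)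
  show "(LINT t:{0<..}|lborel. exp (- z * t) * decay \<theta> t) = \<Phi> z / (z * (\<theta> + \<Phi> z))"
    unfolding set_lebesgue_integral_def using v by (simp only: integral_eq_nn_integral[OF m nonneg] nn enn2real_ennreal)
qed

end

section \<open>A Tauberian theorem for monotone functions\<close>

text \<open>With \<open>x = exp (- s)\<close> this is the positive part of
  \<open>(x - exp (- b)) * (exp (- a) - x)\<close>: a continuous test function of \<open>x\<close>
  that is positive exactly for \<open>a < s < b\<close>.\<close>

lemma tent_outside:
  fixes a b :: real
  assumes "s \<le> a \<or> b \<le> s" "a < b"
  shows "max 0 ((exp (- s) - exp (- b)) * (exp (- a) - exp (- s))) = 0"
proof -
  have "(exp (- s) - exp (- b)) * (exp (- a) - exp (- s)) \<le> 0"
    using assms(1)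
  proof
    assume "s \<le> a"
    then show ?thesis using assms(2) by (intro mult_nonneg_nonpos) auto
  next
    assume "b \<le> s"
    then show ?thesis using assms(2) by (intro mult_nonpos_nonneg) auto
  qed
  then show ?thesis by (rule max_absorb1)
qed

lemma tent_integral_pos:
  fixes a b :: real
  assumes ab: "0 < a" "a < b"
  defines "\<phi> \<equiv> \<lambda>s. max 0 ((exp (- s) - exp (- b)) * (exp (- a) - exp (- s))) * exp (- s)"
  shows "set_integrable lborel {0<..} \<phi>" "0 < (LINT s:{0<..}|lborel. \<phi> s)"
proof -
  have out: "\<phi> s = 0" if "s \<le> a \<or> b \<le> s" for s
    using tent_outside[OF that ab(2)] by (simp add: \<phi>_def)
  have in': "0 < \<phi> s" if "a < s" "s < b" for s using that by (simp add: \<phi>_def max_def)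
  have nn: "0 \<le> \<phi> s" for s by (simp add: \<phi>_def)
  have si: "set_integrable lborel {a..b} \<phi>"
    unfolding \<phi>_def by (intro borel_integrable_atLeastAtMost' continuous_intros)
  have eq: "indicator {0<..} s *\<^sub>R \<phi> s = indicator {a..b} s *\<^sub>R \<phi> s" for s
    using out[of s] ab by (auto simp: indicator_def)
  show i: "set_integrable lborel {0<..} \<phi>" using si unfolding set_integrable_def eq .
  have "0 \<le> (LINT s:{0<..}|lborel. \<phi> s)"
    unfolding set_lebesgue_integral_def by (intro integral_nonneg_AE) (auto simp: nn)
  moreover have "(LINT s:{0<..}|lborel. \<phi> s) \<noteq> 0"
  proof
    assume "(LINT s:{0<..}|lborel. \<phi> s) = 0"
    then have "AE s in lborel. indicator {0<..} s *\<^sub>R \<phi> s = 0"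
      using i nn unfolding set_lebesgue_integral_def set_integrable_def
      by (subst (asm) integral_nonneg_eq_0_iff_AE) auto
    then have "AE s in lborel. s \<notin> {a<..<b}"
    proof eventually_elim
      case (elim s)
      show ?case
      proof
        assume "s \<in> {a<..<b}"
        then have "0 < \<phi> s" "0 < s" using in'[of s] ab by auto
        then show False using elim by simp
      qed
    qed
    then have "emeasure lborel {a<..<b} = 0" by (subst (asm) AE_iff_measurable[where N="{a<..<b}"]) auto
    then show False using ab by simp
  qed
  ultimately show "0 < (LINT s:{0<..}|lborel. \<phi> s)" by simp
qed

text \<open>Convergence of the Laplace transforms at positive integers suffices: in the variable \<open>exp (- s)\<close> they are
  the moments of the measures \<open>exp (- s) * g n s ds\<close>, and polynomials are uniformly dense (Karamata's method).\<close>

locale laplace_convergence =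
  fixes g :: "nat \<Rightarrow> real \<Rightarrow> real" and g' :: "real \<Rightarrow> real"
  assumes int: "\<And>n k. set_integrable lborel {0<..} (\<lambda>s. exp (- real (Suc k) * s) * g n s)"
    and int': "\<And>k. set_integrable lborel {0<..} (\<lambda>s. exp (- real (Suc k) * s) * g' s)"
    and nonneg: "\<And>n s. 0 < s \<Longrightarrow> 0 \<le> g n s" "\<And>s. 0 < s \<Longrightarrow> 0 \<le> g' s"
    and lim: "\<And>k. (\<lambda>n. LINT s:{0<..}|lborel. exp (- real (Suc k) * s) * g n s) \<longlonglongrightarrow> (LINT s:{0<..}|lborel. exp (- real (Suc k) * s) * g' s)"
begin

definition weighted :: "(real \<Rightarrow> real) \<Rightarrow> (real \<Rightarrow> real) \<Rightarrow> real" where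
  "weighted f h = (LINT s:{0<..}|lborel. h (exp (- s)) * (exp (- s) * f s))"

lemma weighted_integrable:
  fixes f h :: "real \<Rightarrow> real"
  assumes f: "set_integrable lborel {0<..} (\<lambda>s. exp (- s) * f s)" and h: "continuous_on {0..1} h"
  shows "set_integrable lborel {0<..} (\<lambda>s. h (exp (- s)) * (exp (- s) * f s))"
proof -
  have "bounded (h ` {0..1})" by (intro compact_imp_bounded compact_continuous_image h compact_Icc)
  then obtain C where C: "\<And>x. 0 \<le> x \<Longrightarrow> x \<le> 1 \<Longrightarrow> \<bar>h x\<bar> \<le> C" unfolding bounded_iff by force
  have m: "(\<lambda>s. indicator {0<..} s * h (exp (- s))) \<in> borel_measurable borel"
  proof -
    have "continuous_on {0<..} (\<lambda>s::real. h (exp (- s)))"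
      by (intro continuous_on_compose2[OF h] continuous_intros) auto
    from borel_measurable_continuous_on_indicator[OF _ this] show ?thesis by simp
  qed
  have fm: "(\<lambda>s. indicator {0<..} s * (exp (- s) * f s)) \<in> borel_measurable borel"
    using f by (simp add: set_integrable_def)
  show ?thesis
    unfolding set_integrable_def
  proof (rule Bochner_Integration.integrable_bound)
    show "integrable lborel (\<lambda>s. C * (indicator {0<..} s *\<^sub>R (exp (- s) * f s)))"
      using f unfolding set_integrable_def by simp
    have "(\<lambda>s. (indicator {0<..} s * h (exp (- s))) * (indicator {0<..} s * (exp (- s) * f s))) \<in> borel_measurable borel"
      using m fm by measurable
    moreover have "(indicator {0<..} s * h (exp (- s))) * (indicator {0<..} s * (exp (- s) * f s)) = indicator {0<..} s *\<^sub>R (h (exp (- s)) * (exp (- s) * f s))" for s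
      by (simp add: indicator_def)
    ultimately show "(\<lambda>s. indicator {0<..} s *\<^sub>R (h (exp (- s)) * (exp (- s) * f s))) \<in> borel_measurable lborel" by simp
    show "AE s in lborel. norm (indicator {0<..} s *\<^sub>R (h (exp (- s)) * (exp (- s) * f s))) \<le> norm (C * (indicator {0<..} s *\<^sub>R (exp (- s) * f s)))"
    proof (rule AE_I2)
      fix s :: real
      show "norm (indicator {0<..} s *\<^sub>R (h (exp (- s)) * (exp (- s) * f s))) \<le> norm (C * (indicator {0<..} s *\<^sub>R (exp (- s) * f s)))"
      proof (cases "0 < s")
        case True
        have "\<bar>h (exp (- s))\<bar> \<le> \<bar>C\<bar>" using C[of "exp (- s)"] True by simp
        then have "\<bar>h (exp (- s))\<bar> * \<bar>exp (- s) * f s\<bar> \<le> \<bar>C\<bar> * \<bar>exp (- s) * f s\<bar>" by (intro mult_right_mono) auto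
        then show ?thesis using True by (simp add: abs_mult)
      qed simp
    qed
  qed
qed

lemma base_int: "set_integrable lborel {0<..} (\<lambda>s. exp (- s) * g n s)" "set_integrable lborel {0<..} (\<lambda>s. exp (- s) * g' s)"
  using int[of 0 n] int'[of 0] by simp_all

lemma weighted_diff_le:
  fixes f h p :: "real \<Rightarrow> real"
  assumes f: "set_integrable lborel {0<..} (\<lambda>s. exp (- s) * f s)" "\<And>s. 0 < s \<Longrightarrow> 0 \<le> f s"
    and h: "continuous_on {0..1} h" "continuous_on {0..1} p" and e: "\<And>x. 0 \<le> x \<Longrightarrow> x \<le> 1 \<Longrightarrow> \<bar>h x - p x\<bar> \<le> e"
  shows "\<bar>weighted f h - weighted f p\<bar> \<le> e * weighted f (\<lambda>_. 1)"
proof -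
  note ih = weighted_integrable[OF f(1) h(1)] and ip = weighted_integrable[OF f(1) h(2)]
  have eq: "weighted f h - weighted f p = (LINT s:{0<..}|lborel. h (exp (- s)) * (exp (- s) * f s) - p (exp (- s)) * (exp (- s) * f s))"
    unfolding weighted_def by (rule set_integral_diff(2)[symmetric, OF ih ip])
  have "\<bar>weighted f h - weighted f p\<bar> \<le> (LINT s:{0<..}|lborel. \<bar>h (exp (- s)) * (exp (- s) * f s) - p (exp (- s)) * (exp (- s) * f s)\<bar>)"
    unfolding eq using set_integral_norm_bound[OF set_integral_diff(1)[OF ih ip]] by simp
  also have "\<dots> \<le> (LINT s:{0<..}|lborel. e * (1 * (exp (- s) * f s)))"
  proof (rule set_integral_mono)
    show "set_integrable lborel {0<..} (\<lambda>s. \<bar>h (exp (- s)) * (exp (- s) * f s) - p (exp (- s)) * (exp (- s) * f s)\<bar>)"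
      by (rule set_integrable_abs[OF set_integral_diff(1)[OF ih ip]])
    show "set_integrable lborel {0<..} (\<lambda>s. e * (1 * (exp (- s) * f s)))" using f(1) by simp
    fix s :: real assume "s \<in> {0<..}"
    then have s: "0 < s" by simp
    have "\<bar>h (exp (- s)) * (exp (- s) * f s) - p (exp (- s)) * (exp (- s) * f s)\<bar> = \<bar>h (exp (- s)) - p (exp (- s))\<bar> * (exp (- s) * f s)"
      unfolding left_diff_distrib[symmetric] abs_mult using f(2)[OF s] by simp
    also have "\<dots> \<le> e * (exp (- s) * f s)" using e[of "exp (- s)"] f(2)[OF s] s by (intro mult_right_mono) auto
    finally show "\<bar>h (exp (- s)) * (exp (- s) * f s) - p (exp (- s)) * (exp (- s) * f s)\<bar> \<le> e * (1 * (exp (- s) * f s))" by simp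
  qed
  also have "\<dots> = e * weighted f (\<lambda>_. 1)" unfolding weighted_def by simp
  finally show ?thesis .
qed

text \<open>The monomial \<open>x ^ i\<close> together with the weight \<open>exp (- s)\<close>
  yields the Laplace transform at \<open>Suc i\<close>; hence the transforms at positive
  integers.\<close>

lemma weighted_poly:
  fixes f :: "real \<Rightarrow> real"
  assumes "\<And>k. set_integrable lborel {0<..} (\<lambda>s. exp (- real (Suc k) * s) * f s)"
  shows "weighted f (\<lambda>x. \<Sum>i\<le>m. a i * x ^ i) = (\<Sum>i\<le>m. a i * (LINT s:{0<..}|lborel. exp (- real (Suc i) * s) * f s))"
proof -
  have eq: "(\<Sum>i\<le>m. a i * exp (- s) ^ i) * (exp (- s) * f s) = (\<Sum>i\<le>m. a i * (exp (- real (Suc i) * s) * f s))" for s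
  proof -
    have "exp (- s) ^ i * exp (- s) = exp (- real (Suc i) * s)" for i
      by (simp add: exp_of_nat_mult[symmetric] exp_add[symmetric] algebra_simps)
    then have "a i * exp (- s) ^ i * (exp (- s) * f s) = a i * (exp (- real (Suc i) * s) * f s)" for i
      by (metis mult.assoc)
    then show ?thesis unfolding sum_distrib_right by (intro sum.cong refl)
  qed
  show ?thesis
    unfolding weighted_def eq set_lebesgue_integral_def scaleR_sum_right
    using assms unfolding set_integrable_def
    by (subst Bochner_Integration.integral_sum) (auto simp: mult.left_commute)
qed

lemma weighted_tendsto:
  assumes h: "continuous_on {0..1} h"
  shows "(\<lambda>n. weighted (g n) h) \<longlonglongrightarrow> weighted g' h"
proof (rule LIMSEQ_I)
  fix r :: real assume r: "0 < r"
  have one: "(\<lambda>n. weighted (g n) (\<lambda>_. 1)) \<longlonglongrightarrow> weighted g' (\<lambda>_. 1)"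
    using lim[of 0] by (simp add: weighted_def)
  \<comment> \<open>Bounds the mass of the limit and, eventually, that of the approximating
    measures. With \<open>e = r / (4 * C)\<close> the two polynomial errors and the convergence at
    \<open>p\<close> cost at most \<open>r / 4\<close> each.\<close>
  define C where "C = \<bar>weighted g' (\<lambda>_. 1)\<bar> + 1"
  have C: "0 < C" by (simp add: C_def)
  define e where "e = r / (4 * C)"
  have e: "0 < e" using r C by (simp add: e_def)
  obtain p where p: "real_polynomial_function p" "\<And>x. x \<in> {0..1} \<Longrightarrow> \<bar>h x - p x\<bar> < e"
    using Stone_Weierstrass_real_polynomial_function[OF compact_Icc h e] by metis
  obtain a m where pa: "p = (\<lambda>x. \<Sum>i\<le>m. a i * x ^ i)" using p(1) unfolding real_polynomial_function_iff_sum by auto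
  have pc: "continuous_on {0..1} p" unfolding pa by (intro continuous_intros)
  have "(\<lambda>n. weighted (g n) p) \<longlonglongrightarrow> weighted g' p"
    unfolding pa weighted_poly[OF int] weighted_poly[OF int'] by (intro tendsto_intros lim)
  then have "\<forall>\<^sub>F n in sequentially. dist (weighted (g n) p) (weighted g' p) < r / 4" using r by (intro tendstoD) auto
  moreover have "\<forall>\<^sub>F n in sequentially. weighted (g n) (\<lambda>_. 1) < C"
    by (rule order_tendstoD(2)[OF one]) (simp add: C_def)
  ultimately have "\<forall>\<^sub>F n in sequentially. norm (weighted (g n) h - weighted g' h) < r"
  proof eventually_elim
    case (elim n)
    have 1: "\<bar>weighted (g n) h - weighted (g n) p\<bar> \<le> e * weighted (g n) (\<lambda>_. 1)"
      by (rule weighted_diff_le[OF base_int(1) nonneg(1) h pc]) (use p(2) in \<open>auto intro: less_imp_le\<close>)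
    have 2: "\<bar>weighted g' h - weighted g' p\<bar> \<le> e * weighted g' (\<lambda>_. 1)"
      by (rule weighted_diff_le[OF base_int(2) nonneg(2) h pc]) (use p(2) in \<open>auto intro: less_imp_le\<close>)
    have "e * weighted (g n) (\<lambda>_. 1) \<le> e * C" "e * weighted g' (\<lambda>_. 1) \<le> e * C"
      using elim e by (auto intro!: mult_left_mono simp: C_def)
    moreover have "e * C = r / 4" using C by (simp add: e_def)
    ultimately show ?case using 1 2 elim(1) r unfolding dist_real_def real_norm_def by linarith
  qed
  then show "\<exists>no. \<forall>n\<ge>no. norm (weighted (g n) h - weighted g' h) < r" by (simp add: eventually_sequentially)
qed

text \<open>Monotonicity turns convergence against test functions into convergence at a point: a
  tent left of 1 averages values of \<open>g n\<close> above \<open>g n 1\<close>, a tent right of 1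
  averages values below it, and continuity of \<open>g'\<close> closes the gap.\<close>

lemma antimono_limit_at_1:
  assumes anti: "\<And>n s t. 0 < s \<Longrightarrow> s \<le> t \<Longrightarrow> g n t \<le> g n s" and anti': "\<And>s t. 0 < s \<Longrightarrow> s \<le> t \<Longrightarrow> g' t \<le> g' s"
    and cont: "isCont g' 1"
  shows "(\<lambda>n. g n 1) \<longlonglongrightarrow> g' 1"
proof -
  define h where "h a b x = max 0 ((x - exp (- b)) * (exp (- a) - x))" for a b x :: real
  have hc: "continuous_on {0..1} (h a b)" for a b unfolding h_def by (intro continuous_intros)
  define T where "T a b = (LINT s:{0<..}|lborel. h a b (exp (- s)) * exp (- s))" for a b
  have T: "set_integrable lborel {0<..} (\<lambda>s. h a b (exp (- s)) * exp (- s))" "0 < T a b" if "0 < a" "a < b" for a b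
    using tent_integral_pos[OF that] by (simp_all add: T_def h_def)
  have h0: "h a b (exp (- s)) = 0" if "s \<le> a \<or> b \<le> s" "a < b" for a b s
    unfolding h_def by (rule tent_outside[OF that])
  have hnn: "0 \<le> h a b x" for a b x by (simp add: h_def)
  have bounds: "f b * T a b \<le> weighted f (h a b) \<and> weighted f (h a b) \<le> f a * T a b"
    if ab: "0 < a" "a < b" and f: "set_integrable lborel {0<..} (\<lambda>s. exp (- s) * f s)"
      "\<And>s t. 0 < s \<Longrightarrow> s \<le> t \<Longrightarrow> f t \<le> f s" for f a b
  proof -
    note w = weighted_integrable[OF f(1) hc, of a b]
    have c: "set_integrable lborel {0<..} (\<lambda>s. k * (h a b (exp (- s)) * exp (- s)))" for k
      using T(1)[OF ab] by (rule set_integrable_mult_right)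
    have le: "f b * (h a b (exp (- s)) * exp (- s)) \<le> h a b (exp (- s)) * (exp (- s) * f s) \<and>
      h a b (exp (- s)) * (exp (- s) * f s) \<le> f a * (h a b (exp (- s)) * exp (- s))" if "0 < s" for s
    proof (cases "a < s \<and> s < b")
      case True
      have "f b \<le> f s" "f s \<le> f a" using True ab that by (auto intro!: f(2))
      then have "f b * (h a b (exp (- s)) * exp (- s)) \<le> f s * (h a b (exp (- s)) * exp (- s))"
        "f s * (h a b (exp (- s)) * exp (- s)) \<le> f a * (h a b (exp (- s)) * exp (- s))"
        using hnn by (auto intro!: mult_right_mono)
      then show ?thesis by (simp_all add: mult_ac)
    next
      case False
      then have "h a b (exp (- s)) = 0" using h0[OF _ ab(2)] by auto
      then show ?thesis by simp_all
    qed
    have "(LINT s:{0<..}|lborel. f b * (h a b (exp (- s)) * exp (- s))) \<le> weighted f (h a b)"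
      unfolding weighted_def by (rule set_integral_mono[OF c w]) (use le in auto)
    moreover have "weighted f (h a b) \<le> (LINT s:{0<..}|lborel. f a * (h a b (exp (- s)) * exp (- s)))"
      unfolding weighted_def by (rule set_integral_mono[OF w c]) (use le in auto)
    ultimately show ?thesis by (simp add: T_def)
  qed
  show ?thesis
  proof (rule LIMSEQ_I)
    fix r :: real assume r: "0 < r"
    from cont have "((\<lambda>x. g' x) \<longlongrightarrow> g' 1) (at 1)" by (simp add: isCont_def)
    then have "\<exists>d>0. \<forall>x. x \<noteq> 1 \<and> dist x 1 < d \<longrightarrow> dist (g' x) (g' 1) < r / 2"
      using half_gt_zero[OF r] unfolding LIM_def by blast
    then obtain d where d: "0 < d" "\<And>x. x \<noteq> 1 \<Longrightarrow> \<bar>x - 1\<bar> < d \<Longrightarrow> \<bar>g' x - g' 1\<bar> < r / 2" by (auto simp: dist_real_def)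
    \<comment> \<open>The bound 1/2 keeps the left tent inside the positive half-line.\<close>
    define \<delta> where "\<delta> = min (d / 2) (1 / 2)"
    have \<delta>: "0 < \<delta>" "\<delta> < 1" "\<delta> < d" using d by (auto simp: \<delta>_def)
    let ?a = "1 - \<delta>" and ?b = "1 + \<delta>"
    have ga: "\<bar>g' ?a - g' 1\<bar> < r / 2" "\<bar>g' ?b - g' 1\<bar> < r / 2" by (rule d(2); use \<delta> in simp)+
    have A: "0 < ?a" "?a < 1" and B: "0 < (1::real)" "1 < ?b" using \<delta> by auto
    have "weighted g' (h ?a 1) < (g' ?a + r / 2) * T ?a 1"
      using bounds[OF A base_int(2) anti'] mult_strict_right_mono[OF _ T(2)[OF A], of "g' ?a" "g' ?a + r / 2"] r by linarith
    then have e1: "\<forall>\<^sub>F n in sequentially. weighted (g n) (h ?a 1) < (g' ?a + r / 2) * T ?a 1"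
      by (rule order_tendstoD(2)[OF weighted_tendsto[OF hc]])
    have "(g' ?b - r / 2) * T 1 ?b < weighted g' (h 1 ?b)"
      using bounds[OF B base_int(2) anti'] mult_strict_right_mono[OF _ T(2)[OF B], of "g' ?b - r / 2" "g' ?b"] r by linarith
    then have e2: "\<forall>\<^sub>F n in sequentially. (g' ?b - r / 2) * T 1 ?b < weighted (g n) (h 1 ?b)"
      by (rule order_tendstoD(1)[OF weighted_tendsto[OF hc]])
    from e1 e2 have "\<forall>\<^sub>F n in sequentially. norm (g n 1 - g' 1) < r"
    proof eventually_elim
      case (elim n)
      have "g n 1 * T ?a 1 < (g' ?a + r / 2) * T ?a 1" using bounds[OF A base_int(1) anti] elim(1) by (rule le_less_trans[OF conjunct1])
      then have "g n 1 < g' ?a + r / 2" using T(2)[OF A] by simp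
      moreover have "(g' ?b - r / 2) * T 1 ?b < g n 1 * T 1 ?b" using elim(2) conjunct2[OF bounds[OF B base_int(1) anti]] by (rule less_le_trans)
      then have "g' ?b - r / 2 < g n 1" using T(2)[OF B] by simp
      ultimately show ?case using ga unfolding real_norm_def by linarith
    qed
    then show "\<exists>no. \<forall>n\<ge>no. norm (g n 1 - g' 1) < r" by (simp add: eventually_sequentially)
  qed
qed

end

section \<open>Decay of the correlation\<close>

lemma set_integral_scale:
  fixes f :: "real \<Rightarrow> real"
  assumes "0 < c"
  shows "set_integrable lborel {0<..} (\<lambda>s. f (c * s)) \<longleftrightarrow> set_integrable lborel {0<..} f"
    "(LINT s:{0<..}|lborel. f (c * s)) = (LINT t:{0<..}|lborel. f t) / c"
proof -
  have ind: "indicator {0<..} (c * s) = (indicator {0<..} s :: real)" for s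
    using assms by (auto simp: indicator_def zero_less_mult_iff)
  show "set_integrable lborel {0<..} (\<lambda>s. f (c * s)) \<longleftrightarrow> set_integrable lborel {0<..} f"
    using lborel_integrable_real_affine_iff[of c "\<lambda>x. indicator {0<..} x *\<^sub>R f x" 0] assms
    by (simp add: set_integrable_def ind)
  show "(LINT s:{0<..}|lborel. f (c * s)) = (LINT t:{0<..}|lborel. f t) / c"
    using lborel_integral_real_affine[of c "\<lambda>x. indicator {0<..} x *\<^sub>R f x" 0] assms
    by (simp add: set_lebesgue_integral_def ind)
qed

lemma power_laplace:
  fixes \<alpha> k :: real
  assumes \<alpha>: "\<alpha> < 1" and k: "0 < k"
  shows "set_integrable lborel {0<..} (\<lambda>s. exp (- k * s) * s powr (- \<alpha>))"
    "(LINT s:{0<..}|lborel. exp (- k * s) * s powr (- \<alpha>)) = Gamma (1 - \<alpha>) * k powr (\<alpha> - 1)"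
proof -
  let ?f = "\<lambda>t::real. exp (- t) * t powr (- \<alpha>)"
  have m: "(\<lambda>t. indicator {0<..} t *\<^sub>R ?f t) \<in> borel_measurable lborel" by measurable
  have nn: "(\<integral>\<^sup>+t. ennreal (indicator {0<..} t *\<^sub>R ?f t) \<partial>lborel) = ennreal (Gamma (1 - \<alpha>))"
  proof -
    have "ennreal (Gamma (1 - \<alpha>)) = (\<integral>\<^sup>+t. ennreal (indicator {0..} t * t powr (1 - \<alpha> - 1) / exp t) \<partial>lborel)"
      by (rule Gamma_conv_nn_integral_real) (use \<alpha> in simp)
    also have "\<dots> = (\<integral>\<^sup>+t. ennreal (indicator {0<..} t *\<^sub>R ?f t) \<partial>lborel)"
      by (intro nn_integral_cong arg_cong[where f=ennreal]) (auto simp: indicator_def exp_minus divide_inverse)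
    finally show ?thesis by simp
  qed
  have nonneg: "AE t in lborel. 0 \<le> indicator {0<..} t *\<^sub>R ?f t" by (intro AE_I2) (auto simp: indicator_def)
  have i: "set_integrable lborel {0<..} ?f"
    unfolding set_integrable_def by (rule integrableI_nonneg[OF m nonneg]) (simp only: nn ennreal_less_top infinity_ennreal_def)
  have v: "(LINT t:{0<..}|lborel. ?f t) = Gamma (1 - \<alpha>)"
    unfolding set_lebesgue_integral_def integral_eq_nn_integral[OF m nonneg] nn using Gamma_real_nonneg[of "1 - \<alpha>"] \<alpha> by simp
  have eq: "indicator {0<..} s *\<^sub>R (exp (- k * s) * s powr (- \<alpha>)) = indicator {0<..} s *\<^sub>R (k powr \<alpha> * ?f (k * s))" for s
  proof (cases "0 < s")
    case True
    have "k powr \<alpha> * (k * s) powr (- \<alpha>) = k powr \<alpha> * k powr (- \<alpha>) * s powr (- \<alpha>)"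
      using k True by (simp add: powr_mult)
    also have "k powr \<alpha> * k powr (- \<alpha>) = 1" using k by (simp add: powr_add[symmetric])
    finally have "k powr \<alpha> * (k * s) powr (- \<alpha>) = s powr (- \<alpha>)" by simp
    then have "k powr \<alpha> * ?f (k * s) = exp (- k * s) * s powr (- \<alpha>)" by (simp add: mult.left_commute)
    then show ?thesis by (simp only:)
  qed simp
  show "set_integrable lborel {0<..} (\<lambda>s. exp (- k * s) * s powr (- \<alpha>))"
    unfolding set_integrable_def eq
    unfolding set_integrable_def[symmetric]
    by (rule set_integrable_mult_right) (rule set_integral_scale(1)[OF k, THEN iffD2, OF i])
  have "(LINT s:{0<..}|lborel. exp (- k * s) * s powr (- \<alpha>)) = (LINT s:{0<..}|lborel. k powr \<alpha> * ?f (k * s))"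
    unfolding set_lebesgue_integral_def eq ..
  also have "\<dots> = k powr \<alpha> * (Gamma (1 - \<alpha>) / k)"
    unfolding set_integral_mult_right set_integral_scale(2)[OF k, of ?f] v ..
  also have "\<dots> = Gamma (1 - \<alpha>) * k powr (\<alpha> - 1)" using k by (simp add: powr_diff)
  finally show "(LINT s:{0<..}|lborel. exp (- k * s) * s powr (- \<alpha>)) = Gamma (1 - \<alpha>) * k powr (\<alpha> - 1)" .
qed

context inverse_subordination
begin

lemma inverse_Suc_at_right: "filterlim (\<lambda>n. inverse (real (Suc n))) (at_right 0) sequentially"
  unfolding filterlim_at by (auto intro: LIMSEQ_inverse_real_of_nat simp del: of_nat_Suc)

text \<open>Time is rescaled by \<open>Suc n\<close> and the values by
  \<open>\<Phi> (1 / Suc n)\<close>. By the explicit Laplace transform and regular variation the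
  transform of \<open>g n\<close> at \<open>k\<close> tends to
  \<open>k powr (\<alpha> - 1) / \<theta>\<close>, which is the transform of
  \<open>c * s powr (- \<alpha>)\<close>. The claim is the limit at \<open>s = 1\<close>.\<close>

lemma decay_regular_variation:
  assumes \<theta>: "0 < \<theta>" and \<alpha>: "0 < \<alpha>" "\<alpha> < 1" and rv: "regularly_varying_at_0 \<Phi> \<alpha>"
  shows "(\<lambda>n. decay \<theta> (real (Suc n)) / \<Phi> (inverse (real (Suc n)))) \<longlonglongrightarrow> 1 / (\<theta> * Gamma (1 - \<alpha>))"
proof -
  define c where "c = 1 / (\<theta> * Gamma (1 - \<alpha>))"
  have G: "0 < Gamma (1 - \<alpha>)" using \<alpha> by (intro Gamma_real_pos) simp
  have c0: "0 < c" using \<theta> G by (simp add: c_def)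
  let ?N = "\<lambda>n. real (Suc n)"
  define g where "g n s = decay \<theta> (?N n * s) / \<Phi> (inverse (?N n))" for n s
  define g' where "g' s = c * s powr (- \<alpha>)" for s
  have P: "0 < \<Phi> (inverse (?N n))" for n by (rule Phi_pos) simp
  have scaled: "exp (- real (Suc k) * s) * g n s = (\<lambda>t. exp (- (real (Suc k) / ?N n) * t) * decay \<theta> t / \<Phi> (inverse (?N n))) (?N n * s)" for n k s
    by (simp add: g_def del: of_nat_Suc)
  have z: "0 < real (Suc k) / ?N n" for k n by simp
  interpret laplace_convergence g g'
  proof
    fix n k
    have i: "set_integrable lborel {0<..} (\<lambda>t. exp (- (real (Suc k) / ?N n) * t) * decay \<theta> t / \<Phi> (inverse (?N n)))"
      by (rule set_integrable_divide) (rule decay_laplace(1)[OF \<theta> z])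
    show "set_integrable lborel {0<..} (\<lambda>s. exp (- real (Suc k) * s) * g n s)"
      unfolding scaled by (rule set_integral_scale(1)[THEN iffD2, OF _ i]) simp
  next
    fix k
    have "set_integrable lborel {0<..} (\<lambda>s. c * (exp (- real (Suc k) * s) * s powr (- \<alpha>)))"
      by (rule set_integrable_mult_right) (rule power_laplace(1)[OF \<alpha>(2)], simp)
    then show "set_integrable lborel {0<..} (\<lambda>s. exp (- real (Suc k) * s) * g' s)" by (simp only: g'_def mult.left_commute)
  next
    show "0 \<le> g n s" if "0 < s" for n s
      unfolding g_def by (intro divide_nonneg_pos decay_bounds(1)[OF \<theta>] P) (use that in simp)
    show "0 \<le> g' s" if "0 < s" for s unfolding g'_def using c0 by simp
  next
    fix k
    let ?k = "real (Suc k)"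
    have k: "0 < ?k" by simp
    have val: "(LINT s:{0<..}|lborel. exp (- ?k * s) * g n s) = (\<Phi> (?k * inverse (?N n)) / \<Phi> (inverse (?N n))) / (?k * (\<theta> + \<Phi> (?k * inverse (?N n))))" for n
    proof -
      have N: "0 < ?N n" by simp
      have kn: "?k / ?N n = ?k * inverse (?N n)" by (simp add: divide_inverse)
      have "(LINT s:{0<..}|lborel. exp (- ?k * s) * g n s) =
        (LINT t:{0<..}|lborel. exp (- (?k / ?N n) * t) * decay \<theta> t / \<Phi> (inverse (?N n))) / ?N n"
        unfolding scaled by (rule set_integral_scale(2)[OF N])
      also have "\<dots> = \<Phi> (?k / ?N n) / ((?k / ?N n) * (\<theta> + \<Phi> (?k / ?N n))) / \<Phi> (inverse (?N n)) / ?N n"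
        unfolding set_integral_divide_zero decay_laplace(2)[OF \<theta> z] ..
      also have "\<dots> = (\<Phi> (?k / ?N n) / \<Phi> (inverse (?N n))) / (?k * (\<theta> + \<Phi> (?k / ?N n)))"
      proof -
        have gen: "a / ((k / m) * d) / b / m = (a / b) / (k * d)" if "m \<noteq> 0" "k \<noteq> 0" "d \<noteq> 0" "b \<noteq> 0" for a b d k m :: real
          using that by (simp add: field_simps)
        have "\<theta> + \<Phi> (?k / ?N n) \<noteq> 0" using Phi_pos[OF z[of k n]] \<theta> by linarith
        then show ?thesis
          by (rule gen[OF less_imp_neq[OF N, symmetric] less_imp_neq[OF k, symmetric] _ less_imp_neq[OF P, symmetric]])
      qed
      finally show ?thesis unfolding kn .
    qed
    have l1: "(\<lambda>n. \<Phi> (?k * inverse (?N n)) / \<Phi> (inverse (?N n))) \<longlonglongrightarrow> ?k powr \<alpha>"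
      by (rule filterlim_compose[OF rv[unfolded regularly_varying_at_0_def, rule_format, OF k] inverse_Suc_at_right])
    have "filterlim (\<lambda>n. ?k * inverse (?N n)) (at_right 0) sequentially"
    proof -
      have "(\<lambda>n. ?k * inverse (?N n)) \<longlonglongrightarrow> ?k * 0" by (intro tendsto_intros LIMSEQ_inverse_real_of_nat)
      then show ?thesis unfolding filterlim_at by (simp del: of_nat_Suc)
    qed
    then have l2: "(\<lambda>n. \<Phi> (?k * inverse (?N n))) \<longlonglongrightarrow> 0" by (rule filterlim_compose[OF levy_tendsto_0[OF levy]])
    have "(\<lambda>n. (\<Phi> (?k * inverse (?N n)) / \<Phi> (inverse (?N n))) / (?k * (\<theta> + \<Phi> (?k * inverse (?N n))))) \<longlonglongrightarrow> ?k powr \<alpha> / (?k * (\<theta> + 0))"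
      by (intro tendsto_divide tendsto_mult tendsto_add tendsto_const l1 l2) (use k \<theta> in \<open>simp del: of_nat_Suc\<close>)
    moreover have "(LINT s:{0<..}|lborel. exp (- ?k * s) * g' s) = ?k powr \<alpha> / (?k * (\<theta> + 0))"
    proof -
      have "(LINT s:{0<..}|lborel. exp (- ?k * s) * g' s) = (LINT s:{0<..}|lborel. c * (exp (- ?k * s) * s powr (- \<alpha>)))"
        by (simp only: g'_def mult.left_commute)
      also have "\<dots> = c * (Gamma (1 - \<alpha>) * ?k powr (\<alpha> - 1))"
        unfolding set_integral_mult_right power_laplace(2)[OF \<alpha>(2) k] ..
      also have "\<dots> = ?k powr \<alpha> / (?k * (\<theta> + 0))"
        using k G \<theta> by (simp add: c_def powr_diff del: of_nat_Suc)
      finally show ?thesis .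
    qed
    ultimately show "(\<lambda>n. LINT s:{0<..}|lborel. exp (- ?k * s) * g n s) \<longlonglongrightarrow> (LINT s:{0<..}|lborel. exp (- ?k * s) * g' s)"
      unfolding val by simp
  qed
  have "(\<lambda>n. g n 1) \<longlonglongrightarrow> g' 1"
  proof (rule antimono_limit_at_1)
    show "g n t \<le> g n s" if "0 < s" "s \<le> t" for n s t
      unfolding g_def using that P[of n] by (intro divide_right_mono decay_antimono[OF \<theta>]) (auto intro: less_imp_le)
    show "g' t \<le> g' s" if "0 < s" "s \<le> t" for s t
      unfolding g'_def using that \<alpha> c0 by (intro mult_left_mono powr_mono2') auto
    show "isCont g' 1" unfolding g'_def[abs_def] by (intro continuous_intros) auto
  qed
  then show ?thesis by (simp add: g_def g'_def c_def del: of_nat_Suc)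
qed

text \<open>\<open>\<Phi> (1 / x)\<close> varies regularly at infinity with index
  \<open>- \<alpha>\<close>, which the factor \<open>x powr \<alpha>\<close> cancels. Continuity of
  \<open>\<Phi>\<close> gives measurability, and the default 0 extends it to the whole line.\<close>

lemma slowly_varying_Phi:
  assumes cont: "continuous_on {0<..} \<Phi>" and rv: "regularly_varying_at_0 \<Phi> \<alpha>" and c: "0 < c"
  shows "slowly_varying (\<lambda>x. if 0 < x then c * x powr \<alpha> * \<Phi> (inverse x) else 0)"
  unfolding slowly_varying_def
proof (intro conjI allI impI)
  let ?l = "\<lambda>x. if 0 < x then c * x powr \<alpha> * \<Phi> (inverse x) else 0"
  have "continuous_on {0<..} (\<lambda>x. c * x powr \<alpha> * \<Phi> (inverse x))"
    by (intro continuous_intros continuous_on_compose2[OF cont]) auto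
  from borel_measurable_continuous_on_indicator[OF _ this]
  have "(\<lambda>x. indicator {0<..} x *\<^sub>R (c * x powr \<alpha> * \<Phi> (inverse x))) \<in> borel_measurable borel" by simp
  also have "(\<lambda>x. indicator {0<..} x *\<^sub>R (c * x powr \<alpha> * \<Phi> (inverse x))) = ?l" by (auto simp: indicator_def)
  finally show "?l \<in> borel_measurable borel" .
  show "\<forall>\<^sub>F x in at_top. ?l x > 0"
    using eventually_gt_at_top[of 0] by eventually_elim (use c in \<open>auto intro!: mult_pos_pos Phi_pos\<close>)
  fix d :: real assume d: "0 < d"
  have inv: "filterlim inverse (at_right 0) (at_top :: real filter)"
    by (rule filterlim_inverse_at_right_top)
  have "((\<lambda>z. \<Phi> (inverse d * z) / \<Phi> z) \<longlongrightarrow> inverse d powr \<alpha>) (at_right 0)"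
    using rv d unfolding regularly_varying_at_0_def by auto
  from filterlim_compose[OF this inv]
  have "((\<lambda>x. \<Phi> (inverse d * inverse x) / \<Phi> (inverse x)) \<longlongrightarrow> inverse d powr \<alpha>) at_top" .
  from tendsto_mult[OF tendsto_const[of "d powr \<alpha>"] this]
  have "((\<lambda>x. d powr \<alpha> * (\<Phi> (inverse d * inverse x) / \<Phi> (inverse x))) \<longlongrightarrow> 1) at_top"
    using d by (simp add: powr_mult[symmetric])
  moreover have "\<forall>\<^sub>F x in at_top. d powr \<alpha> * (\<Phi> (inverse d * inverse x) / \<Phi> (inverse x)) = ?l (d * x) / ?l x"
    using eventually_gt_at_top[of 0]
  proof eventually_elim
    case (elim x)
    have "(d * x) powr \<alpha> = d powr \<alpha> * x powr \<alpha>" using d elim by (simp add: powr_mult)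
    then show ?case using d elim c by simp
  qed
  ultimately show "((\<lambda>x. ?l (d * x) / ?l x) \<longlongrightarrow> 1) at_top" by (rule Lim_transform_eventually)
qed

lemma decay_long_range:
  assumes \<theta>: "0 < \<theta>" and \<alpha>: "0 < \<alpha>" "\<alpha> < 1" and rv: "regularly_varying_at_0 \<Phi> \<alpha>" and cont: "continuous_on {0<..} \<Phi>"
    and ac: "\<And>n. autocorr M Y n = decay \<theta> (real n)"
  shows "long_range_dependent M Y"
proof -
  define c where "c = 1 / (\<theta> * Gamma (1 - \<alpha>))"
  have c0: "0 < c" using \<theta> \<alpha> Gamma_real_pos[of "1 - \<alpha>"] by (simp add: c_def)
  define l where "l = (\<lambda>x::real. if 0 < x then c * x powr \<alpha> * \<Phi> (inverse x) else 0)"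
  have "(\<lambda>n. decay \<theta> (real (Suc n)) / \<Phi> (inverse (real (Suc n)))) \<longlonglongrightarrow> c"
    using decay_regular_variation[OF \<theta> \<alpha> rv] by (simp add: c_def)
  from tendsto_divide[OF this tendsto_const[of c]]
  have 1: "(\<lambda>n. decay \<theta> (real (Suc n)) / \<Phi> (inverse (real (Suc n))) / c) \<longlonglongrightarrow> 1" using c0 by simp
  have eq: "autocorr M Y (Suc n) / (l (real (Suc n)) * real (Suc n) powr - \<alpha>) = decay \<theta> (real (Suc n)) / \<Phi> (inverse (real (Suc n))) / c" for n
  proof -
    have "real (Suc n) powr \<alpha> * real (Suc n) powr - \<alpha> = 1" by (simp add: powr_add[symmetric] del: of_nat_Suc)
    then have "l (real (Suc n)) * real (Suc n) powr - \<alpha> = c * \<Phi> (inverse (real (Suc n)))"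
      by (simp add: l_def del: of_nat_Suc)
    then show ?thesis unfolding ac by (simp add: field_simps del: of_nat_Suc)
  qed
  have "(\<lambda>n. autocorr M Y n / (l (real n) * real n powr - \<alpha>)) \<longlonglongrightarrow> 1"
    \<comment> \<open>The shift avoids \<open>n = 0\<close>, where the comparison function is 0 and
      the quotient a default value.\<close>
    by (rule LIMSEQ_imp_Suc) (simp only: eq 1)
  then have "autocorr M Y \<sim>[sequentially] (\<lambda>n. l (real n) * real n powr - \<alpha>)" by (rule asymp_equivI')
  moreover have "slowly_varying l" unfolding l_def by (rule slowly_varying_Phi[OF cont rv c0])
  ultimately show ?thesis unfolding long_range_dependent_def using \<alpha> by blast
qed

text \<open>For \<open>t \<le> Suc N\<close> and \<open>z = 1 / Suc N\<close> the factor
  \<open>exp (- z * t)\<close> is at least \<open>exp (- 1)\<close>, so by monotonicity the partial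
  sums are at most \<open>exp 1\<close> times the Laplace transform at \<open>z\<close>. The
  transform is at most \<open>\<Phi> z / z / \<theta>\<close>, which the hypothesis keeps
  bounded.\<close>

lemma decay_short_range:
  assumes \<theta>: "0 < \<theta>" and lim: "((\<lambda>z. \<Phi> z / z) \<longlongrightarrow> l) (at_right 0)"
    and ac: "\<And>n. autocorr M Y n = decay \<theta> (real n)"
  shows "short_range_dependent M Y"
proof -
  have d0: "0 \<le> decay \<theta> (real n)" for n by (rule decay_bounds[OF \<theta>]) simp
  have "(\<lambda>n. \<Phi> (inverse (real (Suc n))) / inverse (real (Suc n))) \<longlonglongrightarrow> l" by (rule filterlim_compose[OF lim inverse_Suc_at_right])
  then have "Bseq (\<lambda>n. \<Phi> (inverse (real (Suc n))) / inverse (real (Suc n)))" by (rule convergent_imp_Bseq[OF convergentI])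
  then obtain C where C: "\<And>n. \<Phi> (inverse (real (Suc n))) / inverse (real (Suc n)) \<le> C"
    unfolding Bseq_def real_norm_def by (meson abs_ge_self order_trans)
  have bound: "(\<Sum>i<Suc N. decay \<theta> (real (Suc i))) \<le> exp 1 * (C / \<theta>)" for N
  proof -
    let ?z = "inverse (real (Suc N))"
    have z: "0 < ?z" by simp
    note I = decay_laplace[OF \<theta> z]
    define I' where "I' i = (LINT t:{real i<..real (Suc i)}|lborel. exp (- ?z * t) * decay \<theta> t)" for i
    have si: "set_integrable lborel A (\<lambda>t. exp (- ?z * t) * decay \<theta> t)" if "A \<subseteq> {0<..}" "A \<in> sets borel" for A
      by (rule set_integrable_subset[OF I(1)]) (use that in auto)
    have step: "exp (- 1) * decay \<theta> (real (Suc i)) \<le> I' i" if i: "i < Suc N" for i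
    proof -
      have "(LINT t:{real i<..real (Suc i)}|lborel. exp (- 1) * decay \<theta> (real (Suc i))) \<le> I' i"
        unfolding I'_def
      proof (rule set_integral_mono)
        show "set_integrable lborel {real i<..real (Suc i)} (\<lambda>t. exp (- 1) * decay \<theta> (real (Suc i)))"
          by (simp add: set_integrable_def)
        show "set_integrable lborel {real i<..real (Suc i)} (\<lambda>t. exp (- ?z * t) * decay \<theta> t)" by (rule si) auto
        fix t assume "t \<in> {real i<..real (Suc i)}"
        then have t: "0 < t" "t \<le> real (Suc i)" "t \<le> real (Suc N)" using i by auto
        have "?z * t \<le> ?z * real (Suc N)" using t z by (intro mult_left_mono) auto
        then have "?z * t \<le> 1" by (simp del: of_nat_Suc)
        then show "exp (- 1) * decay \<theta> (real (Suc i)) \<le> exp (- ?z * t) * decay \<theta> t"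
          using t by (intro mult_mono decay_antimono[OF \<theta>] d0) auto
      qed
      then show ?thesis by (simp add: set_lebesgue_integral_def)
    qed
    have sum: "(\<Sum>i<n. I' i) = (LINT t:{0<..real n}|lborel. exp (- ?z * t) * decay \<theta> t)" for n
    proof (induction n)
      case (Suc n)
      have "{0<..real (Suc n)} = {0<..real n} \<union> {real n<..real (Suc n)}" by auto
      then have "(LINT t:{0<..real (Suc n)}|lborel. exp (- ?z * t) * decay \<theta> t) =
        (LINT t:{0<..real n}|lborel. exp (- ?z * t) * decay \<theta> t) + I' n"
        unfolding I'_def by (simp only:) (rule set_integral_Un; (rule si)?; auto)
      then show ?case using Suc by simp
    qed (simp add: set_lebesgue_integral_def)
    have "exp (- 1) * (\<Sum>i<Suc N. decay \<theta> (real (Suc i))) \<le> (\<Sum>i<Suc N. I' i)"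
      unfolding sum_distrib_left by (intro sum_mono step) auto
    also have "\<dots> = (LINT t:{0<..real (Suc N)}|lborel. exp (- ?z * t) * decay \<theta> t)" by (rule sum)
    also have "\<dots> \<le> (LINT t:{0<..}|lborel. exp (- ?z * t) * decay \<theta> t)"
      unfolding set_lebesgue_integral_def
    proof (rule integral_mono)
      show "integrable lborel (\<lambda>t. indicator {0<..real (Suc N)} t *\<^sub>R (exp (- ?z * t) * decay \<theta> t))"
        by (rule si[unfolded set_integrable_def]) auto
      show "integrable lborel (\<lambda>t. indicator {0<..} t *\<^sub>R (exp (- ?z * t) * decay \<theta> t))"
        using I(1) by (simp add: set_integrable_def)
      show "indicator {0<..real (Suc N)} t *\<^sub>R (exp (- ?z * t) * decay \<theta> t) \<le> indicator {0<..} t *\<^sub>R (exp (- ?z * t) * decay \<theta> t)" for t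
        using decay_bounds(1)[OF \<theta>, of t] by (auto simp: indicator_def)
    qed
    also have "\<dots> = \<Phi> ?z / (?z * (\<theta> + \<Phi> ?z))" by (rule I(2))
    also have "\<dots> = (\<Phi> ?z / ?z) / (\<theta> + \<Phi> ?z)" by simp
    also have "\<dots> \<le> (\<Phi> ?z / ?z) / \<theta>"
      using Phi_pos[OF z] z \<theta> by (intro divide_left_mono) (auto intro!: mult_pos_pos divide_nonneg_pos add_pos_pos less_imp_le)
    also have "\<dots> \<le> C / \<theta>" using C[of N] \<theta> by (intro divide_right_mono) auto
    finally have "exp 1 * (exp (- 1) * (\<Sum>i<Suc N. decay \<theta> (real (Suc i)))) \<le> exp 1 * (C / \<theta>)" by (intro mult_left_mono) auto
    moreover have "exp 1 * exp (- 1) = (1::real)" by (simp add: exp_add[symmetric])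
    ultimately show ?thesis by (simp only: mult.assoc[symmetric] mult_1)
  qed
  have "summable (\<lambda>n. decay \<theta> (real (Suc n)))"
  proof (rule summableI_nonneg_bounded)
    fix n
    have "(\<Sum>i<n. decay \<theta> (real (Suc i))) \<le> (\<Sum>i<Suc n. decay \<theta> (real (Suc i)))" using d0[of "Suc n"] by simp
    also have "\<dots> \<le> exp 1 * (C / \<theta>)" by (rule bound)
    finally show "(\<Sum>i<n. decay \<theta> (real (Suc i))) \<le> exp 1 * (C / \<theta>)" .
  qed (rule d0)
  then show ?thesis using d0 by (simp add: short_range_dependent_def ac del: of_nat_Suc)
qed

end

section \<open>The time-changed diffusion\<close>

text \<open>The initial law is given through \<open>ennreal\<close>, which cuts negative values off;
  nonnegativity lets its integrals be computed with the density formula itself.\<close>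

lemma stationary_density_nonneg:
  assumes "admissible p"
  shows "0 \<le> stationary_density p x"
proof (cases "x \<in> state_space p")
  case True
  have "0 \<le> density_formula p x"
  proof (cases p)
    case (CIR a b)
    then show ?thesis using assms by (auto intro!: mult_nonneg_nonneg divide_nonneg_pos Gamma_real_pos)
  next
    case (Jacobi a b)
    then show ?thesis using assms
      by (auto intro!: mult_nonneg_nonneg divide_nonneg_nonneg Gamma_real_nonneg)
  next
    case (Fisher_Snedecor \<alpha> \<beta>)
    have "0 \<le> Beta (\<alpha> / 2) (\<beta> / 2)"
      using assms Fisher_Snedecor unfolding Beta_def by (auto intro!: mult_nonneg_nonneg divide_nonneg_nonneg Gamma_real_nonneg)
    then show ?thesis using assms Fisher_Snedecor True by (auto intro!: mult_nonneg_nonneg)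
  next
    case (Reciprocal_Gamma \<alpha> \<beta>)
    then show ?thesis using assms by (auto intro!: mult_nonneg_nonneg divide_nonneg_pos Gamma_real_pos)
  next
    case (Student \<delta> \<mu> \<mu>' \<nu>)
    have "0 \<le> student_weight \<delta> \<mu> \<mu>' \<nu> y" for y by (simp add: student_weight_def)
    then show ?thesis using Student by (auto intro!: divide_nonneg_nonneg integral_nonneg_AE)
  qed simp
  then show ?thesis using True by (simp add: stationary_density_def)
qed (simp add: stationary_density_def)

text \<open>Fubini with the random time frozen. Independence makes \<open>L t\<close> independent of
  the sigma-algebra \<open>N\<close> generated by \<open>X\<close>, so the law of
  \<open>(L t, \<omega>)\<close> on \<open>borel \<Otimes>\<^sub>M N\<close> is a product. The
  outcome is kept in place of the path because evaluation of a path at a variable time is not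
  measurable on the product space of all paths, whereas
  \<open>(y, \<omega>) \<mapsto> X y \<omega>\<close> is measurable by continuity of the paths. The
  constant \<open>C\<close> makes the integral over the time finite.\<close>

lemma (in prob_space) time_change_expectation:
  fixes X L :: "real \<Rightarrow> 'a \<Rightarrow> real" and \<phi> :: "real \<Rightarrow> real \<Rightarrow> real"
  assumes indep: "indep_processes M X L" and cont: "\<And>\<omega>. \<omega> \<in> space M \<Longrightarrow> continuous_on {0..} (\<lambda>t. X t \<omega>)"
    and L: "0 \<le> t" "\<And>\<omega>. 0 \<le> L t \<omega>"
    and \<phi>: "(\<lambda>z. \<phi> (fst z) (snd z)) \<in> borel_measurable (borel \<Otimes>\<^sub>M borel)"
    and int: "\<And>y. 0 \<le> y \<Longrightarrow> integrable M (\<lambda>\<omega>. \<phi> (X y \<omega>) (X 0 \<omega>))"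
    and bnd: "\<And>y. 0 \<le> y \<Longrightarrow> (\<integral>\<omega>. \<bar>\<phi> (X y \<omega>) (X 0 \<omega>)\<bar> \<partial>M) \<le> C"
  shows "integrable M (\<lambda>\<omega>. \<phi> (X (L t \<omega>) \<omega>) (X 0 \<omega>))"
    "(\<integral>\<omega>. \<phi> (X (L t \<omega>) \<omega>) (X 0 \<omega>) \<partial>M) = (\<integral>\<omega>. (\<integral>\<omega>'. \<phi> (X (L t \<omega>) \<omega>') (X 0 \<omega>') \<partial>M) \<partial>M)"
proof -
  let ?P = "Pi\<^sub>M {0..} (\<lambda>_. borel) :: (real \<Rightarrow> real) measure"
  let ?X = "\<lambda>\<omega>. \<lambda>t\<in>{0..}. X t \<omega>" and ?L = "\<lambda>\<omega>. \<lambda>t\<in>{0..}. L t \<omega>"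
  have iv: "indep_var ?P ?X ?P ?L" using indep by (simp add: indep_processes_def)
  have Xm: "?X \<in> measurable M ?P" and Lm: "?L \<in> measurable M ?P"
    using indep_var_rv1[OF iv] indep_var_rv2[OF iv] by auto
  have comp: "(\<lambda>f. f s) \<in> borel_measurable ?P" if "0 \<le> s" for s
    by (rule measurable_component_singleton) (use that in simp)
  define N where "N = vimage_algebra (space M) ?X ?P"
  have sN: "space N = space M" by (simp add: N_def)
  have Xs: "?X \<in> space M \<rightarrow> space ?P" using measurable_space[OF Xm] by auto
  have XN: "X s \<in> borel_measurable N" if "0 \<le> s" for s
  proof -
    have "?X \<in> measurable N ?P" unfolding N_def by (rule measurable_vimage_algebra1[OF Xs])
    from measurable_compose[OF this comp[OF that]] show ?thesis using that by simp
  qed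
  have setsN: "sets N = {?X -` A \<inter> space M | A. A \<in> sets ?P}" unfolding N_def by (rule sets_vimage_algebra2[OF Xs])
  have idN: "(\<lambda>\<omega>. \<omega>) \<in> measurable M N"
    using measurable_sets[OF Xm] by (intro measurableI) (auto simp: sN setsN sets.Int_space_eq2)
  have LMt[measurable]: "L t \<in> borel_measurable M"
    using measurable_compose[OF Lm comp[OF L(1)]] L(1) by simp
  have ind: "prob (L t -` A \<inter> space M \<inter> B) = prob (L t -` A \<inter> space M) * prob B" if A: "A \<in> sets borel" and B: "B \<in> sets N" for A B
  proof -
    obtain A' where A': "A' \<in> sets ?P" "B = ?X -` A' \<inter> space M" using B unfolding setsN by auto
    let ?A = "(\<lambda>f. f t) -` A \<inter> space ?P"
    have "?A \<in> sets ?P" by (rule measurable_sets[OF comp[OF L(1)] A])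
    moreover have "L t -` A \<inter> space M = ?L -` ?A \<inter> space M"
      using measurable_space[OF Lm] L(1) by auto
    ultimately have "L t -` A \<inter> space M \<in> sigma_sets (space M) {?L -` A \<inter> space M | A. A \<in> sets ?P}" by blast
    moreover have "B \<in> sigma_sets (space M) {?X -` A \<inter> space M | A. A \<in> sets ?P}" using A' by blast
    ultimately have "prob (B \<inter> (L t -` A \<inter> space M)) = prob B * prob (L t -` A \<inter> space M)"
      using iv unfolding indep_var_eq indep_sets2_eq by blast
    then show ?thesis by (simp add: Int_commute mult.commute)
  qed
  let ?Q = "distr M borel (L t)" and ?N = "distr M N (\<lambda>\<omega>. \<omega>)"
  interpret Q: prob_space ?Q by (rule prob_space_distr[OF LMt])
  interpret N: prob_space ?N by (rule prob_space_distr[OF idN])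
  interpret QN: pair_prob_space ?Q ?N ..
  have pairm: "(\<lambda>\<omega>. (L t \<omega>, \<omega>)) \<in> measurable M (borel \<Otimes>\<^sub>M N)" using LMt idN by (rule measurable_Pair)
  have joint: "?Q \<Otimes>\<^sub>M ?N = distr M (borel \<Otimes>\<^sub>M N) (\<lambda>\<omega>. (L t \<omega>, \<omega>))"
  proof (rule pair_measure_eqI)
    fix A B assume "A \<in> sets ?Q" "B \<in> sets ?N"
    then have A: "A \<in> sets borel" and B: "B \<in> sets N" by auto
    have "(\<lambda>\<omega>. (L t \<omega>, \<omega>)) -` (A \<times> B) \<inter> space M = L t -` A \<inter> space M \<inter> B"
      using sets.sets_into_space[OF B] by (auto simp: sN)
    moreover have "B \<inter> space M = B" using sets.sets_into_space[OF B] sN by auto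
    ultimately show "emeasure ?Q A * emeasure ?N B = emeasure (distr M (borel \<Otimes>\<^sub>M N) (\<lambda>\<omega>. (L t \<omega>, \<omega>))) (A \<times> B)"
      using A B ind[OF A B] by (simp add: emeasure_distr[OF LMt A] emeasure_distr[OF idN B] emeasure_distr[OF pairm]
        emeasure_eq_measure ennreal_mult[symmetric])
  qed (auto intro: Q.sigma_finite_measure_axioms N.sigma_finite_measure_axioms cong: sets_pair_measure_cong)
  define G where "G z = \<phi> (X (max 0 (fst z)) (snd z)) (X 0 (snd z))" for z
  have X1: "(\<lambda>z. X (max 0 (fst z)) (snd z)) \<in> borel_measurable (borel \<Otimes>\<^sub>M N)"
  proof (rule right_continuous_measurable_pair[OF XN])
    fix \<omega> y assume w: "\<omega> \<in> space N" "0 \<le> (y::real)"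
    have "continuous (at y within {0..}) (\<lambda>t. X t \<omega>)"
      using cont[of \<omega>] w sN by (auto simp: continuous_on_eq_continuous_within)
    then show "continuous (at_right y) (\<lambda>y. X y \<omega>)" by (rule continuous_within_subset) (use w in auto)
  qed
  have X2: "(\<lambda>z. X 0 (snd z)) \<in> borel_measurable (borel \<Otimes>\<^sub>M N)" by (rule measurable_compose[OF measurable_snd XN]) simp
  have Gm: "G \<in> borel_measurable (borel \<Otimes>\<^sub>M N)"
    unfolding G_def using measurable_compose[OF measurable_Pair[OF X1 X2] \<phi>] by simp
  have Gm': "G \<in> borel_measurable (?Q \<Otimes>\<^sub>M ?N)" using Gm by (simp cong: measurable_cong_sets)
  have \<phi>N: "(\<lambda>\<omega>. \<phi> (X y \<omega>) (X 0 \<omega>)) \<in> borel_measurable N" if "0 \<le> y" for y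
    using measurable_compose[OF measurable_Pair[OF XN[OF that] XN[OF order_refl]] \<phi>] by simp
  have nn: "AE y in ?Q. 0 \<le> y" by (subst AE_distr_iff) (use L(2) in auto)
  have iG: "integrable (?Q \<Otimes>\<^sub>M ?N) G"
  proof (rule QN.Fubini_integrable[OF Gm'])
    show "AE y in ?Q. integrable ?N (\<lambda>\<omega>. G (y, \<omega>))"
      using nn
    proof eventually_elim
      case (elim y)
      then show ?case using int[OF elim] \<phi>N[OF elim] idN by (subst integrable_distr_eq) (auto simp: G_def)
    qed
    show "integrable ?Q (\<lambda>y. \<integral>\<omega>. norm (G (y, \<omega>)) \<partial>?N)"
    proof (rule Q.integrable_const_bound[of _ C])
      show "AE y in ?Q. norm (\<integral>\<omega>. norm (G (y, \<omega>)) \<partial>?N) \<le> C"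
        using nn
      proof eventually_elim
        case (elim y)
        have "(\<integral>\<omega>. norm (G (y, \<omega>)) \<partial>?N) = (\<integral>\<omega>. \<bar>\<phi> (X y \<omega>) (X 0 \<omega>)\<bar> \<partial>M)"
          using \<phi>N[OF elim] idN elim by (subst integral_distr) (auto simp: G_def)
        moreover have "0 \<le> (\<integral>\<omega>. \<bar>\<phi> (X y \<omega>) (X 0 \<omega>)\<bar> \<partial>M)" by (intro integral_nonneg_AE) simp
        ultimately show ?case using bnd[OF elim] by simp
      qed
      show "(\<lambda>y. \<integral>\<omega>. norm (G (y, \<omega>)) \<partial>?N) \<in> borel_measurable ?Q"
        using Gm' by (intro N.borel_measurable_lebesgue_integral) simp
    qed
  qed
  have eq: "G (L t \<omega>, \<omega>) = \<phi> (X (L t \<omega>) \<omega>) (X 0 \<omega>)" for \<omega> using L(2) by (simp add: G_def max_absorb2)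
  show "integrable M (\<lambda>\<omega>. \<phi> (X (L t \<omega>) \<omega>) (X 0 \<omega>))"
    using iG unfolding joint integrable_distr_eq[OF pairm Gm] eq .
  have "(\<integral>\<omega>. \<phi> (X (L t \<omega>) \<omega>) (X 0 \<omega>) \<partial>M) = (\<integral>z. G z \<partial>(?Q \<Otimes>\<^sub>M ?N))"
    unfolding joint integral_distr[OF pairm Gm] eq ..
  also have "\<dots> = (\<integral>y. (\<integral>\<omega>. G (y, \<omega>) \<partial>?N) \<partial>?Q)" by (rule QN.integral_fst'[OF iG, symmetric])
  also have "\<dots> = (\<integral>\<omega>. (\<integral>\<omega>'. G (L t \<omega>, \<omega>') \<partial>?N) \<partial>M)"
    by (rule integral_distr[OF LMt]) (use Gm' in \<open>simp add: N.borel_measurable_lebesgue_integral\<close>)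
  also have "\<dots> = (\<integral>\<omega>. (\<integral>\<omega>'. \<phi> (X (L t \<omega>) \<omega>') (X 0 \<omega>') \<partial>M) \<partial>M)"
  proof (rule Bochner_Integration.integral_cong[OF refl])
    fix \<omega>
    show "(\<integral>\<omega>'. G (L t \<omega>, \<omega>') \<partial>?N) = (\<integral>\<omega>'. \<phi> (X (L t \<omega>) \<omega>') (X 0 \<omega>') \<partial>M)"
      using integral_distr[OF idN \<phi>N[OF L(2)]] L(2) by (simp add: G_def max_absorb2)
  qed
  finally show "(\<integral>\<omega>. \<phi> (X (L t \<omega>) \<omega>) (X 0 \<omega>) \<partial>M) = (\<integral>\<omega>. (\<integral>\<omega>'. \<phi> (X (L t \<omega>) \<omega>') (X 0 \<omega>') \<partial>M) \<partial>M)" .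
qed

lemma (in prob_space) stationary_initial_moments:
  assumes p: "admissible p" and d: "distributed M lborel Z (\<lambda>x. ennreal (stationary_density p x))"
    and i2: "integrable lborel (\<lambda>x. x\<^sup>2 * stationary_density p x)"
  shows "integrable lborel (stationary_density p)" "integrable M (\<lambda>\<omega>. (Z \<omega>)\<^sup>2)"
    "\<And>g. g \<in> borel_measurable borel \<Longrightarrow> (\<integral>\<omega>. g (Z \<omega>) \<partial>M) = (\<integral>x. g x * stationary_density p x \<partial>lborel)"
    "0 < (\<integral>\<omega>. (Z \<omega> - \<mu>)\<^sup>2 \<partial>M)"
proof -
  let ?m = "stationary_density p"
  have nn: "0 \<le> ?m x" for x by (rule stationary_density_nonneg[OF p])
  have Zm[measurable]: "Z \<in> borel_measurable M" using distributed_measurable[OF d] by simp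
  have em: "(\<lambda>x. ennreal (?m x)) \<in> borel_measurable lborel" using distributed_borel_measurable[OF d] .
  have mm[measurable]: "?m \<in> borel_measurable lborel"
    using borel_measurable_enn2real[OF em] nn by simp
  have one: "(\<integral>\<^sup>+x. ennreal (?m x) \<partial>lborel) = 1"
    using distributed_nn_integral[OF d, of "\<lambda>_. 1"] by (simp add: emeasure_space_1)
  show im: "integrable lborel ?m"
    using one nn by (intro integrableI_bounded) auto
  show g: "(\<integral>\<omega>. g (Z \<omega>) \<partial>M) = (\<integral>x. g x * ?m x \<partial>lborel)" if "g \<in> borel_measurable borel" for g :: "real \<Rightarrow> real"
    using distributed_integral[OF d, of g] that nn by (simp add: mult.commute)
  show iZ: "integrable M (\<lambda>\<omega>. (Z \<omega>)\<^sup>2)"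
    by (rule iffD1[OF distributed_integrable[OF d, of "\<lambda>x. x\<^sup>2"]]) (use nn i2 in \<open>simp_all add: mult.commute\<close>)
  have iZ1: "integrable M Z" using square_integrable_imp_integrable[OF Zm] iZ by (simp add: power2_eq_square)
  have sq: "(Z \<omega> - \<mu>)\<^sup>2 = (Z \<omega>)\<^sup>2 - 2 * \<mu> * Z \<omega> + \<mu>\<^sup>2" for \<omega> by (simp add: power2_eq_square algebra_simps)
  have iZm: "integrable M (\<lambda>\<omega>. (Z \<omega> - \<mu>)\<^sup>2)" unfolding sq using iZ iZ1 by simp
  \<comment> \<open>Zero variance would put all mass on the point \<open>\<mu>\<close>, which a law
    with a density does not charge.\<close>
  have "(\<integral>\<omega>. (Z \<omega> - \<mu>)\<^sup>2 \<partial>M) \<noteq> 0"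
  proof
    assume "(\<integral>\<omega>. (Z \<omega> - \<mu>)\<^sup>2 \<partial>M) = 0"
    then have "AE \<omega> in M. Z \<omega> = \<mu>" using iZm by (subst (asm) integral_nonneg_eq_0_iff_AE) auto
    then have "emeasure M (Z -` {\<mu>} \<inter> space M) = 1"
      by (intro emeasure_eq_1_AE) auto
    moreover have "emeasure M (Z -` {\<mu>} \<inter> space M) = (\<integral>\<^sup>+x. ennreal (?m x) * indicator {\<mu>} x \<partial>lborel)"
      by (rule distributed_emeasure[OF d]) simp
    moreover have "(\<integral>\<^sup>+x. ennreal (?m x) * indicator {\<mu>} x \<partial>lborel) = (\<integral>\<^sup>+(x::real). 0 \<partial>lborel)"
    proof (rule nn_integral_cong_AE)
      have "AE x in lborel. x \<noteq> \<mu>" by (rule AE_lborel_singleton)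
      then show "AE x in lborel. ennreal (?m x) * indicator {\<mu>} x = 0" by eventually_elim simp
    qed
    ultimately show False by simp
  qed
  moreover have "0 \<le> (\<integral>\<omega>. (Z \<omega> - \<mu>)\<^sup>2 \<partial>M)" by (intro integral_nonneg_AE) simp
  ultimately show "0 < (\<integral>\<omega>. (Z \<omega> - \<mu>)\<^sup>2 \<partial>M)" by linarith
qed

lemma (in prob_space) correlation_eqI:
  assumes E: "(\<integral>\<omega>. Y \<omega> \<partial>M) = \<mu>" "(\<integral>\<omega>. Z \<omega> \<partial>M) = \<mu>"
    and V: "(\<integral>\<omega>. (Y \<omega> - \<mu>)\<^sup>2 \<partial>M) = v" "(\<integral>\<omega>. (Z \<omega> - \<mu>)\<^sup>2 \<partial>M) = v" "0 < v"
    and C: "(\<integral>\<omega>. (Y \<omega> - \<mu>) * (Z \<omega> - \<mu>) \<partial>M) = v * \<rho>"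
  shows "correlation M Y Z = \<rho>"
  unfolding correlation_def E V C using V(3) by simp

text \<open>\<open>sqrt\<close> is odd on the reals, so it stays continuous where the radicand is
  negative.\<close>

lemma continuous_on_diffusion: "continuous_on UNIV (diffusion \<theta> p)"
  by (cases p) (auto simp: fun_eq_iff divide_inverse diffusion.simps[abs_def] intro!: continuous_intros)

lemma bernstein_continuous_on:
  assumes "bernstein \<Phi>"
  shows "continuous_on {0<..} \<Phi>"
proof -
  have "(deriv ^^ 0) \<Phi> field_differentiable at x" if "0 < x" for x
    using assms that unfolding bernstein_def by blast
  then show ?thesis
    by (auto intro!: continuous_at_imp_continuous_on field_differentiable_imp_continuous_at)
qed

text \<open>\<open>indep_var\<close> includes measurability of both path maps into the product
  space, whose coordinates are measurable.\<close>

lemma (in prob_space) indep_processes_measurable: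
  assumes "indep_processes M X T" "0 \<le> t"
  shows "X t \<in> borel_measurable M" "T t \<in> borel_measurable M"
proof -
  let ?P = "Pi\<^sub>M {0..} (\<lambda>_. borel) :: (real \<Rightarrow> real) measure"
  have comp: "(\<lambda>f. f t) \<in> borel_measurable ?P"
    by (rule measurable_component_singleton) (use assms in simp)
  have iv: "indep_var ?P (\<lambda>\<omega>. \<lambda>t\<in>{0..}. X t \<omega>) ?P (\<lambda>\<omega>. \<lambda>t\<in>{0..}. T t \<omega>)"
    using assms by (simp add: indep_processes_def)
  show "X t \<in> borel_measurable M" "T t \<in> borel_measurable M"
    using measurable_compose[OF indep_var_rv1[OF iv] comp] measurable_compose[OF indep_var_rv2[OF iv] comp] assms(2)
    by auto
qed

text \<open>With the time frozen at \<open>T t\<close>, the moments of the time-changed process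
  become the moments 0, \<open>v0\<close> and \<open>v0 * exp (- \<theta> * T t)\<close> of
  \<open>Y\<close>, averaged over \<open>T t\<close>. The constancy of the second moment also
  supplies the bounds uniform in time that freezing requires.\<close>

lemma (in linear_drift_path) autocorr_time_change:
  fixes X T :: "real \<Rightarrow> 'a \<Rightarrow> real" and \<mu> :: real
  assumes Y: "\<And>t \<omega>. Y t \<omega> = X t \<omega> - \<mu>" and indep: "indep_processes M X T"
    and T: "\<And>t \<omega>. 0 \<le> T t \<omega>" "AE \<omega> in M. T 0 \<omega> = 0" and v0: "0 < v0"
  shows "autocorr M (time_change X T) n = (\<integral>\<omega>. exp (- \<theta> * T (real n) \<omega>) \<partial>M)"
proof -
  have X: "X t \<omega> = Y t \<omega> + \<mu>" for t \<omega> using Y by simp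
  have contX: "continuous_on {0..} (\<lambda>t. X t \<omega>)" if "\<omega> \<in> space M" for \<omega>
    unfolding X by (intro continuous_intros continuous_Y that)
  have Xm: "X t \<in> borel_measurable M" if "0 \<le> t" for t
    using indep_processes_measurable(1)[OF indep that] .
  have sq: "integrable M (\<lambda>\<omega>. (Y t \<omega>)\<^sup>2)" if "0 \<le> t" for t using Y_sq[OF that] by (simp add: square_integrable_def)
  have i1: "integrable M (Y t)" if "0 \<le> t" for t
    using square_integrable_imp_integrable[OF Y_measurable[OF that]] sq[OF that] by (simp add: power2_eq_square)
  have i2: "integrable M (\<lambda>\<omega>. Y t \<omega> * Y 0 \<omega>)" if "0 \<le> t" for t
    by (rule square_integrable_mult[OF Y_sq[OF that] Y_sq]) simp
  have b1: "(\<integral>\<omega>. \<bar>Y t \<omega>\<bar> \<partial>M) \<le> 1 + v0" if t: "0 \<le> t" for t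
  proof -
    have "\<bar>y\<bar> \<le> 1 + y\<^sup>2" for y :: real
    proof (cases "\<bar>y\<bar> \<le> 1")
      case False
      then have "\<bar>y\<bar> * 1 \<le> \<bar>y\<bar> * \<bar>y\<bar>" by (intro mult_left_mono) auto
      then show ?thesis by (simp add: power2_eq_square)
    qed (simp add: add_increasing2)
    then have "(\<integral>\<omega>. \<bar>Y t \<omega>\<bar> \<partial>M) \<le> (\<integral>\<omega>. 1 + (Y t \<omega>)\<^sup>2 \<partial>M)" using i1[OF t] sq[OF t] by (intro integral_mono) auto
    also have "\<dots> = 1 + v0" using sq[OF t] second_moment[OF t] by (simp add: prob_space)
    finally show ?thesis .
  qed
  have b2: "(\<integral>\<omega>. \<bar>Y t \<omega> * Y 0 \<omega>\<bar> \<partial>M) \<le> 2 * v0" if t: "0 \<le> t" for t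
  proof -
    have "\<bar>y * z\<bar> \<le> y\<^sup>2 + z\<^sup>2" for y z :: real
    proof -
      have "0 \<le> (\<bar>y\<bar> - \<bar>z\<bar>)\<^sup>2" by simp
      then have "2 * (\<bar>y\<bar> * \<bar>z\<bar>) \<le> y\<^sup>2 + z\<^sup>2" by (simp add: power2_diff)
      moreover have "0 \<le> \<bar>y\<bar> * \<bar>z\<bar>" by simp
      ultimately show ?thesis unfolding abs_mult by linarith
    qed
    then have "(\<integral>\<omega>. \<bar>Y t \<omega> * Y 0 \<omega>\<bar> \<partial>M) \<le> (\<integral>\<omega>. (Y t \<omega>)\<^sup>2 + (Y 0 \<omega>)\<^sup>2 \<partial>M)"
      using i2[OF t] sq[OF t] sq[of 0] by (intro integral_mono) auto
    also have "\<dots> = 2 * v0" using sq[OF t] sq[of 0] second_moment[OF t] second_moment[of 0] by simp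
    finally show ?thesis .
  qed
  have E1: "integrable M (\<lambda>\<omega>. Y (T t \<omega>) \<omega>)" "(\<integral>\<omega>. Y (T t \<omega>) \<omega> \<partial>M) = 0" if t: "0 \<le> t" for t
    using time_change_expectation[OF indep contX t T(1), where \<phi>="\<lambda>x x0. x - \<mu>" and C="1 + v0", folded Y]
      i1 b1 expectation_Y[OF T(1)] by auto
  have E2: "(\<integral>\<omega>. (Y (T t \<omega>) \<omega>)\<^sup>2 \<partial>M) = v0" if t: "0 \<le> t" for t
    using time_change_expectation(2)[OF indep contX t T(1), where \<phi>="\<lambda>x x0. (x - \<mu>)\<^sup>2" and C="v0", folded Y]
      sq second_moment second_moment[OF T(1)] by (simp add: prob_space)
  have E3: "(\<integral>\<omega>. Y (T t \<omega>) \<omega> * Y 0 \<omega> \<partial>M) = v0 * (\<integral>\<omega>. exp (- \<theta> * T t \<omega>) \<partial>M)" if t: "0 \<le> t" for t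
    using time_change_expectation(2)[OF indep contX t T(1), where \<phi>="\<lambda>x x0. (x - \<mu>) * (x0 - \<mu>)" and C="2 * v0", folded Y]
      i2 b2 expectation_Y_Y0[OF T(1)] by (simp add: mult.commute[of _ "Y 0 _"])
  have tc: "time_change X T t \<omega> = Y (T t \<omega>) \<omega> + \<mu>" for t \<omega> by (simp add: time_change_def X)
  have m: "(\<lambda>\<omega>. Y (T t \<omega>) \<omega>) \<in> borel_measurable M" if "0 \<le> t" for t using E1(1)[OF that] by auto
  \<comment> \<open>The process at time 0 is \<open>Y (T 0)\<close>, which equals \<open>Y 0\<close>
    only almost surely.\<close>
  have "(\<integral>\<omega>. Y (T (real n) \<omega>) \<omega> * Y (T 0 \<omega>) \<omega> \<partial>M) = (\<integral>\<omega>. Y (T (real n) \<omega>) \<omega> * Y 0 \<omega> \<partial>M)"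
    by (rule integral_cong_AE) (use m[of "real n"] m[of 0] Y_measurable[of 0] T(2) in auto)
  with E3[of "real n"] show ?thesis
    unfolding autocorr_def using E1[of "real n"] E1[of 0] E2[of "real n"] E2[of 0] m[of "real n"] m[of 0] v0
    by (intro correlation_eqI[where \<mu>=\<mu> and v=v0]) (auto simp: tc[abs_def] prob_space)
qed

theorem corollary8p8:
  fixes M :: "'a measure" and F :: "real \<Rightarrow> 'a measure"
    and W X \<sigma> L X\<^sub>\<Phi> :: "real \<Rightarrow> 'a \<Rightarrow> real"
    and \<Phi> :: "real \<Rightarrow> real" and \<nu> :: "real measure" and \<theta> :: real and p :: pearson
  assumes "prob_space M"
    and "bernstein \<Phi>"
    and "levy_triplet \<Phi> 0 0 \<nu>"
    and "emeasure \<nu> {0<..} = \<infinity>"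
    and "pearson_diffusion M F W \<theta> p X"
    and "subordinator M \<Phi> \<sigma>"
    and "L = inverse_subordinator \<sigma>"
    and "indep_processes M X L"
    and "X\<^sub>\<Phi> = time_change X L"
    and "distributed M lborel (X\<^sub>\<Phi> 0) (\<lambda>x. ennreal (stationary_density p x))"
    and finite_variance: "integrable lborel (\<lambda>x. x\<^sup>2 * stationary_density p x)"
  shows "(\<forall>\<alpha>. 0 < \<alpha> \<and> \<alpha> < 1 \<and> regularly_varying_at_0 \<Phi> \<alpha> \<longrightarrow> long_range_dependent M X\<^sub>\<Phi>) \<and>
         (\<forall>l>0. ((\<lambda>z. \<Phi> z / z) \<longlongrightarrow> l) (at_right 0) \<longrightarrow> short_range_dependent M X\<^sub>\<Phi>)"
proof -
  interpret prob_space M by fact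
  interpret S: subordination M \<Phi> \<nu> \<sigma> by unfold_locales fact+
  interpret S: inverse_subordination M \<Phi> \<nu> \<sigma>
    by unfold_locales (use indep_processes_measurable(2)[OF assms(8)] assms(7) in auto)
  have L: "0 \<le> L t \<omega>" "AE \<omega> in M. L 0 \<omega> = 0" for t \<omega> using S.L_nonneg S.L_0 assms(7) by auto
  have \<theta>: "0 < \<theta>" and p: "admissible p" and sol: "sde_solution M F W (drift \<theta> p) (diffusion \<theta> p) X"
    and cl: "\<And>t \<omega>. 0 \<le> t \<Longrightarrow> \<omega> \<in> space M \<Longrightarrow> X t \<omega> \<in> closure (state_space p)"
    using assms(5) unfolding pearson_diffusion_def by auto
  let ?m = "stationary_density p"
  note Z = stationary_initial_moments[OF p assms(10) finite_variance]
  obtain \<mu> d0 d1 d2 where "pearson_moments \<theta> p \<mu> d0 d1 d2"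
    using pearson_moments_exist[OF \<theta> p Z(1) finite_variance] by blast
  then have drift: "\<And>x. drift \<theta> p x = - \<theta> * (x - \<mu>)"
    and diff: "\<And>x. x \<in> closure (state_space p) \<Longrightarrow> (diffusion \<theta> p x)\<^sup>2 = d0 + d1 * x + d2 * x\<^sup>2"
    and mean: "(\<integral>x. - \<theta> * (x - \<mu>) * ?m x \<partial>lborel) = 0"
    and var: "(\<integral>x. (d0 / 2 + d1 / 2 * x + d2 / 2 * x\<^sup>2 - \<theta> * (x - \<mu>)\<^sup>2) * ?m x \<partial>lborel) = 0"
    unfolding pearson_moments_def by auto
  have X0m[measurable]: "X 0 \<in> borel_measurable M" using indep_processes_measurable(1)[OF assms(8)] by simp
  have Zm[measurable]: "X\<^sub>\<Phi> 0 \<in> borel_measurable M" using distributed_measurable[OF assms(10)] by simp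
  \<comment> \<open>The density is prescribed for \<open>X\<^sub>\<Phi> 0\<close>; here it is
    carried over to \<open>X 0\<close>.\<close>
  have ae: "AE \<omega> in M. X\<^sub>\<Phi> 0 \<omega> = X 0 \<omega>" using L(2) unfolding assms(9) time_change_def by eventually_elim simp
  have E: "(\<integral>\<omega>. g (X 0 \<omega>) \<partial>M) = (\<integral>\<omega>. g (X\<^sub>\<Phi> 0 \<omega>) \<partial>M)" if [measurable]: "g \<in> borel_measurable borel" for g :: "real \<Rightarrow> real"
    by (rule integral_cong_AE) (use ae in auto)
  define Y where "Y t \<omega> = X t \<omega> - \<mu>" for t \<omega>
  have X: "X t \<omega> = Y t \<omega> + \<mu>" for t \<omega> by (simp add: Y_def)
  have isq: "integrable M (\<lambda>\<omega>. (X 0 \<omega>)\<^sup>2)"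
    by (rule iffD1[OF integrable_cong_AE Z(2)]) (use ae in auto)
  have i1: "integrable M (X 0)" using square_integrable_imp_integrable[OF X0m] isq by (simp add: power2_eq_square)
  have sq: "(Y 0 \<omega>)\<^sup>2 = (X 0 \<omega>)\<^sup>2 - 2 * \<mu> * X 0 \<omega> + \<mu>\<^sup>2" for \<omega> by (simp add: Y_def power2_eq_square algebra_simps)
  have iY: "integrable M (\<lambda>\<omega>. (Y 0 \<omega>)\<^sup>2)" unfolding sq using isq i1 by simp
  have iY1: "integrable M (Y 0)" unfolding Y_def[abs_def] using i1 by simp
  have EY: "(\<integral>\<omega>. Y 0 \<omega> \<partial>M) = 0"
  proof -
    have "(\<integral>\<omega>. - \<theta> * Y 0 \<omega> \<partial>M) = 0"
      using E[of "\<lambda>x. - \<theta> * (x - \<mu>)"] Z(3)[of "\<lambda>x. - \<theta> * (x - \<mu>)"] mean \<theta> by (simp add: Y_def)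
    then show ?thesis using \<theta> by simp
  qed
  let ?v = "\<integral>\<omega>. (Y 0 \<omega>)\<^sup>2 \<partial>M"
  have v: "0 < ?v" using Z(4)[of \<mu>] E[of "\<lambda>x. (x - \<mu>)\<^sup>2"] by (simp add: Y_def)
  \<comment> \<open>Value of the squared diffusion coefficient at the mean; \<open>poly\<close> is
    the Taylor expansion there, written in the centred variable.\<close>
  define A where "A = d0 + d1 * \<mu> + d2 * \<mu>\<^sup>2"
  have poly: "d0 + d1 * (y + \<mu>) + d2 * (y + \<mu>)\<^sup>2 = A + (d1 + 2 * d2 * \<mu>) * y + d2 * y\<^sup>2" for y
    by (simp add: A_def power2_eq_square algebra_simps)
  have balance: "A + d2 * ?v = 2 * \<theta> * ?v"
  proof -
    let ?q = "\<lambda>x. d0 / 2 + d1 / 2 * x + d2 / 2 * x\<^sup>2 - \<theta> * (x - \<mu>)\<^sup>2"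
    have "(\<integral>\<omega>. ?q (X 0 \<omega>) \<partial>M) = 0" using E[of ?q] Z(3)[of ?q] var by simp
    \<comment> \<open>The linear term has expectation 0, so the variance identity of the density
      becomes the balance condition.\<close>
    also have "(\<lambda>\<omega>. ?q (X 0 \<omega>)) = (\<lambda>\<omega>. A / 2 + (d1 / 2 + d2 * \<mu>) * Y 0 \<omega> + (d2 / 2 - \<theta>) * (Y 0 \<omega>)\<^sup>2)"
      by (auto simp: fun_eq_iff X A_def power2_eq_square field_simps)
    finally have "A / 2 + (d2 / 2 - \<theta>) * ?v = 0" using iY iY1 EY by (simp add: prob_space)
    then show ?thesis by (simp add: algebra_simps)
  qed
  \<comment> \<open>\<open>sde_solution\<close> provides an integral for each time separately;
    choice turns these into one family \<open>J\<close>.\<close>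
  have "\<forall>t. \<exists>J. 0 \<le> t \<longrightarrow> has_ito_integral M F W (\<lambda>r \<omega>. diffusion \<theta> p (X r \<omega>)) t J \<and>
      (AE \<omega> in M. X t \<omega> = X 0 \<omega> + (LINT r:{0..t}|lborel. drift \<theta> p (X r \<omega>)) + J \<omega>)"
    using sol unfolding sde_solution_def by blast
  from choice[OF this] obtain J where
    J: "\<And>t. 0 \<le> t \<Longrightarrow> has_ito_integral M F W (\<lambda>r \<omega>. diffusion \<theta> p (X r \<omega>)) t (J t)"
      "\<And>t. 0 \<le> t \<Longrightarrow> AE \<omega> in M. X t \<omega> = X 0 \<omega> + (LINT r:{0..t}|lborel. drift \<theta> p (X r \<omega>)) + J t \<omega>"
    by blast
  interpret D: linear_drift_path M F W Y "\<lambda>y. diffusion \<theta> p (y + \<mu>)" J \<theta> A "d1 + 2 * d2 * \<mu>" d2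
  proof
    show "filtered M F" "brownian_motion M F W" using sol by (auto simp: sde_solution_def)
    show "adapted F Y" using sol unfolding sde_solution_def adapted_def Y_def[abs_def] by auto
    show "continuous_on {0..} (\<lambda>t. Y t \<omega>)" if "\<omega> \<in> space M" for \<omega>
      using sol that unfolding sde_solution_def Y_def by (intro continuous_intros) auto
    show "continuous_on UNIV (\<lambda>y. diffusion \<theta> p (y + \<mu>))"
      by (rule continuous_on_compose2[OF continuous_on_diffusion]) (auto intro!: continuous_intros)
    show "has_ito_integral M F W (\<lambda>r \<omega>. diffusion \<theta> p (Y r \<omega> + \<mu>)) t (J t)" if "0 \<le> t" for t
      using J(1)[OF that] by (simp add: X)
    show "AE \<omega> in M. Y t \<omega> = Y 0 \<omega> + (LINT r:{0..t}|lborel. - \<theta> * Y r \<omega>) + J t \<omega>" if "0 \<le> t" for t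
      using J(2)[OF that] unfolding drift by eventually_elim (simp add: X)
    show "(diffusion \<theta> p (Y t \<omega> + \<mu>))\<^sup>2 = A + (d1 + 2 * d2 * \<mu>) * Y t \<omega> + d2 * (Y t \<omega>)\<^sup>2"
      if "0 \<le> t" "\<omega> \<in> space M" for t \<omega>
      using diff[OF cl[OF that]] unfolding X poly .
  qed (fact \<theta> iY EY balance)+
  have ac: "autocorr M X\<^sub>\<Phi> n = S.decay \<theta> (real n)" for n
    using D.autocorr_time_change[OF Y_def assms(8) L, of n] v unfolding D.v0_def S.decay_def assms(9) assms(7) by blast
  show ?thesis
    using S.decay_long_range[OF \<theta> _ _ _ bernstein_continuous_on[OF assms(2)] ac] S.decay_short_range[OF \<theta> _ ac] by blast
qed

end
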